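(* Let $\mu\ge2$, let $\hat v\in L^\infty_\mu(\mathbb R^3)$ with $$\|\hat v\|_\mu\le C<\frac1{c_1(\mu)+8c_6(\mu)},$$ and, in addition, let $\hat v\in L^\infty_{\mu^*}(\mathbb R^3)$ for some $\mu^*>\mu$. Assume also that $\hat v$ is continuous on $\mathbb R^3$. Let $\gamma:\mathbb R^3\to\mathbb S^2$ be a given measurable (e.g. piecewise continuous) map with $\gamma(p)\cdot p=0$, let $R(p)=H\big(\frac p2+\frac{i|p|}2\gamma(p),p\big)$ for $p\in\mathbb R^3$, and, for $\tau>0$, let $R_{2\tau}(p)=R(p)$ for $|p|<2\tau$ and $R_{2\tau}(p)=0$ for $|p|\ge2\tau$. Let $\hat v_{2\tau}$ denote the function obtained from $R_{2\tau}$ by the reconstruction procedure described in the context (applied to $Q=R_{2\tau}$). Then $$R\in L^\infty_{\mu^*}(\mathbb R^3)$$ and $$\|\hat v-\hat v_{2\tau}\|_\mu\le\frac{1-c_1(\mu)C}{1-(c_1(\mu)+8c_6(\mu))C}\;\frac{\|R\|_{\mu^*}}{(1+2\tau)^{\mu^*-\mu}}\qquad\text{for }\tau>0 .$$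
   Context: Conventions: for $a,b\in\mathbb C^3$, $a\cdot b=\sum_j a_jb_j$ (no conjugation), $a^2=a\cdot a$; $\times$ is the vector product. $\hat v(p)=(2\pi)^{-3}\int_{\mathbb R^3}e^{ip\cdot x}v(x)\,dx$ is the Fourier transform of the potential $v$ on $\mathbb R^3$. $L^\infty_\mu(\mathbb R^3)=\{u\in L^\infty(\mathbb R^3):\|u\|_\mu<\infty\}$, $\|u\|_\mu=\operatorname{ess\,sup}_{p}(1+|p|)^\mu|u(p)|$. $\Sigma=\{k\in\mathbb C^3:k^2=0\}$. For $k\in\Sigma$ let $(A(k)U)(p)=\int_{\mathbb R^3}\frac{\hat v(p+\xi)U(-\xi)}{\xi^2+2k\cdot\xi}d\xi$. The constant $c_1(\mu)>0$ is such that $\|A(k)U\|_\mu\le c_1(\mu)\|\hat v\|_\mu\|U\|_\mu$ for all $k\in\Sigma$, $\hat v,U\in L^\infty_\mu(\mathbb R^3)$. The Faddeev function $H(k,p)$, $k\in\Sigma$, $p\in\mathbb R^3$, is defined by requiring that $H(k,\cdot)\in L^\infty_\mu(\mathbb R^3)$ is the (unique when $c_1(\mu)\|\hat v\|_\mu<1$) solution of $$H(k,p)=\hat v(p)-\int_{\mathbb R^3}\frac{\hat v(p+\xi)H(k,-\xi)}{\xi^2+2k\cdot\xi}\,d\xi .$$ Coordinates: fix $\nu\in\mathbb S^2$, $\mathcal L_\nu=\{t\nu:t\in\mathbb R\}$, $\Omega=\{(k,p)\in\mathbb C^3\times\mathbb R^3: k^2=0,\ p^2=2k\cdot p\}$,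 $\Omega_\nu=\{(k,p)\in\Omega:p\notin\mathcal L_\nu\}$. Fix smooth $\theta,\omega:\mathbb R^3\setminus\mathcal L_\nu\to\mathbb S^2$ with $\theta(p)\cdot p=0$ and $\omega(p)=p\times\theta(p)/|p|$. For $\lambda\in\mathbb C\setminus 0$, $p\in\mathbb R^3\setminus\mathcal L_\nu$, $$k(\lambda,p)=\tfrac{i|p|}4\big(\lambda+\tfrac1\lambda\big)\theta(p)+\tfrac{|p|}4\big(\lambda-\tfrac1\lambda\big)\omega(p)+\tfrac p2 ;$$ the map $(\lambda,p)\mapsto(k(\lambda,p),p)$ is a bijection onto $\Omega_\nu$ with inverse $(k,p)\mapsto(\lambda(k,p),p)$, $\lambda(k,p)=\frac{2k\cdot(\theta(p)+i\omega(p))}{i|p|}$. Let $\lambda_0(p)=\gamma(p)\cdot(\theta(p)+i\omega(p))$, so that $|\lambda_0(p)|=1$ and $k(\lambda_0(p),p)=\frac p2+\frac{i|p|}2\gamma(p)$. For $\varphi\in[-\pi,\pi]$, $\xi(\lambda,p,\varphi)=\mathrm{Re}\,k(\lambda,p)(\cos\varphi-1)+k^\perp(\lambda,p)\sin\varphi$, $k^\perp(\lambda,p)=\frac{\mathrm{Im}\,k(\lambda,p)\times\mathrm{Re}\,k(\lambda,p)}{|\mathrm{Im}\,k(\lambda,p)|}$. For functions $U_1',U_2'$ on $\Omega$ put $$\{U_1',U_2'\}(\lambda,p)=-\frac\pi4\int_{-\pi}^{\pi}\Big(\frac{|p|}2\frac{|\lambda|^2-1}{\bar\lambda|\lambda|}(\cos\varphi-1)-\frac{|p|}{\bar\lambda}\sin\varphi\Big)U_1'(k,-\xi)\,U_2'(k+\xi,p+\xi)\,d\varphi,$$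 with $k=k(\lambda,p)$, $\xi=\xi(\lambda,p,\varphi)$. For functions $U_1,U_2,U$ on $(\mathbb C\setminus0)\times(\mathbb R^3\setminus\mathcal L_\nu)$ put $(U_1,U_2)=\{U_1',U_2'\}$ with $U_j'(k,p)=U_j(\lambda(k,p),p)$ on $\Omega_\nu$, and $$I(U_1,U_2)(\lambda,p)=-\frac1\pi\int_{\mathbb C}(U_1,U_2)(\zeta,p)\frac{d\mathrm{Re}\zeta\,d\mathrm{Im}\zeta}{\zeta-\lambda},\quad N(U)=I(U,U),\quad M(U)(\lambda,p)=N(U)(\lambda,p)-N(U)(\lambda_0(p),p).$$ $L^\infty_\mu((\mathbb C\setminus0)\times(\mathbb R^3\setminus\mathcal L_\nu))$ is the set of $U\in L^\infty$ with $|||U|||_\mu=\operatorname{ess\,sup}_{\lambda,p}(1+|p|)^\mu|U(\lambda,p)|<\infty$. The constant $c_6(\mu)>0$ is such that $|||I(U_1,U_2)|||_\mu\le c_6(\mu)|||U_1|||_\mu|||U_2|||_\mu$ for all $U_1,U_2$ in this space. Identities between $L^\infty$ functions are understood almost everywhere. Reconstruction procedure: put $r=2C/(1-c_1(\mu)C)$. Given $Q\in L^\infty_\mu(\mathbb R^3)$ with $\|Q\|_\mu\le r/2$, let $G$ be the unique solution of $G(\lambda,p)=Q(p)+M(G)(\lambda,p)$ in $\{U\in L^\infty_\mu((\mathbb C\setminus0)\times(\mathbb R^3\setminus\mathcal L_\nu)):|||U|||_\mu\le r\}$ (obtained by successive approximations); the output is the function $p\mapsto\lim_{\lambda\to\infty}G(\lambda,p)=Q(p)-N(G)(\lambda_0(p),p)$,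 $p\in\mathbb R^3\setminus\mathcal L_\nu$. *)

theory Defs
  imports
    "HOL-Analysis.Analysis"
    "HOL-Analysis.Cross3"
    "HOL-Probability.Essential_Supremum"
begin

section \<open>Vectors in complex 3-space\<close>

text \<open>The product of two complex vectors is bilinear, without conjugation; the library's
  inner product on \<^typ>\<open>complex ^ 3\<close> is a different, real one.\<close>

definition cdot :: "complex ^ 3 \<Rightarrow> complex ^ 3 \<Rightarrow> complex" where
  "cdot a b = (\<Sum>j\<in>UNIV. a $ j * b $ j)"

definition cvec :: "real ^ 3 \<Rightarrow> complex ^ 3" where
  "cvec x = (\<chi> j. complex_of_real (x $ j))"

definition Re_vec :: "complex ^ 3 \<Rightarrow> real ^ 3" where
  "Re_vec k = (\<chi> j. Re (k $ j))"

definition Im_vec :: "complex ^ 3 \<Rightarrow> real ^ 3" where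
  "Im_vec k = (\<chi> j. Im (k $ j))"

definition Sigma_cone :: "(complex ^ 3) set" where
  "Sigma_cone = {k. cdot k k = 0}"

definition line :: "real ^ 3 \<Rightarrow> (real ^ 3) set" where
  "line \<nu> = {t *\<^sub>R \<nu> |t. True}"


section \<open>Smooth maps on open sets\<close>

text \<open>\<open>Ck_on n S f\<close>: all iterated directional derivatives of order at most \<open>n\<close> exist and are
  continuous on the open set \<open>S\<close>.\<close>

primrec Ck_on :: "nat \<Rightarrow> 'a set \<Rightarrow> ('a::euclidean_space \<Rightarrow> 'b::euclidean_space) \<Rightarrow> bool" where
  "Ck_on 0 S f \<longleftrightarrow> continuous_on S f"
| "Ck_on (Suc n) S f \<longleftrightarrow>
     (\<forall>x\<in>S. f differentiable (at x)) \<and> (\<forall>h. Ck_on n S (\<lambda>x. frechet_derivative f (at x) h))"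

definition smooth_on :: "'a set \<Rightarrow> ('a::euclidean_space \<Rightarrow> 'b::euclidean_space) \<Rightarrow> bool" where
  "smooth_on S f \<longleftrightarrow> (\<forall>n. Ck_on n S f)"


section \<open>Weighted spaces of essentially bounded functions\<close>

text \<open>The norms take values in \<^typ>\<open>ereal\<close>; an infinite value means that the function is not in
  the space. (\<^const>\<open>esssup\<close> of a nonmeasurable function is infinite.)\<close>

definition norm_mu :: "real \<Rightarrow> (real ^ 3 \<Rightarrow> complex) \<Rightarrow> ereal" where
  "norm_mu \<mu> u = esssup lebesgue (\<lambda>p. ereal ((1 + norm p) powr \<mu> * cmod (u p)))"

definition Linf_mu :: "real \<Rightarrow> (real ^ 3 \<Rightarrow> complex) set" where
  "Linf_mu \<mu> = {u. u \<in> borel_measurable lebesgue \<and> norm_mu \<mu> u < \<infinity>}"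

text \<open>The domain of the coordinates \<open>(\<lambda>, p)\<close>. Functions of \<open>(\<lambda>, p)\<close> are total and curried; values
  off this (full measure) set play no role.\<close>

definition coord_dom :: "real ^ 3 \<Rightarrow> (complex \<times> (real ^ 3)) set" where
  "coord_dom \<nu> = {(z, p). z \<noteq> 0 \<and> p \<notin> line \<nu>}"

definition norm2_mu :: "real ^ 3 \<Rightarrow> real \<Rightarrow> (complex \<Rightarrow> real ^ 3 \<Rightarrow> complex) \<Rightarrow> ereal" where
  "norm2_mu \<nu> \<mu> U =
     esssup (lebesgue_on (coord_dom \<nu>)) (\<lambda>(z, p). ereal ((1 + norm p) powr \<mu> * cmod (U z p)))"

definition Linf2_mu :: "real ^ 3 \<Rightarrow> real \<Rightarrow> (complex \<Rightarrow> real ^ 3 \<Rightarrow> complex) set" where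
  "Linf2_mu \<nu> \<mu> =
     {U. case_prod U \<in> borel_measurable (lebesgue_on (coord_dom \<nu>)) \<and> norm2_mu \<nu> \<mu> U < \<infinity>}"


section \<open>The Faddeev function\<close>

text \<open>The argument \<open>v\<close> stands for the Fourier transform of the potential.\<close>

definition A_op :: "(real ^ 3 \<Rightarrow> complex) \<Rightarrow> complex ^ 3 \<Rightarrow> (real ^ 3 \<Rightarrow> complex) \<Rightarrow> real ^ 3 \<Rightarrow> complex"
  where
  "A_op v k U p =
     (LINT \<xi>|lebesgue. v (p + \<xi>) * U (- \<xi>) / (complex_of_real (\<xi> \<bullet> \<xi>) + 2 * cdot k (cvec \<xi>)))"

text \<open>The equation is required at every \<open>p\<close>, not only almost everywhere: its right-hand side
  depends only on the almost-everywhere class of the unknown, so this singles out the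
  representative for which the value at an individual point is meaningful (the continuous one when
  \<open>v\<close> is continuous).\<close>

definition faddeev_H :: "real \<Rightarrow> (real ^ 3 \<Rightarrow> complex) \<Rightarrow> complex ^ 3 \<Rightarrow> real ^ 3 \<Rightarrow> complex" where
  "faddeev_H \<mu> v k = (THE u. u \<in> Linf_mu \<mu> \<and> (\<forall>p. u p = v p - A_op v k u p))"


section \<open>Coordinates\<close>

definition omega :: "(real ^ 3 \<Rightarrow> real ^ 3) \<Rightarrow> real ^ 3 \<Rightarrow> real ^ 3" where
  "omega \<theta> p = (1 / norm p) *\<^sub>R cross3 p (\<theta> p)"

definition k_of :: "(real ^ 3 \<Rightarrow> real ^ 3) \<Rightarrow> complex \<Rightarrow> real ^ 3 \<Rightarrow> complex ^ 3" where
  "k_of \<theta> z p =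
     (\<i> * of_real (norm p) / 4 * (z + 1 / z)) *s cvec (\<theta> p)
     + (of_real (norm p) / 4 * (z - 1 / z)) *s cvec (omega \<theta> p)
     + (1 / 2) *s cvec p"

definition lambda_of :: "(real ^ 3 \<Rightarrow> real ^ 3) \<Rightarrow> complex ^ 3 \<Rightarrow> real ^ 3 \<Rightarrow> complex" where
  "lambda_of \<theta> k p = 2 * cdot k (cvec (\<theta> p) + \<i> *s cvec (omega \<theta> p)) / (\<i> * of_real (norm p))"

definition lambda0 :: "(real ^ 3 \<Rightarrow> real ^ 3) \<Rightarrow> (real ^ 3 \<Rightarrow> real ^ 3) \<Rightarrow> real ^ 3 \<Rightarrow> complex" where
  "lambda0 \<theta> \<gamma> p = cdot (cvec (\<gamma> p)) (cvec (\<theta> p) + \<i> *s cvec (omega \<theta> p))"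

definition k_perp :: "complex ^ 3 \<Rightarrow> real ^ 3" where
  "k_perp k = (1 / norm (Im_vec k)) *\<^sub>R cross3 (Im_vec k) (Re_vec k)"

definition xi_of :: "(real ^ 3 \<Rightarrow> real ^ 3) \<Rightarrow> complex \<Rightarrow> real ^ 3 \<Rightarrow> real \<Rightarrow> real ^ 3" where
  "xi_of \<theta> z p \<phi> =
     (cos \<phi> - 1) *\<^sub>R Re_vec (k_of \<theta> z p) + sin \<phi> *\<^sub>R k_perp (k_of \<theta> z p)"


section \<open>The nonlinear operators\<close>

text \<open>\<open>brace_op\<close> acts on functions of \<open>(k, p)\<close>, which are evaluated only at points with
  \<open>k\<^sup>2 = 0\<close> and \<open>p\<^sup>2 = 2 k \<cdot> p\<close>.\<close>

definition brace_op ::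
  "(real ^ 3 \<Rightarrow> real ^ 3) \<Rightarrow> (complex ^ 3 \<Rightarrow> real ^ 3 \<Rightarrow> complex) \<Rightarrow> (complex ^ 3 \<Rightarrow> real ^ 3 \<Rightarrow> complex)
    \<Rightarrow> complex \<Rightarrow> real ^ 3 \<Rightarrow> complex" where
  "brace_op \<theta> V1 V2 z p =
     - of_real (pi / 4) * (LINT \<phi>:{-pi..pi}|lebesgue.
         (of_real (norm p / 2 * ((cmod z)\<^sup>2 - 1)) / (cnj z * of_real (cmod z)) * of_real (cos \<phi> - 1)
            - of_real (norm p) / cnj z * of_real (sin \<phi>))
         * V1 (k_of \<theta> z p) (- xi_of \<theta> z p \<phi>)
         * V2 (k_of \<theta> z p + cvec (xi_of \<theta> z p \<phi>)) (p + xi_of \<theta> z p \<phi>))"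

definition paren_op ::
  "(real ^ 3 \<Rightarrow> real ^ 3) \<Rightarrow> (complex \<Rightarrow> real ^ 3 \<Rightarrow> complex) \<Rightarrow> (complex \<Rightarrow> real ^ 3 \<Rightarrow> complex)
    \<Rightarrow> complex \<Rightarrow> real ^ 3 \<Rightarrow> complex" where
  "paren_op \<theta> U1 U2 =
     brace_op \<theta> (\<lambda>k p. U1 (lambda_of \<theta> k p) p) (\<lambda>k p. U2 (lambda_of \<theta> k p) p)"

definition I_op ::
  "(real ^ 3 \<Rightarrow> real ^ 3) \<Rightarrow> (complex \<Rightarrow> real ^ 3 \<Rightarrow> complex) \<Rightarrow> (complex \<Rightarrow> real ^ 3 \<Rightarrow> complex)
    \<Rightarrow> complex \<Rightarrow> real ^ 3 \<Rightarrow> complex" where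
  "I_op \<theta> U1 U2 z p = - of_real (1 / pi) * (LINT \<zeta>|lebesgue. paren_op \<theta> U1 U2 \<zeta> p / (\<zeta> - z))"

definition N_op ::
  "(real ^ 3 \<Rightarrow> real ^ 3) \<Rightarrow> (complex \<Rightarrow> real ^ 3 \<Rightarrow> complex) \<Rightarrow> complex \<Rightarrow> real ^ 3 \<Rightarrow> complex" where
  "N_op \<theta> U = I_op \<theta> U U"

definition M_op ::
  "(real ^ 3 \<Rightarrow> real ^ 3) \<Rightarrow> (real ^ 3 \<Rightarrow> real ^ 3) \<Rightarrow> (complex \<Rightarrow> real ^ 3 \<Rightarrow> complex)
    \<Rightarrow> complex \<Rightarrow> real ^ 3 \<Rightarrow> complex" where
  "M_op \<theta> \<gamma> U z p = N_op \<theta> U z p - N_op \<theta> U (lambda0 \<theta> \<gamma> p) p"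


section \<open>The reconstruction procedure\<close>

definition recon_solution ::
  "real ^ 3 \<Rightarrow> (real ^ 3 \<Rightarrow> real ^ 3) \<Rightarrow> (real ^ 3 \<Rightarrow> real ^ 3) \<Rightarrow> real \<Rightarrow> real
    \<Rightarrow> (real ^ 3 \<Rightarrow> complex) \<Rightarrow> (complex \<Rightarrow> real ^ 3 \<Rightarrow> complex) \<Rightarrow> bool" where
  "recon_solution \<nu> \<theta> \<gamma> \<mu> r Q G \<longleftrightarrow>
     G \<in> Linf2_mu \<nu> \<mu> \<and> norm2_mu \<nu> \<mu> G \<le> ereal r \<and>
     (AE (z, p) in lebesgue_on (coord_dom \<nu>). G z p = Q p + M_op \<theta> \<gamma> G z p)"

text \<open>The solution is unique only up to null sets, whence \<open>SOME\<close> instead of \<open>THE\<close>.\<close>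

definition recon_G ::
  "real ^ 3 \<Rightarrow> (real ^ 3 \<Rightarrow> real ^ 3) \<Rightarrow> (real ^ 3 \<Rightarrow> real ^ 3) \<Rightarrow> real \<Rightarrow> real
    \<Rightarrow> (real ^ 3 \<Rightarrow> complex) \<Rightarrow> complex \<Rightarrow> real ^ 3 \<Rightarrow> complex" where
  "recon_G \<nu> \<theta> \<gamma> \<mu> r Q = (SOME G. recon_solution \<nu> \<theta> \<gamma> \<mu> r Q G)"

text \<open>The output is the limit of \<open>G(\<lambda>, p)\<close> as \<open>\<lambda> \<rightarrow> \<infinity>\<close>. The limit is taken of the representative
  \<open>Q + M(G)\<close> of the class of \<open>G\<close>, since a limit in \<open>\<lambda>\<close> at fixed \<open>p\<close> is not determined by an
  almost-everywhere class. As \<open>N(G)(\<lambda>, p)\<close> tends to 0, the limit equals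
  \<open>Q(p) - N(G)(\<lambda>\<^sub>0(p), p)\<close> for almost every \<open>p\<close>.\<close>

definition reconstruct ::
  "real ^ 3 \<Rightarrow> (real ^ 3 \<Rightarrow> real ^ 3) \<Rightarrow> (real ^ 3 \<Rightarrow> real ^ 3) \<Rightarrow> real \<Rightarrow> real
    \<Rightarrow> (real ^ 3 \<Rightarrow> complex) \<Rightarrow> real ^ 3 \<Rightarrow> complex" where
  "reconstruct \<nu> \<theta> \<gamma> \<mu> r Q p =
     Lim at_infinity (\<lambda>z. Q p + M_op \<theta> \<gamma> (recon_G \<nu> \<theta> \<gamma> \<mu> r Q) z p)"


section \<open>Scattering data\<close>

definition R_data ::
  "real \<Rightarrow> (real ^ 3 \<Rightarrow> complex) \<Rightarrow> (real ^ 3 \<Rightarrow> real ^ 3) \<Rightarrow> real ^ 3 \<Rightarrow> complex" where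
  "R_data \<mu> v \<gamma> p = faddeev_H \<mu> v ((1 / 2) *s cvec p + (\<i> * of_real (norm p) / 2) *s cvec (\<gamma> p)) p"

definition cutoff :: "real \<Rightarrow> (real ^ 3 \<Rightarrow> complex) \<Rightarrow> real ^ 3 \<Rightarrow> complex" where
  "cutoff \<rho> R p = (if norm p < \<rho> then R p else 0)"

end

theory Submission
  imports Defs
begin

text \<open>
  In the frame \<open>(\<theta>(p), \<omega>(p), p/|p|)\<close> the denominator \<open>\<xi>\<^sup>2 + 2 k(\<lambda>, p) \<cdot> \<xi>\<close> is, for fixed \<open>\<xi>\<close>, a rational function of
  \<open>\<lambda>\<close> with two simple zeros, so that its inverse is a sum of two simple poles. The substitution
  \<open>\<xi> = \<xi>(\<zeta>, p, \<phi>)\<close> therefore turns integrals against this inverse into integrals of \<open>1/(\<lambda> - \<zeta>)\<close> over \<open>(\<zeta>, \<phi>)\<close>.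
  Applied to the Neumann series of \<open>H\<close>, this yields \<open>H = v + N(H)\<close> directly, without the
  Cauchy-Riemann operator. Since \<open>H(\<lambda>\<^sub>0(p), p) = R(p)\<close>, the function \<open>H\<close> solves \<open>U = R + M(U)\<close>.

  The map \<open>U \<mapsto> Q + M(U)\<close> contracts the ball of radius \<open>r\<close> with factor \<open>4 c\<^sub>6 r\<close>. Hence the solutions for
  \<open>Q = R\<close> and for the truncated \<open>Q\<close>, and with them the outputs of the reconstruction, differ by at most
  \<open>1/(1 - 4 c\<^sub>6 r)\<close> times the norm of the tail of \<open>R\<close>, which the weight with the larger exponent makes small.

  Values at \<open>\<lambda>\<^sub>0(p)\<close> are meaningful because \<open>I(U\<^sub>1, U\<^sub>2)(\<cdot>, p)\<close> is the Cauchy transform of a bounded integrable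
  function, hence continuous in \<open>\<lambda>\<close> for almost every \<open>p\<close>.
\<close>

section \<open>Changes of variables\<close>

text \<open>The constants come from one balance. In the weighted norm H is at most C/(1 - c1 C) =
  r/2, which is also the size allowed for the data. N is quadratic, which costs a factor 2 in
  differences, and M subtracts a second value of N, which costs another 2. So the contraction factor
  is 4 c6 r = 8 c6 C/(1 - c1 C), and it is below 1 exactly when (c1 + 8 c6) C < 1. Two obstacles
  shape the proof. The constants c1 and c6 bound norms of operators, whereas exchanging integrals
  needs absolute convergence: for the Faddeev kernel it is extracted from c1, for the circle
  integrals it is proved by explicit estimates whose constants depend on p and do not enter the
  result. Moreover the bracket evaluates U at points of the quadric that, for fixed p, fill only a
  null set of the coordinate space. That the operators respect equality almost everywhere must
  therefore be proved; estimates are then stated for almost every p and every \<lambda>.\<close>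

lemma nn_integral_change_of_variables_real:
  fixes g h :: "real \<Rightarrow> real" and f :: "real \<Rightarrow> ennreal"
  assumes S: "S \<in> sets borel"
    and der: "\<And>x. x \<in> S \<Longrightarrow> (g has_field_derivative h x) (at x within S)"
    and inj: "inj_on g S" and im: "g ` S \<in> sets borel"
    and g [measurable]: "g \<in> borel_measurable borel"
    and h [measurable]: "h \<in> borel_measurable borel"
    and f [measurable]: "f \<in> borel_measurable borel"
  shows "(\<integral>\<^sup>+x. f x * indicator (g ` S) x \<partial>lborel) =
         (\<integral>\<^sup>+x. ennreal \<bar>h x\<bar> * f (g x) * indicator S x \<partial>lborel)"
proof -
  note S[measurable] im[measurable]
  let ?N = "distr (density lborel (\<lambda>x. ennreal \<bar>h x\<bar> * indicator S x)) borel g"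
  let ?M = "density lborel (indicator (g ` S) :: real \<Rightarrow> ennreal)"
  \<comment> \<open>It is enough to compare two measures: Lebesgue measure restricted to the image,
    and the push-forward of the density |h|. On a Borel set this is the substitution rule for the
    constant integrand 1.\<close>
  have "emeasure ?M A = emeasure ?N A" if "A \<in> sets ?M" for A
  proof -
    have [measurable]: "A \<in> sets borel" using that by simp
    define S' where "S' = S \<inter> g -` A"
    have S' [measurable]: "S' \<in> sets borel"
      unfolding S'_def using measurable_sets[OF g, of A] by (auto simp: S)
    have im': "g ` S' = A \<inter> g ` S" by (auto simp: S'_def)
    have im'm [measurable]: "g ` S' \<in> sets borel" unfolding im' by simp
    have *: "\<And>b. (\<lambda>x. \<bar>h x\<bar> * 1) absolutely_integrable_on S' \<and> integral S' (\<lambda>x. \<bar>h x\<bar> * 1) = b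
       \<longleftrightarrow> (\<lambda>x. 1::real) absolutely_integrable_on (g ` S') \<and> integral (g ` S') (\<lambda>x. 1) = b"
      by (rule has_absolute_integral_change_of_variables_1')
         (auto simp: S'_def intro: inj_on_subset[OF inj] DERIV_subset[OF der] S' [unfolded S'_def])
    have fin: "(\<lambda>x. k x) absolutely_integrable_on T \<longleftrightarrow> (\<integral>\<^sup>+x. ennreal (k x) * indicator T x \<partial>lborel) < \<infinity>"
      if [measurable]: "k \<in> borel_measurable borel" "T \<in> sets borel" and "\<And>x. k x \<ge> 0" for k :: "real \<Rightarrow> real" and T
    proof -
      have "(\<lambda>x. k x) absolutely_integrable_on T \<longleftrightarrow> integrable lborel (\<lambda>x. indicator T x *\<^sub>R k x)"
        unfolding set_integrable_def by (subst integrable_completion) auto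
      also have "\<dots> \<longleftrightarrow> (\<integral>\<^sup>+x. ennreal (k x) * indicator T x \<partial>lborel) < \<infinity>"
        by (subst integrable_iff_bounded) (auto simp: indicator_def of_bool_def that ennreal_mult if_distrib[of ennreal] mult.commute cong: if_cong)
      finally show ?thesis .
    qed
    have val: "(\<integral>\<^sup>+x. ennreal (k x) * indicator T x \<partial>lborel) = ennreal (integral T k)"
      if [measurable]: "k \<in> borel_measurable borel" "T \<in> sets borel" and "\<And>x. k x \<ge> 0" 
        and int: "k absolutely_integrable_on T" for k :: "real \<Rightarrow> real" and T
    proof -
      have i: "integrable lborel (\<lambda>x. indicator T x *\<^sub>R k x)"
        using int unfolding set_integrable_def by (subst (asm) integrable_completion) auto
      have "integral T k = (LINT x:T|lebesgue. k x)"
        using int by (rule set_lebesgue_integral_eq_integral(2)[symmetric])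
      also have "\<dots> = (LINT x|lborel. indicator T x *\<^sub>R k x)"
        unfolding set_lebesgue_integral_def by (subst integral_completion) auto
      finally have "ennreal (integral T k) = ennreal (LINT x|lborel. indicator T x *\<^sub>R k x)" by simp
      also have "\<dots> = (\<integral>\<^sup>+x. ennreal (indicator T x *\<^sub>R k x) \<partial>lborel)"
        by (rule nn_integral_eq_integral[symmetric]) (use i that in auto)
      finally show ?thesis by (auto intro!: nn_integral_cong simp: indicator_def)
    qed
    have "(\<integral>\<^sup>+x. ennreal \<bar>h x\<bar> * indicator S' x \<partial>lborel) = (\<integral>\<^sup>+x. ennreal 1 * indicator (g ` S') x \<partial>lborel)"
    \<comment> \<open>Absolute integrability holds on both sides or on neither; in the second case
      both nonnegative integrals are infinite.\<close>
    proof (cases "(\<lambda>x. 1::real) absolutely_integrable_on (g ` S')")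
      case True
      then have 1: "(\<lambda>x. \<bar>h x\<bar>) absolutely_integrable_on S'" "integral S' (\<lambda>x. \<bar>h x\<bar>) = integral (g ` S') (\<lambda>x. 1)"
        using *[of "integral (g ` S') (\<lambda>x. 1)"] by auto
      show ?thesis by (subst val, simp, simp, simp, rule 1, subst val) (auto simp: 1 True)
    next
      case False
      then have "\<not> (\<lambda>x. \<bar>h x\<bar>) absolutely_integrable_on S'" using * by auto
      then show ?thesis using False by (auto simp: fin not_less top_unique)
    qed
    moreover have "emeasure ?M A = (\<integral>\<^sup>+x. ennreal 1 * indicator (g ` S') x \<partial>lborel)"
      by (subst emeasure_density) (auto simp: im' indicator_def intro!: nn_integral_cong)
    moreover have "emeasure ?N A = (\<integral>\<^sup>+x. ennreal \<bar>h x\<bar> * indicator S' x \<partial>lborel)"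
      using measurable_sets[OF g, of A] by (subst emeasure_distr) (auto simp: emeasure_density S'_def indicator_def intro!: nn_integral_cong)
    ultimately show ?thesis by simp
  qed
  then have "?M = ?N" by (intro measure_eqI) auto
  then have "(\<integral>\<^sup>+x. f x \<partial>?M) = (\<integral>\<^sup>+x. f x \<partial>?N)" by simp
  then show ?thesis
    by (simp add: nn_integral_density nn_integral_distr mult_ac)
qed

section \<open>Lebesgue measure in the complex plane and signed polar coordinates\<close>

lemma lborel_complex: "distr (lborel :: (real \<times> real) measure) borel (\<lambda>(x, y). Complex x y) = lborel"
proof (rule lborel_eqI[symmetric])
  have [measurable]: "(\<lambda>(x, y). Complex x y) \<in> borel \<rightarrow>\<^sub>M borel"
    by (intro borel_measurable_continuous_onI) (auto intro!: continuous_intros simp: case_prod_beta Complex_eq)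
  fix l u :: complex assume le: "\<And>b. b \<in> Basis \<Longrightarrow> l \<bullet> b \<le> u \<bullet> b"
  then have le': "Re l \<le> Re u" "Im l \<le> Im u"
    using le[of 1] le[of \<i>] by (auto simp: Basis_complex_def inner_complex_def)
  have "(\<lambda>(x, y). Complex x y) -` box l u = {Re l<..<Re u} \<times> {Im l<..<Im u}"
    by (auto simp: box_def Basis_complex_def inner_complex_def)
  then have "emeasure (distr lborel borel (\<lambda>(x, y). Complex x y)) (box l u) = emeasure lborel ({Re l<..<Re u} \<times> {Im l<..<Im u})"
    by (subst emeasure_distr) auto
  also have "\<dots> = emeasure lborel {Re l<..<Re u} * emeasure lborel {Im l<..<Im u}"
    by (subst lborel_prod[symmetric], subst lborel.emeasure_pair_measure_Times) auto
  also have "\<dots> = (\<Prod>b\<in>Basis. (u - l) \<bullet> b)"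
    using le' by (simp add: Basis_complex_def inner_complex_def ennreal_mult)
  finally show "emeasure (distr lborel borel (\<lambda>(x, y). Complex x y)) (box l u) = (\<Prod>b\<in>Basis. (u - l) \<bullet> b)" .
qed simp

lemma nn_integral_complex:
  assumes [measurable]: "f \<in> borel_measurable borel"
  shows "(\<integral>\<^sup>+z. f z \<partial>lborel) = (\<integral>\<^sup>+y. \<integral>\<^sup>+x. f (Complex x y) \<partial>lborel \<partial>lborel)"
    "(\<integral>\<^sup>+z. f z \<partial>lborel) = (\<integral>\<^sup>+x. \<integral>\<^sup>+y. f (Complex x y) \<partial>lborel \<partial>lborel)"
proof -
  have [measurable]: "(\<lambda>(x, y). Complex x y) \<in> borel \<rightarrow>\<^sub>M borel"
    by (intro borel_measurable_continuous_onI) (auto intro!: continuous_intros simp: case_prod_beta Complex_eq)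
  have *: "(\<integral>\<^sup>+z. f z \<partial>lborel) = (\<integral>\<^sup>+w. f (case w of (x, y) \<Rightarrow> Complex x y) \<partial>(lborel \<Otimes>\<^sub>M lborel))"
    by (subst lborel_complex[symmetric], subst nn_integral_distr) (auto simp: lborel_prod)
  show "(\<integral>\<^sup>+z. f z \<partial>lborel) = (\<integral>\<^sup>+y. \<integral>\<^sup>+x. f (Complex x y) \<partial>lborel \<partial>lborel)"
    unfolding * by (subst lborel_pair.nn_integral_snd[symmetric]) (auto simp: lborel_prod)
  show "(\<integral>\<^sup>+z. f z \<partial>lborel) = (\<integral>\<^sup>+x. \<integral>\<^sup>+y. f (Complex x y) \<partial>lborel \<partial>lborel)"
    unfolding * by (subst lborel.nn_integral_fst[symmetric]) (auto simp: lborel_prod)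
qed

lemma borel_measurable_cnj [measurable (raw)]:
  "f \<in> borel_measurable M \<Longrightarrow> (\<lambda>x. cnj (f x)) \<in> borel_measurable M"
  by (rule borel_measurable_continuous_on[where f=cnj]) (auto intro!: continuous_intros)

lemma borel_measurable_Complex [measurable (raw)]:
  assumes "f \<in> borel_measurable M" "g \<in> borel_measurable M"
  shows "(\<lambda>x. Complex (f x) (g x)) \<in> borel_measurable M"
proof -
  have "(\<lambda>x. of_real (f x) + \<i> * of_real (g x)) \<in> borel_measurable M" using assms by measurable
  then show ?thesis by (simp add: Complex_eq)
qed

lemma nn_integral_lborel_cnj:
  assumes [measurable]: "f \<in> borel_measurable borel"
  shows "(\<integral>\<^sup>+z. f (cnj z) \<partial>lborel) = (\<integral>\<^sup>+z. f z \<partial>lborel)"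
proof -
  have "(\<integral>\<^sup>+z. f z \<partial>lborel) = (\<integral>\<^sup>+x. \<integral>\<^sup>+y. f (Complex x y) \<partial>lborel \<partial>lborel)"
    by (rule nn_integral_complex) simp
  also have "\<dots> = (\<integral>\<^sup>+x. \<integral>\<^sup>+y. f (Complex x (- y)) \<partial>lborel \<partial>lborel)"
  proof (rule nn_integral_cong)
    fix x :: real
    show "(\<integral>\<^sup>+y. f (Complex x y) \<partial>lborel) = (\<integral>\<^sup>+y. f (Complex x (- y)) \<partial>lborel)"
      using nn_integral_real_affine[where c="-1" and t=0 and f="\<lambda>y. f (Complex x y)"] by simp
  qed
  also have "\<dots> = (\<integral>\<^sup>+x. \<integral>\<^sup>+y. f (cnj (Complex x y)) \<partial>lborel \<partial>lborel)"
    by (simp add: cnj.code)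
  also have "\<dots> = (\<integral>\<^sup>+z. f (cnj z) \<partial>lborel)"
    by (rule nn_integral_complex(2)[symmetric]) measurable
  finally show ?thesis by simp
qed

text \<open>The point exp(i arctan \<kappa>). With a signed radius these directions reach every
  point off the imaginary axis exactly once.\<close>

definition slope_dir :: "real \<Rightarrow> complex" where
  "slope_dir \<kappa> = Complex 1 \<kappa> / of_real (sqrt (1 + \<kappa>\<^sup>2))"

lemma norm_slope_dir [simp]: "cmod (slope_dir \<kappa>) = 1"
proof -
  have "cmod (Complex 1 \<kappa>) = sqrt (1 + \<kappa>\<^sup>2)" by (simp add: cmod_def)
  moreover have "sqrt (1 + \<kappa>\<^sup>2) > 0" by (simp add: add_pos_nonneg)
  ultimately show ?thesis by (simp add: slope_dir_def norm_divide)
qed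

lemma slope_dir_measurable [measurable (raw)]:
  assumes [measurable]: "f \<in> borel_measurable M"
  shows "(\<lambda>x. slope_dir (f x)) \<in> borel_measurable M"
  unfolding slope_dir_def by measurable

text \<open>Polar coordinates with a signed radius; the angle is parametrised by the slope, so that only
  linear substitutions are needed.\<close>

lemma nn_integral_signed_polar:
  assumes [measurable]: "f \<in> borel_measurable borel"
  shows "(\<integral>\<^sup>+z. f z \<partial>lborel) =
    (\<integral>\<^sup>+\<kappa>. \<integral>\<^sup>+\<rho>. ennreal (\<bar>\<rho>\<bar> / (1 + \<kappa>\<^sup>2)) * f (of_real \<rho> * slope_dir \<kappa>) \<partial>lborel \<partial>lborel)"
proof -
  have "(\<integral>\<^sup>+z. f z \<partial>lborel) = (\<integral>\<^sup>+x. \<integral>\<^sup>+y. f (Complex x y) \<partial>lborel \<partial>lborel)"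
    by (rule nn_integral_complex) simp
  also have "\<dots> = (\<integral>\<^sup>+x. \<integral>\<^sup>+\<kappa>. ennreal \<bar>x\<bar> * f (of_real x * Complex 1 \<kappa>) \<partial>lborel \<partial>lborel)"
  proof (rule nn_integral_cong_AE, rule AE_mp[OF AE_lborel_singleton[of 0]], rule AE_I2, rule impI)
    fix x :: real assume "x \<noteq> 0"
    then have "(\<integral>\<^sup>+y. f (Complex x y) \<partial>lborel) = ennreal \<bar>x\<bar> * (\<integral>\<^sup>+\<kappa>. f (Complex x (0 + x * \<kappa>)) \<partial>lborel)"
      by (intro nn_integral_real_affine) auto
    also have "\<dots> = (\<integral>\<^sup>+\<kappa>. ennreal \<bar>x\<bar> * f (Complex x (0 + x * \<kappa>)) \<partial>lborel)"
      by (intro nn_integral_cmult[symmetric]) measurable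
    also have "\<dots> = (\<integral>\<^sup>+\<kappa>. ennreal \<bar>x\<bar> * f (of_real x * Complex 1 \<kappa>) \<partial>lborel)"
      by (intro nn_integral_cong arg_cong2[where f="(*)"] arg_cong[where f=f] refl) (simp add: complex_eq_iff)
    finally show "(\<integral>\<^sup>+y. f (Complex x y) \<partial>lborel) = (\<integral>\<^sup>+\<kappa>. ennreal \<bar>x\<bar> * f (of_real x * Complex 1 \<kappa>) \<partial>lborel)" .
  qed
  also have "\<dots> = (\<integral>\<^sup>+\<kappa>. \<integral>\<^sup>+x. ennreal \<bar>x\<bar> * f (of_real x * Complex 1 \<kappa>) \<partial>lborel \<partial>lborel)"
    by (rule lborel_pair.Fubini') measurable
  \<comment> \<open>With x = \<rho>/q one factor 1/q comes from the differential and one from |x|;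
    together they give 1/(1 + \<kappa>^2).\<close>
  also have "\<dots> = (\<integral>\<^sup>+\<kappa>. \<integral>\<^sup>+\<rho>. ennreal (\<bar>\<rho>\<bar> / (1 + \<kappa>\<^sup>2)) * f (of_real \<rho> * slope_dir \<kappa>) \<partial>lborel \<partial>lborel)"
  proof (rule nn_integral_cong)
    fix \<kappa> :: real
    define q where "q = sqrt (1 + \<kappa>\<^sup>2)"
    have q: "q > 0" "q * q = 1 + \<kappa>\<^sup>2" by (auto simp: q_def add_pos_nonneg)
    have "(\<integral>\<^sup>+x. ennreal \<bar>x\<bar> * f (of_real x * Complex 1 \<kappa>) \<partial>lborel) =
      ennreal \<bar>1 / q\<bar> * (\<integral>\<^sup>+\<rho>. ennreal \<bar>0 + 1 / q * \<rho>\<bar> * f (of_real (0 + 1 / q * \<rho>) * Complex 1 \<kappa>) \<partial>lborel)"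
      by (rule nn_integral_real_affine) (use q in auto)
    also have "\<dots> = (\<integral>\<^sup>+\<rho>. ennreal \<bar>1 / q\<bar> * (ennreal \<bar>0 + 1 / q * \<rho>\<bar> * f (of_real (0 + 1 / q * \<rho>) * Complex 1 \<kappa>)) \<partial>lborel)"
      by (intro nn_integral_cmult[symmetric]) measurable
    also have "\<dots> = (\<integral>\<^sup>+\<rho>. ennreal (\<bar>\<rho>\<bar> / (1 + \<kappa>\<^sup>2)) * f (of_real \<rho> * slope_dir \<kappa>) \<partial>lborel)"
      using q by (intro nn_integral_cong)
        (auto simp: slope_dir_def q_def[symmetric] ennreal_mult[symmetric] mult.assoc[symmetric] abs_mult q(2)[symmetric] field_simps)
    finally show "(\<integral>\<^sup>+x. ennreal \<bar>x\<bar> * f (of_real x * Complex 1 \<kappa>) \<partial>lborel) =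
      (\<integral>\<^sup>+\<rho>. ennreal (\<bar>\<rho>\<bar> / (1 + \<kappa>\<^sup>2)) * f (of_real \<rho> * slope_dir \<kappa>) \<partial>lborel)" .
  qed
  finally show ?thesis .
qed

section \<open>The substitution a = b/2 (\<rho> - 1/\<rho>) and its two branches\<close>

definition jouk :: "real \<Rightarrow> real \<Rightarrow> real" where "jouk b \<rho> = b / 2 * (\<rho> - 1 / \<rho>)"

text \<open>The roots of \<rho>^2 - (2a/b) \<rho> - 1 = 0. Their product is -1, so there is one of
  each sign, and \<epsilon> names the sign. Hence \<open>jouk b\<close> maps each half line
  bijectively onto the real line.\<close>

definition jouk_inv :: "real \<Rightarrow> real \<Rightarrow> real \<Rightarrow> real" where
  "jouk_inv b \<epsilon> a = a / b + \<epsilon> * sqrt ((a / b)\<^sup>2 + 1)"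

lemma jouk_inv_measurable [measurable (raw)]:
  assumes [measurable]: "f \<in> borel_measurable M"
  shows "(\<lambda>x. jouk_inv b \<epsilon> (f x)) \<in> borel_measurable M"
  unfolding jouk_inv_def by measurable

lemma jouk_measurable [measurable (raw)]:
  assumes [measurable]: "f \<in> borel_measurable M"
  shows "(\<lambda>x. jouk b (f x)) \<in> borel_measurable M"
  unfolding jouk_def by measurable

lemma sqrt_gt_abs: "sqrt (x\<^sup>2 + 1) > \<bar>x::real\<bar>"
  by (metis less_add_one real_sqrt_abs real_sqrt_less_iff)

lemma jouk_inv_sign: "jouk_inv b 1 a > 0" "jouk_inv b (-1) a < 0"
  using sqrt_gt_abs[of "a/b"] unfolding jouk_inv_def by linarith+

lemma jouk_inv_mult: "jouk_inv b 1 a * jouk_inv b (-1) a = -1"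
proof -
  have "jouk_inv b 1 a * jouk_inv b (-1) a = (a/b)\<^sup>2 - (sqrt ((a / b)\<^sup>2 + 1))\<^sup>2"
    unfolding jouk_inv_def by (simp add: algebra_simps power2_eq_square)
  also have "\<dots> = -1" by (subst real_sqrt_pow2) auto
  finally show ?thesis .
qed

lemma jouk_inv_minus: "jouk_inv b \<epsilon> (- a) = - jouk_inv b (- \<epsilon>) a"
  by (simp add: jouk_inv_def)

lemma jouk_jouk_inv:
  assumes "b > 0" "\<epsilon> \<in> {1, -1}" shows "jouk b (jouk_inv b \<epsilon> a) = a"
proof -
  have "1 / jouk_inv b 1 a = - jouk_inv b (-1) a" "1 / jouk_inv b (-1) a = - jouk_inv b 1 a"
    using jouk_inv_mult[of b a] jouk_inv_sign[of b a] by (auto simp: field_simps)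
  moreover have "jouk_inv b 1 a + jouk_inv b (-1) a = 2 * a / b" by (simp add: jouk_inv_def)
  ultimately show ?thesis using assms by (auto simp: jouk_def add.commute)
qed

lemma jouk_inv_jouk:
  assumes "b > 0" "\<epsilon> \<in> {1, -1}" "\<epsilon> * \<rho> > 0" shows "jouk_inv b \<epsilon> (jouk b \<rho>) = \<rho>"
proof -
  have r0: "\<rho> \<noteq> 0" using assms(3) by auto
  have "(jouk b \<rho> / b)\<^sup>2 + 1 = ((\<rho> + 1 / \<rho>) / 2)\<^sup>2"
    using assms(1) r0 by (simp add: jouk_def field_simps power2_eq_square)
  then have "sqrt ((jouk b \<rho> / b)\<^sup>2 + 1) = \<bar>\<rho> + 1 / \<rho>\<bar> / 2" by simp
  moreover have "\<bar>\<rho> + 1 / \<rho>\<bar> = \<epsilon> * (\<rho> + 1 / \<rho>)"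
    using assms(2,3) add_pos_pos[of \<rho> "1/\<rho>"] add_neg_neg[of \<rho> "1/\<rho>"] by (auto simp: abs_if)
  ultimately have "jouk_inv b \<epsilon> (jouk b \<rho>) = jouk b \<rho> / b + \<epsilon> * (\<epsilon> * (\<rho> + 1 / \<rho>)) / 2"
    unfolding jouk_inv_def by simp
  also have "jouk b \<rho> / b = (\<rho> - 1 / \<rho>) / 2" using assms(1) by (simp add: jouk_def)
  finally show ?thesis using assms(2) by (auto simp: field_simps)
qed

lemma nn_integral_jouk:
  assumes b: "b > 0" and e: "\<epsilon> \<in> {1, -1}" and [measurable]: "f \<in> borel_measurable borel"
  shows "(\<integral>\<^sup>+\<rho>. ennreal (b / 2 * (1 + 1 / \<rho>\<^sup>2)) * f \<rho> * indicator {\<rho>. \<epsilon> * \<rho> > 0} \<rho> \<partial>lborel) =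
         (\<integral>\<^sup>+a. f (jouk_inv b \<epsilon> a) \<partial>lborel)"
proof -
  let ?S = "{\<rho>. \<epsilon> * \<rho> > 0}"
  have im: "jouk b ` ?S = UNIV"
  proof -
    have "a = jouk b (jouk_inv b \<epsilon> a) \<and> jouk_inv b \<epsilon> a \<in> ?S" for a
      using jouk_jouk_inv[OF b e] jouk_inv_sign[of b a] e by auto
    then show ?thesis by blast
  qed
  have "(\<integral>\<^sup>+a. f (jouk_inv b \<epsilon> a) * indicator (jouk b ` ?S) a \<partial>lborel) =
    (\<integral>\<^sup>+\<rho>. ennreal \<bar>b / 2 * (1 + 1 / \<rho>\<^sup>2)\<bar> * f (jouk_inv b \<epsilon> (jouk b \<rho>)) * indicator ?S \<rho> \<partial>lborel)"
  proof (rule nn_integral_change_of_variables_real)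
    show "(jouk b has_real_derivative b / 2 * (1 + 1 / \<rho>\<^sup>2)) (at \<rho> within ?S)" if "\<rho> \<in> ?S" for \<rho>
      unfolding jouk_def using that
      by (auto intro!: derivative_eq_intros simp: power2_eq_square)
    show "inj_on (jouk b) ?S"
      by (rule inj_on_inverseI[where g="jouk_inv b \<epsilon>"]) (use b e jouk_inv_jouk in auto)
  qed (auto simp: im)
  also have "\<dots> = (\<integral>\<^sup>+\<rho>. ennreal (b / 2 * (1 + 1 / \<rho>\<^sup>2)) * f \<rho> * indicator ?S \<rho> \<partial>lborel)"
    using b e jouk_inv_jouk by (intro nn_integral_cong) (auto simp: indicator_def)
  finally show ?thesis by (simp add: im)
qed

section \<open>The half-angle substitution\<close>

lemma borel_measurable_tan [measurable (raw)]:
  fixes f :: "'a \<Rightarrow> real"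
  assumes [measurable]: "f \<in> borel_measurable M"
  shows "(\<lambda>x. tan (f x)) \<in> borel_measurable M"
proof -
  have "(\<lambda>x. sin (f x) / cos (f x)) \<in> borel_measurable M" by measurable
  then show ?thesis by (simp add: tan_def)
qed

text \<open>The substitution x = cot(\<phi>/2), with derivative -1/(2 sin^2(\<phi>/2)) = -1/(1 - cos
  \<phi>). The angle 0 and the end points, where the tangent has a default value, are removed as a
  null set.\<close>

lemma nn_integral_cot_half:
  assumes [measurable]: "f \<in> borel_measurable borel"
  shows "(\<integral>\<^sup>+\<phi>. ennreal (1 / (1 - cos \<phi>)) * f (1 / tan (\<phi> / 2)) * indicator {-pi..pi} \<phi> \<partial>lborel) = (\<integral>\<^sup>+x. f x \<partial>lborel)"
proof -
  let ?S = "{-pi<..<pi} - {0::real}"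
  let ?g = "\<lambda>\<phi>. 1 / tan (\<phi> / 2) :: real"
  have cs: "cos (\<phi> / 2) > 0" "sin (\<phi> / 2) \<noteq> 0" if "\<phi> \<in> ?S" for \<phi> :: real
  proof -
    show "cos (\<phi> / 2) > 0" using that by (intro cos_gt_zero_pi) auto
    show "sin (\<phi> / 2) \<noteq> 0"
      using that sin_gt_zero[of "\<phi>/2"] sin_gt_zero[of "-(\<phi>/2)"] by (cases "\<phi> > 0") auto
  qed
  have inv: "2 * arctan (1 / ?g \<phi>) = \<phi>" if "\<phi> \<in> ?S" for \<phi> :: real
    using that by (simp add: arctan_tan)
  have im: "?g ` ?S = - {0}"
  proof (intro equalityI subsetI)
    fix x assume "x \<in> ?g ` ?S"
    then obtain \<phi> where "\<phi> \<in> ?S" "x = ?g \<phi>" by blast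
    then show "x \<in> - {0}" using cs[of \<phi>] by (auto simp: tan_def)
  next
    fix x :: real assume "x \<in> - {0}"
    then have "x \<noteq> 0" by simp
    have "x = ?g (2 * arctan (1 / x))" by (simp add: tan_arctan)
    moreover have "2 * arctan (1 / x) \<in> ?S" using arctan[of "1/x"] \<open>x \<noteq> 0\<close> by auto
    ultimately show "x \<in> ?g ` ?S" by blast
  qed
  have "(\<integral>\<^sup>+x. f x * indicator (?g ` ?S) x \<partial>lborel) =
    (\<integral>\<^sup>+\<phi>. ennreal \<bar>- 1 / (1 - cos \<phi>)\<bar> * f (?g \<phi>) * indicator ?S \<phi> \<partial>lborel)"
  proof (rule nn_integral_change_of_variables_real)
    show "(?g has_real_derivative - 1 / (1 - cos \<phi>)) (at \<phi> within ?S)" if "\<phi> \<in> ?S" for \<phi>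
    proof -
      have c: "1 - cos \<phi> = 2 * (sin (\<phi> / 2))\<^sup>2" using cos_double_sin[of "\<phi>/2"] by simp
      have sc: "sin (\<phi> / 2) * sin (\<phi> / 2) = 1 - cos (\<phi> / 2) * cos (\<phi> / 2)"
        using sin_cos_squared_add3[of "\<phi> / 2"] by linarith
      show ?thesis unfolding c using cs[OF that] sc
        by (auto intro!: derivative_eq_intros simp: tan_def power2_eq_square divide_simps)
    qed
    show "inj_on ?g ?S"
      by (rule inj_on_inverseI[where g="\<lambda>x. 2 * arctan (1 / x)"]) (rule inv)
    show "?S \<in> sets borel" by measurable
    show "?g \<in> borel_measurable borel" by measurable
    show "(\<lambda>\<phi>::real. - 1 / (1 - cos \<phi>)) \<in> borel_measurable borel" by measurable
  qed (simp_all add: im)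
  also have "(\<integral>\<^sup>+x. f x * indicator (?g ` ?S) x \<partial>lborel) = (\<integral>\<^sup>+x. f x \<partial>lborel)"
    unfolding im using AE_lborel_singleton[of 0]
    by (intro nn_integral_cong_AE, eventually_elim) (auto simp: indicator_def)
  also have "(\<integral>\<^sup>+\<phi>. ennreal \<bar>- 1 / (1 - cos \<phi>)\<bar> * f (?g \<phi>) * indicator ?S \<phi> \<partial>lborel) =
    (\<integral>\<^sup>+\<phi>. ennreal (1 / (1 - cos \<phi>)) * f (1 / tan (\<phi> / 2)) * indicator {-pi..pi} \<phi> \<partial>lborel)"
    using AE_lborel_singleton[of 0] AE_lborel_singleton[of pi] AE_lborel_singleton[of "-pi"]
    by (intro nn_integral_cong_AE, eventually_elim) (auto simp: indicator_def)
  finally show ?thesis by simp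
qed

text \<open>With \<open>b = |p| / 2\<close>, \<open>circ_pt b (\<zeta>, \<phi>)\<close> is \<open>\<xi>(\<zeta>, p, \<phi>)\<close> in the frame at \<open>p\<close>: the real and imaginary parts of the first
  component are the coordinates along \<open>\<omega>(p)\<close> and \<open>\<theta>(p)\<close>, the second component is the coordinate along \<open>p\<close>.
  As functions of \<open>z\<close>, the zeros of \<open>\<xi>\<^sup>2 + 2 k(z, p) \<cdot> \<xi>\<close> are \<open>lam b 1 \<xi>\<close> and \<open>lam b (-1) \<xi>\<close>.\<close>

definition circ_m :: "real \<Rightarrow> complex \<Rightarrow> real \<Rightarrow> real" where
  "circ_m b z \<phi> = b / 2 * ((1 - 1 / (cmod z)\<^sup>2) * (cos \<phi> - 1) - 2 * sin \<phi> / cmod z)"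

definition circ_s :: "real \<Rightarrow> complex \<Rightarrow> real \<Rightarrow> real" where
  "circ_s b z \<phi> = b * (cos \<phi> - 1) + jouk b (cmod z) * sin \<phi>"

definition circ_pt :: "real \<Rightarrow> complex \<times> real \<Rightarrow> complex \<times> real" where
  "circ_pt b \<sigma> = (of_real (circ_m b (fst \<sigma>) (snd \<sigma>)) * cnj (fst \<sigma>), circ_s b (fst \<sigma>) (snd \<sigma>))"

text \<open>The absolute value of the Jacobian determinant of \<open>circ_pt b\<close>, in the role
  it has in \<open>nn_integral_circ_pt\<close>.\<close>

definition circ_jac :: "real \<Rightarrow> complex \<times> real \<Rightarrow> real" where
  "circ_jac b \<sigma> = b * (circ_m b (fst \<sigma>) (snd \<sigma>))\<^sup>2 * (1 + (cmod (fst \<sigma>))\<^sup>2) / (2 * cmod (fst \<sigma>))"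

text \<open>The number a for which the circle about (-a, -b) through the origin contains (T, s),
  found by solving (T + a)^2 + (s + b)^2 = a^2 + b^2.\<close>

definition root_par :: "real \<Rightarrow> real \<Rightarrow> real \<Rightarrow> real" where
  "root_par b T s = - (T\<^sup>2 + s\<^sup>2 + 2 * b * s) / (2 * T)"

definition lam :: "real \<Rightarrow> real \<Rightarrow> complex \<times> real \<Rightarrow> complex" where
  "lam b \<epsilon> x = of_real (jouk_inv b \<epsilon> (root_par b (cmod (fst x)) (snd x))) * (cnj (fst x) / of_real (cmod (fst x)))"

lemma borel_fst [measurable]:
  "fst \<in> borel_measurable (borel :: ('a::second_countable_topology \<times> 'b::second_countable_topology) measure)"
  unfolding borel_prod[symmetric] by measurable

lemma borel_snd [measurable]:
  "snd \<in> borel_measurable (borel :: ('a::second_countable_topology \<times> 'b::second_countable_topology) measure)"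
  unfolding borel_prod[symmetric] by measurable

lemma circ_measurable [measurable]:
  "(\<lambda>\<sigma>. circ_m b (fst \<sigma>) (snd \<sigma>)) \<in> borel_measurable (borel \<Otimes>\<^sub>M borel)"
  "(\<lambda>\<sigma>. circ_s b (fst \<sigma>) (snd \<sigma>)) \<in> borel_measurable (borel \<Otimes>\<^sub>M borel)"
  unfolding circ_m_def circ_s_def by measurable

lemma circ_pt_measurable [measurable (raw)]:
  assumes [measurable]: "f \<in> borel_measurable M" "g \<in> borel_measurable M"
  shows "(\<lambda>x. circ_pt (f x) (g x)) \<in> borel_measurable M"
  unfolding circ_pt_def circ_m_def circ_s_def jouk_def by measurable

lemma circ_jac_measurable [measurable]: "circ_jac b \<in> borel_measurable borel"
  unfolding circ_jac_def borel_prod[symmetric] by measurable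

lemma root_par_measurable [measurable (raw)]:
  assumes [measurable]: "f \<in> borel_measurable M" "g \<in> borel_measurable M"
  shows "(\<lambda>x. root_par b (f x) (g x)) \<in> borel_measurable M"
  unfolding root_par_def by measurable

lemma lam_measurable [measurable (raw)]:
  assumes [measurable]: "f \<in> borel_measurable M" "g \<in> borel_measurable M"
  shows "(\<lambda>x. lam (f x) \<epsilon> (g x)) \<in> borel_measurable M"
  unfolding lam_def jouk_inv_def root_par_def by measurable

section \<open>The family of circles through the origin and the map \<open>circ_pt\<close>\<close>

lemma nn_integral_reflect_symmetric_interval:
  assumes [measurable]: "f \<in> borel_measurable borel"
  shows "(\<integral>\<^sup>+\<phi>. indicator {-c..c} \<phi> * f (- \<phi>) \<partial>lborel) = (\<integral>\<^sup>+\<phi>. indicator {-c..c::real} \<phi> * f \<phi> \<partial>lborel)"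
  using nn_integral_real_affine[where c="-1" and t=0 and f="\<lambda>\<phi>. indicator {-c..c} \<phi> * f \<phi>"]
  by (auto simp: indicator_def minus_le_iff le_minus_iff intro!: nn_integral_cong)

lemma root_par_circle:
  assumes "T = a * (cos \<phi> - 1) - b * sin \<phi>" "s = b * (cos \<phi> - 1) + a * sin \<phi>" "T \<noteq> 0"
  shows "root_par b T s = a"
proof -
  have "(a * (C - 1) - b * S)\<^sup>2 + (b * (C - 1) + a * S)\<^sup>2 + 2 * b * (b * (C - 1) + a * S) + 2 * a * (a * (C - 1) - b * S)
    = (a\<^sup>2 + b\<^sup>2) * (S\<^sup>2 + C\<^sup>2 - 1)" for C S :: real
    by (simp add: algebra_simps power2_eq_square)
  from this[of "cos \<phi>" "sin \<phi>"]
  have "T\<^sup>2 + s\<^sup>2 + 2 * b * s + 2 * a * T = (a\<^sup>2 + b\<^sup>2) * ((sin \<phi>)\<^sup>2 + (cos \<phi>)\<^sup>2 - 1)"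
    unfolding assms(1,2) .
  then have "T\<^sup>2 + s\<^sup>2 + 2 * b * s = - 2 * a * T" by simp
  then show ?thesis using assms(3) by (simp add: root_par_def)
qed

text \<open>The two parameters \<open>T\<close>, \<open>s\<close> are the planar coordinates of a point on the circle through the
  origin with centre \<open>(-a, -b)\<close>, seen at the angle \<open>\<phi>\<close> from the centre.\<close>

lemma nn_integral_circles:
  assumes b: "b > 0"
    and [measurable]: "(\<lambda>(T, s, a). K T s a) \<in> borel_measurable borel"
  shows "(\<integral>\<^sup>+a. \<integral>\<^sup>+\<phi>. indicator {-pi..pi} \<phi> * (ennreal ((a * (cos \<phi> - 1) - b * sin \<phi>)\<^sup>2) *
            K (a * (cos \<phi> - 1) - b * sin \<phi>) (b * (cos \<phi> - 1) + a * sin \<phi>) a) \<partial>lborel \<partial>lborel) =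
         (\<integral>\<^sup>+T. \<integral>\<^sup>+s. ennreal \<bar>T\<bar> * K T s (root_par b T s) \<partial>lborel \<partial>lborel)"
proof -
  have K [measurable (raw)]: "(\<lambda>x. K (f x) (g x) (h x)) \<in> borel_measurable M"
    if [measurable]: "f \<in> borel_measurable M" "g \<in> borel_measurable M" "h \<in> borel_measurable M"
    for f g h :: "'x \<Rightarrow> real" and M :: "'x measure"
  proof -
    have "(\<lambda>x. (f x, g x, h x)) \<in> borel_measurable M" by measurable
    from measurable_compose[OF this assms(2)] show ?thesis by simp
  qed
  \<comment> \<open>A point with T \<noteq> 0 lies on exactly one circle of the family, so a is a
    function of (T, s); where T = 0 the weight T^2 vanishes.\<close>
  define G where "G T s = K T s (root_par b T s)" for T s
  have [measurable (raw)]: "(\<lambda>x. G (f x) (g x)) \<in> borel_measurable M"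
    if [measurable]: "f \<in> borel_measurable M" "g \<in> borel_measurable M"
    for f g :: "'x \<Rightarrow> real" and M :: "'x measure"
    unfolding G_def by measurable
  let ?T = "\<lambda>a \<phi>. a * (cos \<phi> - 1) - b * sin \<phi>"
  let ?s = "\<lambda>a \<phi>. b * (cos \<phi> - 1) + a * sin \<phi>"
  have "(\<integral>\<^sup>+a. \<integral>\<^sup>+\<phi>. indicator {-pi..pi} \<phi> * (ennreal ((?T a \<phi>)\<^sup>2) * K (?T a \<phi>) (?s a \<phi>) a) \<partial>lborel \<partial>lborel) =
    (\<integral>\<^sup>+a. \<integral>\<^sup>+\<phi>. indicator {-pi..pi} \<phi> * (ennreal ((?T a \<phi>)\<^sup>2) * G (?T a \<phi>) (?s a \<phi>)) \<partial>lborel \<partial>lborel)"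
    (is "?lhs = _")
  proof (intro nn_integral_cong)
    fix a \<phi> :: real
    show "indicator {-pi..pi} \<phi> * (ennreal ((?T a \<phi>)\<^sup>2) * K (?T a \<phi>) (?s a \<phi>) a) =
      indicator {-pi..pi} \<phi> * (ennreal ((?T a \<phi>)\<^sup>2) * G (?T a \<phi>) (?s a \<phi>))"
      by (cases "?T a \<phi> = 0") (auto simp: G_def root_par_circle[OF refl refl])
  qed
  also have "\<dots> = (\<integral>\<^sup>+\<phi>. \<integral>\<^sup>+a. indicator {-pi..pi} \<phi> * (ennreal ((?T a \<phi>)\<^sup>2) * G (?T a \<phi>) (?s a \<phi>)) \<partial>lborel \<partial>lborel)"
    by (rule lborel_pair.Fubini') measurable
  \<comment> \<open>At a fixed angle, T is affine in a with slope -(1 - cos \<phi>), and s is then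
    affine in T: s = -2b - T cot(\<phi>/2).\<close>
  also have "\<dots> = (\<integral>\<^sup>+\<phi>. \<integral>\<^sup>+T. indicator {-pi..pi} \<phi> * (ennreal (1 / (1 - cos \<phi>)) * (ennreal (T\<^sup>2) * G T (- 2 * b - T * (1 / tan (\<phi> / 2))))) \<partial>lborel \<partial>lborel)"
  proof (rule nn_integral_cong_AE)
    have *: "\<phi> \<in> {-pi..pi} \<Longrightarrow> \<phi> \<noteq> 0 \<Longrightarrow>
      (\<integral>\<^sup>+a. indicator {-pi..pi} \<phi> * (ennreal ((?T a \<phi>)\<^sup>2) * G (?T a \<phi>) (?s a \<phi>)) \<partial>lborel) = 
      (\<integral>\<^sup>+T. indicator {-pi..pi} \<phi> * (ennreal (1 / (1 - cos \<phi>)) * (ennreal (T\<^sup>2) * G T (- 2 * b - T * (1 / tan (\<phi> / 2))))) \<partial>lborel)" for \<phi>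
    proof -
      assume \<phi>: "\<phi> \<in> {-pi..pi}" "\<phi> \<noteq> 0"
      have sn: "sin (\<phi> / 2) \<noteq> 0"
        using \<phi> sin_gt_zero[of "\<phi>/2"] sin_gt_zero[of "-(\<phi>/2)"] by (cases "\<phi> > 0") auto
      have c: "1 - cos \<phi> = 2 * (sin (\<phi> / 2))\<^sup>2" using cos_double_sin[of "\<phi>/2"] by simp
      then have c0: "1 - cos \<phi> > 0" using sn by simp
      have sn2: "sin \<phi> = 2 * sin (\<phi> / 2) * cos (\<phi> / 2)" using sin_double[of "\<phi>/2"] by simp
      let ?a = "\<lambda>T. - b * sin \<phi> / (1 - cos \<phi>) + (- 1 / (1 - cos \<phi>)) * T"
      have T: "?T (?a T) \<phi> = T" for T
      proof -
        have "?T a' \<phi> = - (a' * (1 - cos \<phi>)) - b * sin \<phi>" for a' by (simp add: algebra_simps)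
        from this[of "?a T"] have "?T (?a T) \<phi> = - (?a T * (1 - cos \<phi>)) - b * sin \<phi>" .
        also have "?a T * (1 - cos \<phi>) = - b * sin \<phi> - T" using c0 by (simp add: left_diff_distrib)
        finally show ?thesis by simp
      qed
      have ct: "sin \<phi> / (1 - cos \<phi>) = 1 / tan (\<phi> / 2)"
        unfolding c sn2 using sn by (simp add: tan_def field_simps power2_eq_square)
      have s: "?s (?a T) \<phi> = - 2 * b - T * (1 / tan (\<phi> / 2))" for T
      proof -
        have "?s (?a T) \<phi> = b * (cos \<phi> - 1) - b * (sin \<phi>)\<^sup>2 / (1 - cos \<phi>) - T * (sin \<phi> / (1 - cos \<phi>))"
          by (simp add: left_diff_distrib power2_eq_square)
        also have "b * (sin \<phi>)\<^sup>2 / (1 - cos \<phi>) = b * (1 + cos \<phi>)"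
        proof -
          have "(sin \<phi>)\<^sup>2 = (1 + cos \<phi>) * (1 - cos \<phi>)"
            by (simp add: sin_squared_eq algebra_simps power2_eq_square)
          then show ?thesis using c0 by simp
        qed
        finally have "?s (?a T) \<phi> = b * (cos \<phi> - 1) - b * (1 + cos \<phi>) - T * (1 / tan (\<phi> / 2))" unfolding ct .
        also have "b * (cos \<phi> - 1) - b * (1 + cos \<phi>) = - 2 * b" by (simp add: algebra_simps)
        finally show ?thesis .
      qed
      have "(\<integral>\<^sup>+a. indicator {-pi..pi} \<phi> * (ennreal ((?T a \<phi>)\<^sup>2) * G (?T a \<phi>) (?s a \<phi>)) \<partial>lborel) =
        ennreal \<bar>- 1 / (1 - cos \<phi>)\<bar> * (\<integral>\<^sup>+T. indicator {-pi..pi} \<phi> * (ennreal ((?T (?a T) \<phi>)\<^sup>2) * G (?T (?a T) \<phi>) (?s (?a T) \<phi>)) \<partial>lborel)"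
        by (rule nn_integral_real_affine) (use c0 in auto)
      also have "\<dots> = (\<integral>\<^sup>+T. indicator {-pi..pi} \<phi> * (ennreal (1 / (1 - cos \<phi>)) * (ennreal (T\<^sup>2) * G T (- 2 * b - T * (1 / tan (\<phi> / 2))))) \<partial>lborel)"
        unfolding T s using c0 by (subst nn_integral_cmult[symmetric]) (auto simp: mult_ac)
      finally show ?thesis .
    qed
    have "\<phi> \<noteq> 0 \<Longrightarrow> (\<integral>\<^sup>+a. indicator {-pi..pi} \<phi> * (ennreal ((?T a \<phi>)\<^sup>2) * G (?T a \<phi>) (?s a \<phi>)) \<partial>lborel) =
      (\<integral>\<^sup>+T. indicator {-pi..pi} \<phi> * (ennreal (1 / (1 - cos \<phi>)) * (ennreal (T\<^sup>2) * G T (- 2 * b - T * (1 / tan (\<phi> / 2))))) \<partial>lborel)" for \<phi>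
    proof (cases "\<phi> \<in> {-pi..pi}")
      case False
      then have "indicator {-pi..pi} \<phi> = (0 :: ennreal)" by (rule indicator_simps)
      then show ?thesis by (simp del: indicator_eq_0_iff)
    qed (rule *)
    then show "AE \<phi> in lborel. (\<integral>\<^sup>+a. indicator {-pi..pi} \<phi> * (ennreal ((?T a \<phi>)\<^sup>2) * G (?T a \<phi>) (?s a \<phi>)) \<partial>lborel) =
      (\<integral>\<^sup>+T. indicator {-pi..pi} \<phi> * (ennreal (1 / (1 - cos \<phi>)) * (ennreal (T\<^sup>2) * G T (- 2 * b - T * (1 / tan (\<phi> / 2))))) \<partial>lborel)"
      by (intro AE_mp[OF AE_lborel_singleton[of 0] AE_I2] impI)
  qed
  also have "\<dots> = (\<integral>\<^sup>+T. \<integral>\<^sup>+\<phi>. indicator {-pi..pi} \<phi> * (ennreal (1 / (1 - cos \<phi>)) * (ennreal (T\<^sup>2) * G T (- 2 * b - T * (1 / tan (\<phi> / 2))))) \<partial>lborel \<partial>lborel)"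
    by (rule lborel_pair.Fubini') measurable
  \<comment> \<open>Now x = cot(\<phi>/2) is integrated at fixed T, and passing to s = -2b - T x
    uses up one of the two factors T.\<close>
  also have "\<dots> = (\<integral>\<^sup>+T. \<integral>\<^sup>+s. ennreal \<bar>T\<bar> * G T s \<partial>lborel \<partial>lborel)"
  proof (rule nn_integral_cong_AE, rule AE_mp[OF AE_lborel_singleton[of 0]], rule AE_I2, rule impI)
    fix T :: real assume T: "T \<noteq> 0"
    have "(\<integral>\<^sup>+\<phi>. indicator {-pi..pi} \<phi> * (ennreal (1 / (1 - cos \<phi>)) * (ennreal (T\<^sup>2) * G T (- 2 * b - T * (1 / tan (\<phi> / 2))))) \<partial>lborel) =
      (\<integral>\<^sup>+\<phi>. ennreal (1 / (1 - cos \<phi>)) * (ennreal (T\<^sup>2) * G T (- 2 * b - T * (1 / tan (\<phi> / 2)))) * indicator {-pi..pi} \<phi> \<partial>lborel)"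
      by (simp add: mult_ac)
    also have "\<dots> = (\<integral>\<^sup>+x. ennreal (T\<^sup>2) * G T (- 2 * b - T * x) \<partial>lborel)"
      by (rule nn_integral_cot_half) measurable
    also have "\<dots> = ennreal \<bar>T\<bar> * (ennreal \<bar>T\<bar> * (\<integral>\<^sup>+x. G T (- 2 * b + (- T) * x) \<partial>lborel))"
      by (subst nn_integral_cmult) (auto simp: mult.assoc[symmetric] ennreal_mult[symmetric] power2_eq_square abs_mult_self_eq)
    also have "ennreal \<bar>T\<bar> * (\<integral>\<^sup>+x. G T (- 2 * b + (- T) * x) \<partial>lborel) = (\<integral>\<^sup>+s. G T s \<partial>lborel)"
      using nn_integral_real_affine[of "G T" "-T" "-2*b"] T by simp
    finally show "(\<integral>\<^sup>+\<phi>. indicator {-pi..pi} \<phi> * (ennreal (1 / (1 - cos \<phi>)) * (ennreal (T\<^sup>2) * G T (- 2 * b - T * (1 / tan (\<phi> / 2))))) \<partial>lborel) =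
      (\<integral>\<^sup>+s. ennreal \<bar>T\<bar> * G T s \<partial>lborel)"
      by (subst nn_integral_cmult) auto
  qed
  finally show ?thesis by (simp add: G_def)
qed

text \<open>In signed polar coordinates the pole is \<zeta> = \<rho>
  \<open>slope_dir \<kappa>\<close>, and the first component of the point is T times the conjugate
  direction. The slope is thus common to both, and a planar problem from (\<rho>, \<phi>) to (T, s)
  remains, which is \<open>nn_integral_circles\<close> after a = \<open>jouk b \<rho>\<close>. Over
  each a there is a positive and a negative \<rho>, so the map is two-to-one; the two terms on the
  right list the preimages by their poles.\<close>

theorem nn_integral_circ_pt:
  assumes b: "b > 0" and [measurable]: "F \<in> borel_measurable borel"
  shows "(\<integral>\<^sup>+\<sigma>. indicator (UNIV \<times> {-pi..pi}) \<sigma> * (ennreal (circ_jac b \<sigma>) * F (circ_pt b \<sigma>, fst \<sigma>)) \<partial>lborel) =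
         (\<integral>\<^sup>+x. F (x, lam b 1 x) + F (x, lam b (-1) x) \<partial>lborel)"
proof -
  have [measurable (raw)]: "(\<lambda>x. F ((f x, g x), h x)) \<in> borel_measurable M"
    if [measurable]: "f \<in> borel_measurable M" "g \<in> borel_measurable M" "h \<in> borel_measurable M"
    for f :: "'x \<Rightarrow> complex" and g :: "'x \<Rightarrow> real" and h :: "'x \<Rightarrow> complex" and M :: "'x measure"
  proof -
    have "(\<lambda>x. ((f x, g x), h x)) \<in> borel_measurable M" by measurable
    from measurable_compose[OF this assms(2)] show ?thesis by simp
  qed
  define K where "K \<kappa> T s \<rho> = F ((of_real T * cnj (slope_dir \<kappa>), s), of_real \<rho> * slope_dir \<kappa>)" for \<kappa> T s \<rho>
  have [measurable (raw)]: "(\<lambda>x. K (k x) (f x) (g x) (h x)) \<in> borel_measurable M"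
    if [measurable]: "k \<in> borel_measurable M" "f \<in> borel_measurable M" "g \<in> borel_measurable M" "h \<in> borel_measurable M"
    for k f g h :: "'x \<Rightarrow> real" and M :: "'x measure"
    unfolding K_def by measurable
  let ?T = "\<lambda>a \<phi>. a * (cos \<phi> - 1) - b * sin \<phi>"
  let ?s = "\<lambda>a \<phi>. b * (cos \<phi> - 1) + a * sin \<phi>"
  define \<Psi> where "\<Psi> \<kappa> \<rho> a = (\<integral>\<^sup>+\<phi>. indicator {-pi..pi} \<phi> * (ennreal ((?T a \<phi>)\<^sup>2) * K \<kappa> (?T a \<phi>) (?s a \<phi>) \<rho>) \<partial>lborel)" for \<kappa> \<rho> a
  have [measurable (raw)]: "(\<lambda>x. \<Psi> (k x) (f x) (g x)) \<in> borel_measurable M"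
    if [measurable]: "k \<in> borel_measurable M" "f \<in> borel_measurable M" "g \<in> borel_measurable M"
    for k f g :: "'x \<Rightarrow> real" and M :: "'x measure"
    unfolding \<Psi>_def by measurable
  define L where "L z = (\<integral>\<^sup>+\<phi>. indicator {-pi..pi} \<phi> * (ennreal (circ_jac b (z, \<phi>)) * F (circ_pt b (z, \<phi>), z)) \<partial>lborel)" for z
  have L [measurable]: "L \<in> borel_measurable borel"
    unfolding L_def circ_jac_def circ_pt_def circ_m_def circ_s_def fst_conv snd_conv by measurable
  have "(\<integral>\<^sup>+\<sigma>. indicator (UNIV \<times> {-pi..pi}) \<sigma> * (ennreal (circ_jac b \<sigma>) * F (circ_pt b \<sigma>, fst \<sigma>)) \<partial>lborel) =
    (\<integral>\<^sup>+z. L z \<partial>lborel)"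
  proof -
    have ind: "indicator (UNIV \<times> {-pi..pi}) \<sigma> = (indicator {-pi..pi} (snd \<sigma>) :: ennreal)" for \<sigma> :: "complex \<times> real"
      by (cases \<sigma>) (auto simp: indicator_def)
    have "(\<lambda>\<sigma>. indicator {-pi..pi} (snd \<sigma>) * (ennreal (circ_jac b \<sigma>) * F (circ_pt b \<sigma>, fst \<sigma>))) \<in> borel_measurable (lborel \<Otimes>\<^sub>M lborel)"
      unfolding circ_jac_def circ_pt_def circ_m_def circ_s_def by measurable
    from lborel.nn_integral_fst[OF this] show ?thesis
      unfolding L_def by (simp add: lborel_prod ind)
  qed
  also have "\<dots> = (\<integral>\<^sup>+\<kappa>. \<integral>\<^sup>+\<rho>. ennreal (\<bar>\<rho>\<bar> / (1 + \<kappa>\<^sup>2)) * L (of_real \<rho> * slope_dir \<kappa>) \<partial>lborel \<partial>lborel)"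
    by (rule nn_integral_signed_polar) simp
  also have "\<dots> = (\<integral>\<^sup>+\<kappa>. \<integral>\<^sup>+T. \<integral>\<^sup>+s. ennreal (1 / (1 + \<kappa>\<^sup>2)) * (ennreal \<bar>T\<bar> *
      (K \<kappa> T s (jouk_inv b 1 (root_par b T s)) + K \<kappa> T s (jouk_inv b (-1) (root_par b T s)))) \<partial>lborel \<partial>lborel \<partial>lborel)"
  proof (rule nn_integral_cong)
    fix \<kappa> :: real
    have L_eq: "ennreal \<bar>\<rho>\<bar> * L (of_real \<rho> * slope_dir \<kappa>) = ennreal (b / 2 * (1 + 1 / \<rho>\<^sup>2)) * \<Psi> \<kappa> \<rho> (jouk b \<rho>)"
      if \<rho>: "\<rho> \<noteq> 0" for \<rho> :: real
    proof -
      \<comment> \<open>For \<rho> < 0 the modulus of \<zeta> is -\<rho>. Reversing the angle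
        compensates for this, so that the formulas in \<rho> hold for both signs.\<close>
      define sg where "sg = sgn \<rho>"
      have sg: "sg \<in> {1, -1}" "\<bar>\<rho>\<bar> = sg * \<rho>" using \<rho> by (auto simp: sg_def sgn_if)
      let ?z = "of_real \<rho> * slope_dir \<kappa>"
      have nz: "cmod ?z = sg * \<rho>" using sg(2) by (simp add: norm_mult)
      have m: "circ_m b ?z (sg * \<phi>) * \<rho> = ?T (jouk b \<rho>) \<phi>" for \<phi>
        using sg(1) \<rho> unfolding circ_m_def nz jouk_def by (auto simp: field_simps power2_eq_square)
      have s: "circ_s b ?z (sg * \<phi>) = ?s (jouk b \<rho>) \<phi>" for \<phi>
        using sg(1) \<rho> unfolding circ_s_def nz jouk_def by (auto simp: field_simps)
      have pt: "circ_pt b (?z, sg * \<phi>) = (of_real (?T (jouk b \<rho>) \<phi>) * cnj (slope_dir \<kappa>), ?s (jouk b \<rho>) \<phi>)" for \<phi>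
        unfolding circ_pt_def fst_conv snd_conv s m[symmetric] by simp
      have jac: "\<bar>\<rho>\<bar> * circ_jac b (?z, sg * \<phi>) = b / 2 * (1 + 1 / \<rho>\<^sup>2) * (?T (jouk b \<rho>) \<phi>)\<^sup>2" for \<phi>
        unfolding circ_jac_def fst_conv snd_conv m[symmetric] nz sg(2) using sg(1) \<rho>
        by (auto simp: field_simps power2_eq_square)
      have "L ?z = (\<integral>\<^sup>+\<phi>. indicator {-pi..pi} \<phi> * (ennreal (circ_jac b (?z, sg * \<phi>)) * F (circ_pt b (?z, sg * \<phi>), ?z)) \<partial>lborel)"
        (is "_ = nn_integral lborel ?f")
      proof (cases "sg = 1")
        case True then show ?thesis by (simp add: L_def)
      next
        case False
        then have [simp]: "sg = -1" using sg by simp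
        show ?thesis unfolding L_def
          by (subst nn_integral_reflect_symmetric_interval[symmetric])
            (simp_all add: circ_jac_def circ_pt_def circ_m_def circ_s_def)
      qed
      then have "ennreal \<bar>\<rho>\<bar> * L ?z = (\<integral>\<^sup>+\<phi>. ennreal \<bar>\<rho>\<bar> * ?f \<phi> \<partial>lborel)"
        by (simp, intro nn_integral_cmult[symmetric]) (simp add: circ_jac_def circ_pt_def circ_m_def circ_s_def)
      also have "\<dots> = (\<integral>\<^sup>+\<phi>. ennreal (b / 2 * (1 + 1 / \<rho>\<^sup>2)) * (indicator {-pi..pi} \<phi> * (ennreal ((?T (jouk b \<rho>) \<phi>)\<^sup>2) *
          K \<kappa> (?T (jouk b \<rho>) \<phi>) (?s (jouk b \<rho>) \<phi>) \<rho>)) \<partial>lborel)"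
      proof (rule nn_integral_cong)
        fix \<phi> :: real
        have "ennreal \<bar>\<rho>\<bar> * ennreal (circ_jac b (?z, sg * \<phi>)) = ennreal (b / 2 * (1 + 1 / \<rho>\<^sup>2)) * ennreal ((?T (jouk b \<rho>) \<phi>)\<^sup>2)"
        proof -
          have "0 \<le> circ_jac b (?z, sg * \<phi>)" using b by (simp add: circ_jac_def)
          then have "ennreal \<bar>\<rho>\<bar> * ennreal (circ_jac b (?z, sg * \<phi>)) = ennreal (\<bar>\<rho>\<bar> * circ_jac b (?z, sg * \<phi>))"
            by (simp add: ennreal_mult)
          also have "\<dots> = ennreal (b / 2 * (1 + 1 / \<rho>\<^sup>2)) * ennreal ((?T (jouk b \<rho>) \<phi>)\<^sup>2)"
            unfolding jac using b by (intro ennreal_mult) auto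
          finally show ?thesis .
        qed
        then show "ennreal \<bar>\<rho>\<bar> * ?f \<phi> = ennreal (b / 2 * (1 + 1 / \<rho>\<^sup>2)) * (indicator {-pi..pi} \<phi> * (ennreal ((?T (jouk b \<rho>) \<phi>)\<^sup>2) *
          K \<kappa> (?T (jouk b \<rho>) \<phi>) (?s (jouk b \<rho>) \<phi>) \<rho>))"
          unfolding pt K_def by (simp add: indicator_def mult.assoc[symmetric])
      qed
      also have "\<dots> = ennreal (b / 2 * (1 + 1 / \<rho>\<^sup>2)) * \<Psi> \<kappa> \<rho> (jouk b \<rho>)"
        unfolding \<Psi>_def by (rule nn_integral_cmult) measurable
      finally show ?thesis .
    qed
    have half: "(\<integral>\<^sup>+\<rho>. ennreal (b / 2 * (1 + 1 / \<rho>\<^sup>2)) * \<Psi> \<kappa> \<rho> (jouk b \<rho>) * indicator {\<rho>. \<epsilon> * \<rho> > 0} \<rho> \<partial>lborel) =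
      (\<integral>\<^sup>+T. \<integral>\<^sup>+s. ennreal \<bar>T\<bar> * K \<kappa> T s (jouk_inv b \<epsilon> (root_par b T s)) \<partial>lborel \<partial>lborel)"
      if \<epsilon>: "\<epsilon> \<in> {1, -1}" for \<epsilon>
    proof -
      have "(\<integral>\<^sup>+\<rho>. ennreal (b / 2 * (1 + 1 / \<rho>\<^sup>2)) * \<Psi> \<kappa> \<rho> (jouk b \<rho>) * indicator {\<rho>. \<epsilon> * \<rho> > 0} \<rho> \<partial>lborel) =
        (\<integral>\<^sup>+a. \<Psi> \<kappa> (jouk_inv b \<epsilon> a) (jouk b (jouk_inv b \<epsilon> a)) \<partial>lborel)"
        by (rule nn_integral_jouk[OF b \<epsilon>]) measurable
      also have "\<dots> = (\<integral>\<^sup>+a. \<Psi> \<kappa> (jouk_inv b \<epsilon> a) a \<partial>lborel)"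
        by (simp add: jouk_jouk_inv[OF b \<epsilon>])
      also have "\<dots> = (\<integral>\<^sup>+T. \<integral>\<^sup>+s. ennreal \<bar>T\<bar> * K \<kappa> T s (jouk_inv b \<epsilon> (root_par b T s)) \<partial>lborel \<partial>lborel)"
        unfolding \<Psi>_def
        by (rule nn_integral_circles[OF b, where K="\<lambda>T s a. K \<kappa> T s (jouk_inv b \<epsilon> a)"])
          (unfold borel_prod[symmetric] case_prod_beta, measurable)
      finally show ?thesis .
    qed
    have "(\<integral>\<^sup>+\<rho>. ennreal (\<bar>\<rho>\<bar> / (1 + \<kappa>\<^sup>2)) * L (of_real \<rho> * slope_dir \<kappa>) \<partial>lborel) =
      (\<integral>\<^sup>+\<rho>. ennreal (1 / (1 + \<kappa>\<^sup>2)) *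
        (ennreal (b / 2 * (1 + 1 / \<rho>\<^sup>2)) * \<Psi> \<kappa> \<rho> (jouk b \<rho>) * indicator {\<rho>. 1 * \<rho> > 0} \<rho> +
         ennreal (b / 2 * (1 + 1 / \<rho>\<^sup>2)) * \<Psi> \<kappa> \<rho> (jouk b \<rho>) * indicator {\<rho>. -1 * \<rho> > 0} \<rho>) \<partial>lborel)"
    proof (rule nn_integral_cong_AE, rule AE_mp[OF AE_lborel_singleton[of 0]], rule AE_I2, rule impI)
      fix \<rho> :: real assume \<rho>: "\<rho> \<noteq> 0"
      have "ennreal (\<bar>\<rho>\<bar> / (1 + \<kappa>\<^sup>2)) = ennreal (1 / (1 + \<kappa>\<^sup>2)) * ennreal \<bar>\<rho>\<bar>"
        by (subst ennreal_mult[symmetric]) auto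
      then show "ennreal (\<bar>\<rho>\<bar> / (1 + \<kappa>\<^sup>2)) * L (of_real \<rho> * slope_dir \<kappa>) = ennreal (1 / (1 + \<kappa>\<^sup>2)) *
        (ennreal (b / 2 * (1 + 1 / \<rho>\<^sup>2)) * \<Psi> \<kappa> \<rho> (jouk b \<rho>) * indicator {\<rho>. 1 * \<rho> > 0} \<rho> +
         ennreal (b / 2 * (1 + 1 / \<rho>\<^sup>2)) * \<Psi> \<kappa> \<rho> (jouk b \<rho>) * indicator {\<rho>. -1 * \<rho> > 0} \<rho>)"
        using L_eq[OF \<rho>] \<rho> by (auto simp: mult.assoc indicator_def)
    qed
    also have "\<dots> = ennreal (1 / (1 + \<kappa>\<^sup>2)) *
       ((\<integral>\<^sup>+T. \<integral>\<^sup>+s. ennreal \<bar>T\<bar> * K \<kappa> T s (jouk_inv b 1 (root_par b T s)) \<partial>lborel \<partial>lborel) +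
        (\<integral>\<^sup>+T. \<integral>\<^sup>+s. ennreal \<bar>T\<bar> * K \<kappa> T s (jouk_inv b (-1) (root_par b T s)) \<partial>lborel \<partial>lborel))"
      by (subst nn_integral_cmult, measurable, subst nn_integral_add, measurable, subst (1 2) half) auto
    also have "\<dots> = (\<integral>\<^sup>+T. \<integral>\<^sup>+s. ennreal (1 / (1 + \<kappa>\<^sup>2)) * (ennreal \<bar>T\<bar> *
      (K \<kappa> T s (jouk_inv b 1 (root_par b T s)) + K \<kappa> T s (jouk_inv b (-1) (root_par b T s)))) \<partial>lborel \<partial>lborel)"
      by (simp add: nn_integral_cmult nn_integral_add distrib_left)
    finally show "(\<integral>\<^sup>+\<rho>. ennreal (\<bar>\<rho>\<bar> / (1 + \<kappa>\<^sup>2)) * L (of_real \<rho> * slope_dir \<kappa>) \<partial>lborel) =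
      (\<integral>\<^sup>+T. \<integral>\<^sup>+s. ennreal (1 / (1 + \<kappa>\<^sup>2)) * (ennreal \<bar>T\<bar> *
      (K \<kappa> T s (jouk_inv b 1 (root_par b T s)) + K \<kappa> T s (jouk_inv b (-1) (root_par b T s)))) \<partial>lborel \<partial>lborel)" .
  qed
  also have "\<dots> = (\<integral>\<^sup>+\<kappa>. \<integral>\<^sup>+s. \<integral>\<^sup>+T. ennreal (1 / (1 + \<kappa>\<^sup>2)) * (ennreal \<bar>T\<bar> *
      (K \<kappa> T s (jouk_inv b 1 (root_par b T s)) + K \<kappa> T s (jouk_inv b (-1) (root_par b T s)))) \<partial>lborel \<partial>lborel \<partial>lborel)"
    by (rule nn_integral_cong, rule lborel_pair.Fubini') measurable
  also have "\<dots> = (\<integral>\<^sup>+s. \<integral>\<^sup>+\<kappa>. \<integral>\<^sup>+T. ennreal (1 / (1 + \<kappa>\<^sup>2)) * (ennreal \<bar>T\<bar> *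
      (K \<kappa> T s (jouk_inv b 1 (root_par b T s)) + K \<kappa> T s (jouk_inv b (-1) (root_par b T s)))) \<partial>lborel \<partial>lborel \<partial>lborel)"
    by (rule lborel_pair.Fubini') measurable
  also have "\<dots> = (\<integral>\<^sup>+s. \<integral>\<^sup>+w. F ((w, s), lam b 1 (w, s)) + F ((w, s), lam b (-1) (w, s)) \<partial>lborel \<partial>lborel)"
  proof (rule nn_integral_cong)
    fix s :: real
    let ?h = "\<lambda>w. F ((w, s), lam b 1 (w, s)) + F ((w, s), lam b (-1) (w, s))"
    have hm [measurable]: "?h \<in> borel_measurable borel" unfolding lam_def fst_conv snd_conv by measurable
    \<comment> \<open>The point carries the conjugate of the direction of its pole; conjugating w
      first makes both polar representations refer to the same \<kappa>.\<close>
    have "(\<integral>\<^sup>+w. ?h w \<partial>lborel) = (\<integral>\<^sup>+w. ?h (cnj w) \<partial>lborel)"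
      by (rule nn_integral_lborel_cnj[symmetric]) (rule hm)
    also have "\<dots> = (\<integral>\<^sup>+\<kappa>. \<integral>\<^sup>+T. ennreal (\<bar>T\<bar> / (1 + \<kappa>\<^sup>2)) * ?h (cnj (of_real T * slope_dir \<kappa>)) \<partial>lborel \<partial>lborel)"
      by (rule nn_integral_signed_polar) (rule measurable_compose[OF _ hm], measurable)
    also have "\<dots> = (\<integral>\<^sup>+\<kappa>. \<integral>\<^sup>+T. ennreal (1 / (1 + \<kappa>\<^sup>2)) * (ennreal \<bar>T\<bar> *
      (K \<kappa> T s (jouk_inv b 1 (root_par b T s)) + K \<kappa> T s (jouk_inv b (-1) (root_par b T s)))) \<partial>lborel \<partial>lborel)"
    proof (rule nn_integral_cong, rule nn_integral_cong)
      fix \<kappa> T :: real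
      have e: "ennreal (\<bar>T\<bar> / (1 + \<kappa>\<^sup>2)) = ennreal (1 / (1 + \<kappa>\<^sup>2)) * ennreal \<bar>T\<bar>"
        by (subst ennreal_mult[symmetric]) auto
      have h: "?h (cnj (of_real T * slope_dir \<kappa>)) = K \<kappa> T s (jouk_inv b 1 (root_par b T s)) + K \<kappa> T s (jouk_inv b (-1) (root_par b T s))"
        if "T \<noteq> 0"
      proof (cases "T > 0")
        case True
        then show ?thesis by (simp add: K_def lam_def norm_mult)
      next
        \<comment> \<open>For T < 0 the modulus is -T and \<open>root_par\<close> changes sign. This
          exchanges the two zeros, which leaves the sum unchanged.\<close>
        case False
        then have "root_par b \<bar>T\<bar> s = - root_par b T s" "\<bar>T\<bar> = - T" using that
          by (auto simp: root_par_def divide_simps)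
        then show ?thesis using that
          by (simp add: K_def lam_def norm_mult jouk_inv_minus add.commute)
      qed
      show "ennreal (\<bar>T\<bar> / (1 + \<kappa>\<^sup>2)) * ?h (cnj (of_real T * slope_dir \<kappa>)) = ennreal (1 / (1 + \<kappa>\<^sup>2)) * (ennreal \<bar>T\<bar> *
        (K \<kappa> T s (jouk_inv b 1 (root_par b T s)) + K \<kappa> T s (jouk_inv b (-1) (root_par b T s))))"
      proof (cases "T = 0")
        case False
        show ?thesis unfolding h[OF False] e by (rule mult.assoc)
      qed simp
    qed
    finally show "(\<integral>\<^sup>+\<kappa>. \<integral>\<^sup>+T. ennreal (1 / (1 + \<kappa>\<^sup>2)) * (ennreal \<bar>T\<bar> *
      (K \<kappa> T s (jouk_inv b 1 (root_par b T s)) + K \<kappa> T s (jouk_inv b (-1) (root_par b T s)))) \<partial>lborel \<partial>lborel) =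
      (\<integral>\<^sup>+w. ?h w \<partial>lborel)" by simp
  qed
  also have "\<dots> = (\<integral>\<^sup>+x. F (x, lam b 1 x) + F (x, lam b (-1) x) \<partial>lborel)"
  proof -
    have "(\<lambda>x. F ((fst x, snd x), lam b 1 x) + F ((fst x, snd x), lam b (-1) x)) \<in> borel_measurable (lborel \<Otimes>\<^sub>M lborel)"
      unfolding lam_def by measurable
    from lborel_pair.nn_integral_snd[OF this] show ?thesis by (simp add: lborel_prod)
  qed
  finally show ?thesis .
qed

section \<open>Partial fractions in the spectral parameter\<close>

lemma AE_fst_neq: "AE x in (lborel :: ('a::euclidean_space \<times> 'b::euclidean_space) measure). fst x \<noteq> a"
proof -
  have "emeasure (lborel :: ('a \<times> 'b) measure) ({a} \<times> UNIV) = 0"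
    by (subst lborel_prod[symmetric], subst lborel.emeasure_pair_measure_Times) auto
  moreover have "{a} \<times> UNIV \<in> sets (lborel :: ('a \<times> 'b) measure)"
    by (simp add: borel_closed closed_Times)
  ultimately have "{a} \<times> UNIV \<in> null_sets (lborel :: ('a \<times> 'b) measure)" by auto
  then show ?thesis by (rule AE_I') auto
qed

text \<open>\<open>circ_w\<close> is a quarter of the weight in the bracket \<open>{\<cdot>, \<cdot>}\<close>, and \<open>den\<close> is \<open>\<xi>\<^sup>2 + 2 k(z, p) \<cdot> \<xi>\<close>, both in the
  frame at \<open>p\<close>.\<close>

definition circ_w :: "real \<Rightarrow> complex \<times> real \<Rightarrow> complex" where
  "circ_w b \<sigma> = of_real (circ_m b (fst \<sigma>) (snd \<sigma>) * cmod (fst \<sigma>)) / (2 * cnj (fst \<sigma>))"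

definition den :: "real \<Rightarrow> complex \<Rightarrow> complex \<times> real \<Rightarrow> complex" where
  "den b z x = of_real ((cmod (fst x))\<^sup>2 + (snd x)\<^sup>2 + 2 * b * snd x) + of_real b * (z * fst x - cnj (fst x) / z)"

text \<open>The residue of 1/\<open>den\<close> at a zero z, for a point with first component w. The
  other zero is -1/\<open>cnj z\<close>, which is why only |z| appears.\<close>

definition resid :: "real \<Rightarrow> complex \<Rightarrow> complex \<Rightarrow> complex" where
  "resid b w z = 1 / (of_real b * w * of_real (1 + 1 / (cmod z)\<^sup>2))"

lemma circ_w_measurable [measurable (raw)]:
  assumes [measurable]: "f \<in> borel_measurable M" "g \<in> borel_measurable M"
  shows "(\<lambda>x. circ_w (f x) (g x)) \<in> borel_measurable M"
  unfolding circ_w_def circ_m_def by measurable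

lemma den_measurable [measurable]: "den b z \<in> borel_measurable borel"
  unfolding den_def borel_prod[symmetric] by measurable

lemma resid_measurable [measurable (raw)]:
  assumes [measurable]: "f \<in> borel_measurable M" "g \<in> borel_measurable M"
  shows "(\<lambda>x. resid b (f x) (g x)) \<in> borel_measurable M"
  unfolding resid_def by measurable

lemma sgn_complex_mult_cnj: "w \<noteq> 0 \<Longrightarrow> w * (cnj w / of_real (cmod w)) = of_real (cmod w)"
  using complex_norm_square[of w] by (simp add: power2_eq_square field_simps)

lemma mult_lam:
  assumes "fst x \<noteq> 0" shows "fst x * lam b \<epsilon> x = of_real (jouk_inv b \<epsilon> (root_par b (cmod (fst x)) (snd x)) * cmod (fst x))"
proof -
  have "fst x * lam b \<epsilon> x = of_real (jouk_inv b \<epsilon> (root_par b (cmod (fst x)) (snd x))) * (fst x * (cnj (fst x) / of_real (cmod (fst x))))"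
    unfolding lam_def by (simp only: mult_ac)
  then show ?thesis unfolding sgn_complex_mult_cnj[OF assms] by simp
qed

lemma lam_nonzero:
  assumes "fst x \<noteq> 0" "\<epsilon> \<in> {1, -1}" shows "lam b \<epsilon> x \<noteq> 0"
  using assms jouk_inv_sign[of b "root_par b (cmod (fst x)) (snd x)"] by (auto simp: lam_def)

text \<open>The two zeros are antipodal on the Riemann sphere: they lie on one line through 0, and
  their signed moduli are the two values of \<open>jouk_inv\<close>, with product -1. In particular
  they never coincide.\<close>

lemma lam_antipode:
  assumes "fst x \<noteq> 0" shows "lam b 1 x * cnj (lam b (-1) x) = - 1"
proof -
  let ?a = "root_par b (cmod (fst x)) (snd x)"
  have "lam b 1 x * cnj (lam b (-1) x) = of_real (jouk_inv b 1 ?a * jouk_inv b (-1) ?a) *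
      (cnj (fst x) * fst x / (of_real (cmod (fst x)) * of_real (cmod (fst x))))"
    unfolding lam_def by simp
  also have "cnj (fst x) * fst x / (of_real (cmod (fst x)) * of_real (cmod (fst x))) = 1"
    using complex_norm_square[of "fst x"] assms by (simp add: power2_eq_square mult.commute)
  finally show ?thesis by (simp add: jouk_inv_mult)
qed

text \<open>Multiplied by z, \<open>den\<close> is a quadratic polynomial in z with leading
  coefficient b w. The facts 1 and 2 are Vieta's formulas for the sum and the product of its
  zeros.\<close>

lemma den_factor:
  assumes b: "b > 0" and w: "fst x \<noteq> 0" and z: "z \<noteq> 0"
  shows "den b z x = of_real b * fst x * (z - lam b 1 x) * (z - lam b (-1) x) / z"
proof -
  let ?w = "fst x" and ?a = "root_par b (cmod (fst x)) (snd x)"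
  let ?E = "(cmod ?w)\<^sup>2 + (snd x)\<^sup>2 + 2 * b * snd x"
  have E: "2 * ?a * cmod ?w = - ?E" using w by (simp add: root_par_def)
  have "jouk_inv b 1 ?a + jouk_inv b (-1) ?a = 2 * ?a / b" by (simp add: jouk_inv_def)
  then have j: "b * (jouk_inv b 1 ?a * cmod ?w + jouk_inv b (-1) ?a * cmod ?w) = - ?E"
  proof -
    have "b * (jouk_inv b 1 ?a * cmod ?w + jouk_inv b (-1) ?a * cmod ?w) = b * (jouk_inv b 1 ?a + jouk_inv b (-1) ?a) * cmod ?w"
      by (simp add: algebra_simps)
    also have "\<dots> = 2 * ?a * cmod ?w" unfolding \<open>jouk_inv b 1 ?a + jouk_inv b (-1) ?a = 2 * ?a / b\<close> using b by simp
    finally show ?thesis unfolding E .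
  qed
  have "of_real b * (?w * lam b 1 x + ?w * lam b (-1) x) = complex_of_real (- ?E)"
    unfolding mult_lam[OF w] by (simp only: j flip: of_real_add of_real_mult)
  then have 1: "of_real b * ?w * (lam b 1 x + lam b (-1) x) = - complex_of_real ?E"
    by (simp add: algebra_simps)
  have "?w * (lam b 1 x * lam b (-1) x) = (?w * lam b 1 x) * (?w * lam b (-1) x) / ?w"
    using w by simp
  also have "\<dots> = of_real (jouk_inv b 1 ?a * jouk_inv b (-1) ?a) * (of_real (cmod ?w) * of_real (cmod ?w)) / ?w"
    unfolding mult_lam[OF w] by simp
  also have "\<dots> = - cnj ?w"
    using w complex_norm_square[of ?w] by (simp add: jouk_inv_mult power2_eq_square)
  finally have 2: "?w * (lam b 1 x * lam b (-1) x) = - cnj ?w" .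
  have "of_real b * ?w * (z - lam b 1 x) * (z - lam b (-1) x) =
    of_real b * ?w * z * z - z * (of_real b * ?w * (lam b 1 x + lam b (-1) x)) + of_real b * (?w * (lam b 1 x * lam b (-1) x))"
    by (simp add: algebra_simps)
  also have "\<dots> = z * den b z x"
    unfolding 1 2 den_def using z by (simp add: algebra_simps)
  finally show ?thesis using z by simp
qed

lemma resid_lam:
  assumes w: "fst x \<noteq> 0"
  shows "resid b (fst x) (lam b 1 x) = lam b 1 x / (of_real b * fst x * (lam b 1 x - lam b (-1) x))"
    "resid b (fst x) (lam b (-1) x) = lam b (-1) x / (of_real b * fst x * (lam b (-1) x - lam b 1 x))"
proof -
  have *: "resid b (fst x) l = l / (of_real b * fst x * (l - l'))" if "l \<noteq> 0" "l * cnj l' = -1" for l l'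
  proof -
    have "cnj l * l' = -1" using arg_cong[OF that(2), of cnj] by simp
    have "l * of_real (1 + 1 / (cmod l)\<^sup>2) = l + l / (l * cnj l)"
      by (simp only: of_real_add of_real_divide of_real_1 complex_norm_square ring_distribs) simp
    also have "\<dots> = l - l'" using that(1) \<open>cnj l * l' = -1\<close> by (simp add: field_simps)
    finally have e: "l - l' = l * of_real (1 + 1 / (cmod l)\<^sup>2)" by simp
    show ?thesis unfolding resid_def e using that(1) by simp
  qed
  show "resid b (fst x) (lam b 1 x) = lam b 1 x / (of_real b * fst x * (lam b 1 x - lam b (-1) x))"
    using lam_nonzero[OF w] lam_antipode[OF w] by (intro *) auto
  show "resid b (fst x) (lam b (-1) x) = lam b (-1) x / (of_real b * fst x * (lam b (-1) x - lam b 1 x))"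
    using lam_nonzero[OF w] arg_cong[OF lam_antipode[OF w], of cnj b] by (intro *) (auto simp: mult.commute)
qed

lemma partial_fractions:
  assumes b: "b > 0" and w: "fst x \<noteq> 0" and z: "z \<noteq> 0" "z \<noteq> lam b 1 x" "z \<noteq> lam b (-1) x"
  shows "1 / den b z x = resid b (fst x) (lam b 1 x) / (z - lam b 1 x) + resid b (fst x) (lam b (-1) x) / (z - lam b (-1) x)"
proof -
  have ne: "lam b 1 x \<noteq> lam b (-1) x"
  proof
    assume *: "lam b 1 x = lam b (-1) x"
    have "complex_of_real ((cmod (lam b 1 x))\<^sup>2) = -1"
      using lam_antipode[OF w, of b] unfolding complex_norm_square by (simp add: *)
    then have "(cmod (lam b 1 x))\<^sup>2 = -1" by (metis of_real_eq_iff of_real_minus of_real_1)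
    then show False by (smt (verit) zero_le_power2)
  qed
  have *: "z / (B * (z - l) * (z - m)) = l / (B * (l - m)) / (z - l) + m / (B * (m - l)) / (z - m)"
    if "B \<noteq> 0" "z \<noteq> l" "z \<noteq> m" "l \<noteq> m" for B l m :: complex
  proof -
    have ml: "B * (m - l) = - (B * (l - m))" by (simp add: algebra_simps)
    have "l / (B * (l - m)) / (z - l) + m / (B * (m - l)) / (z - m) = (l / (z - l) - m / (z - m)) / (B * (l - m))"
      unfolding ml by (simp add: diff_divide_distrib mult.commute del: mult_minus_right)
    also have "l / (z - l) - m / (z - m) = z * (l - m) / ((z - l) * (z - m))"
      using that by (simp add: field_simps)
    finally show ?thesis using that by simp
  qed
  show ?thesis
    unfolding den_factor[OF b w z(1)] resid_lam[OF w]
    using *[of "of_real b * fst x" "lam b 1 x" "lam b (-1) x"] b w z ne by simp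
qed

section \<open>The substitution for kernels with poles\<close>

definition circ_dom :: "(complex \<times> real) set" where "circ_dom = UNIV \<times> {-pi..pi}"

lemma circ_dom_measurable [measurable]: "circ_dom \<in> sets borel"
  unfolding circ_dom_def by (simp add: borel_closed closed_Times)

lemma circ_dom_indicator: "indicator circ_dom \<sigma> = indicator {-pi..pi} (snd \<sigma>)"
  by (cases \<sigma>) (auto simp: circ_dom_def indicator_def)

definition circ_half :: "real \<Rightarrow> real \<Rightarrow> (complex \<times> real) set" where
  "circ_half b \<epsilon> = {\<sigma> \<in> circ_dom. 0 < \<epsilon> * circ_m b (fst \<sigma>) (snd \<sigma>)}"

lemma circ_half_measurable [measurable]: "circ_half b \<epsilon> \<in> sets borel"
proof -
  have "{\<sigma>. \<sigma> \<in> circ_dom \<and> 0 < \<epsilon> * circ_m b (fst \<sigma>) (snd \<sigma>)} \<in> sets borel"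
    using circ_measurable(1)[of b] unfolding borel_prod by measurable
  then show ?thesis by (simp add: circ_half_def)
qed

text \<open>The sign of \<open>circ_m\<close> tells which of the two zeros the pole \<zeta> is: the
  first component of the point times \<zeta> is \<open>circ_m\<close> |\<zeta>|^2, whereas w
  \<open>lam b \<epsilon> x\<close> is real with the sign of \<epsilon>. Putting this sign condition
  into F selects one of the two preimages.\<close>

lemma nn_integral_circ_half:
  assumes b: "b > 0" and e: "\<epsilon> \<in> {1, -1}" and [measurable]: "F \<in> borel_measurable borel"
  shows "(\<integral>\<^sup>+\<sigma>. indicator (circ_half b \<epsilon>) \<sigma> * (ennreal (circ_jac b \<sigma>) * F (circ_pt b \<sigma>, fst \<sigma>)) \<partial>lborel) =
         (\<integral>\<^sup>+x. F (x, lam b \<epsilon> x) \<partial>lborel)"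
proof -
  define F' where "F' y = indicator {y. 0 < \<epsilon> * Re (fst (fst y) * snd y)} y * F y" for y
  have [measurable]: "F' \<in> borel_measurable borel"
  proof -
    have "(\<lambda>y::(complex \<times> real) \<times> complex. \<epsilon> * Re (fst (fst y) * snd y)) \<in> borel_measurable borel"
      unfolding borel_prod[symmetric] by measurable
    then have "{y::(complex \<times> real) \<times> complex. 0 < \<epsilon> * Re (fst (fst y) * snd y)} \<in> sets borel" by measurable
    then show ?thesis unfolding F'_def by measurable
  qed
  have "(\<integral>\<^sup>+\<sigma>. indicator (circ_half b \<epsilon>) \<sigma> * (ennreal (circ_jac b \<sigma>) * F (circ_pt b \<sigma>, fst \<sigma>)) \<partial>lborel) =
    (\<integral>\<^sup>+\<sigma>. indicator (UNIV \<times> {-pi..pi}) \<sigma> * (ennreal (circ_jac b \<sigma>) * F' (circ_pt b \<sigma>, fst \<sigma>)) \<partial>lborel)"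
  proof (rule nn_integral_cong)
    fix \<sigma> :: "complex \<times> real"
    have "0 < \<epsilon> * Re (fst (circ_pt b \<sigma>) * fst \<sigma>) \<longleftrightarrow> 0 < \<epsilon> * circ_m b (fst \<sigma>) (snd \<sigma>)" if "fst \<sigma> \<noteq> 0"
    proof -
      have "fst (circ_pt b \<sigma>) * fst \<sigma> = of_real (circ_m b (fst \<sigma>) (snd \<sigma>) * (cmod (fst \<sigma>))\<^sup>2)"
        by (simp only: circ_pt_def fst_conv of_real_mult complex_norm_square) (simp add: mult_ac)
      then have "Re (fst (circ_pt b \<sigma>) * fst \<sigma>) = circ_m b (fst \<sigma>) (snd \<sigma>) * (cmod (fst \<sigma>))\<^sup>2"
        by (simp only: Re_complex_of_real)
      then have "\<epsilon> * Re (fst (circ_pt b \<sigma>) * fst \<sigma>) = (\<epsilon> * circ_m b (fst \<sigma>) (snd \<sigma>)) * (cmod (fst \<sigma>))\<^sup>2"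
        by (simp only: mult.assoc)
      moreover have "0 < x * (cmod (fst \<sigma>))\<^sup>2 \<longleftrightarrow> 0 < x" for x :: real
        using that by (simp add: zero_less_mult_iff)
      ultimately show ?thesis by (simp only:)
    qed
    moreover have "circ_jac b \<sigma> = 0" if "fst \<sigma> = 0" using that by (simp add: circ_jac_def)
    ultimately show "indicator (circ_half b \<epsilon>) \<sigma> * (ennreal (circ_jac b \<sigma>) * F (circ_pt b \<sigma>, fst \<sigma>)) =
      indicator (UNIV \<times> {-pi..pi}) \<sigma> * (ennreal (circ_jac b \<sigma>) * F' (circ_pt b \<sigma>, fst \<sigma>))"
      by (cases "fst \<sigma> = 0") (auto simp: indicator_def F'_def circ_half_def circ_dom_def)
  qed
  also have "\<dots> = (\<integral>\<^sup>+x. F' (x, lam b 1 x) + F' (x, lam b (-1) x) \<partial>lborel)"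
    by (rule nn_integral_circ_pt[OF b]) simp
  also have "\<dots> = (\<integral>\<^sup>+x. F (x, lam b \<epsilon> x) \<partial>lborel)"
  proof (rule nn_integral_cong_AE, rule AE_mp[OF AE_fst_neq[of 0]], rule AE_I2, rule impI)
    fix x :: "complex \<times> real" assume w: "fst x \<noteq> 0"
    have "Re (fst x * lam b 1 x) > 0" "Re (fst x * lam b (-1) x) < 0"
      unfolding mult_lam[OF w] using w jouk_inv_sign[of b "root_par b (cmod (fst x)) (snd x)"]
      by (auto simp: mult_pos_pos mult_neg_pos)
    then show "F' (x, lam b 1 x) + F' (x, lam b (-1) x) = F (x, lam b \<epsilon> x)"
      using e by (auto simp: F'_def)
  qed
  finally show ?thesis .
qed

text \<open>For indicator functions the preceding identity says that two image measures on the pairs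
  (x, zero) coincide. Integrability and integrals of complex functions then transfer
  together.\<close>

lemma
  fixes f :: "(complex \<times> real) \<times> complex \<Rightarrow> complex"
  assumes b: "b > 0" and e: "\<epsilon> \<in> {1, -1}" and [measurable]: "f \<in> borel_measurable borel"
  shows integrable_circ_half: "integrable lborel (\<lambda>\<sigma>. (indicator (circ_half b \<epsilon>) \<sigma> * circ_jac b \<sigma>) *\<^sub>R f (circ_pt b \<sigma>, fst \<sigma>)) \<longleftrightarrow>
      integrable lborel (\<lambda>x. f (x, lam b \<epsilon> x))" (is ?A)
    and integral_circ_half: "(LINT \<sigma>|lborel. (indicator (circ_half b \<epsilon>) \<sigma> * circ_jac b \<sigma>) *\<^sub>R f (circ_pt b \<sigma>, fst \<sigma>)) =
      (LINT x|lborel. f (x, lam b \<epsilon> x))" (is ?B)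
proof -
  have [measurable]: "(\<lambda>\<sigma>. (circ_pt b \<sigma>, fst \<sigma>)) \<in> borel \<rightarrow>\<^sub>M borel"
    by (intro borel_measurable_Pair) measurable
  have [measurable]: "(\<lambda>x. (x, lam b \<epsilon> x)) \<in> borel \<rightarrow>\<^sub>M borel" by measurable
  let ?g = "\<lambda>\<sigma>. indicator (circ_half b \<epsilon>) \<sigma> * circ_jac b \<sigma>"
  have g: "?g \<sigma> \<ge> 0" for \<sigma> using b by (auto simp: circ_jac_def indicator_def)
  let ?D = "density lborel (\<lambda>\<sigma>. ennreal (?g \<sigma>))"
  have eq: "distr ?D borel (\<lambda>\<sigma>. (circ_pt b \<sigma>, fst \<sigma>)) = distr lborel borel (\<lambda>x. (x, lam b \<epsilon> x))"
  proof (rule measure_eqI)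
    fix A assume "A \<in> sets (distr ?D borel (\<lambda>\<sigma>. (circ_pt b \<sigma>, fst \<sigma>)))"
    then have A [measurable]: "A \<in> sets borel" by simp
    have "emeasure (distr ?D borel (\<lambda>\<sigma>. (circ_pt b \<sigma>, fst \<sigma>))) A = (\<integral>\<^sup>+y. indicator A y \<partial>distr ?D borel (\<lambda>\<sigma>. (circ_pt b \<sigma>, fst \<sigma>)))"
      by (subst nn_integral_indicator) auto
    also have "\<dots> = (\<integral>\<^sup>+\<sigma>. ennreal (?g \<sigma>) * indicator A (circ_pt b \<sigma>, fst \<sigma>) \<partial>lborel)"
      by (subst nn_integral_distr, measurable, subst nn_integral_density) auto
    also have "\<dots> = (\<integral>\<^sup>+\<sigma>. indicator (circ_half b \<epsilon>) \<sigma> * (ennreal (circ_jac b \<sigma>) * indicator A (circ_pt b \<sigma>, fst \<sigma>)) \<partial>lborel)"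
      by (intro nn_integral_cong) (auto simp: indicator_def)
    also have "\<dots> = (\<integral>\<^sup>+x. indicator A (x, lam b \<epsilon> x) \<partial>lborel)"
      by (rule nn_integral_circ_half[OF b e]) simp
    also have "\<dots> = (\<integral>\<^sup>+y. indicator A y \<partial>distr lborel borel (\<lambda>x. (x, lam b \<epsilon> x)))"
      by (subst nn_integral_distr) auto
    also have "\<dots> = emeasure (distr lborel borel (\<lambda>x. (x, lam b \<epsilon> x))) A"
      by (subst nn_integral_indicator) auto
    finally show "emeasure (distr ?D borel (\<lambda>\<sigma>. (circ_pt b \<sigma>, fst \<sigma>))) A = emeasure (distr lborel borel (\<lambda>x. (x, lam b \<epsilon> x))) A" .
  qed simp
  have "integrable (distr ?D borel (\<lambda>\<sigma>. (circ_pt b \<sigma>, fst \<sigma>))) f = integrable (distr lborel borel (\<lambda>x. (x, lam b \<epsilon> x))) f"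
    unfolding eq ..
  then show ?A
    using g by (simp add: integrable_distr_eq integrable_density)
  have "integral\<^sup>L (distr ?D borel (\<lambda>\<sigma>. (circ_pt b \<sigma>, fst \<sigma>))) f = integral\<^sup>L (distr lborel borel (\<lambda>x. (x, lam b \<epsilon> x))) f"
    unfolding eq ..
  then show ?B
    using g by (simp add: integral_distr integral_density)
qed

text \<open>Through the substitution \<open>lam\<close> becomes the first coordinate of \<sigma>,
  which avoids a given value almost everywhere.\<close>

lemma AE_lam_neq:
  assumes b: "b > 0" and e: "\<epsilon> \<in> {1, -1}" shows "AE x in lborel. lam b \<epsilon> x \<noteq> z"
proof -
  have [measurable]: "(\<lambda>y::(complex \<times> real) \<times> complex. indicator {z} (snd y) :: ennreal) \<in> borel_measurable borel"
    unfolding borel_prod[symmetric] by measurable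
  have "(\<integral>\<^sup>+x. indicator {z} (lam b \<epsilon> x) \<partial>lborel) =
    (\<integral>\<^sup>+\<sigma>. indicator (circ_half b \<epsilon>) \<sigma> * (ennreal (circ_jac b \<sigma>) * indicator {z} (fst \<sigma>)) \<partial>lborel)"
    using nn_integral_circ_half[OF b e, of "\<lambda>y. indicator {z} (snd y)"] by simp
  also have "\<dots> = (\<integral>\<^sup>+\<sigma>. 0 \<partial>(lborel :: (complex \<times> real) measure))"
    by (rule nn_integral_cong_AE, rule AE_mp[OF AE_fst_neq[of z]]) (auto simp: indicator_def)
  finally have "(\<integral>\<^sup>+x. indicator {z} (lam b \<epsilon> x) \<partial>lborel) = 0" by simp
  then have "AE x in lborel. indicator {z} (lam b \<epsilon> x) = (0 :: ennreal)"
    by (subst (asm) nn_integral_0_iff_AE) auto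
  then show ?thesis by eventually_elim (auto simp: indicator_def)
qed

text \<open>The factor 1 + |\<zeta>|^2 of the Jacobian cancels against that of the residue. What
  remains is the weight of the bracket, whose form is thereby explained.\<close>

lemma circ_jac_resid:
  assumes b: "b > 0" and m: "circ_m b (fst \<sigma>) (snd \<sigma>) \<noteq> 0"
  shows "of_real (circ_jac b \<sigma>) * resid b (fst (circ_pt b \<sigma>)) (fst \<sigma>) = circ_w b \<sigma>"
proof (cases "fst \<sigma> = 0")
  case True then show ?thesis by (simp add: circ_jac_def circ_w_def)
next
  case False
  let ?r = "cmod (fst \<sigma>)" and ?m = "circ_m b (fst \<sigma>) (snd \<sigma>)"
  have r: "?r > 0" "1 + ?r\<^sup>2 > 0" using False by (auto simp: add_pos_nonneg)
  have "circ_jac b \<sigma> / (b * ?m * (1 + 1 / ?r\<^sup>2)) = ?m * ?r / 2"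
  proof -
    have "1 + 1 / ?r\<^sup>2 = (1 + ?r\<^sup>2) / ?r\<^sup>2" using r by (simp add: field_simps)
    then have "circ_jac b \<sigma> / (b * ?m * (1 + 1 / ?r\<^sup>2)) = (b * ?m * (1 + ?r\<^sup>2)) * (?m * ?r\<^sup>2) / ((b * ?m * (1 + ?r\<^sup>2)) * (2 * ?r))"
      unfolding circ_jac_def by (simp add: power2_eq_square mult_ac)
    also have "\<dots> = (?m * ?r\<^sup>2) / (2 * ?r)"
      using b m r by (intro mult_divide_mult_cancel_left) auto
    finally show ?thesis using r by (simp add: power2_eq_square)
  qed
  then have *: "complex_of_real (circ_jac b \<sigma> / (b * ?m * (1 + 1 / ?r\<^sup>2))) / cnj (fst \<sigma>) = complex_of_real (?m * ?r / 2) / cnj (fst \<sigma>)" by (simp only:)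
  have "of_real J * (1 / (of_real b * (of_real m * c) * of_real K)) = complex_of_real (J / (b * m * K)) / c" for J m K and c :: complex
    by (simp add: mult_ac)
  from this[of "circ_jac b \<sigma>" ?m "cnj (fst \<sigma>)" "1 + 1 / ?r\<^sup>2"] *
  have "of_real (circ_jac b \<sigma>) * resid b (fst (circ_pt b \<sigma>)) (fst \<sigma>) = complex_of_real (?m * ?r / 2) / cnj (fst \<sigma>)"
    unfolding resid_def circ_pt_def fst_conv by (rule trans)
  then show ?thesis unfolding circ_w_def by simp
qed

text \<open>Each of the two partial fractions is moved to its own half of \<open>circ_dom\<close>,
  where its zero becomes the variable \<zeta> and its residue, times the Jacobian, becomes
  \<open>circ_w\<close>. Points with \<open>circ_m\<close> = 0 belong to neither half, but there the
  weight vanishes.\<close>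

theorem
  fixes h :: "complex \<times> real \<Rightarrow> complex"
  assumes b: "b > 0" and z: "z \<noteq> 0" and [measurable]: "h \<in> borel_measurable borel"
    and int: "integrable lborel (\<lambda>\<sigma>. indicator circ_dom \<sigma> *\<^sub>R (circ_w b \<sigma> * h (circ_pt b \<sigma>) / (z - fst \<sigma>)))"
  shows integrable_den: "integrable lborel (\<lambda>x. h x / den b z x)"
    and integral_den: "(LINT x|lborel. h x / den b z x) =
      (LINT \<sigma>|lborel. indicator circ_dom \<sigma> *\<^sub>R (circ_w b \<sigma> * h (circ_pt b \<sigma>) / (z - fst \<sigma>)))"
proof -
  define f where "f y = h (fst y) * resid b (fst (fst y)) (snd y) / (z - snd y)" for y
  have [measurable]: "f \<in> borel_measurable borel"
    unfolding f_def by measurable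
  let ?g = "\<lambda>\<sigma>. indicator circ_dom \<sigma> *\<^sub>R (circ_w b \<sigma> * h (circ_pt b \<sigma>) / (z - fst \<sigma>))"
  have half: "(indicator (circ_half b \<epsilon>) \<sigma> * circ_jac b \<sigma>) *\<^sub>R f (circ_pt b \<sigma>, fst \<sigma>) = indicator (circ_half b \<epsilon>) \<sigma> *\<^sub>R ?g \<sigma>" for \<epsilon> \<sigma>
  proof (cases "\<sigma> \<in> circ_half b \<epsilon>")
    case True
    then have m: "circ_m b (fst \<sigma>) (snd \<sigma>) \<noteq> 0" and d: "\<sigma> \<in> circ_dom" by (auto simp: circ_half_def)
    show ?thesis using True d
      by (simp add: f_def circ_jac_resid[OF b m, symmetric] scaleR_conv_of_real mult_ac)
  qed simp
  have int': "integrable lborel (\<lambda>\<sigma>. indicator (circ_half b \<epsilon>) \<sigma> *\<^sub>R ?g \<sigma>)" for \<epsilon>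
    by (rule integrable_mult_indicator[OF _ int]) simp
  have split: "?g \<sigma> = indicator (circ_half b 1) \<sigma> *\<^sub>R ?g \<sigma> + indicator (circ_half b (-1)) \<sigma> *\<^sub>R ?g \<sigma>" for \<sigma>
    by (cases "circ_m b (fst \<sigma>) (snd \<sigma>)" "0::real" rule: linorder_cases)
      (auto simp: circ_half_def indicator_def circ_w_def)
  have i: "integrable lborel (\<lambda>x. f (x, lam b \<epsilon> x))" if "\<epsilon> \<in> {1, -1}" for \<epsilon>
    using integrable_circ_half[OF b that, of f] int'[of \<epsilon>] unfolding half by simp
  have ae: "AE x in lborel. h x / den b z x = f (x, lam b 1 x) + f (x, lam b (-1) x)"
    using AE_fst_neq[of "0::complex"] AE_lam_neq[OF b insertI1, of z] AE_lam_neq[OF b insertI2[OF singletonI], of z]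
  proof eventually_elim
    case (elim x)
    then have "h x / den b z x = h x * (1 / den b z x)" by simp
    also have "1 / den b z x = resid b (fst x) (lam b 1 x) / (z - lam b 1 x) + resid b (fst x) (lam b (-1) x) / (z - lam b (-1) x)"
      using elim by (intro partial_fractions b z) auto
    finally show ?case by (simp add: f_def ring_distribs)
  qed
  have "integrable lborel (\<lambda>x. f (x, lam b 1 x) + f (x, lam b (-1) x))" using i by auto
  then show "integrable lborel (\<lambda>x. h x / den b z x)"
    by (subst integrable_cong_AE[OF _ _ ae]) auto
  have "(LINT x|lborel. h x / den b z x) = (LINT x|lborel. f (x, lam b 1 x) + f (x, lam b (-1) x))"
    by (rule integral_cong_AE[OF _ _ ae]) auto
  also have "\<dots> = (LINT x|lborel. f (x, lam b 1 x)) + (LINT x|lborel. f (x, lam b (-1) x))"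
    using i by (intro Bochner_Integration.integral_add) auto
  also have "\<dots> = (LINT \<sigma>|lborel. indicator (circ_half b 1) \<sigma> *\<^sub>R ?g \<sigma>) + (LINT \<sigma>|lborel. indicator (circ_half b (-1)) \<sigma> *\<^sub>R ?g \<sigma>)"
    using integral_circ_half[OF b, of 1 f] integral_circ_half[OF b, of "-1" f] unfolding half by simp
  also have "\<dots> = (LINT \<sigma>|lborel. indicator (circ_half b 1) \<sigma> *\<^sub>R ?g \<sigma> + indicator (circ_half b (-1)) \<sigma> *\<^sub>R ?g \<sigma>)"
    by (rule Bochner_Integration.integral_add[symmetric]) (rule int')+
  also have "\<dots> = (LINT \<sigma>|lborel. ?g \<sigma>)" unfolding split[symmetric] ..
  finally show "(LINT x|lborel. h x / den b z x) = (LINT \<sigma>|lborel. ?g \<sigma>)" .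
qed

section \<open>The Cauchy transform\<close>

text \<open>Under x = cot(\<phi>/2) the integrand turns into the constant 1/2; the cruder bound 1 is
  enough and gives 2\<pi> instead of \<pi>.\<close>

lemma nn_integral_inverse_1_plus_square: "(\<integral>\<^sup>+(x::real). ennreal (1 / (1 + x\<^sup>2)) \<partial>lborel) \<le> ennreal (2 * pi)"
proof -
  have "(\<integral>\<^sup>+(x::real). ennreal (1 / (1 + x\<^sup>2)) \<partial>lborel) =
    (\<integral>\<^sup>+\<phi>. ennreal (1 / (1 - cos \<phi>)) * ennreal (1 / (1 + (1 / tan (\<phi> / 2))\<^sup>2)) * indicator {-pi..pi} \<phi> \<partial>lborel)"
    by (rule nn_integral_cot_half[symmetric]) measurable
  also have "\<dots> \<le> (\<integral>\<^sup>+\<phi>. indicator {-pi..pi} \<phi> \<partial>lborel)"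
  proof (rule nn_integral_mono)
    fix \<phi> :: real
    have c: "1 - cos \<phi> = 2 * (sin (\<phi> / 2))\<^sup>2" using cos_double_sin[of "\<phi>/2"] by simp
    have "1 / (1 - cos \<phi>) * (1 / (1 + (1 / tan (\<phi> / 2))\<^sup>2)) \<le> 1"
    proof (cases "sin (\<phi> / 2) = 0")
      case False
      have "1 / (1 + (1 / tan (\<phi> / 2))\<^sup>2) = (sin (\<phi> / 2))\<^sup>2 / ((sin (\<phi> / 2))\<^sup>2 + (cos (\<phi> / 2))\<^sup>2)"
        using False by (simp add: tan_def power_divide add_divide_distrib[symmetric] divide_simps)
      then show ?thesis unfolding c using False by simp
    qed (simp add: c)
    moreover have "0 \<le> 1 / (1 - cos \<phi>)" "0 \<le> 1 / (1 + (1 / tan (\<phi> / 2))\<^sup>2)"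
      by (auto simp: add_nonneg_nonneg)
    ultimately have "ennreal (1 / (1 - cos \<phi>)) * ennreal (1 / (1 + (1 / tan (\<phi> / 2))\<^sup>2)) \<le> ennreal 1"
      by (subst ennreal_mult[symmetric]) (auto intro!: ennreal_leI)
    then show "ennreal (1 / (1 - cos \<phi>)) * ennreal (1 / (1 + (1 / tan (\<phi> / 2))\<^sup>2)) * indicator {-pi..pi} \<phi> \<le> indicator {-pi..pi} \<phi>"
      by (auto simp: indicator_def)
  qed
  also have "\<dots> = ennreal (2 * pi)" by simp
  finally show ?thesis .
qed

lemma nn_integral_radial_le:
  fixes f :: "real \<Rightarrow> real"
  assumes [measurable]: "f \<in> borel_measurable borel" and "\<And>r. f r \<ge> 0"
  shows "(\<integral>\<^sup>+(z::complex). ennreal (f (cmod z)) \<partial>lborel) \<le> ennreal (2 * pi) * (\<integral>\<^sup>+r. ennreal (\<bar>r\<bar> * f \<bar>r\<bar>) \<partial>lborel)"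
proof -
  have "(\<integral>\<^sup>+(z::complex). ennreal (f (cmod z)) \<partial>lborel) =
    (\<integral>\<^sup>+\<kappa>. \<integral>\<^sup>+\<rho>. ennreal (\<bar>\<rho>\<bar> / (1 + \<kappa>\<^sup>2)) * ennreal (f (cmod (of_real \<rho> * slope_dir \<kappa>))) \<partial>lborel \<partial>lborel)"
    by (rule nn_integral_signed_polar) measurable
  also have "\<dots> = (\<integral>\<^sup>+\<kappa>. \<integral>\<^sup>+\<rho>. ennreal (1 / (1 + \<kappa>\<^sup>2)) * ennreal (\<bar>\<rho>\<bar> * f \<bar>\<rho>\<bar>) \<partial>lborel \<partial>lborel)"
    using assms(2) by (intro nn_integral_cong) (simp add: norm_mult ennreal_mult[symmetric] add_nonneg_nonneg)
  also have "\<dots> = (\<integral>\<^sup>+\<kappa>. ennreal (1 / (1 + \<kappa>\<^sup>2)) \<partial>lborel) * (\<integral>\<^sup>+r. ennreal (\<bar>r\<bar> * f \<bar>r\<bar>) \<partial>lborel)"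
    by (simp add: nn_integral_cmult nn_integral_multc)
  finally show ?thesis
    using nn_integral_inverse_1_plus_square by (simp add: mult_right_mono)
qed

lemma nn_integral_inverse_disc:
  assumes "\<delta> \<ge> 0"
  shows "(\<integral>\<^sup>+(z::complex). ennreal (indicator {..<\<delta>} (cmod z) / cmod z) \<partial>lborel) \<le> ennreal (4 * pi * \<delta>)"
proof -
  \<comment> \<open>The maximum with 0 keeps the profile nonnegative at negative arguments, as the
    radial estimate demands.\<close>
  have "(\<integral>\<^sup>+(z::complex). ennreal (indicator {..<\<delta>} (cmod z) / cmod z) \<partial>lborel) \<le>
     ennreal (2 * pi) * (\<integral>\<^sup>+r. ennreal (\<bar>r\<bar> * (indicator {..<\<delta>} \<bar>r\<bar> / max \<bar>r\<bar> 0)) \<partial>lborel)"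
    using nn_integral_radial_le[of "\<lambda>r. indicator {..<\<delta>} r / max r 0"] by simp
  also have "(\<integral>\<^sup>+r. ennreal (\<bar>r\<bar> * (indicator {..<\<delta>} \<bar>r\<bar> / max \<bar>r\<bar> 0)) \<partial>lborel) \<le> (\<integral>\<^sup>+r. indicator {-\<delta>..\<delta>} r \<partial>lborel)"
    by (intro nn_integral_mono) (auto simp: indicator_def)
  also have "\<dots> = ennreal (2 * \<delta>)" using assms by simp
  finally show ?thesis using assms by (simp add: ennreal_mult[symmetric] mult_left_mono mult.assoc)
qed

lemma nn_integral_decay:
  "(\<integral>\<^sup>+(z::complex). ennreal ((1 + (cmod z)\<^sup>2) powr (-3/2)) \<partial>lborel) \<le> ennreal (4 * pi\<^sup>2)"
proof -
  have "(\<integral>\<^sup>+(z::complex). ennreal ((1 + (cmod z)\<^sup>2) powr (-3/2)) \<partial>lborel) \<le>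
     ennreal (2 * pi) * (\<integral>\<^sup>+r. ennreal (\<bar>r\<bar> * ((1 + \<bar>r\<bar>\<^sup>2) powr (-3/2))) \<partial>lborel)"
    by (rule nn_integral_radial_le) auto
  also have "(\<integral>\<^sup>+r. ennreal (\<bar>r\<bar> * ((1 + \<bar>r\<bar>\<^sup>2) powr (-3/2))) \<partial>lborel) \<le> (\<integral>\<^sup>+r. ennreal (1 / (1 + r\<^sup>2)) \<partial>lborel)"
  proof (intro nn_integral_mono ennreal_leI)
    fix r :: real
    have p: "1 + r\<^sup>2 > 0" by (simp add: add_pos_nonneg)
    have "\<bar>r\<bar> \<le> (1 + r\<^sup>2) powr (1/2)"
      using p by (simp add: powr_half_sqrt real_le_rsqrt)
    then have "\<bar>r\<bar> * ((1 + \<bar>r\<bar>\<^sup>2) powr (-3/2)) \<le> (1 + r\<^sup>2) powr (1/2) * ((1 + r\<^sup>2) powr (-3/2))"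
      by (intro mult_mono) auto
    also have "\<dots> = 1 / (1 + r\<^sup>2)"
      using p by (subst powr_add[symmetric]) (simp add: powr_minus_divide)
    finally show "\<bar>r\<bar> * ((1 + \<bar>r\<bar>\<^sup>2) powr (-3/2)) \<le> 1 / (1 + r\<^sup>2)" .
  qed
  also have "\<dots> \<le> ennreal (2 * pi)" by (rule nn_integral_inverse_1_plus_square)
  finally have "(\<integral>\<^sup>+(z::complex). ennreal ((1 + (cmod z)\<^sup>2) powr (-3/2)) \<partial>lborel) \<le> ennreal (2 * pi) * ennreal (2 * pi)"
    by (simp add: mult_left_mono)
  also have "\<dots> = ennreal (4 * pi\<^sup>2)"
    by (subst ennreal_mult[symmetric]) (auto simp: power2_eq_square)
  finally show ?thesis .
qed

lemma nn_integral_translate: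
  fixes f :: "'a::euclidean_space \<Rightarrow> ennreal"
  assumes [measurable]: "f \<in> borel_measurable borel"
  shows "(\<integral>\<^sup>+x. f (x + a) \<partial>lborel) = (\<integral>\<^sup>+x. f x \<partial>lborel)"
proof -
  have "(\<integral>\<^sup>+x. f x \<partial>lborel) = (\<integral>\<^sup>+x. f x \<partial>distr lborel borel ((+) a))"
    by (simp add: lborel_distr_plus)
  also have "\<dots> = (\<integral>\<^sup>+x. f (x + a) \<partial>lborel)" by (subst nn_integral_distr) (auto simp: add.commute)
  finally show ?thesis by simp
qed

text \<open>The point is uniformity in z. Write A = 1 + |\<zeta>|^2 and x = |\<zeta> - z|. For x < 1
  the integrand is at most 1/x, which is integrable over the unit disc. For x \<ge> 1, comparing
  sqrt A with x bounds it by A^(-3/2) or by x^(-3), and the integrals of both are bounded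
  independently of z.\<close>

lemma nn_integral_cauchy_majorant:
  "(\<integral>\<^sup>+(\<zeta>::complex). ennreal (1 / (1 + (cmod \<zeta>)\<^sup>2) / cmod (\<zeta> - z)) \<partial>lborel) \<le> ennreal (4 * pi + 16 * pi\<^sup>2)"
proof -
  let ?d = "\<lambda>z::complex. (1 + (cmod z)\<^sup>2) powr (-3/2)"
  let ?i = "\<lambda>z::complex. indicator {..<1} (cmod z) / cmod z"
  have "(\<integral>\<^sup>+(\<zeta>::complex). ennreal (1 / (1 + (cmod \<zeta>)\<^sup>2) / cmod (\<zeta> - z)) \<partial>lborel) \<le>
    (\<integral>\<^sup>+\<zeta>. ennreal (?i (\<zeta> - z)) + (ennreal (?d \<zeta>) + 3 * ennreal (?d (\<zeta> - z))) \<partial>lborel)"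
  proof (intro nn_integral_mono)
    fix \<zeta> :: complex
    define A x where "A = 1 + (cmod \<zeta>)\<^sup>2" and "x = cmod (\<zeta> - z)"
    have A: "A \<ge> 1" by (simp add: A_def)
    have "1 / A / x \<le> indicator {..<1} x / x + (A powr (-3/2) + 3 * (1 + x\<^sup>2) powr (-3/2))"
    proof (cases "x < 1")
      case True
      have "1 / A \<le> 1" using A by simp
      then have "1 / A / x \<le> 1 / x" by (rule divide_right_mono) (simp add: x_def)
      moreover have "0 \<le> A powr (-3/2)" "0 \<le> (1 + x\<^sup>2) powr (-3/2)" by auto
      ultimately show ?thesis using True by (simp add: add_increasing2)
    next
      case False
      then have x: "x \<ge> 1" by simp
      have pa: "A powr (-3/2) = 1 / A / sqrt A"
      proof -
        have "A powr (-3/2) = A powr (-1) * A powr (-1/2)" by (subst powr_add[symmetric]) simp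
        moreover have "A powr (-1/2) = 1 / sqrt A" using A by (simp add: powr_half_sqrt[symmetric] powr_minus_divide)
        ultimately show ?thesis using A by (simp add: powr_minus_divide)
      qed
      \<comment> \<open>Since 1 + x^2 \<le> 2 x^2, the power x^(-3) can be replaced by the profile
        of \<open>nn_integral_decay\<close>; the factor 3 exceeds 2^(3/2).\<close>
      have px: "1 / x / x\<^sup>2 \<le> 3 * (1 + x\<^sup>2) powr (-3/2)"
      proof -
        have "x\<^sup>2 \<ge> 1" using x by simp
        then have "(2 * x\<^sup>2) powr (-3/2) \<le> (1 + x\<^sup>2) powr (-3/2)"
          using x by (intro powr_mono2') (auto simp: add_pos_nonneg)
        moreover have "(x\<^sup>2) powr (-3/2) = 1 / x / x\<^sup>2"
        proof -
          have "(x\<^sup>2) powr (-3/2) = x powr (-3)"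
            using x by (simp add: powr_powr flip: powr_numeral)
          moreover have "x powr (-3) = 1 / x ^ 3" using x by (simp add: powr_minus_divide powr_numeral)
          ultimately show ?thesis by (simp add: power3_eq_cube power2_eq_square)
        qed
        ultimately have le: "2 powr (-3/2) * (1 / x / x\<^sup>2) \<le> (1 + x\<^sup>2) powr (-3/2)"
          using x by (simp add: powr_mult)
        have "3 * 2 powr (-3/2) \<ge> (1::real)"
        proof -
          have "(2::real) powr (3/2) = 2 * sqrt 2"
          proof -
            have "(2::real) powr (3/2) = 2 powr 1 * 2 powr (1/2)" by (subst powr_add[symmetric]) simp
            then show ?thesis by (simp add: powr_half_sqrt)
          qed
          also have "\<dots> \<le> 3" 
          proof -
            have "sqrt 2 \<le> 3/2" by (rule real_le_lsqrt) (auto simp: power2_eq_square)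
            then show ?thesis by simp
          qed
          finally show ?thesis by (simp add: powr_minus field_simps)
        qed
        then have "1 * (1 / x / x\<^sup>2) \<le> (3 * 2 powr (-3/2)) * (1 / x / x\<^sup>2)"
          using x by (intro mult_right_mono) auto
        then show ?thesis using le by simp
      qed
      have "1 / A / x \<le> 1 / A / sqrt A + 1 / x / x\<^sup>2"
      proof (cases "sqrt A \<le> x")
        case True
        then have "1 / A / x \<le> 1 / A / sqrt A" using A x by (intro divide_left_mono) auto
        then show ?thesis using x by (simp add: add_increasing2)
      next
        case False
        then have "x\<^sup>2 \<le> A" using x A by (simp add: real_le_rsqrt less_imp_le sqrt_ge_absD)
        then have "1 / A / x \<le> 1 / x\<^sup>2 / x" using x A by (intro divide_right_mono divide_left_mono) auto
        then show ?thesis using A by (simp add: mult.commute add_increasing)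
      qed
      then show ?thesis using False px pa by simp
    qed
    then have "ennreal (1 / A / x) \<le> ennreal (indicator {..<1} x / x + (A powr (-3/2) + 3 * (1 + x\<^sup>2) powr (-3/2)))"
      by (rule ennreal_leI)
    also have "\<dots> = ennreal (indicator {..<1} x / x) + (ennreal (A powr (-3/2)) + 3 * ennreal ((1 + x\<^sup>2) powr (-3/2)))"
      by (simp add: ennreal_plus ennreal_mult x_def)
    finally show "ennreal (1 / (1 + (cmod \<zeta>)\<^sup>2) / cmod (\<zeta> - z)) \<le> ennreal (?i (\<zeta> - z)) + (ennreal (?d \<zeta>) + 3 * ennreal (?d (\<zeta> - z)))"
      by (simp add: A_def x_def)
  qed
  also have "\<dots> = (\<integral>\<^sup>+\<zeta>. ennreal (?i (\<zeta> + (- z))) \<partial>lborel) + ((\<integral>\<^sup>+\<zeta>. ennreal (?d \<zeta>) \<partial>lborel) + 3 * (\<integral>\<^sup>+\<zeta>. ennreal (?d (\<zeta> + (- z))) \<partial>lborel))"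
    by (simp add: nn_integral_add nn_integral_cmult)
  also have "\<dots> = (\<integral>\<^sup>+\<zeta>. ennreal (?i \<zeta>) \<partial>lborel) + ((\<integral>\<^sup>+\<zeta>. ennreal (?d \<zeta>) \<partial>lborel) + 3 * (\<integral>\<^sup>+\<zeta>. ennreal (?d \<zeta>) \<partial>lborel))"
    using nn_integral_translate[of "\<lambda>\<zeta>. ennreal (?i \<zeta>)" "-z"] nn_integral_translate[of "\<lambda>\<zeta>. ennreal (?d \<zeta>)" "-z"]
    by simp
  also have "\<dots> \<le> ennreal (4 * pi * 1) + (ennreal (4 * pi\<^sup>2) + 3 * ennreal (4 * pi\<^sup>2))"
    by (intro add_mono mult_left_mono nn_integral_decay nn_integral_inverse_disc) auto
  also have "3 * ennreal (4 * pi\<^sup>2) = ennreal (3 * (4 * pi\<^sup>2))" by (subst ennreal_mult) auto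
  also have "ennreal (4 * pi * 1) + (ennreal (4 * pi\<^sup>2) + ennreal (3 * (4 * pi\<^sup>2))) = ennreal (4 * pi + 16 * pi\<^sup>2)"
    by (subst ennreal_plus[symmetric], simp, simp, subst ennreal_plus[symmetric]) auto
  finally show ?thesis .
qed

section \<open>Cauchy transforms of bounded integrable functions\<close>

lemma cauchy_kernel_integrable:
  fixes f :: "complex \<Rightarrow> complex"
  assumes [measurable]: "f \<in> borel_measurable borel" and int: "integrable lborel f" and bd: "\<And>\<zeta>. cmod (f \<zeta>) \<le> c"
  shows "integrable lborel (\<lambda>\<zeta>. f \<zeta> / (\<zeta> - z))"
proof (rule integrableI_bounded)
  have c: "c \<ge> 0" using bd[of 0] norm_ge_zero[of "f 0"] by linarith
  have "(\<integral>\<^sup>+\<zeta>. ennreal (norm (f \<zeta> / (\<zeta> - z))) \<partial>lborel) \<le>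
    (\<integral>\<^sup>+\<zeta>. ennreal c * ennreal (indicator {..<1} (cmod (\<zeta> + (- z))) / cmod (\<zeta> + (- z))) + ennreal (norm (f \<zeta>)) \<partial>lborel)"
  proof (intro nn_integral_mono)
    fix \<zeta>
    have "cmod (f \<zeta>) / cmod (\<zeta> - z) \<le> c * (indicator {..<1} (cmod (\<zeta> - z)) / cmod (\<zeta> - z)) + cmod (f \<zeta>)"
    proof (cases "cmod (\<zeta> - z) < 1")
      case True
      then show ?thesis using bd[of \<zeta>] by (simp add: divide_right_mono add_increasing2)
    next
      case False
      then have "cmod (f \<zeta>) / cmod (\<zeta> - z) \<le> cmod (f \<zeta>) / 1" by (intro divide_left_mono) auto
      then show ?thesis using False by simp
    qed
    then have "ennreal (cmod (f \<zeta>) / cmod (\<zeta> - z)) \<le> ennreal (c * (indicator {..<1} (cmod (\<zeta> - z)) / cmod (\<zeta> - z)) + cmod (f \<zeta>))"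
      by (rule ennreal_leI)
    then show "ennreal (norm (f \<zeta> / (\<zeta> - z))) \<le> ennreal c * ennreal (indicator {..<1} (cmod (\<zeta> + (- z))) / cmod (\<zeta> + (- z))) + ennreal (norm (f \<zeta>))"
      using c by (simp add: norm_divide ennreal_mult[symmetric] ennreal_plus[symmetric] del: ennreal_plus)
  qed
  also have "\<dots> = ennreal c * (\<integral>\<^sup>+(\<zeta>::complex). ennreal (indicator {..<1} (cmod \<zeta>) / cmod \<zeta>) \<partial>lborel) + (\<integral>\<^sup>+\<zeta>. ennreal (norm (f \<zeta>)) \<partial>lborel)"
    by (subst nn_integral_add, measurable, subst nn_integral_cmult, measurable, subst nn_integral_translate[where a="-z"]) auto
  also have "\<dots> < \<infinity>"
    using int le_less_trans[OF nn_integral_inverse_disc[of 1] ennreal_less_top]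
    by (auto simp: integrable_iff_bounded ennreal_mult_less_top)
  finally show "(\<integral>\<^sup>+\<zeta>. ennreal (norm (f \<zeta> / (\<zeta> - z))) \<partial>lborel) < \<infinity>" .
qed measurable

text \<open>For |x| \<ge> \<delta> this is 1/x, written as the conjugate over |x|^2. Raising |x| to
  \<delta> in the denominator keeps the kernel continuous and bounded near 0.\<close>

definition trunc_kernel :: "real \<Rightarrow> complex \<Rightarrow> complex" where
  "trunc_kernel \<delta> x = cnj x / of_real ((max (cmod x) \<delta>)\<^sup>2)"

lemma trunc_kernel_continuous: "\<delta> > 0 \<Longrightarrow> continuous_on UNIV (trunc_kernel \<delta>)"
  unfolding trunc_kernel_def
  by (intro continuous_intros) (auto simp: max_def)

lemma trunc_kernel_measurable [measurable (raw)]: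
  assumes [measurable]: "f \<in> borel_measurable M"
  shows "(\<lambda>x. trunc_kernel \<delta> (f x)) \<in> borel_measurable M"
  unfolding trunc_kernel_def by measurable

lemma norm_trunc_kernel: "cmod (trunc_kernel \<delta> x) = cmod x / (max (cmod x) \<delta>)\<^sup>2"
  by (simp add: trunc_kernel_def norm_divide norm_power)

lemma norm_trunc_kernel_le1: assumes "\<delta> > 0" shows "cmod (trunc_kernel \<delta> x) \<le> 1 / \<delta>"
proof -
  have "cmod x / (max (cmod x) \<delta>)\<^sup>2 \<le> max (cmod x) \<delta> / (max (cmod x) \<delta>)\<^sup>2" by (intro divide_right_mono) auto
  also have "\<dots> = 1 / max (cmod x) \<delta>" using assms by (simp add: power2_eq_square)
  also have "\<dots> \<le> 1 / \<delta>" using assms by (intro divide_left_mono) auto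
  finally show ?thesis by (simp add: norm_trunc_kernel)
qed

lemma norm_trunc_kernel_le2: assumes "\<delta> > 0" shows "cmod (trunc_kernel \<delta> x) \<le> 1 / cmod x"
proof (cases "x = 0")
  case False
  have "cmod x / (max (cmod x) \<delta>)\<^sup>2 \<le> cmod x / (cmod x)\<^sup>2"
    using assms False by (intro divide_left_mono power_mono) auto
  then show ?thesis using False by (simp add: norm_trunc_kernel power2_eq_square)
qed (simp add: trunc_kernel_def)

lemma norm_trunc_kernel_diff:
  assumes "\<delta> > 0" shows "cmod (1 / x - trunc_kernel \<delta> x) \<le> indicator {..<\<delta>} (cmod x) / cmod x"
proof (cases "cmod x < \<delta>")
  case True
  show ?thesis
  proof (cases "x = 0")
    case False
    have "1 / x = cnj x / (x * cnj x)" using False by simp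
    then have "1 / x - trunc_kernel \<delta> x = cnj x * of_real (1 / (cmod x)\<^sup>2 - 1 / \<delta>\<^sup>2)"
      using True by (simp add: trunc_kernel_def complex_norm_square[symmetric] right_diff_distrib)
    then have "cmod (1 / x - trunc_kernel \<delta> x) = cmod x * \<bar>1 / (cmod x)\<^sup>2 - 1 / \<delta>\<^sup>2\<bar>"
      by (simp only: norm_mult complex_mod_cnj norm_of_real)
    also have "1 / \<delta>\<^sup>2 \<le> 1 / (cmod x)\<^sup>2" using True False assms by (intro divide_left_mono power_mono) auto
    then have "\<bar>1 / (cmod x)\<^sup>2 - 1 / \<delta>\<^sup>2\<bar> \<le> 1 / (cmod x)\<^sup>2" by simp
    then have "cmod x * \<bar>1 / (cmod x)\<^sup>2 - 1 / \<delta>\<^sup>2\<bar> \<le> cmod x * (1 / (cmod x)\<^sup>2)" by (intro mult_left_mono) auto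
    finally show ?thesis using True False by (simp add: power2_eq_square)
  qed (simp add: trunc_kernel_def)
next
  case False
  then have "x \<noteq> 0" using assms by auto
  then have "1 / x = cnj x / (x * cnj x)" by simp
  then have "1 / x = trunc_kernel \<delta> x"
    using False by (simp add: trunc_kernel_def complex_norm_square[symmetric] max_def)
  then show ?thesis using False by simp
qed

text \<open>With the truncated kernel both claims follow from dominated convergence, the majorant
  being a multiple of |f|. The truncation error is at most c times the integral of 1/|x| over the
  disc of radius 1/(n + 1), uniformly in z, so both properties survive the limit.\<close>

theorem
  fixes f :: "complex \<Rightarrow> complex"
  assumes [measurable]: "f \<in> borel_measurable borel" and int: "integrable lborel f" and bd: "\<And>\<zeta>. cmod (f \<zeta>) \<le> c"
  shows cauchy_transform_continuous: "continuous_on UNIV (\<lambda>z. LINT \<zeta>|lborel. f \<zeta> / (\<zeta> - z))" (is ?A)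
    and cauchy_transform_vanishes: "((\<lambda>z. LINT \<zeta>|lborel. f \<zeta> / (\<zeta> - z)) \<longlongrightarrow> 0) at_infinity" (is ?B)
proof -
  have c: "c \<ge> 0" using bd[of 0] norm_ge_zero[of "f 0"] by linarith
  define F where "F z = (LINT \<zeta>|lborel. f \<zeta> / (\<zeta> - z))" for z
  define FF where "FF n z = (LINT \<zeta>|lborel. f \<zeta> * trunc_kernel (1 / real (Suc n)) (\<zeta> - z))" for n z
  have intF: "integrable lborel (\<lambda>\<zeta>. f \<zeta> / (\<zeta> - z))" for z by (rule cauchy_kernel_integrable[OF _ int bd]) simp
  have dom: "cmod (f \<zeta> * trunc_kernel (1 / real (Suc n)) x) \<le> real (Suc n) * cmod (f \<zeta>)" for \<zeta> x n
    using norm_trunc_kernel_le1[of "1 / real (Suc n)" x]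
    by (simp add: norm_mult mult.commute[of "cmod (f \<zeta>)"] mult_right_mono)
  have intdom: "integrable lborel (\<lambda>\<zeta>. real (Suc n) * cmod (f \<zeta>))" for n using int by simp
  have intFF: "integrable lborel (\<lambda>\<zeta>. f \<zeta> * trunc_kernel (1 / real (Suc n)) (\<zeta> - z))" for n z
    using dom by (intro Bochner_Integration.integrable_bound[OF intdom[of n]]) auto
  have close: "dist (FF n z) (F z) \<le> c * (4 * pi) / real (Suc n)" for n z
  proof -
    let ?d = "1 / real (Suc n)"
    have "norm (F z - FF n z) = norm (LINT \<zeta>|lborel. f \<zeta> / (\<zeta> - z) - f \<zeta> * trunc_kernel ?d (\<zeta> - z))"
      unfolding F_def FF_def by (subst Bochner_Integration.integral_diff[OF intF intFF]) simp
    also have "ennreal \<dots> \<le> (\<integral>\<^sup>+\<zeta>. ennreal (norm (f \<zeta> / (\<zeta> - z) - f \<zeta> * trunc_kernel ?d (\<zeta> - z))) \<partial>lborel)"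
      by (intro integral_norm_bound_ennreal Bochner_Integration.integrable_diff intF intFF)
    also have "\<dots> \<le> (\<integral>\<^sup>+\<zeta>. ennreal c * ennreal (indicator {..<?d} (cmod (\<zeta> + (-z))) / cmod (\<zeta> + (-z))) \<partial>lborel)"
    proof (intro nn_integral_mono)
      fix \<zeta>
      have "norm (f \<zeta> / (\<zeta> - z) - f \<zeta> * trunc_kernel ?d (\<zeta> - z)) = norm (f \<zeta>) * norm (1 / (\<zeta> - z) - trunc_kernel ?d (\<zeta> - z))"
        by (subst norm_mult[symmetric]) (simp add: right_diff_distrib)
      also have "\<dots> \<le> c * (indicator {..<?d} (cmod (\<zeta> - z)) / cmod (\<zeta> - z))"
        using bd c by (intro mult_mono norm_trunc_kernel_diff) auto
      finally show "ennreal (norm (f \<zeta> / (\<zeta> - z) - f \<zeta> * trunc_kernel ?d (\<zeta> - z))) \<le>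
        ennreal c * ennreal (indicator {..<?d} (cmod (\<zeta> + (-z))) / cmod (\<zeta> + (-z)))"
        using c by (subst ennreal_mult[symmetric]) (auto intro!: ennreal_leI)
    qed
    also have "\<dots> = ennreal c * (\<integral>\<^sup>+(\<zeta>::complex). ennreal (indicator {..<?d} (cmod \<zeta>) / cmod \<zeta>) \<partial>lborel)"
      by (subst nn_integral_cmult, measurable, subst nn_integral_translate[where a="-z"]) auto
    also have "\<dots> \<le> ennreal c * ennreal (4 * pi * ?d)"
      by (intro mult_left_mono nn_integral_inverse_disc) auto
    also have "\<dots> = ennreal (c * (4 * pi) / real (Suc n))" using c by (subst ennreal_mult[symmetric]) auto
    finally show ?thesis using c by (simp add: dist_norm norm_minus_commute)
  qed
  have unif: "uniform_limit UNIV FF F sequentially"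
  proof (rule uniform_limitI)
    fix e :: real assume "e > 0"
    have "(\<lambda>n. c * (4 * pi) / real (Suc n)) \<longlonglongrightarrow> 0" by (rule LIMSEQ_Suc[OF lim_const_over_n])
    then have "\<forall>\<^sub>F n in sequentially. c * (4 * pi) / real (Suc n) < e" using \<open>e > 0\<close> by (rule order_tendstoD)
    then show "\<forall>\<^sub>F n in sequentially. \<forall>x\<in>UNIV. dist (FF n x) (F x) < e"
      by eventually_elim (use close le_less_trans in blast)
  qed
  have contFF: "continuous_on UNIV (FF n)" for n
    unfolding continuous_on_sequentially
  proof (safe, unfold o_def FF_def)
    fix x :: "nat \<Rightarrow> complex" and a assume "x \<longlonglongrightarrow> a"
    then have "(\<lambda>j. f \<zeta> * trunc_kernel (1 / real (Suc n)) (\<zeta> - x j)) \<longlonglongrightarrow> f \<zeta> * trunc_kernel (1 / real (Suc n)) (\<zeta> - a)" for \<zeta>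
      by (intro tendsto_intros continuous_on_tendsto_compose[OF trunc_kernel_continuous[of "1 / real (Suc n)"]]) auto
    then show "(\<lambda>j. LINT \<zeta>|lborel. f \<zeta> * trunc_kernel (1 / real (Suc n)) (\<zeta> - x j)) \<longlonglongrightarrow> (LINT \<zeta>|lborel. f \<zeta> * trunc_kernel (1 / real (Suc n)) (\<zeta> - a))"
      using dom by (intro integral_dominated_convergence[OF _ _ intdom[of n]]) auto
  qed
  have "continuous_on UNIV F"
    by (rule uniform_limit_theorem[OF _ unif]) (use contFF in auto)
  then show ?A by (simp add: F_def[abs_def])
  have "(F \<longlongrightarrow> 0) at_infinity"
  proof (rule ccontr)
    assume "\<not> (F \<longlongrightarrow> 0) at_infinity"
    then obtain e where e: "e > 0" "\<And>B. \<exists>z. B \<le> norm z \<and> \<not> norm (F z) < e"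
      unfolding Lim_at_infinity by (auto simp: dist_norm)
    then have "\<forall>j. \<exists>z. real j \<le> norm z \<and> \<not> norm (F z) < e" by blast
    then obtain z where z: "\<And>j. real j \<le> norm (z j)" "\<And>j::nat. \<not> norm (F (z j)) < e" by metis
    obtain n where n: "c * (4 * pi) / real (Suc n) < e / 2"
    proof -
      have "(\<lambda>n. c * (4 * pi) / real (Suc n)) \<longlonglongrightarrow> 0" by (rule LIMSEQ_Suc[OF lim_const_over_n])
      then have "\<forall>\<^sub>F n in sequentially. c * (4 * pi) / real (Suc n) < e / 2" using e(1) by (intro order_tendstoD) auto
      then show ?thesis using that by (auto simp: eventually_sequentially)
    qed
    have zlim: "filterlim (\<lambda>j. norm (z j)) at_top sequentially"
      by (rule filterlim_at_top_mono[OF filterlim_real_sequentially]) (use z in auto)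
    have "(\<lambda>j. FF n (z j)) \<longlonglongrightarrow> (LINT \<zeta>|(lborel :: complex measure). 0)"
      unfolding FF_def
    proof (rule integral_dominated_convergence[OF _ _ intdom[of n]])
      show "AE \<zeta> in lborel. (\<lambda>j. f \<zeta> * trunc_kernel (1 / real (Suc n)) (\<zeta> - z j)) \<longlonglongrightarrow> 0"
      proof (rule AE_I2)
        fix \<zeta> :: complex
        have "filterlim (\<lambda>j. norm (z j) - norm \<zeta>) at_top sequentially"
          using filterlim_tendsto_add_at_top[OF tendsto_const[of "- norm \<zeta>"] zlim] by simp
        then have l: "filterlim (\<lambda>j. norm (\<zeta> - z j)) at_top sequentially"
          by (rule filterlim_at_top_mono) (metis (lifting) always_eventually norm_minus_commute norm_triangle_ineq2)
        have "(\<lambda>j. trunc_kernel (1 / real (Suc n)) (\<zeta> - z j)) \<longlonglongrightarrow> 0"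
        proof (rule Lim_null_comparison)
          show "\<forall>\<^sub>F j in sequentially. norm (trunc_kernel (1 / real (Suc n)) (\<zeta> - z j)) \<le> 1 / norm (\<zeta> - z j)"
            using norm_trunc_kernel_le2[of "1 / real (Suc n)"] by (intro always_eventually) auto
          show "(\<lambda>j. 1 / norm (\<zeta> - z j)) \<longlonglongrightarrow> 0"
            by (rule real_tendsto_divide_at_top[OF tendsto_const l])
        qed
        then show "(\<lambda>j. f \<zeta> * trunc_kernel (1 / real (Suc n)) (\<zeta> - z j)) \<longlonglongrightarrow> 0"
          using tendsto_mult_left[of _ 0 sequentially "f \<zeta>"] by simp
      qed
    qed (use dom in auto)
    then have "(\<lambda>j. norm (FF n (z j))) \<longlonglongrightarrow> 0" by (simp add: tendsto_norm_zero)
    then have "\<forall>\<^sub>F j in sequentially. norm (FF n (z j)) < e / 2"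
      using e(1) by (intro order_tendstoD) auto
    then obtain j where j: "norm (FF n (z j)) < e / 2" by (auto simp: eventually_sequentially)
    have "norm (F (z j)) \<le> norm (FF n (z j)) + dist (FF n (z j)) (F (z j))"
      by (metis dist_norm norm_minus_commute norm_triangle_sub)
    then have "norm (F (z j)) < e" using j close[of n "z j"] n by linarith
    then show False using z(2) by blast
  qed
  then show ?B by (simp add: F_def[abs_def])
qed

section \<open>The frame at a point\<close>

lemma cdot_simps:
  "cdot (a + b) c = cdot a c + cdot b c" "cdot c (a + b) = cdot c a + cdot c b"
  "cdot (x *s a) c = x * cdot a c" "cdot c (x *s a) = x * cdot c a"
  "cdot (cvec u) (cvec v) = of_real (u \<bullet> v)"
  "cdot (- a) c = - cdot a c" "cdot c (- a) = - cdot c a" "cdot (a - b) c = cdot a c - cdot b c" "cdot c (a - b) = cdot c a - cdot c b"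
  by (simp_all add: cdot_def cvec_def inner_vec_def sum.distrib sum_subtractf sum_negf sum_distrib_left algebra_simps)

lemma cdot_commute: "cdot a b = cdot b a"
  by (simp add: cdot_def mult.commute)

lemma cvec_simps:
  "cvec (u + v) = cvec u + cvec v" "cvec (r *\<^sub>R u) = of_real r *s cvec u" "cvec (- u) = - cvec u" "cvec (u - v) = cvec u - cvec v"
  by (simp_all add: cvec_def vec_eq_iff)

lemma Re_Im_vec_simps:
  "Re_vec (a + b) = Re_vec a + Re_vec b" "Im_vec (a + b) = Im_vec a + Im_vec b"
  "Re_vec (c *s cvec u) = Re c *\<^sub>R u" "Im_vec (c *s cvec u) = Im c *\<^sub>R u"
  by (simp_all add: Re_vec_def Im_vec_def cvec_def vec_eq_iff)

definition orthonormal :: "real ^ 3 \<Rightarrow> real ^ 3 \<Rightarrow> real ^ 3 \<Rightarrow> bool" where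
  "orthonormal e1 e2 e3 \<longleftrightarrow> e1 \<bullet> e1 = 1 \<and> e2 \<bullet> e2 = 1 \<and> e3 \<bullet> e3 = 1 \<and> e1 \<bullet> e2 = 0 \<and> e1 \<bullet> e3 = 0 \<and> e2 \<bullet> e3 = 0"

lemma cdot_orthonormal:
  assumes "orthonormal e1 e2 e3"
  shows "cdot (A *s cvec e1 + B *s cvec e2 + C *s cvec e3) (A *s cvec e1 + B *s cvec e2 + C *s cvec e3) = A * A + B * B + C * C"
  using assms by (simp add: cdot_simps orthonormal_def inner_commute)

text \<open>The imaginary part goes with the first vector, so that in the frame
  (\<open>\<theta>\<close>, \<open>omega\<close>, p/|p|) with b = |p|/2 the product 2 k(z, p)
  \<cdot> \<xi> becomes b (z w - \<open>cnj w\<close>/z) + 2 b s, with a single complex coordinate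
  w.\<close>

definition from_frame :: "real ^ 3 \<Rightarrow> real ^ 3 \<Rightarrow> real ^ 3 \<Rightarrow> complex \<times> real \<Rightarrow> real ^ 3" where
  "from_frame e1 e2 e3 x = Im (fst x) *\<^sub>R e1 + Re (fst x) *\<^sub>R e2 + snd x *\<^sub>R e3"

lemma from_frame_continuous: "continuous_on UNIV (from_frame e1 e2 e3)"
  unfolding from_frame_def by (intro continuous_intros)

lemma from_frame_measurable [measurable]: "from_frame e1 e2 e3 \<in> borel \<rightarrow>\<^sub>M borel"
  by (rule borel_measurable_continuous_onI[OF from_frame_continuous])

lemma inner_from_frame:
  assumes "orthonormal e1 e2 e3"
  shows "e1 \<bullet> from_frame e1 e2 e3 x = Im (fst x)" "e2 \<bullet> from_frame e1 e2 e3 x = Re (fst x)" "e3 \<bullet> from_frame e1 e2 e3 x = snd x"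
  using assms by (auto simp: orthonormal_def from_frame_def inner_simps inner_commute)

lemma from_frame_inner_self:
  assumes "orthonormal e1 e2 e3"
  shows "from_frame e1 e2 e3 x \<bullet> from_frame e1 e2 e3 x = (cmod (fst x))\<^sup>2 + (snd x)\<^sup>2"
proof -
  have "from_frame e1 e2 e3 x \<bullet> from_frame e1 e2 e3 x =
    Im (fst x) * (e1 \<bullet> from_frame e1 e2 e3 x) + Re (fst x) * (e2 \<bullet> from_frame e1 e2 e3 x) + snd x * (e3 \<bullet> from_frame e1 e2 e3 x)"
    by (subst from_frame_def) (simp add: inner_simps)
  then show ?thesis unfolding inner_from_frame[OF assms] cmod_power2 by (simp add: power2_eq_square)
qed

lemma norm_from_frame:
  assumes "orthonormal e1 e2 e3" shows "norm (from_frame e1 e2 e3 x) = norm x"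
  unfolding norm_eq_sqrt_inner[of "from_frame e1 e2 e3 x"] from_frame_inner_self[OF assms] by (simp add: norm_prod_def)

lemma from_frame_std: "distr lborel borel (from_frame (axis 1 1) (axis 2 1) (axis 3 1)) = lborel"
proof (rule lborel_eqI[symmetric])
  let ?f = "from_frame (axis 1 1) (axis 2 1) (axis 3 1)"
  fix l u :: "real ^ 3" assume le: "\<And>b. b \<in> Basis \<Longrightarrow> l \<bullet> b \<le> u \<bullet> b"
  have le': "l $ i \<le> u $ i" for i
    using le[of "axis i 1"] by (simp add: axis_in_Basis_iff inner_axis)
  have comp: "?f x $ 1 = Im (fst x)" "?f x $ 2 = Re (fst x)" "?f x $ 3 = snd x" for x
    by (simp_all add: from_frame_def axis_def)
  let ?B = "box (Complex (l $ 2) (l $ 1)) (Complex (u $ 2) (u $ 1))"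
  have B: "w \<in> ?B \<longleftrightarrow> l $ 2 < Re w \<and> Re w < u $ 2 \<and> l $ 1 < Im w \<and> Im w < u $ 1" for w
    by (auto simp: box_def Basis_complex_def inner_complex_def)
  have "?f -` box l u = ?B \<times> {l $ 3<..<u $ 3}"
    by (auto simp: mem_box_cart forall_3 comp B)
  then have "emeasure (distr lborel borel ?f) (box l u) = emeasure lborel (?B \<times> {l $ 3<..<u $ 3})"
    by (subst emeasure_distr) auto
  also have "\<dots> = emeasure lborel ?B * emeasure lborel {l $ 3<..<u $ 3}"
    by (subst lborel_prod[symmetric], subst lborel.emeasure_pair_measure_Times) auto
  also have "emeasure lborel ?B = ennreal ((u $ 2 - l $ 2) * (u $ 1 - l $ 1))"
    using le'[of 1] le'[of 2] by (subst emeasure_lborel_box_eq) (auto simp: Basis_complex_def inner_complex_def)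
  also have "\<dots> * emeasure lborel {l $ 3<..<u $ 3} = ennreal ((u $ 2 - l $ 2) * (u $ 1 - l $ 1) * (u $ 3 - l $ 3))"
    using le' by (simp add: ennreal_mult)
  also have "(u $ 2 - l $ 2) * (u $ 1 - l $ 1) * (u $ 3 - l $ 3) = (\<Prod>b\<in>Basis. (u - l) \<bullet> b)"
  proof -
    have B3: "Basis = {axis 1 1, axis 2 1, axis (3::3) (1::real)}"
      by (auto simp: Basis_vec_def UNIV_3)
    show ?thesis unfolding B3 by (simp add: inner_axis axis_eq_axis)
  qed
  finally show "emeasure (distr lborel borel ?f) (box l u) = (\<Prod>b\<in>Basis. (u - l) \<bullet> b)" .
qed simp

lemma distr_orthogonal:
  fixes f :: "real ^ 3 \<Rightarrow> real ^ 3"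
  assumes f: "orthogonal_transformation f"
  shows "distr lborel borel f = lborel"
proof (rule lborel_eqI[symmetric])
  have lin: "linear f" using f by (rule orthogonal_transformation_linear)
  have fm [measurable]: "f \<in> borel \<rightarrow>\<^sub>M borel"
    by (intro borel_measurable_continuous_onI linear_continuous_on linear_conv_bounded_linear[THEN iffD1] lin)
  obtain g where g: "orthogonal_transformation g" "\<And>x. g (f x) = x" "\<And>x. f (g x) = x"
    using orthogonal_transformation_inv[OF f] orthogonal_transformation_bij[OF f]
    by (metis bij_inv_eq_iff)
  fix l u :: "real ^ 3" assume le: "\<And>b. b \<in> Basis \<Longrightarrow> l \<bullet> b \<le> u \<bullet> b"
  have pre: "f -` box l u = g ` box l u" using g by (auto simp: image_iff) metis
  have "box l u \<in> lmeasurable" by simp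
  then have 1: "g ` box l u \<in> lmeasurable" "measure lebesgue (g ` box l u) = measure lebesgue (box l u)"
    using measurable_orthogonal_image[OF g(1)] measure_orthogonal_image[OF g(1)] by auto
  have gb: "g ` box l u \<in> sets borel" using measurable_sets[OF fm, of "box l u"] pre by simp
  have "emeasure (distr lborel borel f) (box l u) = emeasure lborel (g ` box l u)"
    by (subst emeasure_distr) (auto simp: pre)
  also have "\<dots> = emeasure lebesgue (g ` box l u)" using gb by simp
  also have "\<dots> = ennreal (measure lebesgue (g ` box l u))"
    using 1(1) by (simp add: emeasure_eq_measure2)
  also have "\<dots> = emeasure lebesgue (box l u)"
    unfolding 1(2) by (simp add: emeasure_eq_measure2)
  also have "\<dots> = (\<Prod>b\<in>Basis. (u - l) \<bullet> b)" using le by (simp add: emeasure_lborel_box_eq)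
  finally show "emeasure (distr lborel borel f) (box l u) = (\<Prod>b\<in>Basis. (u - l) \<bullet> b)" .
qed simp

lemma orthogonal_orthonormal:
  assumes "orthonormal e1 e2 e3"
  shows "orthogonal_transformation (\<lambda>x :: real ^ 3. x $ 1 *\<^sub>R e1 + x $ 2 *\<^sub>R e2 + x $ 3 *\<^sub>R e3)"
  unfolding orthogonal_transformation_def
proof (intro conjI allI)
  show "linear (\<lambda>x :: real ^ 3. x $ 1 *\<^sub>R e1 + x $ 2 *\<^sub>R e2 + x $ 3 *\<^sub>R e3)"
    by (intro linearI) (auto simp: algebra_simps)
  fix v w :: "real ^ 3"
  have vw: "v \<bullet> w = v $ 1 * w $ 1 + v $ 2 * w $ 2 + v $ 3 * w $ 3" by (simp add: inner_vec_def sum_3)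
  show "(v $ 1 *\<^sub>R e1 + v $ 2 *\<^sub>R e2 + v $ 3 *\<^sub>R e3) \<bullet> (w $ 1 *\<^sub>R e1 + w $ 2 *\<^sub>R e2 + w $ 3 *\<^sub>R e3) = v \<bullet> w"
    using assms unfolding vw by (simp add: inner_simps inner_commute orthonormal_def)
qed

lemma orthonormal_expansion:
  assumes "orthonormal e1 e2 e3"
  shows "v = (e1 \<bullet> v) *\<^sub>R e1 + (e2 \<bullet> v) *\<^sub>R e2 + (e3 \<bullet> v) *\<^sub>R e3"
proof -
  obtain x :: "real ^ 3" where "v = x $ 1 *\<^sub>R e1 + x $ 2 *\<^sub>R e2 + x $ 3 *\<^sub>R e3"
    using orthogonal_transformation_surj[OF orthogonal_orthonormal[OF assms]] unfolding surj_def by blast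
  then have v: "v = from_frame e1 e2 e3 (Complex (x $ 2) (x $ 1), x $ 3)" by (simp add: from_frame_def)
  show ?thesis unfolding v inner_from_frame[OF assms] by (simp add: from_frame_def)
qed

lemma distr_from_frame:
  assumes "orthonormal e1 e2 e3" shows "distr lborel borel (from_frame e1 e2 e3) = lborel"
proof -
  define f :: "real ^ 3 \<Rightarrow> real ^ 3" where "f x = x $ 1 *\<^sub>R e1 + x $ 2 *\<^sub>R e2 + x $ 3 *\<^sub>R e3" for x
  have orth: "orthogonal_transformation f"
    unfolding f_def by (rule orthogonal_orthonormal[OF assms])
  then have lin: "linear f" by (rule orthogonal_transformation_linear)
  have [measurable]: "f \<in> borel \<rightarrow>\<^sub>M borel"
    by (intro borel_measurable_continuous_onI linear_continuous_on linear_conv_bounded_linear[THEN iffD1] lin)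
  have eq: "from_frame e1 e2 e3 = f \<circ> from_frame (axis 1 1) (axis 2 1) (axis 3 1)"
    by (rule ext) (simp add: f_def from_frame_def axis_def)
  have "distr lborel borel (from_frame e1 e2 e3) = distr (distr lborel borel (from_frame (axis 1 1) (axis 2 1) (axis 3 1))) borel f"
    unfolding eq by (subst distr_distr) auto
  then show ?thesis unfolding from_frame_std distr_orthogonal[OF orth] .
qed

lemma
  fixes h :: "real ^ 3 \<Rightarrow> complex"
  assumes "orthonormal e1 e2 e3"
  shows integral_from_frame: "h \<in> borel_measurable borel \<Longrightarrow> (LINT x|lborel. h (from_frame e1 e2 e3 x)) = (LINT x|lborel. h x)"
    and integrable_from_frame: "h \<in> borel_measurable borel \<Longrightarrow> integrable lborel (\<lambda>x. h (from_frame e1 e2 e3 x)) \<longleftrightarrow> integrable lborel h"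
proof -
  assume "h \<in> borel_measurable borel"
  then show "(LINT x|lborel. h (from_frame e1 e2 e3 x)) = (LINT x|lborel. h x)"
    by (subst distr_from_frame[OF assms, symmetric], subst integral_distr) auto
next
  assume "h \<in> borel_measurable borel"
  then show "integrable lborel (\<lambda>x. h (from_frame e1 e2 e3 x)) \<longleftrightarrow> integrable lborel h"
    by (subst distr_from_frame[OF assms, symmetric], subst integrable_distr_eq) auto
qed

definition disp_den :: "complex ^ 3 \<Rightarrow> real ^ 3 \<Rightarrow> complex" where
  "disp_den k \<xi> = of_real (\<xi> \<bullet> \<xi>) + 2 * cdot k (cvec \<xi>)"

lemma zero_mem_line [simp]: "0 \<in> line \<nu>" by (auto simp: line_def intro: exI[of _ 0])

section \<open>The moving frame and the coordinates of the quadric\<close>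

locale frame_field =
  fixes \<nu> :: "real ^ 3" and \<theta> :: "real ^ 3 \<Rightarrow> real ^ 3"
  assumes nu: "norm \<nu> = 1"
    and theta_borel [measurable]: "\<theta> \<in> borel_measurable borel"
    and theta_unit: "\<And>p. p \<notin> line \<nu> \<Longrightarrow> norm (\<theta> p) = 1"
    and theta_orth: "\<And>p. p \<notin> line \<nu> \<Longrightarrow> \<theta> p \<bullet> p = 0"
begin

lemma nonzero: "p \<notin> line \<nu> \<Longrightarrow> p \<noteq> 0" by auto

abbreviation ax :: "real ^ 3 \<Rightarrow> real ^ 3" where "ax p \<equiv> (1 / norm p) *\<^sub>R p"

definition fr :: "real ^ 3 \<Rightarrow> complex \<times> real \<Rightarrow> real ^ 3" where
  "fr p = from_frame (\<theta> p) (omega \<theta> p) (ax p)"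

definition Xi :: "real ^ 3 \<Rightarrow> complex \<times> real \<Rightarrow> real ^ 3" where
  "Xi p \<sigma> = fr p (circ_pt (norm p / 2) \<sigma>)"

lemma frame_facts:
  assumes p: "p \<notin> line \<nu>"
  shows "orthonormal (\<theta> p) (omega \<theta> p) (ax p)"
    "cross3 (\<theta> p) (omega \<theta> p) = ax p" "cross3 (\<theta> p) p = - norm p *\<^sub>R omega \<theta> p" "cross3 (omega \<theta> p) p = norm p *\<^sub>R \<theta> p"
    "\<theta> p \<bullet> \<theta> p = 1" "omega \<theta> p \<bullet> omega \<theta> p = 1" "\<theta> p \<bullet> omega \<theta> p = 0" "\<theta> p \<bullet> p = 0" "omega \<theta> p \<bullet> p = 0"
proof -
  have np: "norm p \<noteq> 0" using nonzero[OF p] by simp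
  have tt: "\<theta> p \<bullet> \<theta> p = 1" using theta_unit[OF p] by (simp add: norm_eq_1)
  have tp: "\<theta> p \<bullet> p = 0" by (rule theta_orth[OF p])
  have pp: "p \<bullet> p = norm p * norm p" by (simp add: dot_square_norm power2_eq_square)
  have lag: "cross3 x (cross3 y z) = (x \<bullet> z) *\<^sub>R y - (x \<bullet> y) *\<^sub>R z" for x y z :: "real ^ 3"
    by (rule Lagrange)
  have c: "cross3 p (\<theta> p) \<bullet> cross3 p (\<theta> p) = norm p * norm p"
    using norm_cross_dot[of p "\<theta> p"] tp theta_unit[OF p]
    unfolding dot_square_norm by (simp add: inner_commute power2_eq_square)
  show oo: "omega \<theta> p \<bullet> omega \<theta> p = 1" using np by (simp add: omega_def c)
  show to: "\<theta> p \<bullet> omega \<theta> p = 0" by (simp add: omega_def dot_cross_self)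
  show op: "omega \<theta> p \<bullet> p = 0" by (simp add: omega_def dot_cross_self)
  show "orthonormal (\<theta> p) (omega \<theta> p) (ax p)"
    using tt oo to tp op np by (simp add: orthonormal_def pp)
  show "cross3 (\<theta> p) (omega \<theta> p) = ax p"
    by (simp add: omega_def cross_mult_right lag tt tp)
  show "cross3 (\<theta> p) p = - norm p *\<^sub>R omega \<theta> p"
    using np cross_skew[of "\<theta> p" p] by (simp add: omega_def)
  have "cross3 (omega \<theta> p) p = - cross3 p (omega \<theta> p)" by (rule cross_skew)
  also have "\<dots> = - ((1 / norm p) *\<^sub>R (- (norm p * norm p) *\<^sub>R \<theta> p))"
    by (simp add: omega_def cross_mult_right lag inner_commute[of p "\<theta> p"] tp pp)
  also have "\<dots> = norm p *\<^sub>R \<theta> p" using np by simp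
  finally show "cross3 (omega \<theta> p) p = norm p *\<^sub>R \<theta> p" .
  show "\<theta> p \<bullet> \<theta> p = 1" by (rule tt)
  show "\<theta> p \<bullet> p = 0" by (rule tp)
qed

lemma cdot_k_of:
  "cdot (k_of \<theta> z p) (cvec q) = \<i> * of_real (norm p) / 4 * (z + 1 / z) * of_real (\<theta> p \<bullet> q)
     + of_real (norm p) / 4 * (z - 1 / z) * of_real (omega \<theta> p \<bullet> q) + of_real (p \<bullet> q) / 2"
  by (simp add: k_of_def cdot_simps)

lemma disp_den_fr:
  assumes p: "p \<notin> line \<nu>"
  shows "disp_den (k_of \<theta> z p) (fr p x) = den (norm p / 2) z x"
proof -
  have on: "orthonormal (\<theta> p) (omega \<theta> p) (ax p)" by (rule frame_facts(1)[OF p])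
  have "p \<bullet> fr p x = norm p * (ax p \<bullet> fr p x)" using nonzero[OF p] by simp
  then have pf: "p \<bullet> fr p x = norm p * snd x" unfolding fr_def inner_from_frame[OF on] .
  let ?w = "fst x"
  have w: "?w = of_real (Re ?w) + \<i> * of_real (Im ?w)" "cnj ?w = of_real (Re ?w) - \<i> * of_real (Im ?w)"
    by (simp_all add: complex_eq_iff)
  have "2 * cdot (k_of \<theta> z p) (cvec (fr p x)) = \<i> * of_real (norm p) / 2 * (z + 1 / z) * of_real (Im ?w)
     + of_real (norm p) / 2 * (z - 1 / z) * of_real (Re ?w) + of_real (norm p * snd x)"
    unfolding cdot_k_of pf unfolding fr_def inner_from_frame[OF on] by (simp add: field_simps)
  also have "\<dots> = of_real (norm p * snd x) + of_real (norm p / 2) * (z * ?w - cnj ?w / z)"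
    unfolding w(2) by (subst (3) w(1)) (simp add: algebra_simps add_divide_distrib diff_divide_distrib)
  finally have 1: "2 * cdot (k_of \<theta> z p) (cvec (fr p x)) = of_real (norm p * snd x) + of_real (norm p / 2) * (z * ?w - cnj ?w / z)" .
  show ?thesis
    unfolding disp_den_def 1 den_def unfolding fr_def from_frame_inner_self[OF on] by simp
qed

lemma Re_Im_k_of:
  assumes z: "z \<noteq> 0"
  shows "Re_vec (k_of \<theta> z p) = (norm p / 4 * (1 - 1 / (cmod z)\<^sup>2)) *\<^sub>R (- Im z *\<^sub>R \<theta> p + Re z *\<^sub>R omega \<theta> p) + (1 / 2) *\<^sub>R p"
    "Im_vec (k_of \<theta> z p) = (norm p / 4 * (1 + 1 / (cmod z)\<^sup>2)) *\<^sub>R (Re z *\<^sub>R \<theta> p + Im z *\<^sub>R omega \<theta> p)"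
proof -
  have iz: "1 / z = cnj z / of_real ((cmod z)\<^sup>2)"
    using z by (simp only: complex_norm_square) simp
  have inv: "Re (1 / z) = Re z / (cmod z)\<^sup>2" "Im (1 / z) = - Im z / (cmod z)\<^sup>2"
    unfolding iz by (simp_all only: Re_divide_of_real Im_divide_of_real cnj.simps)
  obtain W where W: "1 / z = W" by simp
  show "Re_vec (k_of \<theta> z p) = (norm p / 4 * (1 - 1 / (cmod z)\<^sup>2)) *\<^sub>R (- Im z *\<^sub>R \<theta> p + Re z *\<^sub>R omega \<theta> p) + (1 / 2) *\<^sub>R p"
    using inv unfolding k_of_def Re_Im_vec_simps W
    by (simp add: scaleR_add_right algebra_simps diff_divide_distrib add_divide_distrib)
  show "Im_vec (k_of \<theta> z p) = (norm p / 4 * (1 + 1 / (cmod z)\<^sup>2)) *\<^sub>R (Re z *\<^sub>R \<theta> p + Im z *\<^sub>R omega \<theta> p)"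
    using inv unfolding k_of_def Re_Im_vec_simps W
    by (simp add: scaleR_add_right algebra_simps diff_divide_distrib add_divide_distrib)
qed

lemma k_perp_k_of:
  assumes p: "p \<notin> line \<nu>" and z: "z \<noteq> 0"
  shows "k_perp (k_of \<theta> z p) = jouk (norm p / 2) (cmod z) *\<^sub>R ax p +
    (norm p / (2 * cmod z)) *\<^sub>R (Im z *\<^sub>R \<theta> p - Re z *\<^sub>R omega \<theta> p)"
proof -
  define c where "c = norm p / 4 * (1 + 1 / (cmod z)\<^sup>2)"
  define d where "d = norm p / 4 * (1 - 1 / (cmod z)\<^sup>2)"
  define r where "r = cmod z"
  have r: "r > 0" using z by (simp add: r_def)
  have np: "norm p > 0" using nonzero[OF p] by simp
  have c: "c > 0" using np r unfolding c_def r_def by (intro mult_pos_pos add_pos_nonneg) auto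
  note ff = frame_facts[OF p]
  have xy: "Re z * Re z + Im z * Im z = r * r"
    unfolding r_def using cmod_power2[of z] by (simp add: power2_eq_square)
  have n: "norm (Im_vec (k_of \<theta> z p)) = c * r"
  proof -
    have "(Re z *\<^sub>R \<theta> p + Im z *\<^sub>R omega \<theta> p) \<bullet> (Re z *\<^sub>R \<theta> p + Im z *\<^sub>R omega \<theta> p) = r * r"
      using ff xy by (simp add: inner_simps inner_commute)
    then have "norm (Re z *\<^sub>R \<theta> p + Im z *\<^sub>R omega \<theta> p) = r" using r by (simp add: norm_eq_sqrt_inner)
    then show ?thesis unfolding Re_Im_k_of[OF z] c_def[symmetric] using c by simp
  qed
  have "cross3 (Im_vec (k_of \<theta> z p)) (Re_vec (k_of \<theta> z p)) =
    c *\<^sub>R ((d * (Re z * Re z + Im z * Im z)) *\<^sub>R ax p + (norm p / 2) *\<^sub>R (Im z *\<^sub>R \<theta> p - Re z *\<^sub>R omega \<theta> p))"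
  proof -
    have co: "cross3 (omega \<theta> p) (\<theta> p) = - ax p" using ff(2) cross_skew[of "omega \<theta> p" "\<theta> p"] by simp
    show ?thesis
      unfolding Re_Im_k_of[OF z] c_def[symmetric] d_def[symmetric]
      by (simp only: cross_add_left cross_add_right cross_mult_left cross_mult_right cross_refl ff(2,3,4) co scaleR_add_right)
        (simp add: algebra_simps)
  qed
  then have "k_perp (k_of \<theta> z p) = (1 / r) *\<^sub>R ((d * (r * r)) *\<^sub>R ax p + (norm p / 2) *\<^sub>R (Im z *\<^sub>R \<theta> p - Re z *\<^sub>R omega \<theta> p))"
    unfolding k_perp_def n xy using c by simp
  also have "\<dots> = (d * r) *\<^sub>R ax p + (norm p / (2 * r)) *\<^sub>R (Im z *\<^sub>R \<theta> p - Re z *\<^sub>R omega \<theta> p)"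
    using r by (simp only: scaleR_add_right scaleR_scaleR) (simp add: mult.commute)
  also have "d * r = jouk (norm p / 2) (cmod z)"
    using r unfolding d_def jouk_def r_def[symmetric] by (simp add: field_simps power2_eq_square)
  finally show ?thesis unfolding r_def .
qed

lemma xi_of_eq:
  assumes p: "p \<notin> line \<nu>" and z: "z \<noteq> 0"
  shows "xi_of \<theta> z p \<phi> = Xi p (z, \<phi>)"
proof -
  define r where "r = cmod z"
  have r: "r > 0" using z by (simp add: r_def)
  have np: "norm p > 0" using nonzero[OF p] by simp
  define d where "d = norm p / 4 * (1 - 1 / (cmod z)\<^sup>2)"
  have m: "circ_m (norm p / 2) z \<phi> = (cos \<phi> - 1) * d - sin \<phi> * (norm p / (2 * r))"
    unfolding circ_m_def d_def r_def by (simp add: algebra_simps)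
  have pp: "p = norm p *\<^sub>R ax p" using np by simp
  have "xi_of \<theta> z p \<phi> = (cos \<phi> - 1) *\<^sub>R (d *\<^sub>R (- Im z *\<^sub>R \<theta> p + Re z *\<^sub>R omega \<theta> p) + (norm p / 2) *\<^sub>R ax p) +
     sin \<phi> *\<^sub>R (jouk (norm p / 2) r *\<^sub>R ax p + (norm p / (2 * r)) *\<^sub>R (Im z *\<^sub>R \<theta> p - Re z *\<^sub>R omega \<theta> p))"
    unfolding xi_of_def k_perp_k_of[OF p z] Re_Im_k_of[OF z] d_def r_def using np by simp
  also have "\<dots> = (- (Im z * circ_m (norm p / 2) z \<phi>)) *\<^sub>R \<theta> p + (Re z * circ_m (norm p / 2) z \<phi>) *\<^sub>R omega \<theta> p
     + circ_s (norm p / 2) z \<phi> *\<^sub>R ax p"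
    unfolding m circ_s_def r_def by (simp add: algebra_simps diff_divide_distrib add_divide_distrib)
  finally show ?thesis
    by (simp add: Xi_def fr_def from_frame_def circ_pt_def mult.commute)
qed

end

text \<open>The vanishing of \<open>den\<close> at \<zeta> is the equation of a circle: (|\<zeta>|
  \<open>circ_m\<close>, \<open>circ_s\<close>) moves on the circle about (-a, -b) through the
  origin, with a = \<open>jouk b (cmod \<zeta>)\<close>.\<close>

lemma circ_pt_identity:
  assumes z: "fst \<sigma> \<noteq> 0"
  shows "den b (fst \<sigma>) (circ_pt b \<sigma>) = 0"
proof -
  define r where "r = cmod (fst \<sigma>)"
  have r: "r > 0" using z by (simp add: r_def)
  define a where "a = jouk b r"
  let ?m = "circ_m b (fst \<sigma>) (snd \<sigma>)" and ?s = "circ_s b (fst \<sigma>) (snd \<sigma>)" and ?\<phi> = "snd \<sigma>"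
  have T: "?m * r = a * (cos ?\<phi> - 1) - b * sin ?\<phi>"
    using r unfolding circ_m_def a_def jouk_def r_def[symmetric] by (simp add: field_simps power2_eq_square)
  have s: "?s = b * (cos ?\<phi> - 1) + a * sin ?\<phi>"
    unfolding circ_s_def a_def r_def by simp
  have "(a * (C - 1) - b * S)\<^sup>2 + (b * (C - 1) + a * S)\<^sup>2 + 2 * b * (b * (C - 1) + a * S) + 2 * a * (a * (C - 1) - b * S)
    = (a\<^sup>2 + b\<^sup>2) * (S\<^sup>2 + C\<^sup>2 - 1)" for C S :: real
    by (simp add: algebra_simps power2_eq_square)
  from this[of "cos ?\<phi>" "sin ?\<phi>"]
  have 0: "(?m * r)\<^sup>2 + ?s\<^sup>2 + 2 * b * ?s + 2 * a * (?m * r) = 0" unfolding T[symmetric] s[symmetric] by simp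
  have a2: "2 * a * (?m * r) = b * (?m * r\<^sup>2 - ?m)"
    using r unfolding a_def jouk_def by (simp add: field_simps power2_eq_square)
  have zz: "fst \<sigma> * cnj (fst \<sigma>) = of_real (r\<^sup>2)" unfolding r_def by (simp only: complex_norm_square)
  have 1: "fst \<sigma> * fst (circ_pt b \<sigma>) = of_real (?m * r\<^sup>2)"
    using zz by (simp add: circ_pt_def mult.left_commute)
  have 2: "cnj (fst (circ_pt b \<sigma>)) / fst \<sigma> = of_real ?m" using z by (simp add: circ_pt_def)
  have "den b (fst \<sigma>) (circ_pt b \<sigma>) = of_real ((?m * r)\<^sup>2 + ?s\<^sup>2 + 2 * b * ?s + b * (?m * r\<^sup>2 - ?m))"
    unfolding den_def 1 2 by (simp add: circ_pt_def norm_mult r_def power_mult_distrib)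
  then show ?thesis using 0 unfolding a2 by simp
qed

context frame_field
begin

lemma disp_den_Xi:
  assumes "p \<notin> line \<nu>" "fst \<sigma> \<noteq> 0" shows "disp_den (k_of \<theta> (fst \<sigma>) p) (Xi p \<sigma>) = 0"
  unfolding Xi_def disp_den_fr[OF assms(1)] by (rule circ_pt_identity[OF assms(2)])

lemma k_of_on_quadric:
  assumes p: "p \<notin> line \<nu>" and z: "z \<noteq> 0"
  shows "cdot (k_of \<theta> z p) (k_of \<theta> z p) = 0" "2 * cdot (k_of \<theta> z p) (cvec p) = of_real (p \<bullet> p)"
proof -
  note ff = frame_facts[OF p]
  let ?A = "\<i> * of_real (norm p) / 4 * (z + 1 / z)" and ?B = "of_real (norm p) / 4 * (z - 1 / z)"
  have k: "k_of \<theta> z p = ?A *s cvec (\<theta> p) + ?B *s cvec (omega \<theta> p) + (1 / 2) *s cvec p" by (simp add: k_of_def)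
  have "cdot (k_of \<theta> z p) (k_of \<theta> z p) = ?A * ?A + ?B * ?B + of_real (p \<bullet> p) / 4"
    unfolding k using ff by (simp add: cdot_simps inner_commute[of p "\<theta> p"] inner_commute[of p "omega \<theta> p"] inner_commute[of "omega \<theta> p" "\<theta> p"])
  also have "of_real (p \<bullet> p) = (of_real (norm p) * of_real (norm p) :: complex)"
    by (simp add: dot_square_norm power2_eq_square)
  also have "?A * ?A + ?B * ?B + of_real (norm p) * of_real (norm p) / 4 = 0"
    using z by (simp add: field_simps power2_eq_square)
  finally show "cdot (k_of \<theta> z p) (k_of \<theta> z p) = 0" .
  show "2 * cdot (k_of \<theta> z p) (cvec p) = of_real (p \<bullet> p)"
    unfolding cdot_k_of using ff by simp
qed

text \<open>Expand k in the complexified frame with coefficients A, B, C. The condition on k \<cdot>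
  p fixes C = |p|/2, and k^2 = 0 becomes (A + iB)(A - iB) = -|p|^2/4. So A + iB is nonzero; it is a
  multiple of \<lambda>, and A - iB is the same multiple of 1/\<lambda>, from which A and B are
  recovered.\<close>

lemma k_of_lambda_of:
  assumes p: "p \<notin> line \<nu>" and k: "cdot k k = 0" "2 * cdot k (cvec p) = of_real (p \<bullet> p)"
  shows "lambda_of \<theta> k p \<noteq> 0" "k_of \<theta> (lambda_of \<theta> k p) p = k"
proof -
  note ff = frame_facts[OF p]
  have np: "norm p > 0" using nonzero[OF p] by simp
  define A B where "A = cdot k (cvec (\<theta> p))" and "B = cdot k (cvec (omega \<theta> p))"
  define C where "C = cdot k (cvec (ax p))"
  have C: "C = of_real (norm p) / 2"
  proof -
    have "2 * (of_real (1 / norm p) * cdot k (cvec p)) = of_real (1 / norm p) * of_real (norm p * norm p)"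
      using k(2) by (simp add: dot_square_norm power2_eq_square)
    then show ?thesis unfolding C_def cvec_simps cdot_simps using np by (simp add: mult.commute)
  qed
  have k_exp: "k = A *s cvec (\<theta> p) + B *s cvec (omega \<theta> p) + C *s cvec (ax p)"
  proof -
    have kk: "k = cvec (Re_vec k) + \<i> *s cvec (Im_vec k)"
      by (simp add: vec_eq_iff cvec_def Re_vec_def Im_vec_def complex_eq_iff)
    have e: "cvec v = of_real (\<theta> p \<bullet> v) *s cvec (\<theta> p) + of_real (omega \<theta> p \<bullet> v) *s cvec (omega \<theta> p) + of_real (ax p \<bullet> v) *s cvec (ax p)" for v
      by (subst orthonormal_expansion[OF ff(1), of v]) (simp only: cvec_simps)
    have ip: "A = of_real (\<theta> p \<bullet> Re_vec k) + \<i> * of_real (\<theta> p \<bullet> Im_vec k)"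
      "B = of_real (omega \<theta> p \<bullet> Re_vec k) + \<i> * of_real (omega \<theta> p \<bullet> Im_vec k)"
      "C = of_real (ax p \<bullet> Re_vec k) + \<i> * of_real (ax p \<bullet> Im_vec k)"
      unfolding A_def B_def C_def by (subst kk, simp only: cdot_simps inner_commute)+
    show ?thesis
      unfolding ip by (subst kk, subst (1 2) e) (simp add: vec_eq_iff algebra_simps)
  qed
  have "cdot k k = A * A + B * B + C * C"
    using cdot_orthonormal[OF ff(1), of A B C] unfolding k_exp[symmetric] .
  then have AB: "A * A + B * B = - (of_real (norm p) * of_real (norm p) / 4)"
    using k(1) C by (simp add: eq_neg_iff_add_eq_0)
  have l: "lambda_of \<theta> k p = 2 * (A + \<i> * B) / (\<i> * of_real (norm p))"
    by (simp add: lambda_of_def cdot_simps A_def B_def)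
  let ?P = "complex_of_real (norm p)"
  have P: "?P \<noteq> 0" using np by simp
  have prod: "(A + \<i> * B) * (A - \<i> * B) = - (?P * ?P / 4)"
    unfolding AB[symmetric] by (simp add: algebra_simps)
  then have ne: "A + \<i> * B \<noteq> 0" using P by auto
  define S D where "S = A + \<i> * B" and "D = A - \<i> * B"
  have S: "S \<noteq> 0" "S * D = - (?P * ?P / 4)" using ne prod by (simp_all add: S_def D_def)
  have l': "lambda_of \<theta> k p = - 2 * \<i> * S / ?P" unfolding l S_def[symmetric] using P by (simp add: field_simps)
  show "lambda_of \<theta> k p \<noteq> 0" unfolding l' using S P by simp
  have li: "1 / lambda_of \<theta> k p = - 2 * \<i> * D / ?P"
  proof -
    have "(c * S / ?P) * (c * D / ?P) = (c * c) * (S * D) / (?P * ?P)" for c by (simp add: mult_ac)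
    moreover have "(- 2 * \<i>) * (- 2 * \<i>) = - 4" by (simp add: complex_eq_iff)
    ultimately have "(- 2 * \<i> * S / ?P) * (- 2 * \<i> * D / ?P) = - 4 * (S * D) / (?P * ?P)" by metis
    also have "\<dots> = 1" unfolding S(2) using P by simp
    finally show ?thesis unfolding l' using S P by (simp add: divide_eq_eq mult.commute)
  qed
  have c1: "\<i> * ?P / 4 * (lambda_of \<theta> k p + 1 / lambda_of \<theta> k p) = A"
    unfolding li unfolding l' S_def D_def using P by (simp add: field_simps)
  have c2: "?P / 4 * (lambda_of \<theta> k p - 1 / lambda_of \<theta> k p) = B"
    unfolding li unfolding l' S_def D_def using P by (simp add: field_simps)
  show "k_of \<theta> (lambda_of \<theta> k p) p = k"
  proof -
    have "?P / 2 * of_real (1 / norm p) = 1 / 2" using np by simp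
    then have "C *s cvec (ax p) = (1 / 2) *s cvec p"
      unfolding C cvec_simps vector_smult_assoc by simp
    then show ?thesis unfolding k_of_def c1 c2 using k_exp by simp
  qed
qed

end

section \<open>Weights and the circle integrals\<close>

text \<open>The reciprocal weight: a bound on \<open>norm_mu\<close> by M becomes a pointwise bound
  by M \<open>wt \<mu>\<close>, and such bounds can be multiplied.\<close>

definition wt :: "real \<Rightarrow> 'a::real_normed_vector \<Rightarrow> real" where "wt \<mu> x = (1 + norm x) powr (- \<mu>)"

lemma one_plus_norm_pos [simp]: "0 < 1 + norm x" "1 + norm x \<noteq> 0"
  by (smt (verit) norm_ge_zero)+

lemma wt_pos [simp]: "wt \<mu> x > 0" "wt \<mu> x \<ge> 0" "wt \<mu> x \<noteq> 0"
  by (auto simp: wt_def)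

lemma wt_le_1: "\<mu> \<ge> 0 \<Longrightarrow> wt \<mu> x \<le> 1"
  by (simp add: wt_def powr_minus_divide ge_one_powr_ge_zero)

lemma wt_uminus [simp]: "wt \<mu> (- x) = wt \<mu> x" by (simp add: wt_def)

lemma wt_add_exponents: "wt (\<mu> + \<delta>) x = wt \<mu> x * wt \<delta> x"
  by (simp add: wt_def powr_add[symmetric])

lemma powr_wt: "(1 + norm x) powr \<mu> * wt \<mu> x = 1"
  by (simp add: wt_def powr_add[symmetric])

lemma wt_exponent_mono: "\<mu> \<le> \<mu>' \<Longrightarrow> wt \<mu>' x \<le> wt \<mu> x"
  unfolding wt_def by (intro powr_mono) auto

text \<open>A form of Peetre's inequality, from 1 + |x + y| \<le> (1 + |x|)(1 + |y|).\<close>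

lemma wt_shift: "\<mu> \<ge> 0 \<Longrightarrow> wt \<mu> x \<le> (1 + norm y) powr \<mu> * wt \<mu> (x + y)"
proof -
  assume mu: "\<mu> \<ge> 0"
  have "norm (x + y) \<le> norm x + norm y" by (rule norm_triangle_ineq)
  then have "1 + norm (x + y) \<le> (1 + norm x) * (1 + norm y)"
    by (simp add: algebra_simps) (smt (verit) mult_nonneg_nonneg norm_ge_zero)
  then have "(1 + norm (x + y)) powr \<mu> \<le> (1 + norm x) powr \<mu> * (1 + norm y) powr \<mu>"
    using mu by (subst powr_mult[symmetric]) (auto intro!: powr_mono2)
  then have "wt \<mu> x * (1 + norm (x + y)) powr \<mu> * wt \<mu> (x + y) \<le>
      wt \<mu> x * ((1 + norm x) powr \<mu> * (1 + norm y) powr \<mu>) * wt \<mu> (x + y)"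
    by (intro mult_right_mono mult_left_mono) auto
  moreover have "wt \<mu> x * (1 + norm (x + y)) powr \<mu> * wt \<mu> (x + y) = wt \<mu> x"
    by (simp only: mult.assoc powr_wt mult_1_right)
  moreover have "wt \<mu> x * ((1 + norm x) powr \<mu> * (1 + norm y) powr \<mu>) * wt \<mu> (x + y) =
      ((1 + norm x) powr \<mu> * wt \<mu> x) * ((1 + norm y) powr \<mu> * wt \<mu> (x + y))"
    by (simp only: mult_ac)
  ultimately show ?thesis by (simp only: powr_wt mult_1_left)
qed

lemma wt_measurable [measurable (raw)]:
  fixes f :: "'x \<Rightarrow> 'a::{real_normed_vector, second_countable_topology}"
  assumes [measurable]: "f \<in> borel_measurable M"
  shows "(\<lambda>x. wt \<mu> (f x)) \<in> borel_measurable M"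
  unfolding wt_def by measurable

lemma wt_continuous: "continuous_on UNIV (wt \<mu>)"
  unfolding wt_def by (intro continuous_intros) auto

text \<open>With r = |\<zeta>|, the circle has radius q = b/2 (r + 1/r), and N is the length of a
  chord from the origin, so N^2 = 2 q^2 (1 - cos \<phi>). Both parts of r \<open>circ_m\<close> = a
  (cos \<phi> - 1) - b sin \<phi> are controlled by N, since |a| \<le> q and |sin \<phi>| \<le> N/q.
  The decay in \<zeta> comes from 2 q r = b (1 + r^2).\<close>

lemma circ_m_bound:
  fixes \<sigma> :: "complex \<times> real"
  assumes b: "b > 0" and z: "fst \<sigma> \<noteq> 0"
  shows "\<bar>circ_m b (fst \<sigma>) (snd \<sigma>)\<bar> \<le> ((norm (circ_pt b \<sigma>))\<^sup>2 + 2 * b * norm (circ_pt b \<sigma>)) / (b * (1 + (cmod (fst \<sigma>))\<^sup>2))"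
proof -
  define r where "r = cmod (fst \<sigma>)"
  have r: "r > 0" using z by (simp add: r_def)
  define a where "a = jouk b r"
  let ?m = "circ_m b (fst \<sigma>) (snd \<sigma>)" and ?s = "circ_s b (fst \<sigma>) (snd \<sigma>)"
  define C S where "C = cos (snd \<sigma>)" and "S = sin (snd \<sigma>)"
  have CS: "S\<^sup>2 = (1 - C) * (1 + C)" "C \<le> 1" "C \<ge> -1"
    by (auto simp: C_def S_def sin_squared_eq algebra_simps power2_eq_square)
  have T: "?m * r = a * (C - 1) - b * S"
    using r unfolding circ_m_def a_def jouk_def r_def[symmetric] C_def S_def by (simp add: field_simps power2_eq_square)
  have s: "?s = b * (C - 1) + a * S"
    unfolding circ_s_def a_def r_def C_def S_def by simp
  define q where "q = b / 2 * (r + 1 / r)"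
  have q: "q > 0" using b r by (simp add: q_def add_pos_pos)
  have q2: "q\<^sup>2 = a\<^sup>2 + b\<^sup>2" using r unfolding q_def a_def jouk_def by (simp add: field_simps power2_eq_square)
  define N where "N = norm (circ_pt b \<sigma>)"
  have N0: "N \<ge> 0" by (simp add: N_def)
  have "N\<^sup>2 = (?m * r)\<^sup>2 + ?s\<^sup>2"
    unfolding N_def norm_prod_def by (simp add: circ_pt_def norm_mult r_def power_mult_distrib)
  also have "\<dots> = (a\<^sup>2 + b\<^sup>2) * ((1 - C)\<^sup>2 + S\<^sup>2)" unfolding T s by (simp add: algebra_simps power2_eq_square)
  also have "(1 - C)\<^sup>2 + S\<^sup>2 = 2 * (1 - C)" unfolding CS(1) by (simp add: algebra_simps power2_eq_square)
  finally have N2: "N\<^sup>2 = q\<^sup>2 * (2 * (1 - C))" by (simp add: q2)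
  have "\<bar>a\<bar> \<le> q" using q q2 by (simp add: abs_le_square_iff power2_le_imp_le[of "\<bar>a\<bar>" q])
  then have 1: "\<bar>a * (C - 1)\<bar> \<le> N\<^sup>2 / (2 * q)"
  proof -
    have "\<bar>a * (C - 1)\<bar> = \<bar>a\<bar> * (1 - C)" using CS by (simp add: abs_mult)
    also have "\<dots> \<le> q * (1 - C)" using CS \<open>\<bar>a\<bar> \<le> q\<close> by (intro mult_right_mono) auto
    also have "\<dots> = N\<^sup>2 / (2 * q)" unfolding N2 using q by (simp add: power2_eq_square)
    finally show ?thesis .
  qed
  have "\<bar>S\<bar> \<le> N / q"
  proof (rule power2_le_imp_le)
    have "S\<^sup>2 \<le> 2 * (1 - C)" unfolding CS(1) using CS by (subst mult.commute[of 2]) (intro mult_left_mono, auto)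
    then show "\<bar>S\<bar>\<^sup>2 \<le> (N / q)\<^sup>2" unfolding power_divide N2 using q by simp
  qed (use N0 q in auto)
  then have "\<bar>?m * r\<bar> \<le> N\<^sup>2 / (2 * q) + b * (N / q)"
    unfolding T using abs_triangle_ineq4[of "a * (C - 1)" "b * S"] 1 b mult_left_mono[of "\<bar>S\<bar>" "N / q" b]
    by (simp add: abs_mult)
  then have "\<bar>?m\<bar> * r \<le> (N\<^sup>2 + 2 * b * N) / (2 * q)"
    using r q by (simp add: abs_mult field_simps)
  then have "\<bar>?m\<bar> \<le> (N\<^sup>2 + 2 * b * N) / (2 * q) / r"
    by (subst pos_le_divide_eq[OF r])
  also have "\<dots> = (N\<^sup>2 + 2 * b * N) / (b * (1 + r\<^sup>2))"
  proof -
    have "2 * q * r = b * (1 + r\<^sup>2)" using r by (simp add: q_def field_simps power2_eq_square)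
    then show ?thesis by simp
  qed
  finally show ?thesis unfolding N_def r_def .
qed

lemma norm_circ_w: "fst \<sigma> \<noteq> 0 \<Longrightarrow> cmod (circ_w b \<sigma>) = \<bar>circ_m b (fst \<sigma>) (snd \<sigma>)\<bar> / 2"
  by (simp add: circ_w_def norm_divide norm_mult abs_mult)

text \<open>The bound on \<open>circ_m\<close> grows quadratically in the size of the point, and a
  weight of exponent at least 2 absorbs this. The remaining decay in \<zeta> is the one handled by
  \<open>nn_integral_cauchy_majorant\<close>.\<close>

lemma circ_w_bound:
  assumes b: "b > 0" and mu: "\<mu> \<ge> 2"
  shows "cmod (circ_w b \<sigma>) * wt \<mu> (circ_pt b \<sigma>) \<le> (1 + 2 * b) / (2 * b) * (1 / (1 + (cmod (fst \<sigma>))\<^sup>2))"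
proof (cases "fst \<sigma> = 0")
  case True
  then show ?thesis using b by (simp add: circ_w_def)
next
  case False
  define N where "N = norm (circ_pt b \<sigma>)"
  have N0: "N \<ge> 0" by (simp add: N_def)
  have R: "1 + (cmod (fst \<sigma>))\<^sup>2 > 0" by (simp add: add_pos_nonneg)
  have "wt \<mu> (circ_pt b \<sigma>) \<le> (1 + N) powr (- 2)" unfolding wt_def N_def using mu by (intro powr_mono) auto
  also have "\<dots> = 1 / (1 + N)\<^sup>2" using N0 by (simp add: powr_minus_divide powr_numeral)
  finally have w: "wt \<mu> (circ_pt b \<sigma>) \<le> 1 / (1 + N)\<^sup>2" .
  have "N\<^sup>2 + 2 * b * N \<le> (1 + 2 * b) * (1 + N)\<^sup>2"
    using N0 b by (simp add: algebra_simps power2_eq_square)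
  then have nb: "(N\<^sup>2 + 2 * b * N) * (1 / (1 + N)\<^sup>2) \<le> 1 + 2 * b"
    using N0 by (simp add: divide_le_eq)
  have "cmod (circ_w b \<sigma>) \<le> (N\<^sup>2 + 2 * b * N) / (b * (1 + (cmod (fst \<sigma>))\<^sup>2)) / 2"
    unfolding norm_circ_w[OF False] N_def by (intro divide_right_mono circ_m_bound[OF b False]) simp
  then have "cmod (circ_w b \<sigma>) * wt \<mu> (circ_pt b \<sigma>) \<le> (N\<^sup>2 + 2 * b * N) / (b * (1 + (cmod (fst \<sigma>))\<^sup>2)) / 2 * (1 / (1 + N)\<^sup>2)"
    using w b N0 R by (intro mult_mono) auto
  also have "\<dots> = ((N\<^sup>2 + 2 * b * N) * (1 / (1 + N)\<^sup>2)) * (1 / (2 * b * (1 + (cmod (fst \<sigma>))\<^sup>2)))" by simp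
  also have "\<dots> \<le> (1 + 2 * b) * (1 / (2 * b * (1 + (cmod (fst \<sigma>))\<^sup>2)))"
    using nb b R by (intro mult_right_mono) auto
  finally show ?thesis by simp
qed

lemma nn_integral_circ_dom:
  assumes [measurable]: "f \<in> borel_measurable borel"
  shows "(\<integral>\<^sup>+\<sigma>. indicator circ_dom \<sigma> * f (fst \<sigma>) \<partial>lborel) = ennreal (2 * pi) * (\<integral>\<^sup>+\<zeta>. f \<zeta> \<partial>lborel)"
proof -
  have "(\<integral>\<^sup>+\<sigma>. indicator circ_dom \<sigma> * f (fst \<sigma>) \<partial>lborel) =
    (\<integral>\<^sup>+\<sigma>. indicator {-pi..pi} (snd \<sigma>) * f (fst \<sigma>) \<partial>(lborel \<Otimes>\<^sub>M lborel))"
    by (simp add: circ_dom_indicator lborel_prod)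
  also have "\<dots> = (\<integral>\<^sup>+\<zeta>. \<integral>\<^sup>+\<phi>. indicator {-pi..pi} \<phi> * f \<zeta> \<partial>lborel \<partial>lborel)"
    by (subst lborel.nn_integral_fst[symmetric]) auto
  also have "\<dots> = (\<integral>\<^sup>+\<zeta>. ennreal (2 * pi) * f \<zeta> \<partial>lborel)"
    by (intro nn_integral_cong) (simp add: nn_integral_multc)
  finally show ?thesis by (simp add: nn_integral_cmult)
qed

text \<open>The product of the length 2\<pi> of the range of \<phi>, the factor in
  \<open>circ_w_bound\<close> and the bound in \<open>nn_integral_cauchy_majorant\<close>.\<close>

definition circ_const :: "real \<Rightarrow> real" where
  "circ_const b = 2 * pi * ((1 + 2 * b) / (2 * b)) * (4 * pi + 16 * pi\<^sup>2)"

lemma circ_const_nonneg: "b > 0 \<Longrightarrow> circ_const b \<ge> 0"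
  unfolding circ_const_def by (intro mult_nonneg_nonneg add_nonneg_nonneg divide_nonneg_nonneg) auto

lemma circ_kernel_bound:
  assumes b: "b > 0" and mu: "\<mu> \<ge> 2"
  shows "(\<integral>\<^sup>+\<sigma>. indicator circ_dom \<sigma> * ennreal (cmod (circ_w b \<sigma>) * wt \<mu> (circ_pt b \<sigma>) / cmod (z - fst \<sigma>)) \<partial>lborel) \<le> ennreal (circ_const b)"
proof -
  let ?c = "(1 + 2 * b) / (2 * b)"
  have c: "?c \<ge> 0" using b by simp
  have "(\<integral>\<^sup>+\<sigma>. indicator circ_dom \<sigma> * ennreal (cmod (circ_w b \<sigma>) * wt \<mu> (circ_pt b \<sigma>) / cmod (z - fst \<sigma>)) \<partial>lborel) \<le>
    (\<integral>\<^sup>+\<sigma>. indicator circ_dom \<sigma> * (ennreal ?c * ennreal (1 / (1 + (cmod (fst \<sigma>))\<^sup>2) / cmod (fst \<sigma> - z))) \<partial>lborel)"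
  proof (intro nn_integral_mono mult_left_mono)
    fix \<sigma> :: "complex \<times> real"
    have "cmod (circ_w b \<sigma>) * wt \<mu> (circ_pt b \<sigma>) / cmod (z - fst \<sigma>) \<le> ?c * (1 / (1 + (cmod (fst \<sigma>))\<^sup>2)) / cmod (z - fst \<sigma>)"
      by (intro divide_right_mono circ_w_bound b mu) auto
    then show "ennreal (cmod (circ_w b \<sigma>) * wt \<mu> (circ_pt b \<sigma>) / cmod (z - fst \<sigma>)) \<le>
      ennreal ?c * ennreal (1 / (1 + (cmod (fst \<sigma>))\<^sup>2) / cmod (fst \<sigma> - z))"
      using c by (subst ennreal_mult'[symmetric]) (auto simp: norm_minus_commute intro!: ennreal_leI)
  qed auto
  also have "\<dots> = ennreal (2 * pi) * (ennreal ?c * (\<integral>\<^sup>+\<zeta>. ennreal (1 / (1 + (cmod \<zeta>)\<^sup>2) / cmod (\<zeta> - z)) \<partial>lborel))"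
    by (subst nn_integral_circ_dom) (auto simp: nn_integral_cmult)
  also have "\<dots> \<le> ennreal (2 * pi) * (ennreal ?c * ennreal (4 * pi + 16 * pi\<^sup>2))"
    by (intro mult_left_mono nn_integral_cauchy_majorant) auto
  also have "\<dots> = ennreal (circ_const b)"
    unfolding circ_const_def using c by (simp add: ennreal_mult'[symmetric] mult.assoc del: ennreal_plus)
  finally show ?thesis .
qed

lemma norm_resid_le:
  assumes b: "b > 0" shows "cmod (resid b w z) \<le> 1 / (b * cmod w)"
proof -
  have "cmod (resid b w z) = 1 / (b * cmod w) * (1 / (1 + 1 / (cmod z)\<^sup>2))"
    unfolding resid_def norm_divide norm_mult norm_of_real using b by (simp add: add_nonneg_nonneg abs_of_nonneg)
  also have "\<dots> \<le> 1 / (b * cmod w) * 1"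
    using b by (intro mult_left_mono) (auto simp: divide_le_eq add_pos_nonneg)
  finally show ?thesis by simp
qed

text \<open>Read backwards through \<open>circ_jac_resid\<close>, the weight becomes
  |\<open>resid\<close>| \<le> 1/(b |w|) in the variable x. The singularity at w = 0 is integrable
  in the plane, and the fourth power of 1 + |x| dominates (1 + |w|^2)(1 + s^2). The exponent 4 is
  the sum of two exponents 2, one for each factor of the bracket.\<close>

lemma circ_w_integrable:
  assumes b: "b > 0"
  shows "(\<integral>\<^sup>+\<sigma>. indicator circ_dom \<sigma> * ennreal (cmod (circ_w b \<sigma>) * wt 4 (circ_pt b \<sigma>)) \<partial>lborel) < \<infinity>"
proof -
  define F where "F y = ennreal (cmod (resid b (fst (fst y)) (snd y)) * wt 4 (fst y))" for y :: "(complex \<times> real) \<times> complex"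
  have [measurable]: "F \<in> borel_measurable borel" unfolding F_def by measurable
  define G where "G x = ennreal (1 / b) * (ennreal (1 / (1 + (cmod (fst x))\<^sup>2) / cmod (fst x - 0)) * ennreal (1 / (1 + (snd x)\<^sup>2)))" for x :: "complex \<times> real"
  have FG: "F (x, l) \<le> G x" for x l
  proof -
    have "wt 4 x \<le> 1 / (1 + (cmod (fst x))\<^sup>2) * (1 / (1 + (snd x)\<^sup>2))"
    proof -
      have n: "(norm x)\<^sup>2 = (cmod (fst x))\<^sup>2 + (snd x)\<^sup>2" by (simp add: norm_prod_def)
      have p1: "0 < 1 + (cmod (fst x))\<^sup>2" "0 < 1 + (snd x)\<^sup>2" by (auto simp: add_pos_nonneg)
      have "(1 + (cmod (fst x))\<^sup>2) * (1 + (snd x)\<^sup>2) \<le> (1 + (norm x)\<^sup>2) * (1 + (norm x)\<^sup>2)"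
        using p1 by (intro mult_mono) (auto simp: n)
      also have "\<dots> \<le> (1 + norm x)\<^sup>2 * (1 + norm x)\<^sup>2"
        by (intro mult_mono) (auto simp: power2_eq_square algebra_simps)
      also have "\<dots> = (1 + norm x) ^ 4" by (simp add: power2_eq_square power4_eq_xxxx mult.assoc)
      finally have "1 / (1 + norm x) ^ 4 \<le> 1 / ((1 + (cmod (fst x))\<^sup>2) * (1 + (snd x)\<^sup>2))"
        using p1 by (intro divide_left_mono mult_pos_pos) auto
      then show ?thesis by (simp add: wt_def powr_minus_divide powr_numeral)
    qed
    then have "cmod (resid b (fst x) l) * wt 4 x \<le> 1 / (b * cmod (fst x)) * (1 / (1 + (cmod (fst x))\<^sup>2) * (1 / (1 + (snd x)\<^sup>2)))"
      using b by (intro mult_mono norm_resid_le) auto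
    also have "\<dots> = 1 / b * (1 / (1 + (cmod (fst x))\<^sup>2) / cmod (fst x - 0) * (1 / (1 + (snd x)\<^sup>2)))" by simp
    finally have "F (x, l) \<le> ennreal (1 / b * (1 / (1 + (cmod (fst x))\<^sup>2) / cmod (fst x - 0) * (1 / (1 + (snd x)\<^sup>2))))"
      unfolding F_def fst_conv snd_conv by (rule ennreal_leI)
    also have "\<dots> = G x"
    proof -
      have *: "ennreal (u * (v * w)) = ennreal u * (ennreal v * ennreal w)" if "u \<ge> 0" "v \<ge> 0" for u v w
        by (simp add: ennreal_mult' that)
      show ?thesis unfolding G_def by (rule *) (use b in \<open>auto simp: add_nonneg_nonneg\<close>)
    qed
    finally show ?thesis .
  qed
  have int: "(\<integral>\<^sup>+x. G x \<partial>lborel) < \<infinity>"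
  proof -
    have "(\<integral>\<^sup>+x. G x \<partial>lborel) = ennreal (1 / b) * ((\<integral>\<^sup>+\<zeta>. ennreal (1 / (1 + (cmod \<zeta>)\<^sup>2) / cmod (\<zeta> - 0)) \<partial>lborel) * (\<integral>\<^sup>+(s::real). ennreal (1 / (1 + s\<^sup>2)) \<partial>lborel))"
      unfolding G_def lborel_prod[symmetric]
      by (subst lborel.nn_integral_fst[symmetric], measurable) (simp add: nn_integral_cmult nn_integral_multc)
    also have "\<dots> \<le> ennreal (1 / b) * (ennreal (4 * pi + 16 * pi\<^sup>2) * ennreal (2 * pi))"
      by (intro mult_left_mono mult_mono nn_integral_cauchy_majorant nn_integral_inverse_1_plus_square) auto
    also have "\<dots> < \<infinity>" by (simp add: ennreal_mult_less_top del: ennreal_plus)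
    finally show ?thesis .
  qed
  have "(\<integral>\<^sup>+\<sigma>. indicator circ_dom \<sigma> * ennreal (cmod (circ_w b \<sigma>) * wt 4 (circ_pt b \<sigma>)) \<partial>lborel) \<le>
    (\<integral>\<^sup>+\<sigma>. indicator (circ_half b 1) \<sigma> * (ennreal (circ_jac b \<sigma>) * F (circ_pt b \<sigma>, fst \<sigma>)) +
      indicator (circ_half b (-1)) \<sigma> * (ennreal (circ_jac b \<sigma>) * F (circ_pt b \<sigma>, fst \<sigma>)) \<partial>lborel)"
  proof (intro nn_integral_mono)
    fix \<sigma> :: "complex \<times> real"
    let ?m = "circ_m b (fst \<sigma>) (snd \<sigma>)"
    have "ennreal (cmod (circ_w b \<sigma>) * wt 4 (circ_pt b \<sigma>)) = ennreal (circ_jac b \<sigma>) * F (circ_pt b \<sigma>, fst \<sigma>)" if "?m \<noteq> 0"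
    proof -
      have "cmod (circ_w b \<sigma>) = circ_jac b \<sigma> * cmod (resid b (fst (circ_pt b \<sigma>)) (fst \<sigma>))"
        unfolding circ_jac_resid[OF b that, symmetric] norm_mult norm_of_real using b by (simp add: circ_jac_def abs_mult)
      moreover have "circ_jac b \<sigma> \<ge> 0" using b by (simp add: circ_jac_def)
      ultimately show ?thesis by (simp add: F_def ennreal_mult'[symmetric] mult.assoc)
    qed
    moreover have "circ_w b \<sigma> = 0" if "?m = 0" using that by (simp add: circ_w_def)
    ultimately show "indicator circ_dom \<sigma> * ennreal (cmod (circ_w b \<sigma>) * wt 4 (circ_pt b \<sigma>)) \<le>
      indicator (circ_half b 1) \<sigma> * (ennreal (circ_jac b \<sigma>) * F (circ_pt b \<sigma>, fst \<sigma>)) +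
      indicator (circ_half b (-1)) \<sigma> * (ennreal (circ_jac b \<sigma>) * F (circ_pt b \<sigma>, fst \<sigma>))"
      by (cases "?m" "0::real" rule: linorder_cases) (auto simp: circ_half_def indicator_def)
  qed
  also have "\<dots> = (\<integral>\<^sup>+x. F (x, lam b 1 x) \<partial>lborel) + (\<integral>\<^sup>+x. F (x, lam b (-1) x) \<partial>lborel)"
    by (subst nn_integral_add) (auto simp: nn_integral_circ_half[OF b])
  also have "\<dots> \<le> (\<integral>\<^sup>+x. G x \<partial>lborel) + (\<integral>\<^sup>+x. G x \<partial>lborel)"
    by (intro add_mono nn_integral_mono FG)
  also have "\<dots> < \<infinity>" using int by simp
  finally show ?thesis .
qed

section \<open>Null sets under the substitution\<close>

lemma AE_circ_m_neq_0:
  assumes b: "b > 0" shows "AE \<sigma> in lborel. \<sigma> \<in> circ_dom \<longrightarrow> circ_m b (fst \<sigma>) (snd \<sigma>) \<noteq> 0 \<and> fst \<sigma> \<noteq> 0"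
proof -
  \<comment> \<open>For given \<zeta> the zeros of \<open>circ_m\<close> are among finitely many
    angles: besides 0 and the end points, only tan(\<phi>/2) = -b/a with a =
    \<open>jouk b (cmod z)\<close>. By Fubini's theorem the zero set is null.\<close>
  have m0: "\<phi> \<in> {0, pi, -pi, 2 * arctan (- b / jouk b (cmod z))}"
    if z: "z \<noteq> 0" and \<phi>: "\<phi> \<in> {-pi..pi}" and m: "circ_m b z \<phi> = 0" for z \<phi>
  proof (rule ccontr)
    assume n: "\<phi> \<notin> {0, pi, -pi, 2 * arctan (- b / jouk b (cmod z))}"
    then have \<phi>': "-pi < \<phi>" "\<phi> < pi" "\<phi> \<noteq> 0" using \<phi> by auto
    have c: "cos (\<phi> / 2) > 0" using \<phi>' by (intro cos_gt_zero_pi) auto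
    have s: "sin (\<phi> / 2) \<noteq> 0"
      using \<phi>' sin_gt_zero[of "\<phi>/2"] sin_gt_zero[of "-(\<phi>/2)"] by (cases "\<phi> > 0") auto
    let ?a = "jouk b (cmod z)"
    have "circ_m b z \<phi> * cmod z = ?a * (cos \<phi> - 1) - b * sin \<phi>"
      using z unfolding circ_m_def jouk_def by (simp add: field_simps power2_eq_square)
    then have "?a * (cos \<phi> - 1) = b * sin \<phi>" using m by simp
    moreover have "cos \<phi> - 1 = - 2 * (sin (\<phi> / 2))\<^sup>2" using cos_double_sin[of "\<phi>/2"] by simp
    moreover have "sin \<phi> = 2 * sin (\<phi> / 2) * cos (\<phi> / 2)" using sin_double[of "\<phi>/2"] by simp
    ultimately have "sin (\<phi> / 2) * (- ?a * sin (\<phi> / 2)) = sin (\<phi> / 2) * (b * cos (\<phi> / 2))"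
      by (simp add: power2_eq_square mult_ac)
    then have e: "- ?a * sin (\<phi> / 2) = b * cos (\<phi> / 2)" using s by (metis mult_left_cancel)
    then have a: "?a \<noteq> 0" using b c by auto
    have "tan (\<phi> / 2) = - b / ?a" using e a c by (simp add: tan_def field_simps)
    then have "arctan (- b / ?a) = \<phi> / 2" using \<phi>' by (intro arctan_unique) auto
    then show False using n by auto
  qed
  have "AE z in lborel. AE \<phi> in lborel. \<phi> \<in> {-pi..pi} \<longrightarrow> circ_m b z \<phi> \<noteq> 0 \<and> z \<noteq> 0"
    using AE_lborel_singleton[of "0::complex"]
  proof eventually_elim
    case (elim z)
    show ?case
      using AE_lborel_singleton[of "0::real"] AE_lborel_singleton[of pi] AE_lborel_singleton[of "-pi"]
        AE_lborel_singleton[of "2 * arctan (- b / jouk b (cmod z))"]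
    proof eventually_elim
      case (elim \<phi>)
      then show ?case using m0[OF \<open>z \<noteq> 0\<close>, of \<phi>] \<open>z \<noteq> 0\<close> by blast
    qed
  qed
  then have "AE \<sigma> in (lborel \<Otimes>\<^sub>M lborel). snd \<sigma> \<in> {-pi..pi} \<longrightarrow> circ_m b (fst \<sigma>) (snd \<sigma>) \<noteq> 0 \<and> fst \<sigma> \<noteq> 0"
  proof (intro lborel_pair.AE_pair_measure)
    show "{\<sigma> \<in> space (lborel \<Otimes>\<^sub>M lborel). snd \<sigma> \<in> {-pi..pi} \<longrightarrow> circ_m b (fst \<sigma>) (snd \<sigma>) \<noteq> 0 \<and> fst \<sigma> \<noteq> 0}
        \<in> sets (lborel \<Otimes>\<^sub>M lborel)" by measurable
  qed (simp only: fst_conv snd_conv)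
  then have "AE \<sigma> in lborel. snd \<sigma> \<in> {-pi..pi} \<longrightarrow> circ_m b (fst \<sigma>) (snd \<sigma>) \<noteq> 0 \<and> fst \<sigma> \<noteq> 0"
    by (simp only: lborel_prod)
  then show ?thesis
    by eventually_elim (simp add: circ_dom_def mem_Times_iff)
qed

text \<open>The integral of the Jacobian over the preimage of a null set is 0. As the Jacobian is
  positive almost everywhere on \<open>circ_dom\<close>, the part of the preimage in
  \<open>circ_dom\<close> is null.\<close>

lemma AE_circ_pt:
  assumes b: "b > 0" and P: "AE x in lborel. P x"
  shows "AE \<sigma> in lborel. \<sigma> \<in> circ_dom \<longrightarrow> P (circ_pt b \<sigma>)"
proof -
  obtain N where N: "{x. \<not> P x} \<subseteq> N" "N \<in> null_sets lborel" using P by (auto simp: eventually_ae_filter)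
  then have [measurable]: "N \<in> sets borel" by auto
  have F [measurable]: "(\<lambda>y :: (complex \<times> real) \<times> complex. indicator N (fst y) :: ennreal) \<in> borel_measurable borel" by measurable
  have *: "AE \<sigma> in lborel. indicator (circ_half b \<epsilon>) \<sigma> * (ennreal (circ_jac b \<sigma>) * indicator N (circ_pt b \<sigma>)) = 0" if e: "\<epsilon> \<in> {1, -1}" for \<epsilon>
  proof -
    have "(\<integral>\<^sup>+\<sigma>. indicator (circ_half b \<epsilon>) \<sigma> * (ennreal (circ_jac b \<sigma>) * indicator N (circ_pt b \<sigma>)) \<partial>lborel) = (\<integral>\<^sup>+x. indicator N x \<partial>lborel)"
      using nn_integral_circ_half[OF b e F] by simp
    also have "\<dots> = 0" using N by auto
    finally show ?thesis by (subst (asm) nn_integral_0_iff_AE) auto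
  qed
  show ?thesis using *[OF insertI1] *[OF insertI2[OF singletonI]] AE_circ_m_neq_0[OF b]
  proof eventually_elim
    case (elim \<sigma>)
    show ?case
    proof (rule impI, rule ccontr)
      assume d: "\<sigma> \<in> circ_dom" and "\<not> P (circ_pt b \<sigma>)"
      then have "indicator N (circ_pt b \<sigma>) = (1::ennreal)" using N by auto
      moreover have "circ_m b (fst \<sigma>) (snd \<sigma>) \<noteq> 0" "fst \<sigma> \<noteq> 0" using elim d by auto
      moreover from this have "circ_jac b \<sigma> > 0" using b by (auto simp: circ_jac_def intro!: mult_pos_pos divide_pos_pos add_pos_nonneg)
      moreover have "\<sigma> \<in> circ_half b 1 \<or> \<sigma> \<in> circ_half b (-1)" using d \<open>circ_m b (fst \<sigma>) (snd \<sigma>) \<noteq> 0\<close> by (auto simp: circ_half_def)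
      ultimately show False using elim by auto
    qed
  qed
qed

text \<open>The graph of \<open>lam\<close> is parametrised by \<sigma> with \<zeta> as the value,
  so the measure of the preimage of N is a weighted integral over \<zeta> in N, which is 0.\<close>

lemma AE_lam:
  assumes b: "b > 0" and e: "\<epsilon> \<in> {1, -1}" and P: "AE z in lborel. P z"
  shows "AE x in lborel. P (lam b \<epsilon> x)"
proof -
  obtain N where N: "{x. \<not> P x} \<subseteq> N" "N \<in> null_sets lborel" using P by (auto simp: eventually_ae_filter)
  then have [measurable]: "N \<in> sets borel" by auto
  have F [measurable]: "(\<lambda>y :: (complex \<times> real) \<times> complex. indicator N (snd y) :: ennreal) \<in> borel_measurable borel" by measurable
  have "AE z in lborel. z \<notin> N" using N(2) by (rule AE_not_in)
  then have "AE z in lborel. AE \<phi> in (lborel :: real measure). z \<notin> N" by (rule eventually_mono) simp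
  then have "AE \<sigma> in (lborel \<Otimes>\<^sub>M (lborel :: real measure)). fst \<sigma> \<notin> N"
    by (intro lborel_pair.AE_pair_measure) measurable
  then have fst: "AE \<sigma> in (lborel :: (complex \<times> real) measure). fst \<sigma> \<notin> N" by (simp only: lborel_prod)
  have "(\<integral>\<^sup>+x. indicator N (lam b \<epsilon> x) \<partial>lborel) =
    (\<integral>\<^sup>+\<sigma>. indicator (circ_half b \<epsilon>) \<sigma> * (ennreal (circ_jac b \<sigma>) * indicator N (fst \<sigma>)) \<partial>lborel)"
    using nn_integral_circ_half[OF b e F] by simp
  also have "\<dots> = (\<integral>\<^sup>+\<sigma>. 0 \<partial>(lborel :: (complex \<times> real) measure))"
    using fst by (intro nn_integral_cong_AE, eventually_elim) auto
  finally have "(\<integral>\<^sup>+x. indicator N (lam b \<epsilon> x) \<partial>lborel) = 0" by simp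
  then have "AE x in lborel. indicator N (lam b \<epsilon> x) = (0 :: ennreal)"
    by (subst (asm) nn_integral_0_iff_AE) auto
  then show ?thesis by eventually_elim (use N in \<open>auto simp: indicator_def\<close>)
qed

section \<open>The Faddeev function\<close>

lemma borel_measurable_vec_nth [measurable (raw)]:
  fixes f :: "'x \<Rightarrow> 'b::euclidean_space ^ 'n"
  assumes "f \<in> borel_measurable M" shows "(\<lambda>x. f x $ i) \<in> borel_measurable M"
  by (rule borel_measurable_continuous_on[OF _ assms]) (intro continuous_intros)

lemma borel_measurable_cvec [measurable (raw)]:
  assumes "f \<in> borel_measurable M" shows "(\<lambda>x. cvec (f x)) \<in> borel_measurable M"
  by (rule borel_measurable_continuous_on[OF _ assms]) (unfold cvec_def, intro continuous_intros)

lemma borel_measurable_cdot [measurable (raw)]: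
  assumes [measurable]: "f \<in> borel_measurable M" "g \<in> borel_measurable M"
  shows "(\<lambda>x. cdot (f x) (g x)) \<in> borel_measurable M"
  unfolding cdot_def by measurable

lemma borel_measurable_disp_den [measurable (raw)]:
  assumes [measurable]: "f \<in> borel_measurable M" "g \<in> borel_measurable M"
  shows "(\<lambda>x. disp_den (f x) (g x)) \<in> borel_measurable M"
  unfolding disp_den_def by measurable

lemma completion_ex_borel_measurable_complex:
  fixes g :: "'a \<Rightarrow> complex"
  assumes g: "g \<in> borel_measurable (completion M)"
  shows "\<exists>g'\<in>borel_measurable M. AE x in M. g x = g' x"
proof -
  have "(\<lambda>x. Re (g x)) \<in> borel_measurable (completion M)" "(\<lambda>x. Im (g x)) \<in> borel_measurable (completion M)"
    using g by (simp_all add: borel_measurable_complex_iff)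
  then obtain a b where ab: "a \<in> borel_measurable M" "AE x in M. Re (g x) = a x" "b \<in> borel_measurable M" "AE x in M. Im (g x) = b x"
    using completion_ex_borel_measurable_real by metis
  have "AE x in M. g x = Complex (a x) (b x)" using ab(2,4) by eventually_elim (simp add: complex_eq_iff)
  moreover have "(\<lambda>x. Complex (a x) (b x)) \<in> borel_measurable M" using ab(1,3) by measurable
  ultimately show ?thesis by (intro bexI[of _ "\<lambda>x. Complex (a x) (b x)"])
qed

lemma norm_muD: "norm_mu \<mu> u \<le> ereal M \<Longrightarrow> AE p in lborel. cmod (u p) \<le> M * wt \<mu> p"
proof -
  assume "norm_mu \<mu> u \<le> ereal M"
  have "AE p in lebesgue. ereal ((1 + norm p) powr \<mu> * cmod (u p)) \<le> norm_mu \<mu> u"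
    unfolding norm_mu_def by (rule esssup_AE)
  then have "AE p in lborel. ereal ((1 + norm p) powr \<mu> * cmod (u p)) \<le> norm_mu \<mu> u"
    by (simp only: AE_completion_iff)
  then show ?thesis
  proof eventually_elim
    case (elim p)
    then have "ereal ((1 + norm p) powr \<mu> * cmod (u p)) \<le> ereal M"
      using \<open>norm_mu \<mu> u \<le> ereal M\<close> by (rule order_trans)
    then have "wt \<mu> p * ((1 + norm p) powr \<mu> * cmod (u p)) \<le> wt \<mu> p * M" by (intro mult_left_mono) auto
    moreover have "wt \<mu> p * ((1 + norm p) powr \<mu> * cmod (u p)) = ((1 + norm p) powr \<mu> * wt \<mu> p) * cmod (u p)"
      by (simp only: mult_ac)
    ultimately show ?case by (simp add: powr_wt mult.commute[of "wt \<mu> p" M])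
  qed
qed

lemma norm_muI:
  assumes "u \<in> borel_measurable lebesgue" "AE p in lborel. cmod (u p) \<le> M * wt \<mu> p"
  shows "norm_mu \<mu> u \<le> ereal M"
  unfolding norm_mu_def
proof (rule esssup_I)
  have [measurable]: "(\<lambda>p. (1 + norm p) powr \<mu>) \<in> borel_measurable lebesgue"
    by (rule measurable_completion) measurable
  show "(\<lambda>p. ereal ((1 + norm p) powr \<mu> * cmod (u p))) \<in> borel_measurable lebesgue"
    using assms(1) by measurable
  show "AE p in lebesgue. ereal ((1 + norm p) powr \<mu> * cmod (u p)) \<le> ereal M"
    unfolding AE_completion_iff using assms(2)
  proof eventually_elim
    case (elim p)
    then have "(1 + norm p) powr \<mu> * cmod (u p) \<le> (1 + norm p) powr \<mu> * (M * wt \<mu> p)" by (intro mult_left_mono) auto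
    also have "\<dots> = M" using powr_wt[of p \<mu>] by (simp add: mult_ac)
    finally show ?case by simp
  qed
qed

lemma Linf_muI:
  assumes "u \<in> borel_measurable lebesgue" "AE p in lborel. cmod (u p) \<le> M * wt \<mu> p"
  shows "u \<in> Linf_mu \<mu>"
  using assms(1) le_less_trans[OF norm_muI[OF assms], of \<infinity>] by (simp add: Linf_mu_def)

lemma AE_ex_in_open:
  fixes S :: "'a::euclidean_space set"
  assumes "AE x in lborel. P x" "open S" "S \<noteq> {}"
  shows "\<exists>x\<in>S. P x"
proof (rule ccontr)
  assume "\<not> ?thesis"
  then have "S \<subseteq> {x. \<not> P x}" by blast
  moreover obtain N where "{x. \<not> P x} \<subseteq> N" "N \<in> null_sets lborel" using assms(1) by (auto simp: eventually_ae_filter)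
  ultimately have "negligible S" by (meson negligible_iff_null_sets negligible_subset null_sets_completionI)
  then show False using open_not_negligible[OF assms(2,3)] by blast
qed

lemma norm_mu_nonneg: "norm_mu \<mu> u \<ge> 0"
proof -
  have "AE p in lebesgue. ereal ((1 + norm p) powr \<mu> * cmod (u p)) \<le> norm_mu \<mu> u"
    unfolding norm_mu_def by (rule esssup_AE)
  then obtain p where "ereal ((1 + norm p) powr \<mu> * cmod (u p)) \<le> norm_mu \<mu> u"
    unfolding AE_completion_iff using AE_ex_in_open[OF _ open_UNIV] by blast
  then show ?thesis by (rule order_trans[rotated]) simp
qed

lemma nonneg_of_mult_pos: "0 \<le> B * c \<Longrightarrow> 0 < c \<Longrightarrow> 0 \<le> (B :: real)"
  by (auto simp: zero_le_mult_iff)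

lemma distr_lborel_uminus: "distr lborel borel (uminus :: 'a::euclidean_space \<Rightarrow> _) = lborel"
  using lborel_affine[of "-1" "0 :: 'a"] by (simp add: density_1)

lemma AE_lborel_uminus:
  fixes P :: "'a::euclidean_space \<Rightarrow> bool"
  assumes "AE x in lborel. P x" shows "AE x in lborel. P (- x)"
proof -
  have "AE x in distr lborel borel (uminus :: 'a \<Rightarrow> _). P x" unfolding distr_lborel_uminus by (rule assms)
  then show ?thesis by (rule AE_distrD[rotated]) simp
qed

text \<open>The set where the inequality fails is open, and a null open set is empty.\<close>

lemma AE_le_continuous:
  fixes f g :: "'a::euclidean_space \<Rightarrow> real"
  assumes "AE x in lborel. f x \<le> g x" and f: "continuous_on UNIV f" and g: "continuous_on UNIV g"
  shows "f x \<le> g x"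
proof (rule ccontr)
  assume "\<not> f x \<le> g x"
  then have "{x. g x < f x} \<noteq> {}" by (auto simp: not_le)
  moreover have "open {x. g x < f x}" by (rule open_Collect_less[OF g f])
  ultimately show False using AE_ex_in_open[OF assms(1)] by force
qed

lemma A_op_lborel:
  assumes [measurable]: "v \<in> borel_measurable borel" "U \<in> borel_measurable borel"
  shows "A_op v k U p = (LINT \<xi>|lborel. v (p + \<xi>) * U (- \<xi>) / disp_den k \<xi>)"
  unfolding A_op_def disp_den_def[symmetric] by (rule integral_completion) measurable

locale kernel_bound =
  fixes \<mu> c1 :: real
  assumes mu: "\<mu> \<ge> 2" and c1_pos: "c1 > 0"
    and c1: "\<And>k w U. k \<in> Sigma_cone \<Longrightarrow> w \<in> Linf_mu \<mu> \<Longrightarrow> U \<in> Linf_mu \<mu> \<Longrightarrow>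
               norm_mu \<mu> (A_op w k U) \<le> ereal c1 * norm_mu \<mu> w * norm_mu \<mu> U"
begin

lemma mu0: "\<mu> \<ge> 0" using mu by simp

text \<open>The bound on the operator norm controls the integral of the absolute value of the kernel: the
  phase of the kernel is put into \<open>U\<close>, which gives the bound for almost every \<open>p\<close>, and Fatou's lemma
  extends it to every \<open>p\<close>.\<close>

theorem kernel_abs_bound:
  assumes k: "k \<in> Sigma_cone"
  shows "(\<integral>\<^sup>+\<xi>. ennreal (wt \<mu> (p + \<xi>) * wt \<mu> \<xi> / cmod (disp_den k \<xi>)) \<partial>lborel) \<le> ennreal (c1 * wt \<mu> p)"
proof -
  \<comment> \<open>Cutting off small denominators and large \<xi> makes the truncated kernel
    bounded with bounded support, hence integrable before any bound on its integral is
    known.\<close>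
  define S where "S n = {\<xi>. 1 / real (Suc n) < cmod (disp_den k \<xi>) \<and> norm \<xi> < real n}" for n
  have S [measurable]: "S n \<in> sets borel" for n unfolding S_def by measurable
  define h where "h n p \<xi> = wt \<mu> (p + \<xi>) * wt \<mu> \<xi> / cmod (disp_den k \<xi>) * indicator (S n) \<xi>" for n p \<xi>
  have [measurable]: "h n p \<in> borel_measurable borel" for n p unfolding h_def by measurable
  have h0: "h n p \<xi> \<ge> 0" for n p \<xi> unfolding h_def by simp
  have good: "AE p in lborel. (\<integral>\<^sup>+\<xi>. ennreal (h n p \<xi>) \<partial>lborel) \<le> ennreal (c1 * wt \<mu> p)" for n
  proof -
    \<comment> \<open>The reflection is there because \<open>A_op\<close> evaluates U at -\<xi>.
      There its phase cancels that of 1/\<open>disp_den\<close>, so that \<open>A_op\<close> returns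
      the integral of the nonnegative function \<open>h n p\<close>.\<close>
    define U where "U x = of_real (wt \<mu> x * indicator (S n) (- x)) * (disp_den k (- x) / of_real (cmod (disp_den k (- x))))" for x
    have [measurable]: "U \<in> borel_measurable borel" unfolding U_def by measurable
    have Ub: "cmod (U x) \<le> 1 * wt \<mu> x" for x
      by (auto simp: U_def norm_mult norm_divide indicator_def)
    have w: "(\<lambda>x. of_real (wt \<mu> x) :: complex) \<in> Linf_mu \<mu>" "norm_mu \<mu> (\<lambda>x. of_real (wt \<mu> x)) \<le> ereal 1"
      by (intro Linf_muI[where M=1] norm_muI measurable_completion; simp)+
    have U: "U \<in> Linf_mu \<mu>" "norm_mu \<mu> U \<le> ereal 1"
      using Ub by (intro Linf_muI[where M=1] norm_muI measurable_completion; simp)+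
    have "norm_mu \<mu> (A_op (\<lambda>x. of_real (wt \<mu> x)) k U) \<le> ereal c1 * norm_mu \<mu> (\<lambda>x. of_real (wt \<mu> x)) * norm_mu \<mu> U"
      by (rule c1[OF k w(1) U(1)])
    also have "\<dots> \<le> ereal c1 * ereal 1 * ereal 1"
      using c1_pos w(2) U(2) norm_mu_nonneg by (intro ereal_mult_mono mult_nonneg_nonneg ereal_mult_left_mono) auto
    finally have "norm_mu \<mu> (A_op (\<lambda>x. of_real (wt \<mu> x)) k U) \<le> ereal c1" by simp
    then have "AE p in lborel. cmod (A_op (\<lambda>x. of_real (wt \<mu> x)) k U p) \<le> c1 * wt \<mu> p" by (rule norm_muD)
    then show ?thesis
    proof eventually_elim
      case (elim p)
      have "of_real (wt \<mu> (p + \<xi>)) * U (- \<xi>) / disp_den k \<xi> = of_real (h n p \<xi>)" for \<xi>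
        by (cases "disp_den k \<xi> = 0") (simp_all add: U_def h_def)
      then have "A_op (\<lambda>x. of_real (wt \<mu> x)) k U p = of_real (LINT \<xi>|lborel. h n p \<xi>)"
        by (subst A_op_lborel) simp_all
      then have le: "(LINT \<xi>|lborel. h n p \<xi>) \<le> c1 * wt \<mu> p" using elim by simp
      have "integrable lborel (h n p)"
      proof (rule integrableI_bounded_set[where A="ball 0 (real n)" and B="real (Suc n)"])
        show "AE \<xi> in lborel. \<xi> \<in> ball 0 (real n) \<longrightarrow> norm (h n p \<xi>) \<le> real (Suc n)"
        proof (intro AE_I2 impI)
          fix \<xi> :: "real ^ 3"
          show "norm (h n p \<xi>) \<le> real (Suc n)"
          proof (cases "\<xi> \<in> S n")
            case True
            then have d: "1 / real (Suc n) < cmod (disp_den k \<xi>)" by (simp add: S_def)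
            then have d0: "0 < cmod (disp_den k \<xi>)" by (rule le_less_trans[rotated]) simp
            have "wt \<mu> (p + \<xi>) * wt \<mu> \<xi> \<le> 1 * 1" using mu0 by (intro mult_mono wt_le_1) auto
            then have "norm (h n p \<xi>) \<le> 1 / cmod (disp_den k \<xi>)"
              using True h0[of n p \<xi>] by (simp add: h_def divide_right_mono abs_mult)
            also have "\<dots> \<le> 1 / (1 / real (Suc n))" using d d0 by (intro divide_left_mono) auto
            finally show ?thesis by simp
          qed (simp add: h_def)
        qed
        show "AE \<xi> in lborel. \<xi> \<notin> ball 0 (real n) \<longrightarrow> h n p \<xi> = 0"
          by (auto simp: h_def S_def indicator_def)
        show "emeasure lborel (ball (0 :: real ^ 3) (real n)) < \<infinity>" by (rule emeasure_lborel_ball_finite)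
      qed auto
      then show ?case using le h0 by (subst nn_integral_eq_integral) (auto intro!: ennreal_leI)
    qed
  qed
  then have "AE p in lborel. \<forall>n. (\<integral>\<^sup>+\<xi>. ennreal (h n p \<xi>) \<partial>lborel) \<le> ennreal (c1 * wt \<mu> p)"
    by (simp add: AE_all_countable)
  \<comment> \<open>The points at which all truncated bounds hold are dense, so p is a limit of such
    points. Truncation and base point are then varied with the same index, so that Fatou's lemma is
    applied only once.\<close>
  then have "\<exists>q\<in>ball p (1 / real (Suc n)). \<forall>n. (\<integral>\<^sup>+\<xi>. ennreal (h n q \<xi>) \<partial>lborel) \<le> ennreal (c1 * wt \<mu> q)" for n
    by (rule AE_ex_in_open) auto
  then obtain q where q: "\<And>n. dist p (q n) < 1 / real (Suc n)"
      "\<And>n m. (\<integral>\<^sup>+\<xi>. ennreal (h m (q n) \<xi>) \<partial>lborel) \<le> ennreal (c1 * wt \<mu> (q n))"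
    unfolding Bex_def mem_ball by metis
  have qlim: "q \<longlonglongrightarrow> p"
  proof (rule metric_tendsto_imp_tendsto[of "\<lambda>n. 1 / real (Suc n)" 0])
    show "(\<lambda>n. 1 / real (Suc n)) \<longlonglongrightarrow> 0" by (rule LIMSEQ_Suc[OF lim_const_over_n])
    show "\<forall>\<^sub>F n in sequentially. dist (q n) p \<le> dist (1 / real (Suc n)) 0"
      using q(1) by (intro always_eventually) (auto simp: dist_commute intro: less_imp_le)
  qed
  have wlim: "(\<lambda>n. wt \<mu> (q n + x)) \<longlonglongrightarrow> wt \<mu> (p + x)" for x
    by (rule continuous_on_tendsto_compose[OF wt_continuous]) (auto intro!: tendsto_intros qlim)
  have lim: "(\<lambda>n. ennreal (h n (q n) \<xi>)) \<longlonglongrightarrow> ennreal (wt \<mu> (p + \<xi>) * wt \<mu> \<xi> / cmod (disp_den k \<xi>))" for \<xi>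
  proof (cases "disp_den k \<xi> = 0")
    case False
    have "\<forall>\<^sub>F n in sequentially. 1 / real (Suc n) < cmod (disp_den k \<xi>)"
      using False by (intro order_tendstoD(2)[OF LIMSEQ_Suc[OF lim_const_over_n]]) auto
    moreover have "\<forall>\<^sub>F n in sequentially. norm \<xi> < real n"
      using filterlim_at_top_dense filterlim_real_sequentially by blast
    ultimately have "\<forall>\<^sub>F n in sequentially. \<xi> \<in> S n" by eventually_elim (simp add: S_def)
    then have ev: "\<forall>\<^sub>F n in sequentially. wt \<mu> (q n + \<xi>) * wt \<mu> \<xi> / cmod (disp_den k \<xi>) = h n (q n) \<xi>"
      by eventually_elim (simp add: h_def)
    have "(\<lambda>n. wt \<mu> (q n + \<xi>) * wt \<mu> \<xi> / cmod (disp_den k \<xi>)) \<longlonglongrightarrow> wt \<mu> (p + \<xi>) * wt \<mu> \<xi> / cmod (disp_den k \<xi>)"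
      using False by (intro tendsto_intros wlim) auto
    then show ?thesis by (intro tendsto_ennrealI Lim_transform_eventually[OF _ ev])
  qed (simp add: h_def)
  have "(\<integral>\<^sup>+\<xi>. ennreal (wt \<mu> (p + \<xi>) * wt \<mu> \<xi> / cmod (disp_den k \<xi>)) \<partial>lborel) =
    (\<integral>\<^sup>+\<xi>. liminf (\<lambda>n. ennreal (h n (q n) \<xi>)) \<partial>lborel)"
    by (intro nn_integral_cong lim_imp_Liminf[symmetric] lim) simp
  also have "\<dots> \<le> liminf (\<lambda>n. \<integral>\<^sup>+\<xi>. ennreal (h n (q n) \<xi>) \<partial>lborel)"
    by (rule nn_integral_liminf) simp
  also have "\<dots> \<le> liminf (\<lambda>n. ennreal (c1 * wt \<mu> (q n)))"
    by (intro Liminf_mono always_eventually allI q(2))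
  also have "\<dots> = ennreal (c1 * wt \<mu> p)"
    using wlim[of 0] by (intro lim_imp_Liminf tendsto_ennrealI tendsto_intros) auto
  finally show ?thesis .
qed

lemma kernel_estimate:
  fixes f :: "real ^ 3 \<Rightarrow> complex"
  assumes k: "k \<in> Sigma_cone" and f [measurable]: "f \<in> borel_measurable borel"
    and bd: "\<And>\<xi>. cmod (f \<xi>) \<le> B * (wt \<mu> (p + \<xi>) * wt \<mu> \<xi>)"
  shows "integrable lborel (\<lambda>\<xi>. f \<xi> / disp_den k \<xi>)" (is ?A)
    and "(\<integral>\<^sup>+\<xi>. ennreal (cmod (f \<xi> / disp_den k \<xi>)) \<partial>lborel) \<le> ennreal (B * c1 * wt \<mu> p)" (is ?B)
    and "cmod (LINT \<xi>|lborel. f \<xi> / disp_den k \<xi>) \<le> B * c1 * wt \<mu> p" (is ?C)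
proof -
  have B: "B \<ge> 0" by (rule nonneg_of_mult_pos[OF order_trans[OF norm_ge_zero bd[of 0]]]) simp
  have "(\<integral>\<^sup>+\<xi>. ennreal (cmod (f \<xi> / disp_den k \<xi>)) \<partial>lborel) \<le>
    (\<integral>\<^sup>+\<xi>. ennreal B * ennreal (wt \<mu> (p + \<xi>) * wt \<mu> \<xi> / cmod (disp_den k \<xi>)) \<partial>lborel)"
  proof (intro nn_integral_mono)
    fix \<xi>
    have "cmod (f \<xi> / disp_den k \<xi>) \<le> B * (wt \<mu> (p + \<xi>) * wt \<mu> \<xi>) / cmod (disp_den k \<xi>)"
      unfolding norm_divide by (intro divide_right_mono bd) simp
    then show "ennreal (cmod (f \<xi> / disp_den k \<xi>)) \<le> ennreal B * ennreal (wt \<mu> (p + \<xi>) * wt \<mu> \<xi> / cmod (disp_den k \<xi>))"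
      using B by (subst ennreal_mult'[symmetric]) (auto intro!: ennreal_leI)
  qed
  also have "\<dots> = ennreal B * (\<integral>\<^sup>+\<xi>. ennreal (wt \<mu> (p + \<xi>) * wt \<mu> \<xi> / cmod (disp_den k \<xi>)) \<partial>lborel)"
    by (rule nn_integral_cmult) measurable
  also have "\<dots> \<le> ennreal B * ennreal (c1 * wt \<mu> p)" by (intro mult_left_mono kernel_abs_bound k) auto
  also have "\<dots> = ennreal (B * c1 * wt \<mu> p)" using B by (subst ennreal_mult'[symmetric]) (auto simp: mult.assoc)
  finally show ?B .
  then show int: ?A by (intro integrableI_bounded) (auto intro: le_less_trans)
  have "ennreal (cmod (LINT \<xi>|lborel. f \<xi> / disp_den k \<xi>)) \<le> ennreal (B * c1 * wt \<mu> p)"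
    by (rule order_trans[OF integral_norm_bound_ennreal[OF int] \<open>?B\<close>])
  then show ?C using B c1_pos by (subst (asm) ennreal_le_iff) auto
qed

end

section \<open>The Neumann series\<close>

lemma summable_power_powr:
  fixes x \<delta> :: real
  assumes x0: "0 \<le> x" and x1: "x < 1"
  shows "summable (\<lambda>n. x ^ n * real (Suc n) powr \<delta>)"
proof -
  let ?a = "\<lambda>n. x ^ n * real (Suc n) powr \<delta>"
  have "(\<lambda>n. x * (1 + 1 / real (Suc n)) powr \<delta>) \<longlonglongrightarrow> x * (1 + 0) powr \<delta>"
    by (intro tendsto_intros LIMSEQ_Suc[OF lim_const_over_n]) auto
  then have "(\<lambda>n. x * (1 + 1 / real (Suc n)) powr \<delta>) \<longlonglongrightarrow> x" by simp
  moreover obtain y where y: "x < y" "y < 1" using dense[OF x1] by blast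
  ultimately have "\<forall>\<^sub>F n in sequentially. x * (1 + 1 / real (Suc n)) powr \<delta> < y" by (intro order_tendstoD)
  then obtain N where N: "\<And>n. n \<ge> N \<Longrightarrow> x * (1 + 1 / real (Suc n)) powr \<delta> < y" by (auto simp: eventually_sequentially)
  show ?thesis
  proof (rule summable_ratio_test[OF y(2)])
    fix n assume "N \<le> n"
    have e: "real (Suc (Suc n)) = (1 + 1 / real (Suc n)) * real (Suc n)" by (simp add: field_simps)
    have "?a (Suc n) = x * (1 + 1 / real (Suc n)) powr \<delta> * ?a n"
      unfolding e by (subst powr_mult) (auto simp: mult_ac)
    also have "\<dots> \<le> y * ?a n"
      using N[OF \<open>N \<le> n\<close>] x0 by (intro mult_right_mono) auto
    finally have "?a (Suc n) \<le> y * ?a n" .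
    moreover have "?a m \<ge> 0" for m using x0 by simp
    ultimately show "norm (?a (Suc n)) \<le> y * norm (?a n)" by (simp only: real_norm_def abs_of_nonneg)
  qed
qed

text \<open>The functions (-A(k))^n v, defined at every (k, p), so that they can be evaluated at
  points of the quadric.\<close>

primrec neumann :: "(real ^ 3 \<Rightarrow> complex) \<Rightarrow> nat \<Rightarrow> complex ^ 3 \<Rightarrow> real ^ 3 \<Rightarrow> complex" where
  "neumann v 0 k p = v p"
| "neumann v (Suc n) k p = - (LINT \<xi>|lborel. v (p + \<xi>) * neumann v n k (- \<xi>) / disp_den k \<xi>)"

locale faddeev_potential = kernel_bound +
  fixes v :: "real ^ 3 \<Rightarrow> complex" and C :: real
  assumes v_cont: "continuous_on UNIV v" and v_bd: "\<And>p. cmod (v p) \<le> C * wt \<mu> p" and C0: "C \<ge> 0" and cC: "c1 * C < 1"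
begin

lemma v_measurable [measurable]: "v \<in> borel_measurable borel"
  by (rule borel_measurable_continuous_onI[OF v_cont])

lemma neumann_measurable': "(\<lambda>(k, p). neumann v n k p) \<in> borel_measurable borel"
proof (induction n)
  case 0 show ?case by (simp add: case_prod_beta)
next
  case (Suc n)
  have [measurable]: "(\<lambda>x :: ((complex ^ 3) \<times> (real ^ 3)) \<times> (real ^ 3). neumann v n (fst (fst x)) (- snd x)) \<in> borel_measurable (borel \<Otimes>\<^sub>M lborel)"
    using measurable_compose[of "\<lambda>x. (fst (fst x), - snd x)" "(borel :: ((complex ^ 3) \<times> (real ^ 3)) measure) \<Otimes>\<^sub>M lborel", OF _ Suc] by simp
  show ?case by (simp add: case_prod_beta)
qed

lemma neumann_measurable [measurable (raw)]:
  assumes [measurable]: "f \<in> borel_measurable M" "g \<in> borel_measurable M"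
  shows "(\<lambda>x. neumann v n (f x) (g x)) \<in> borel_measurable M"
  using measurable_compose[OF _ neumann_measurable', of "\<lambda>x. (f x, g x)" M n] by simp

lemma neumann_bound:
  assumes k: "k \<in> Sigma_cone"
  shows "cmod (neumann v n k p) \<le> C * (c1 * C) ^ n * wt \<mu> p"
proof (induction n arbitrary: p)
  case 0 show ?case using v_bd by simp
next
  case (Suc n)
  have "cmod (LINT \<xi>|lborel. v (p + \<xi>) * neumann v n k (- \<xi>) / disp_den k \<xi>) \<le> (C * (C * (c1 * C) ^ n)) * c1 * wt \<mu> p"
  proof (rule kernel_estimate(3)[OF k])
    fix \<xi>
    have "cmod (v (p + \<xi>) * neumann v n k (- \<xi>)) \<le> (C * wt \<mu> (p + \<xi>)) * (C * (c1 * C) ^ n * wt \<mu> (- \<xi>))"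
      unfolding norm_mult by (intro mult_mono v_bd Suc) (auto simp: C0)
    then show "cmod (v (p + \<xi>) * neumann v n k (- \<xi>)) \<le> C * (C * (c1 * C) ^ n) * (wt \<mu> (p + \<xi>) * wt \<mu> \<xi>)"
      by (simp add: mult_ac)
  qed measurable
  then show ?case by (simp add: mult_ac)
qed

definition fadH :: "complex ^ 3 \<Rightarrow> real ^ 3 \<Rightarrow> complex" where "fadH k p = (\<Sum>n. neumann v n k p)"

lemma fadH_measurable [measurable (raw)]:
  assumes [measurable]: "f \<in> borel_measurable M" "g \<in> borel_measurable M"
  shows "(\<lambda>x. fadH (f x) (g x)) \<in> borel_measurable M"
  unfolding fadH_def by measurable

lemma c1C0: "c1 * C \<ge> 0" using c1_pos C0 by simp

lemma geometric_sums: "(\<lambda>n. C * (c1 * C) ^ n * w) sums (C / (1 - c1 * C) * w)"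
proof -
  have "(\<lambda>n. (c1 * C) ^ n) sums (1 / (1 - c1 * C))" using c1C0 cC by (intro geometric_sums) auto
  then have "(\<lambda>n. C * w * (c1 * C) ^ n) sums (C * w * (1 / (1 - c1 * C)))" by (rule sums_mult)
  then show ?thesis by (simp add: mult_ac)
qed

lemma neumann_summable:
  assumes k: "k \<in> Sigma_cone" shows "summable (\<lambda>n. cmod (neumann v n k p))"
  by (rule summable_comparison_test'[OF sums_summable[OF geometric_sums]]) (use neumann_bound[OF k] in simp)

lemma fadH_bound:
  assumes k: "k \<in> Sigma_cone" shows "cmod (fadH k p) \<le> C / (1 - c1 * C) * wt \<mu> p"
proof -
  have "cmod (fadH k p) \<le> (\<Sum>n. cmod (neumann v n k p))" unfolding fadH_def by (rule summable_norm[OF neumann_summable[OF k]])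
  also have "\<dots> \<le> (\<Sum>n. C * (c1 * C) ^ n * wt \<mu> p)"
    by (intro suminf_le neumann_bound[OF k] neumann_summable[OF k] sums_summable[OF geometric_sums])
  finally show ?thesis using sums_unique[OF geometric_sums] by simp
qed

lemma fadH_equation:
  assumes k: "k \<in> Sigma_cone" shows "fadH k p = v p - A_op v k (fadH k) p"
proof -
  let ?f = "\<lambda>n \<xi>. v (p + \<xi>) * neumann v n k (- \<xi>) / disp_den k \<xi>"
  have bd: "cmod (v (p + \<xi>) * neumann v n k (- \<xi>)) \<le> C * (C * (c1 * C) ^ n) * (wt \<mu> (p + \<xi>) * wt \<mu> \<xi>)" for n \<xi>
  proof -
    have "cmod (v (p + \<xi>) * neumann v n k (- \<xi>)) \<le> (C * wt \<mu> (p + \<xi>)) * (C * (c1 * C) ^ n * wt \<mu> (- \<xi>))"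
      unfolding norm_mult by (intro mult_mono v_bd neumann_bound k) (auto simp: C0)
    then show ?thesis by (simp add: mult_ac)
  qed
  have int: "integrable lborel (?f n)" for n by (rule kernel_estimate(1)[OF k _ bd]) measurable
  have nb: "(LINT \<xi>|lborel. norm (?f n \<xi>)) \<le> C * (C * (c1 * C) ^ n) * c1 * wt \<mu> p" for n
  proof -
    have "ennreal (LINT \<xi>|lborel. norm (?f n \<xi>)) \<le> ennreal (C * (C * (c1 * C) ^ n) * c1 * wt \<mu> p)"
      using kernel_estimate(2)[OF k _ bd] by (subst nn_integral_eq_integral[symmetric]) (use int in auto)
    then show ?thesis using C0 c1_pos by (subst (asm) ennreal_le_iff) auto
  qed
  have "(\<lambda>n. LINT \<xi>|lborel. ?f n \<xi>) sums (LINT \<xi>|lborel. (\<Sum>n. ?f n \<xi>))"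
  proof (rule sums_integral[OF int])
    show "AE \<xi> in lborel. summable (\<lambda>n. norm (?f n \<xi>))"
      by (intro AE_I2) (auto simp: norm_mult norm_divide intro!: summable_divide summable_mult neumann_summable[OF k])
    show "summable (\<lambda>n. LINT \<xi>|lborel. norm (?f n \<xi>))"
    proof (rule summable_comparison_test'[of "\<lambda>n. C * (c1 * C) ^ n * (C * c1 * wt \<mu> p)"])
      show "summable (\<lambda>n. C * (c1 * C) ^ n * (C * c1 * wt \<mu> p))" by (rule sums_summable[OF geometric_sums])
      show "norm (LINT \<xi>|lborel. norm (?f n \<xi>)) \<le> C * (c1 * C) ^ n * (C * c1 * wt \<mu> p)" for n
        using nb[of n] by (simp add: mult_ac)
    qed
  qed
  moreover have "(\<Sum>n. ?f n \<xi>) = v (p + \<xi>) * fadH k (- \<xi>) / disp_den k \<xi>" for \<xi>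
    unfolding fadH_def
    using suminf_mult[OF summable_norm_cancel[OF neumann_summable[OF k, of "- \<xi>"]], of "v (p + \<xi>) / disp_den k \<xi>"] by simp
  ultimately have "(\<lambda>n. - neumann v (Suc n) k p) sums (A_op v k (fadH k) p)"
    by (subst A_op_lborel) auto
  then have "(\<lambda>n. neumann v (Suc n) k p) sums (- A_op v k (fadH k) p)"
    using sums_minus by fastforce
  then have "(\<lambda>n. neumann v n k p) sums (- A_op v k (fadH k) p + neumann v 0 k p)"
    by (rule iffD1[OF sums_Suc_iff])
  then show ?thesis unfolding fadH_def by (simp add: sums_iff)
qed

text \<open>The difference from the Neumann sum is a fixed point of -A(k), and A(k) contracts
  weighted bounds by the factor \<open>c1 * C\<close>. A bound almost everywhere on the difference
  gives a better bound at every point, because A(k) sees only the class of its argument. Iteration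
  drives the bound to 0, so the functions agree everywhere, as \<open>THE\<close> requires.\<close>

lemma faddeev_unique:
  assumes k: "k \<in> Sigma_cone" and u: "u \<in> Linf_mu \<mu>" and eq: "\<And>p. u p = v p - A_op v k u p"
  shows "u = fadH k"
proof -
  have um: "u \<in> borel_measurable lebesgue" using u by (simp add: Linf_mu_def)
  obtain u' where u' [measurable]: "u' \<in> borel_measurable borel" and ae: "AE x in lborel. u x = u' x"
    using completion_ex_borel_measurable_complex[OF um] by auto
  define M where "M = real_of_ereal (norm_mu \<mu> u)"
  have "norm_mu \<mu> u = ereal M" using u norm_mu_nonneg[of \<mu> u] unfolding M_def Linf_mu_def
    by (cases "norm_mu \<mu> u") auto
  then have M: "AE x in lborel. cmod (u x) \<le> M * wt \<mu> x" by (intro norm_muD) simp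
  have M0: "M \<ge> 0" using norm_mu_nonneg[of \<mu> u] by (simp add: M_def real_of_ereal_pos)
  \<comment> \<open>The function u is only Lebesgue measurable and only essentially bounded. A Borel
    version, set to 0 where the bound fails, admits the estimates that ask for a bound at every
    point.\<close>
  define w where "w x = (if cmod (u' x) \<le> M * wt \<mu> x then u' x else 0)" for x
  have w [measurable]: "w \<in> borel_measurable borel" unfolding w_def by measurable
  have wb: "cmod (w x) \<le> M * wt \<mu> x" for x using M0 by (simp add: w_def)
  have uw: "AE x in lborel. u x = w x" using ae M by eventually_elim (simp add: w_def)
  have "AE x in lborel. u (- x) = w (- x)" by (rule AE_lborel_uminus[OF uw])
  then have Aw: "A_op v k u p = A_op v k w p" for p
    unfolding A_op_def
  proof (intro integral_cong_AE)
    have [measurable]: "(\<lambda>x. u (- x)) \<in> borel_measurable lebesgue"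
      using measurable_compose[OF lebesgue_measurable_scaling[of "-1"] um] by simp
    have [measurable]: "(\<lambda>\<xi>. v (p + \<xi>)) \<in> borel_measurable lebesgue" "(\<lambda>\<xi>. w (- \<xi>)) \<in> borel_measurable lebesgue"
      "(\<lambda>\<xi>. complex_of_real (\<xi> \<bullet> \<xi>) + 2 * cdot k (cvec \<xi>)) \<in> borel_measurable lebesgue"
      by (intro measurable_completion; measurable)+
    show "(\<lambda>\<xi>. v (p + \<xi>) * u (- \<xi>) / (complex_of_real (\<xi> \<bullet> \<xi>) + 2 * cdot k (cvec \<xi>))) \<in> borel_measurable lebesgue"
      "(\<lambda>\<xi>. v (p + \<xi>) * w (- \<xi>) / (complex_of_real (\<xi> \<bullet> \<xi>) + 2 * cdot k (cvec \<xi>))) \<in> borel_measurable lebesgue"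
      by measurable
    show "AE x in lborel. u (- x) = w (- x) \<Longrightarrow> AE x in lebesgue. v (p + x) * u (- x) / (complex_of_real (x \<bullet> x) + 2 * cdot k (cvec x)) =
            v (p + x) * w (- x) / (complex_of_real (x \<bullet> x) + 2 * cdot k (cvec x))"
      unfolding AE_completion_iff by (auto elim: eventually_mono)
  qed
  define d where "d x = w x - fadH k x" for x
  have [measurable]: "d \<in> borel_measurable borel" unfolding d_def by measurable
  have diff: "u p - fadH k p = - (LINT \<xi>|lborel. v (p + \<xi>) * d (- \<xi>) / disp_den k \<xi>)" for p
  proof -
    have b1: "cmod (v (p + \<xi>) * w (- \<xi>)) \<le> C * M * (wt \<mu> (p + \<xi>) * wt \<mu> \<xi>)"
      and b2: "cmod (v (p + \<xi>) * fadH k (- \<xi>)) \<le> C * (C / (1 - c1 * C)) * (wt \<mu> (p + \<xi>) * wt \<mu> \<xi>)" for \<xi>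
      using mult_mono[OF v_bd[of "p + \<xi>"] wb[of "- \<xi>"]] mult_mono[OF v_bd[of "p + \<xi>"] fadH_bound[OF k, of "- \<xi>"]] C0
      by (simp_all add: norm_mult mult_ac)
    have "(LINT \<xi>|lborel. v (p + \<xi>) * d (- \<xi>) / disp_den k \<xi>) =
      (LINT \<xi>|lborel. v (p + \<xi>) * w (- \<xi>) / disp_den k \<xi>) - (LINT \<xi>|lborel. v (p + \<xi>) * fadH k (- \<xi>) / disp_den k \<xi>)"
      by (subst Bochner_Integration.integral_diff[symmetric])
        (auto simp: d_def diff_divide_distrib right_diff_distrib intro!: kernel_estimate(1)[OF k _ b1] kernel_estimate(1)[OF k _ b2])
    then show ?thesis unfolding eq[of p] fadH_equation[OF k, of p] Aw by (simp add: A_op_lborel)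
  qed
  have iter: "AE x in lborel. cmod (d x) \<le> D * wt \<mu> x \<Longrightarrow> D \<ge> 0 \<Longrightarrow> cmod (u p - fadH k p) \<le> c1 * C * D * wt \<mu> p" for D p
  proof -
    assume D: "AE x in lborel. cmod (d x) \<le> D * wt \<mu> x" "D \<ge> 0"
    define e where "e x = (if cmod (d x) \<le> D * wt \<mu> x then d x else 0)" for x
    have [measurable]: "e \<in> borel_measurable borel" unfolding e_def by measurable
    have eb: "cmod (e x) \<le> D * wt \<mu> x" for x using D by (simp add: e_def)
    have "AE x in lborel. d x = e x" using D(1) by eventually_elim (simp add: e_def)
    then have de: "AE x in lborel. d (- x) = e (- x)" by (rule AE_lborel_uminus)
    have "(LINT \<xi>|lborel. v (p + \<xi>) * d (- \<xi>) / disp_den k \<xi>) = (LINT \<xi>|lborel. v (p + \<xi>) * e (- \<xi>) / disp_den k \<xi>)"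
      by (rule integral_cong_AE) (use de in \<open>auto elim: eventually_mono\<close>)
    moreover have "cmod (LINT \<xi>|lborel. v (p + \<xi>) * e (- \<xi>) / disp_den k \<xi>) \<le> C * D * c1 * wt \<mu> p"
    proof (rule kernel_estimate(3)[OF k])
      show "cmod (v (p + \<xi>) * e (- \<xi>)) \<le> C * D * (wt \<mu> (p + \<xi>) * wt \<mu> \<xi>)" for \<xi>
        using mult_mono[OF v_bd[of "p + \<xi>"] eb[of "- \<xi>"]] C0 by (simp add: norm_mult mult_ac)
    qed measurable
    ultimately show ?thesis unfolding diff by (simp add: mult_ac)
  qed
  define D0 where "D0 = M + C / (1 - c1 * C)"
  have D0: "D0 \<ge> 0" using M0 C0 cC by (simp add: D0_def)
  have pw: "cmod (u p - fadH k p) \<le> (c1 * C) ^ Suc n * D0 * wt \<mu> p" for n p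
  proof (induction n arbitrary: p)
    case 0
    have "cmod (d x) \<le> D0 * wt \<mu> x" for x
      unfolding d_def D0_def using norm_triangle_ineq4[of "w x" "fadH k x"] wb[of x] fadH_bound[OF k, of x]
      by (simp add: distrib_right)
    then show ?case using iter[of D0 p] D0 by simp
  next
    case (Suc n)
    have "AE x in lborel. cmod (d x) \<le> (c1 * C) ^ Suc n * D0 * wt \<mu> x"
      using uw
    proof eventually_elim
      case (elim x)
      then show ?case using Suc[of x] by (simp only: d_def)
    qed
    moreover have "0 \<le> (c1 * C) ^ Suc n * D0" by (intro mult_nonneg_nonneg zero_le_power c1C0 D0)
    ultimately show ?case using iter[of "(c1 * C) ^ Suc n * D0" p] by (simp add: mult_ac)
  qed
  have "cmod (u p - fadH k p) \<le> 0" for p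
  proof (rule LIMSEQ_le_const)
    have "(\<lambda>n. (c1 * C) ^ n) \<longlonglongrightarrow> 0" using c1C0 cC by (intro LIMSEQ_power_zero) auto
    then have "(\<lambda>n. (c1 * C) ^ Suc n) \<longlonglongrightarrow> 0" by (rule LIMSEQ_Suc)
    then show "(\<lambda>n. (c1 * C) ^ Suc n * D0 * wt \<mu> p) \<longlonglongrightarrow> 0"
      by (intro tendsto_mult_left_zero)
    show "\<exists>N. \<forall>n\<ge>N. cmod (u p - fadH k p) \<le> (c1 * C) ^ Suc n * D0 * wt \<mu> p" using pw by blast
  qed
  then show ?thesis by (simp add: fun_eq_iff)
qed

lemma faddeev_H_eq:
  assumes k: "k \<in> Sigma_cone" shows "faddeev_H \<mu> v k = fadH k"
  unfolding faddeev_H_def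
proof (rule the_equality)
  have "fadH k \<in> Linf_mu \<mu>"
    by (intro Linf_muI[where M="C / (1 - c1 * C)"] measurable_completion AE_I2 fadH_bound k) measurable
  then show "fadH k \<in> Linf_mu \<mu> \<and> (\<forall>p. fadH k p = v p - A_op v k (fadH k) p)"
    using fadH_equation[OF k] by simp
qed (use faddeev_unique[OF k] in blast)

text \<open>Among the \<open>n + 1\<close> momenta that add up to \<open>p\<close> in the \<open>n\<close>-th Neumann term, one has size at
  least \<open>|p| / (n + 1)\<close>; the faster decay of \<open>v\<close> is used for that factor only.\<close>

lemma neumann_decay:
  assumes k: "k \<in> Sigma_cone" and \<delta>: "\<delta> \<ge> 0" and vs: "\<And>p. cmod (v p) \<le> Cs * wt (\<mu> + \<delta>) p"
  shows "cmod (neumann v n k p) \<le> Cs * (c1 * C) ^ n * real (Suc n) powr \<delta> * wt (\<mu> + \<delta>) p"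
proof (induction n arbitrary: p)
  case 0 show ?case using vs by simp
next
  case (Suc n)
  have Cs: "Cs \<ge> 0" by (rule nonneg_of_mult_pos[OF order_trans[OF norm_ge_zero vs[of 0]]]) simp
  let ?N = "real (Suc n)" and ?N' = "real (Suc (Suc n))"
  have sc: "wt \<delta> q \<le> (t powr \<delta>) * wt \<delta> p" if "norm p \<le> t * norm q" "t \<ge> 1" for p q :: "real ^ 3" and t
  proof -
    have "1 + norm p \<le> t * (1 + norm q)" using that by (simp add: algebra_simps)
    then have "(1 + norm p) powr \<delta> \<le> t powr \<delta> * (1 + norm q) powr \<delta>"
      using that \<delta> by (subst powr_mult[symmetric]) (auto intro!: powr_mono2)
    then have "wt \<delta> q * wt \<delta> p * (1 + norm p) powr \<delta> \<le> wt \<delta> q * wt \<delta> p * (t powr \<delta> * (1 + norm q) powr \<delta>)"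
      by (intro mult_left_mono) auto
    moreover have "wt \<delta> q * wt \<delta> p * (1 + norm p) powr \<delta> = wt \<delta> q * ((1 + norm p) powr \<delta> * wt \<delta> p)"
      "wt \<delta> q * wt \<delta> p * (t powr \<delta> * (1 + norm q) powr \<delta>) = t powr \<delta> * wt \<delta> p * ((1 + norm q) powr \<delta> * wt \<delta> q)"
      by (simp_all only: mult_ac)
    ultimately show ?thesis by (simp only: powr_wt mult_1_right)
  qed
  let ?B = "Cs * C * (c1 * C) ^ n * ?N' powr \<delta> * wt \<delta> p"
  have "cmod (LINT \<xi>|lborel. v (p + \<xi>) * neumann v n k (- \<xi>) / disp_den k \<xi>) \<le> ?B * c1 * wt \<mu> p"
  proof (rule kernel_estimate(3)[OF k])
    fix \<xi> :: "real ^ 3"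
    have nn: "0 \<le> C * (c1 * C) ^ n" using C0 c1C0 by simp
    show "cmod (v (p + \<xi>) * neumann v n k (- \<xi>)) \<le> ?B * (wt \<mu> (p + \<xi>) * wt \<mu> \<xi>)"
    \<comment> \<open>If |p| \<le> (n + 2) |p + \<xi>|, the surplus decay is taken from v. Otherwise
      |p| \<le> (n + 2)/(n + 1) |\<xi>|, and it is taken from the induction hypothesis, where the
      power of (n + 2)/(n + 1) raises (n + 1)^\<delta> to (n + 2)^\<delta>. In either case the other
      factor needs exponent \<mu> only.\<close>
    proof (cases "norm p \<le> ?N' * norm (p + \<xi>)")
      case True
      have "cmod (v (p + \<xi>)) \<le> Cs * (wt \<mu> (p + \<xi>) * (?N' powr \<delta> * wt \<delta> p))"
        using order_trans[OF vs[of "p + \<xi>"]] sc[OF True] Cs unfolding wt_add_exponents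
        by (simp add: mult_left_mono)
      then have "cmod (v (p + \<xi>)) * cmod (neumann v n k (- \<xi>)) \<le> Cs * (wt \<mu> (p + \<xi>) * (?N' powr \<delta> * wt \<delta> p)) * (C * (c1 * C) ^ n * wt \<mu> (- \<xi>))"
        using Cs by (intro mult_mono neumann_bound[OF k]) auto
      then show ?thesis unfolding norm_mult by (simp add: mult_ac)
    next
      case False
      have "norm p \<le> norm (p + \<xi>) + norm \<xi>" using norm_triangle_ineq4[of "p + \<xi>" \<xi>] by simp
      then have "?N' * norm p \<le> ?N' * norm (p + \<xi>) + ?N' * norm \<xi>"
        by (metis distrib_left mult_left_mono of_nat_0_le_iff)
      then have "?N * norm p \<le> ?N' * norm \<xi>" using False by (simp add: algebra_simps)
      then have "norm p \<le> (?N' / ?N) * norm (- \<xi>)" by (simp add: field_simps)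
      then have "wt \<delta> (- \<xi>) \<le> (?N' / ?N) powr \<delta> * wt \<delta> p" by (rule sc) simp
      then have "?N powr \<delta> * wt \<delta> (- \<xi>) \<le> ?N powr \<delta> * ((?N' / ?N) powr \<delta> * wt \<delta> p)" by (intro mult_left_mono) auto
      also have "\<dots> = ?N' powr \<delta> * wt \<delta> p" by (simp add: powr_divide)
      finally have w: "?N powr \<delta> * wt \<delta> \<xi> \<le> ?N' powr \<delta> * wt \<delta> p" by simp
      have "cmod (neumann v n k (- \<xi>)) \<le> Cs * (c1 * C) ^ n * (wt \<mu> \<xi> * (?N powr \<delta> * wt \<delta> \<xi>))"
        using Suc[of "- \<xi>"] by (simp add: wt_add_exponents mult_ac)
      also have "\<dots> \<le> Cs * (c1 * C) ^ n * (wt \<mu> \<xi> * (?N' powr \<delta> * wt \<delta> p))"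
        using Cs c1C0 w by (intro mult_left_mono) auto
      finally have "cmod (v (p + \<xi>)) * cmod (neumann v n k (- \<xi>)) \<le> (C * wt \<mu> (p + \<xi>)) * (Cs * (c1 * C) ^ n * (wt \<mu> \<xi> * (?N' powr \<delta> * wt \<delta> p)))"
        using C0 by (intro mult_mono v_bd) auto
      then show ?thesis unfolding norm_mult by (simp add: mult_ac)
    qed
  qed measurable
  then show ?case by (simp add: wt_add_exponents mult_ac)
qed

lemma fadH_decay:
  assumes \<delta>: "\<delta> \<ge> 0" and vs: "\<And>p. cmod (v p) \<le> Cs * wt (\<mu> + \<delta>) p"
  obtains B where "\<And>k p. k \<in> Sigma_cone \<Longrightarrow> cmod (fadH k p) \<le> B * wt (\<mu> + \<delta>) p"
proof -
  let ?x = "c1 * C"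
  let ?a = "\<lambda>n. ?x ^ n * real (Suc n) powr \<delta>"
  have sm: "summable ?a" by (rule summable_power_powr[OF c1C0 cC])
  have "cmod (fadH k p) \<le> (Cs * suminf ?a) * wt (\<mu> + \<delta>) p" if k: "k \<in> Sigma_cone" for k p
  proof -
    have sm': "summable (\<lambda>n. Cs * wt (\<mu> + \<delta>) p * ?a n)" by (rule summable_mult[OF sm])
    have "cmod (fadH k p) \<le> (\<Sum>n. cmod (neumann v n k p))" unfolding fadH_def by (rule summable_norm[OF neumann_summable[OF k]])
    also have "\<dots> \<le> (\<Sum>n. Cs * wt (\<mu> + \<delta>) p * ?a n)"
      using neumann_decay[OF k \<delta> vs] by (intro suminf_le neumann_summable[OF k] sm') (simp add: mult_ac)
    also have "\<dots> = Cs * wt (\<mu> + \<delta>) p * suminf ?a" by (rule suminf_mult[OF sm])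
    finally show ?thesis by (simp add: mult_ac)
  qed
  then show ?thesis by (rule that)
qed

end

section \<open>Pole expansion of the Faddeev function\<close>

lemma integral_translate:
  fixes f :: "'a::euclidean_space \<Rightarrow> complex"
  assumes [measurable]: "f \<in> borel_measurable borel"
  shows "(LINT x|lborel. f (x + a)) = (LINT x|lborel. f x)"
proof -
  have "(LINT x|lborel. f x) = (LINT x|distr lborel borel ((+) a). f x)"
    by (simp add: lborel_distr_plus)
  also have "\<dots> = (LINT x|lborel. f (x + a))" by (subst integral_distr) (auto simp: add.commute)
  finally show ?thesis by simp
qed

lemma
  fixes f :: "'a::euclidean_space \<Rightarrow> 'b::euclidean_space \<Rightarrow> complex"
  assumes f: "case_prod f \<in> borel_measurable borel"
    and fin: "(\<integral>\<^sup>+x. \<integral>\<^sup>+y. ennreal (cmod (f x y)) \<partial>lborel \<partial>lborel) < \<infinity>"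
  shows lborel_integral_swap: "(LINT x|lborel. LINT y|lborel. f x y) = (LINT y|lborel. LINT x|lborel. f x y)"
    and lborel_integrable_inner: "integrable lborel (\<lambda>x. LINT y|lborel. f x y)"
proof -
  have fm [measurable]: "case_prod f \<in> borel_measurable (lborel \<Otimes>\<^sub>M lborel)"
    using f by (simp add: lborel_prod)
  have "(\<integral>\<^sup>+x. \<integral>\<^sup>+y. ennreal (cmod (f x y)) \<partial>lborel \<partial>lborel) = (\<integral>\<^sup>+z. ennreal (norm (case_prod f z)) \<partial>(lborel \<Otimes>\<^sub>M lborel))"
    by (subst lborel.nn_integral_fst[symmetric]) (auto simp: case_prod_beta)
  then have int: "integrable (lborel \<Otimes>\<^sub>M lborel) (case_prod f)"
    using fin by (intro integrableI_bounded) auto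
  show "(LINT x|lborel. LINT y|lborel. f x y) = (LINT y|lborel. LINT x|lborel. f x y)"
    by (rule lborel_pair.Fubini_integral[OF int, symmetric])
  show "integrable lborel (\<lambda>x. LINT y|lborel. f x y)"
    using lborel_pair.integrable_fst'[OF int] by simp
qed

lemma nn_integral_lborel_swap:
  fixes f :: "'a::euclidean_space \<Rightarrow> 'b::euclidean_space \<Rightarrow> ennreal"
  assumes f: "(\<lambda>(y, x). f x y) \<in> borel_measurable borel"
  shows "(\<integral>\<^sup>+x. \<integral>\<^sup>+y. f x y \<partial>lborel \<partial>lborel) = (\<integral>\<^sup>+y. \<integral>\<^sup>+x. f x y \<partial>lborel \<partial>lborel)"
  by (rule lborel_pair.Fubini') (use f in \<open>simp add: lborel_prod\<close>)

text \<open>The reason why residues factor: for k on the cone with \<open>disp_den k \<xi>\<close> =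
  0, the vector k + \<xi> is on the cone again by \<open>cdot_shift\<close>, and its denominator at
  \<eta> - \<xi> is the denominator of k at \<eta>.\<close>

lemma disp_den_shift: "disp_den (k + cvec \<xi>) (\<eta> - \<xi>) = disp_den k \<eta> - disp_den k \<xi>"
  by (simp add: disp_den_def cdot_simps cvec_simps inner_simps inner_commute algebra_simps)

lemma cdot_shift: "cdot (k + cvec \<xi>) (k + cvec \<xi>) = cdot k k + disp_den k \<xi>"
  by (simp add: disp_den_def cdot_simps cdot_commute[of "cvec \<xi>"] algebra_simps)

lemma borel_measurable_cross3 [measurable (raw)]:
  assumes "f \<in> borel_measurable M" "g \<in> borel_measurable M"
  shows "(\<lambda>x. cross3 (f x) (g x)) \<in> borel_measurable M"
  by (rule borel_measurable_continuous_Pair[OF assms]) (intro continuous_intros continuous_on_cross)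

lemma borel_measurable_vector_smult [measurable (raw)]:
  fixes f :: "'x \<Rightarrow> complex" and g :: "'x \<Rightarrow> complex ^ 3"
  assumes "f \<in> borel_measurable M" "g \<in> borel_measurable M"
  shows "(\<lambda>x. f x *s g x) \<in> borel_measurable M"
  by (rule borel_measurable_continuous_Pair[OF assms]) (unfold vector_scalar_mult_def, intro continuous_intros)

lemma borel_measurable_frame_maps [measurable (raw)]:
  assumes [measurable]: "\<theta> \<in> borel_measurable borel" "f \<in> borel_measurable M" "g \<in> borel_measurable M" "h \<in> borel_measurable M"
  shows "(\<lambda>x. omega \<theta> (f x)) \<in> borel_measurable M"
    and "(\<lambda>x. k_of \<theta> (g x) (f x)) \<in> borel_measurable M"
    and "(\<lambda>x. lambda_of \<theta> (h x) (f x)) \<in> borel_measurable M"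
proof -
  show [measurable]: "(\<lambda>x. omega \<theta> (f x)) \<in> borel_measurable M" unfolding omega_def by measurable
  show "(\<lambda>x. k_of \<theta> (g x) (f x)) \<in> borel_measurable M" unfolding k_of_def by measurable
  show "(\<lambda>x. lambda_of \<theta> (h x) (f x)) \<in> borel_measurable M" unfolding lambda_of_def by measurable
qed

section \<open>The substitution in momentum space\<close>

context frame_field
begin

lemma b_pos: "p \<notin> line \<nu> \<Longrightarrow> norm p / 2 > 0" using nonzero by auto

text \<open>With the indicator built in, integrals over \<sigma> run over the whole space. The
  weight is 0 at \<zeta> = 0, where \<open>k_of\<close> has a default value off the cone.\<close>

definition gw :: "real ^ 3 \<Rightarrow> complex \<times> real \<Rightarrow> complex" where
  "gw p \<sigma> = indicator circ_dom \<sigma> *\<^sub>R circ_w (norm p / 2) \<sigma>"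

abbreviation kk :: "real ^ 3 \<Rightarrow> complex \<times> real \<Rightarrow> complex ^ 3" where "kk p \<sigma> \<equiv> k_of \<theta> (fst \<sigma>) p"

lemma gw_0: "fst \<sigma> = 0 \<Longrightarrow> gw p \<sigma> = 0"
  by (simp add: gw_def circ_w_def)

lemma gw_measurable [measurable (raw)]:
  assumes [measurable]: "f \<in> borel_measurable M" "g \<in> borel_measurable M"
  shows "(\<lambda>x. gw (f x) (g x)) \<in> borel_measurable M"
  unfolding gw_def by measurable

lemma Xi_measurable [measurable (raw)]:
  assumes [measurable]: "f \<in> borel_measurable M" "g \<in> borel_measurable M"
  shows "(\<lambda>x. Xi (f x) (g x)) \<in> borel_measurable M"
  unfolding Xi_def fr_def from_frame_def by measurable

lemma norm_Xi: "p \<notin> line \<nu> \<Longrightarrow> norm (Xi p \<sigma>) = norm (circ_pt (norm p / 2) \<sigma>)"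
  unfolding Xi_def fr_def by (rule norm_from_frame[OF frame_facts(1)])

lemma wt_Xi: "p \<notin> line \<nu> \<Longrightarrow> wt \<mu> (Xi p \<sigma>) = wt \<mu> (circ_pt (norm p / 2) \<sigma>)"
  by (simp add: wt_def norm_Xi)

lemma kk_Sigma:
  assumes "p \<notin> line \<nu>" "fst \<sigma> \<noteq> 0"
  shows "kk p \<sigma> \<in> Sigma_cone" "kk p \<sigma> + cvec (Xi p \<sigma>) \<in> Sigma_cone"
  using k_of_on_quadric(1)[OF assms] disp_den_Xi[OF assms] by (simp_all add: Sigma_cone_def cdot_shift)

lemma circ_estimate:
  assumes p: "p \<notin> line \<nu>" and mu: "\<mu> \<ge> 2" and B: "B \<ge> 0" and f [measurable]: "f \<in> borel_measurable borel"
    and bd: "\<And>\<sigma>. fst \<sigma> \<noteq> 0 \<Longrightarrow> cmod (f \<sigma>) \<le> B * wt \<mu> (Xi p \<sigma>)"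
  shows "(\<integral>\<^sup>+\<sigma>. ennreal (cmod (gw p \<sigma> * f \<sigma> / (z - fst \<sigma>))) \<partial>lborel) \<le> ennreal (B * circ_const (norm p / 2))" (is ?A)
    and "integrable lborel (\<lambda>\<sigma>. gw p \<sigma> * f \<sigma> / (z - fst \<sigma>))" (is ?B)
proof -
  let ?b = "norm p / 2"
  have "(\<integral>\<^sup>+\<sigma>. ennreal (cmod (gw p \<sigma> * f \<sigma> / (z - fst \<sigma>))) \<partial>lborel) \<le>
    (\<integral>\<^sup>+\<sigma>. ennreal B * (indicator circ_dom \<sigma> * ennreal (cmod (circ_w ?b \<sigma>) * wt \<mu> (circ_pt ?b \<sigma>) / cmod (z - fst \<sigma>))) \<partial>lborel)"
  proof (intro nn_integral_mono)
    fix \<sigma> :: "complex \<times> real"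
    have "cmod (gw p \<sigma> * f \<sigma> / (z - fst \<sigma>)) \<le> B * (indicator circ_dom \<sigma> * (cmod (circ_w ?b \<sigma>) * wt \<mu> (circ_pt ?b \<sigma>) / cmod (z - fst \<sigma>)))"
    proof (cases "fst \<sigma> = 0 \<or> \<sigma> \<notin> circ_dom")
      case True
      then have "gw p \<sigma> = 0" using gw_0[of \<sigma> p] by (auto simp: gw_def)
      then show ?thesis using B by simp
    next
      case False
      then have "cmod (gw p \<sigma>) * cmod (f \<sigma>) / cmod (z - fst \<sigma>) \<le> cmod (circ_w ?b \<sigma>) * (B * wt \<mu> (Xi p \<sigma>)) / cmod (z - fst \<sigma>)"
        using bd by (intro divide_right_mono mult_mono) (auto simp: gw_def)
      then show ?thesis using False by (simp add: norm_mult norm_divide wt_Xi[OF p] mult_ac)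
    qed
    then have "ennreal (cmod (gw p \<sigma> * f \<sigma> / (z - fst \<sigma>))) \<le> ennreal (B * (indicator circ_dom \<sigma> * (cmod (circ_w ?b \<sigma>) * wt \<mu> (circ_pt ?b \<sigma>) / cmod (z - fst \<sigma>))))"
      by (rule ennreal_leI)
    also have "\<dots> = ennreal B * (indicator circ_dom \<sigma> * ennreal (cmod (circ_w ?b \<sigma>) * wt \<mu> (circ_pt ?b \<sigma>) / cmod (z - fst \<sigma>)))"
      using B by (auto simp: ennreal_mult'[symmetric] indicator_def)
    finally show "ennreal (cmod (gw p \<sigma> * f \<sigma> / (z - fst \<sigma>))) \<le> \<dots>" .
  qed
  also have "\<dots> = ennreal B * (\<integral>\<^sup>+\<sigma>. indicator circ_dom \<sigma> * ennreal (cmod (circ_w ?b \<sigma>) * wt \<mu> (circ_pt ?b \<sigma>) / cmod (z - fst \<sigma>)) \<partial>lborel)"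
    by (rule nn_integral_cmult) measurable
  also have "\<dots> \<le> ennreal B * ennreal (circ_const ?b)"
    by (intro mult_left_mono circ_kernel_bound b_pos p mu) auto
  also have "\<dots> = ennreal (B * circ_const ?b)" using B by (simp add: ennreal_mult')
  finally show ?A .
  then show ?B by (intro integrableI_bounded) (auto intro: le_less_trans)
qed

text \<open>The orthonormal frame at p preserves Lebesgue measure and turns \<open>disp_den\<close>
  into \<open>den\<close>, so that \<open>integral_den\<close> carries over.\<close>

lemma
  assumes p: "p \<notin> line \<nu>" and z: "z \<noteq> 0" and mu: "\<mu> \<ge> 2" and B: "B \<ge> 0" and h [measurable]: "h \<in> borel_measurable borel"
    and bd: "\<And>\<xi>. cmod (h \<xi>) \<le> B * wt \<mu> \<xi>"
  shows integrable_disp_den: "integrable lborel (\<lambda>\<xi>. h \<xi> / disp_den (k_of \<theta> z p) \<xi>)"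
    and integral_disp_den: "(LINT \<xi>|lborel. h \<xi> / disp_den (k_of \<theta> z p) \<xi>) = (LINT \<sigma>|lborel. gw p \<sigma> * h (Xi p \<sigma>) / (z - fst \<sigma>))"
proof -
  let ?b = "norm p / 2"
  have [measurable]: "fr p \<in> borel \<rightarrow>\<^sub>M borel" unfolding fr_def by measurable
  have eq: "gw p \<sigma> * h (Xi p \<sigma>) / (z - fst \<sigma>) = indicator circ_dom \<sigma> *\<^sub>R (circ_w ?b \<sigma> * h (fr p (circ_pt ?b \<sigma>)) / (z - fst \<sigma>))" for \<sigma>
    by (simp add: gw_def Xi_def scaleR_conv_of_real)
  have int: "integrable lborel (\<lambda>\<sigma>. indicator circ_dom \<sigma> *\<^sub>R (circ_w ?b \<sigma> * h (fr p (circ_pt ?b \<sigma>)) / (z - fst \<sigma>)))"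
    unfolding eq[symmetric] by (rule circ_estimate(2)[OF p mu B]) (use bd in auto)
  note D = integrable_den[OF b_pos[OF p] z _ int] integral_den[OF b_pos[OF p] z _ int]
  have fr: "(\<lambda>x. h (fr p x) / disp_den (k_of \<theta> z p) (fr p x)) = (\<lambda>x. h (fr p x) / den ?b z x)"
    by (simp add: disp_den_fr[OF p])
  have "integrable lborel (\<lambda>x. h (fr p x) / disp_den (k_of \<theta> z p) (fr p x))" unfolding fr by (rule D) measurable
  then show "integrable lborel (\<lambda>\<xi>. h \<xi> / disp_den (k_of \<theta> z p) \<xi>)"
    unfolding fr_def by (subst (asm) integrable_from_frame[OF frame_facts(1)[OF p]]) auto
  have "(LINT \<xi>|lborel. h \<xi> / disp_den (k_of \<theta> z p) \<xi>) = (LINT x|lborel. h (fr p x) / disp_den (k_of \<theta> z p) (fr p x))"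
    unfolding fr_def by (subst integral_from_frame[OF frame_facts(1)[OF p]]) auto
  also have "\<dots> = (LINT \<sigma>|lborel. gw p \<sigma> * h (Xi p \<sigma>) / (z - fst \<sigma>))"
    unfolding fr eq by (rule D) measurable
  finally show "(LINT \<xi>|lborel. h \<xi> / disp_den (k_of \<theta> z p) \<xi>) = (LINT \<sigma>|lborel. gw p \<sigma> * h (Xi p \<sigma>) / (z - fst \<sigma>))" .
qed

end

section \<open>Poles of the Neumann terms\<close>

locale faddeev_frame = frame_field + faddeev_potential
begin

lemma CC0: "C * (c1 * C) ^ n \<ge> 0" using C0 c1C0 by simp

text \<open>The Neumann term at the shifted pair (k + \<xi>, q + \<xi>), where k and \<xi> belong to
  \<sigma>. These are the left factors of the residues.\<close>

definition W :: "real ^ 3 \<Rightarrow> nat \<Rightarrow> complex \<times> real \<Rightarrow> real ^ 3 \<Rightarrow> complex" where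
  "W p n \<sigma> q = neumann v n (kk p \<sigma> + cvec (Xi p \<sigma>)) (q + Xi p \<sigma>)"

lemma W_measurable [measurable (raw)]:
  assumes [measurable]: "f \<in> borel_measurable M" "g \<in> borel_measurable M"
  shows "(\<lambda>x. W p n (f x) (g x)) \<in> borel_measurable M"
  unfolding W_def by measurable

lemma W_bound: "p \<notin> line \<nu> \<Longrightarrow> fst \<sigma> \<noteq> 0 \<Longrightarrow> cmod (W p n \<sigma> q) \<le> C * (c1 * C) ^ n"
proof -
  assume "p \<notin> line \<nu>" "fst \<sigma> \<noteq> 0"
  then have "cmod (W p n \<sigma> q) \<le> C * (c1 * C) ^ n * wt \<mu> (q + Xi p \<sigma>)"
    unfolding W_def by (intro neumann_bound kk_Sigma)
  also have "\<dots> \<le> C * (c1 * C) ^ n * 1" by (intro mult_left_mono wt_le_1 mu0 CC0)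
  finally show ?thesis by simp
qed

lemma W_0: "W p 0 \<sigma> q = v (q + Xi p \<sigma>)" by (simp add: W_def)

lemma v_shift_bound: "cmod (v (q + \<xi>)) \<le> C * (1 + norm q) powr \<mu> * wt \<mu> \<xi>"
proof -
  have "wt \<mu> (q + \<xi>) \<le> (1 + norm (- q)) powr \<mu> * wt \<mu> ((q + \<xi>) + (- q))" by (rule wt_shift[OF mu0])
  then have "C * wt \<mu> (q + \<xi>) \<le> C * ((1 + norm q) powr \<mu> * wt \<mu> \<xi>)" using C0 by (intro mult_left_mono) auto
  then show ?thesis using v_bd[of "q + \<xi>"] by simp
qed

lemma vW_bound:
  assumes "p \<notin> line \<nu>" "fst \<sigma> \<noteq> 0"
  shows "cmod (v (q + \<eta>) * W p i \<sigma> (- \<eta>)) \<le> C * (1 + norm q) powr \<mu> * (C * (c1 * C) ^ i) * wt \<mu> \<eta>"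
  using mult_mono[OF v_shift_bound[of q \<eta>] W_bound[OF assms, of i "- \<eta>"]] C0 CC0
  by (simp add: norm_mult mult_ac)

text \<open>Translating the integration variable by \<xi> brings the denominator back to that of k,
  by \<open>disp_den_shift\<close>. Hence W satisfies a recursion over the same circles as the
  unshifted terms, with the pole of \<sigma> in the place of z.\<close>

lemma W_Suc:
  assumes p: "p \<notin> line \<nu>" and z: "fst \<sigma> \<noteq> 0"
  shows "W p (Suc i) \<sigma> q = - (LINT \<tau>|lborel. gw p \<tau> * (v (q + Xi p \<tau>) * W p i \<sigma> (- Xi p \<tau>)) / (fst \<sigma> - fst \<tau>))"
proof -
  let ?k = "kk p \<sigma>" and ?\<xi> = "Xi p \<sigma>"
  have d0: "disp_den ?k ?\<xi> = 0" by (rule disp_den_Xi[OF p z])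
  have "W p (Suc i) \<sigma> q = - (LINT \<eta>|lborel. v (q + ?\<xi> + \<eta>) * neumann v i (?k + cvec ?\<xi>) (- \<eta>) / disp_den (?k + cvec ?\<xi>) \<eta>)"
    by (simp add: W_def)
  also have "(LINT \<eta>|lborel. v (q + ?\<xi> + \<eta>) * neumann v i (?k + cvec ?\<xi>) (- \<eta>) / disp_den (?k + cvec ?\<xi>) \<eta>) =
    (LINT \<eta>|lborel. v (q + ?\<xi> + (\<eta> + - ?\<xi>)) * neumann v i (?k + cvec ?\<xi>) (- (\<eta> + - ?\<xi>)) / disp_den (?k + cvec ?\<xi>) (\<eta> + - ?\<xi>))"
    by (rule integral_translate[symmetric]) measurable
  also have "\<dots> = (LINT \<eta>|lborel. (v (q + \<eta>) * W p i \<sigma> (- \<eta>)) / disp_den ?k \<eta>)"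
    using disp_den_shift[of ?k ?\<xi>] d0 by (simp add: W_def algebra_simps)
  also have "\<dots> = (LINT \<tau>|lborel. gw p \<tau> * (v (q + Xi p \<tau>) * W p i \<sigma> (- Xi p \<tau>)) / (fst \<sigma> - fst \<tau>))"
    using C0 CC0 by (intro integral_disp_den[OF p z mu _ _ vW_bound[OF p z]]) auto
  finally show ?thesis .
qed

text \<open>The n-th term of the Cauchy product of the Neumann series for H(k + \<xi>, q + \<xi>)
  and H(k, -\<xi>). Up to the weight it is the residue of the Neumann term with index n + 1.\<close>

definition SS :: "real ^ 3 \<Rightarrow> nat \<Rightarrow> complex \<times> real \<Rightarrow> real ^ 3 \<Rightarrow> complex" where
  "SS p n \<sigma> q = (\<Sum>i\<le>n. W p i \<sigma> q * neumann v (n - i) (kk p \<sigma>) (- Xi p \<sigma>))"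

lemma SS_measurable [measurable (raw)]:
  assumes [measurable]: "f \<in> borel_measurable M" "g \<in> borel_measurable M"
  shows "(\<lambda>x. SS p n (f x) (g x)) \<in> borel_measurable M"
  unfolding SS_def by measurable

lemma psi_bound:
  assumes "p \<notin> line \<nu>" "fst \<sigma> \<noteq> 0"
  shows "cmod (neumann v n (kk p \<sigma>) (- Xi p \<sigma>)) \<le> C * (c1 * C) ^ n * wt \<mu> (Xi p \<sigma>)"
  using neumann_bound[OF kk_Sigma(1)[OF assms], of n "- Xi p \<sigma>"] by simp

lemma SS_bound:
  assumes p: "p \<notin> line \<nu>" and z: "fst \<sigma> \<noteq> 0"
  shows "cmod (SS p n \<sigma> q) \<le> real (Suc n) * (C * C * (c1 * C) ^ n) * wt \<mu> (Xi p \<sigma>)"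
proof -
  have "cmod (SS p n \<sigma> q) \<le> (\<Sum>i\<le>n. C * C * (c1 * C) ^ n * wt \<mu> (Xi p \<sigma>))"
    unfolding SS_def
  proof (rule sum_norm_le)
    fix i assume "i \<in> {..n}"
    then have e: "(c1 * C) ^ n = (c1 * C) ^ i * (c1 * C) ^ (n - i)" by (simp add: power_add[symmetric])
    have "cmod (W p i \<sigma> q) * cmod (neumann v (n - i) (kk p \<sigma>) (- Xi p \<sigma>)) \<le> (C * (c1 * C) ^ i) * (C * (c1 * C) ^ (n - i) * wt \<mu> (Xi p \<sigma>))"
      by (intro mult_mono W_bound psi_bound p z CC0) auto
    then show "cmod (W p i \<sigma> q * neumann v (n - i) (kk p \<sigma>) (- Xi p \<sigma>)) \<le> C * C * (c1 * C) ^ n * wt \<mu> (Xi p \<sigma>)"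
      unfolding e norm_mult by (simp add: mult_ac)
  qed
  then show ?thesis by (simp add: mult_ac)
qed

lemma SS_const_nonneg: "0 \<le> real (Suc n) * (C * C * (c1 * C) ^ n)"
  using C0 c1C0 by simp

text \<open>The Neumann terms, as functions of \<open>z\<close>, are superpositions of simple poles; the residues
  factor because \<open>1/D(z) - 1/D(\<zeta>)\<close> is again such a superposition.\<close>

theorem neumann_poles:
  assumes p: "p \<notin> line \<nu>" and z: "z \<noteq> 0"
  shows "neumann v (Suc n) (k_of \<theta> z p) q = - (LINT \<sigma>|lborel. gw p \<sigma> * SS p n \<sigma> q / (z - fst \<sigma>))"
  using z
proof (induction n arbitrary: q z)
  case 0
  have "(LINT \<xi>|lborel. (v (q + \<xi>) * v (- \<xi>)) / disp_den (k_of \<theta> z p) \<xi>) =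
    (LINT \<sigma>|lborel. gw p \<sigma> * (v (q + Xi p \<sigma>) * v (- Xi p \<sigma>)) / (z - fst \<sigma>))"
  proof (rule integral_disp_den[OF p 0 mu])
    show "0 \<le> C * C" using C0 by simp
    show "cmod (v (q + \<xi>) * v (- \<xi>)) \<le> C * C * wt \<mu> \<xi>" for \<xi>
    proof -
      have "cmod (v (q + \<xi>)) \<le> C * 1" by (rule order_trans[OF v_bd mult_left_mono[OF wt_le_1[OF mu0] C0]])
      then show ?thesis using mult_mono[OF _ v_bd[of "- \<xi>"], of "cmod (v (q + \<xi>))" C] C0 by (simp add: norm_mult mult_ac)
    qed
  qed measurable
  then show ?case by (simp add: SS_def W_0)
next
  case (Suc n)
  define g where "g \<sigma> = gw p \<sigma> / (z - fst \<sigma>)" for \<sigma>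
  define K where "K = real (Suc n) * (C * C * (c1 * C) ^ n)"
  have K0: "K \<ge> 0" unfolding K_def by (rule SS_const_nonneg)
  define V where "V = C * (1 + norm q) powr \<mu>"
  have V0: "V \<ge> 0" using C0 by (simp add: V_def)
  define cc where "cc = circ_const (norm p / 2)"
  have cc0: "cc \<ge> 0" unfolding cc_def by (rule circ_const_nonneg[OF b_pos[OF p]])
  have [measurable]: "g \<in> borel_measurable borel" unfolding g_def by measurable
  let ?k = "k_of \<theta> z p"
  note IH = Suc.IH
  have Sest: "(\<integral>\<^sup>+\<sigma>. ennreal (cmod (gw p \<sigma> * SS p n \<sigma> q' / (z' - fst \<sigma>))) \<partial>lborel) \<le> ennreal (K * cc)" for q' z'
    unfolding cc_def K_def by (rule circ_estimate(1)[OF p mu SS_const_nonneg]) (use SS_bound[OF p] in auto)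
  have vint: "integrable lborel (\<lambda>\<eta>. v (q + \<eta>) / disp_den ?k \<eta>)"
    using V0 v_shift_bound[of q] unfolding V_def by (intro integrable_disp_den[OF p Suc.prems mu]) auto

  have "neumann v (Suc (Suc n)) ?k q = - (LINT \<eta>|lborel. v (q + \<eta>) * neumann v (Suc n) ?k (- \<eta>) / disp_den ?k \<eta>)" by simp
  also have "\<dots> = (LINT \<eta>|lborel. LINT \<sigma>|lborel. v (q + \<eta>) / disp_den ?k \<eta> * (g \<sigma> * SS p n \<sigma> (- \<eta>)))"
  proof -
    have "v (q + \<eta>) * (LINT \<sigma>|lborel. gw p \<sigma> * SS p n \<sigma> (- \<eta>) / (z - fst \<sigma>)) / disp_den ?k \<eta> =
      (LINT \<sigma>|lborel. v (q + \<eta>) / disp_den ?k \<eta> * (g \<sigma> * SS p n \<sigma> (- \<eta>)))" for \<eta>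
      by (subst integral_mult_right_zero) (simp add: g_def)
    then show ?thesis unfolding IH[OF Suc.prems] mult_minus_right minus_divide_left[symmetric]
      by (simp only: Bochner_Integration.integral_minus minus_minus)
  qed
  \<comment> \<open>The exchange is justified by \<open>Sest\<close>, whose bound does not depend on
    \<eta>, and by the absolute integrability of v/D(z).\<close>
  also have "\<dots> = (LINT \<sigma>|lborel. LINT \<eta>|lborel. v (q + \<eta>) / disp_den ?k \<eta> * (g \<sigma> * SS p n \<sigma> (- \<eta>)))"
  proof (rule lborel_integral_swap)
    show "(\<lambda>(\<eta>, \<sigma>). v (q + \<eta>) / disp_den ?k \<eta> * (g \<sigma> * SS p n \<sigma> (- \<eta>))) \<in> borel_measurable borel"
      by (simp add: case_prod_beta)
    have "(\<integral>\<^sup>+\<eta>. \<integral>\<^sup>+\<sigma>. ennreal (cmod (v (q + \<eta>) / disp_den ?k \<eta> * (g \<sigma> * SS p n \<sigma> (- \<eta>)))) \<partial>lborel \<partial>lborel) =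
      (\<integral>\<^sup>+\<eta>. ennreal (cmod (v (q + \<eta>) / disp_den ?k \<eta>)) * (\<integral>\<^sup>+\<sigma>. ennreal (cmod (gw p \<sigma> * SS p n \<sigma> (- \<eta>) / (z - fst \<sigma>))) \<partial>lborel) \<partial>lborel)"
      by (intro nn_integral_cong, subst nn_integral_cmult[symmetric])
        (auto simp: g_def norm_mult norm_divide ennreal_mult'[symmetric] mult_ac)
    also have "\<dots> \<le> (\<integral>\<^sup>+\<eta>. ennreal (cmod (v (q + \<eta>) / disp_den ?k \<eta>)) * ennreal (K * cc) \<partial>lborel)"
      by (intro nn_integral_mono mult_left_mono Sest) auto
    also have "\<dots> = (\<integral>\<^sup>+\<eta>. ennreal (cmod (v (q + \<eta>) / disp_den ?k \<eta>)) \<partial>lborel) * ennreal (K * cc)"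
      by (rule nn_integral_multc) measurable
    also have "\<dots> < \<infinity>" using vint by (auto simp: integrable_iff_bounded ennreal_mult_less_top)
    finally show "(\<integral>\<^sup>+\<eta>. \<integral>\<^sup>+\<sigma>. ennreal (cmod (v (q + \<eta>) / disp_den ?k \<eta> * (g \<sigma> * SS p n \<sigma> (- \<eta>)))) \<partial>lborel \<partial>lborel) < \<infinity>" .
  qed
  \<comment> \<open>For a fixed \<sigma> with pole \<zeta>, the integral against 1/D(z) is compared
    with the one against 1/D(\<zeta>), which is -\<open>W p (Suc i) \<sigma> q\<close> by
    \<open>W_Suc\<close>. The difference carries the factor \<zeta> - z, which cancels the pole 1/(z
    - \<zeta>) contained in \<open>g \<sigma>\<close>.\<close>
  also have "\<dots> = (LINT \<sigma>|lborel. - (\<Sum>i\<le>n. g \<sigma> * (W p (Suc i) \<sigma> q * neumann v (n - i) (kk p \<sigma>) (- Xi p \<sigma>)))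
      - (LINT \<tau>|lborel. (gw p \<sigma> * SS p n \<sigma> (- Xi p \<tau>) / (fst \<sigma> - fst \<tau>)) * (g \<tau> * v (q + Xi p \<tau>))))"
  proof (rule integral_cong_AE)
    show "AE \<sigma> in lborel. (LINT \<eta>|lborel. v (q + \<eta>) / disp_den ?k \<eta> * (g \<sigma> * SS p n \<sigma> (- \<eta>))) =
      - (\<Sum>i\<le>n. g \<sigma> * (W p (Suc i) \<sigma> q * neumann v (n - i) (kk p \<sigma>) (- Xi p \<sigma>)))
      - (LINT \<tau>|lborel. (gw p \<sigma> * SS p n \<sigma> (- Xi p \<tau>) / (fst \<sigma> - fst \<tau>)) * (g \<tau> * v (q + Xi p \<tau>)))"
      using AE_fst_neq[of z] AE_fst_neq[of 0]
    proof eventually_elim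
      case (elim \<sigma>)
      define \<psi> where "\<psi> i = neumann v (n - i) (kk p \<sigma>) (- Xi p \<sigma>)" for i
      define h where "h i \<eta> = v (q + \<eta>) * W p i \<sigma> (- \<eta>)" for i \<eta>
      have [measurable]: "h i \<in> borel_measurable borel" for i unfolding h_def by measurable
      have hb: "cmod (h i \<eta>) \<le> V * (C * (c1 * C) ^ i) * wt \<mu> \<eta>" for i \<eta>
        unfolding h_def V_def using vW_bound[OF p elim(2)] .
      have h0: "0 \<le> V * (C * (c1 * C) ^ i)" for i using V0 CC0 by simp
      note hint = integrable_disp_den[OF p Suc.prems mu h0 _ hb]
      have cint: "integrable lborel (\<lambda>\<tau>. gw p \<tau> * h i (Xi p \<tau>) / (z' - fst \<tau>))" for i z'
        using hb by (intro circ_estimate(2)[OF p mu h0]) auto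
      have "(LINT \<eta>|lborel. v (q + \<eta>) / disp_den ?k \<eta> * (g \<sigma> * SS p n \<sigma> (- \<eta>))) =
        (LINT \<eta>|lborel. (\<Sum>i\<le>n. (g \<sigma> * \<psi> i) * (h i \<eta> / disp_den ?k \<eta>)))"
        by (intro Bochner_Integration.integral_cong refl)
          (simp add: SS_def \<psi>_def h_def sum_distrib_left sum_divide_distrib mult_ac)
      also have "\<dots> = (\<Sum>i\<le>n. (g \<sigma> * \<psi> i) * (LINT \<eta>|lborel. h i \<eta> / disp_den ?k \<eta>))"
      proof -
        have i: "integrable lborel (\<lambda>\<eta>. (g \<sigma> * \<psi> i) * (h i \<eta> / disp_den ?k \<eta>))" for i
          by (rule integrable_mult_right[OF hint]) measurable
        show ?thesis by (subst Bochner_Integration.integral_sum[OF i]) (simp only: integral_mult_right_zero)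
      qed
      also have "\<dots> = (\<Sum>i\<le>n. - (g \<sigma> * (W p (Suc i) \<sigma> q * \<psi> i)) -
          (LINT \<tau>|lborel. gw p \<sigma> * \<psi> i * (gw p \<tau> * h i (Xi p \<tau>) / (z - fst \<tau>) / (fst \<sigma> - fst \<tau>))))"
      proof (rule sum.cong[OF refl])
        fix i
        have B: "(LINT \<tau>|lborel. gw p \<tau> * h i (Xi p \<tau>) / (fst \<sigma> - fst \<tau>)) = - W p (Suc i) \<sigma> q"
          unfolding h_def W_Suc[OF p elim(2)] by simp
        have "(LINT \<tau>|lborel. gw p \<tau> * h i (Xi p \<tau>) / (z - fst \<tau>)) - (- W p (Suc i) \<sigma> q) =
          (LINT \<tau>|lborel. gw p \<tau> * h i (Xi p \<tau>) / (z - fst \<tau>) - gw p \<tau> * h i (Xi p \<tau>) / (fst \<sigma> - fst \<tau>))"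
          unfolding B[symmetric] by (rule Bochner_Integration.integral_diff[symmetric]) (rule cint)+
        also have "\<dots> = (LINT \<tau>|lborel. (fst \<sigma> - z) * (gw p \<tau> * h i (Xi p \<tau>) / (z - fst \<tau>) / (fst \<sigma> - fst \<tau>)))"
        proof (rule integral_cong_AE)
          show "AE \<tau> in lborel. gw p \<tau> * h i (Xi p \<tau>) / (z - fst \<tau>) - gw p \<tau> * h i (Xi p \<tau>) / (fst \<sigma> - fst \<tau>) =
            (fst \<sigma> - z) * (gw p \<tau> * h i (Xi p \<tau>) / (z - fst \<tau>) / (fst \<sigma> - fst \<tau>))"
            using AE_fst_neq[of z] AE_fst_neq[of "fst \<sigma>"] by eventually_elim (simp add: field_simps)
        qed measurable
        also have "\<dots> = (fst \<sigma> - z) * (LINT \<tau>|lborel. gw p \<tau> * h i (Xi p \<tau>) / (z - fst \<tau>) / (fst \<sigma> - fst \<tau>))" by (rule integral_mult_right_zero)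
        finally have A: "(LINT \<tau>|lborel. gw p \<tau> * h i (Xi p \<tau>) / (z - fst \<tau>)) =
          - W p (Suc i) \<sigma> q + (fst \<sigma> - z) * (LINT \<tau>|lborel. gw p \<tau> * h i (Xi p \<tau>) / (z - fst \<tau>) / (fst \<sigma> - fst \<tau>))"
          by (simp add: algebra_simps)
        have gz: "g \<sigma> * (fst \<sigma> - z) = - gw p \<sigma>" using elim(1) by (simp add: g_def field_simps)
        have "(g \<sigma> * \<psi> i) * (LINT \<eta>|lborel. h i \<eta> / disp_den ?k \<eta>) = (g \<sigma> * \<psi> i) * (LINT \<tau>|lborel. gw p \<tau> * h i (Xi p \<tau>) / (z - fst \<tau>))"
          by (subst integral_disp_den[OF p Suc.prems mu h0 _ hb]) auto
        also have "\<dots> = - (g \<sigma> * (W p (Suc i) \<sigma> q * \<psi> i)) + (g \<sigma> * (fst \<sigma> - z)) * \<psi> i * (LINT \<tau>|lborel. gw p \<tau> * h i (Xi p \<tau>) / (z - fst \<tau>) / (fst \<sigma> - fst \<tau>))"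
          unfolding A by (simp add: algebra_simps)
        finally show "(g \<sigma> * \<psi> i) * (LINT \<eta>|lborel. h i \<eta> / disp_den ?k \<eta>) = - (g \<sigma> * (W p (Suc i) \<sigma> q * \<psi> i)) -
          (LINT \<tau>|lborel. gw p \<sigma> * \<psi> i * (gw p \<tau> * h i (Xi p \<tau>) / (z - fst \<tau>) / (fst \<sigma> - fst \<tau>)))"
          unfolding gz integral_mult_right_zero by simp
      qed
      also have "\<dots> = - (\<Sum>i\<le>n. g \<sigma> * (W p (Suc i) \<sigma> q * \<psi> i)) -
        (\<Sum>i\<le>n. (LINT \<tau>|lborel. gw p \<sigma> * \<psi> i * (gw p \<tau> * h i (Xi p \<tau>) / (z - fst \<tau>) / (fst \<sigma> - fst \<tau>))))"
        by (simp add: sum_subtractf sum_negf)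
      also have "(\<Sum>i\<le>n. (LINT \<tau>|lborel. gw p \<sigma> * \<psi> i * (gw p \<tau> * h i (Xi p \<tau>) / (z - fst \<tau>) / (fst \<sigma> - fst \<tau>)))) =
        (LINT \<tau>|lborel. (\<Sum>i\<le>n. gw p \<sigma> * \<psi> i * (gw p \<tau> * h i (Xi p \<tau>) / (z - fst \<tau>) / (fst \<sigma> - fst \<tau>))))"
      proof (rule Bochner_Integration.integral_sum[symmetric])
        fix i
        \<comment> \<open>The product of two poles in \<tau> is integrable because, up to the
          constant \<open>fst \<sigma> - z\<close>, it is a difference of single poles.\<close>
        have "integrable lborel (\<lambda>\<tau>. gw p \<tau> * h i (Xi p \<tau>) / (z - fst \<tau>) - gw p \<tau> * h i (Xi p \<tau>) / (fst \<sigma> - fst \<tau>))"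
          by (intro Bochner_Integration.integrable_diff cint)
        then have "integrable lborel (\<lambda>\<tau>. (gw p \<sigma> * \<psi> i / (fst \<sigma> - z)) * (gw p \<tau> * h i (Xi p \<tau>) / (z - fst \<tau>) - gw p \<tau> * h i (Xi p \<tau>) / (fst \<sigma> - fst \<tau>)))"
          by (rule integrable_mult_right)
        then show "integrable lborel (\<lambda>\<tau>. gw p \<sigma> * \<psi> i * (gw p \<tau> * h i (Xi p \<tau>) / (z - fst \<tau>) / (fst \<sigma> - fst \<tau>)))"
        proof (rule iffD1[OF integrable_cong_AE, rotated -1])
          show "AE \<tau> in lborel. (gw p \<sigma> * \<psi> i / (fst \<sigma> - z)) * (gw p \<tau> * h i (Xi p \<tau>) / (z - fst \<tau>) - gw p \<tau> * h i (Xi p \<tau>) / (fst \<sigma> - fst \<tau>)) =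
            gw p \<sigma> * \<psi> i * (gw p \<tau> * h i (Xi p \<tau>) / (z - fst \<tau>) / (fst \<sigma> - fst \<tau>))"
            using AE_fst_neq[of z] AE_fst_neq[of "fst \<sigma>"]
          proof eventually_elim
            case (elim \<tau>)
            have "a / (z - t) - a / (s - t) = (s - z) * (a / (z - t) / (s - t))" if "t \<noteq> z" "t \<noteq> s" for a s t :: complex
              using that by (simp add: field_simps)
            from this[OF elim(1) elim(2)] show ?case using \<open>fst \<sigma> \<noteq> z\<close> by simp
          qed
        qed measurable
      qed
      also have "\<dots> = (LINT \<tau>|lborel. (gw p \<sigma> * SS p n \<sigma> (- Xi p \<tau>) / (fst \<sigma> - fst \<tau>)) * (g \<tau> * v (q + Xi p \<tau>)))"
        by (intro Bochner_Integration.integral_cong refl)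
          (simp add: SS_def \<psi>_def h_def g_def sum_distrib_left sum_distrib_right sum_divide_distrib mult_ac)
      finally show ?case unfolding \<psi>_def .
    qed
  qed measurable
  \<comment> \<open>When \<sigma> is integrated first in the double integral, the induction
    hypothesis at z = \<open>fst \<tau>\<close> turns the inner integral into
    \<open>neumann v (Suc n)\<close> at the pole of \<tau>. This supplies the term of
    \<open>SS p (Suc n)\<close> with factor \<open>W p 0\<close>, which the sum over
    \<open>W p (Suc i)\<close> does not contain.\<close>
  also have "\<dots> = - (LINT \<sigma>|lborel. gw p \<sigma> * (\<Sum>i\<le>n. W p (Suc i) \<sigma> q * neumann v (n - i) (kk p \<sigma>) (- Xi p \<sigma>)) / (z - fst \<sigma>))
      - (LINT \<sigma>|lborel. gw p \<sigma> * (W p 0 \<sigma> q * neumann v (Suc n) (kk p \<sigma>) (- Xi p \<sigma>)) / (z - fst \<sigma>))"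
  proof -
    let ?F = "\<lambda>\<tau> \<sigma>. (gw p \<sigma> * SS p n \<sigma> (- Xi p \<tau>) / (fst \<sigma> - fst \<tau>)) * (g \<tau> * v (q + Xi p \<tau>))"
    have Fm: "(\<lambda>(\<sigma>, \<tau>). ?F \<tau> \<sigma>) \<in> borel_measurable borel"
      by (simp add: case_prod_beta)
    have "(\<integral>\<^sup>+\<tau>. \<integral>\<^sup>+\<sigma>. ennreal (cmod (?F \<tau> \<sigma>)) \<partial>lborel \<partial>lborel) =
      (\<integral>\<^sup>+\<tau>. (\<integral>\<^sup>+\<sigma>. ennreal (cmod (gw p \<sigma> * SS p n \<sigma> (- Xi p \<tau>) / (fst \<tau> - fst \<sigma>))) \<partial>lborel) * ennreal (cmod (g \<tau> * v (q + Xi p \<tau>))) \<partial>lborel)"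
      by (intro nn_integral_cong, subst nn_integral_multc[symmetric])
        (auto simp: norm_mult norm_divide ennreal_mult'[symmetric] norm_minus_commute)
    also have "\<dots> \<le> (\<integral>\<^sup>+\<tau>. ennreal (K * cc) * ennreal (cmod (gw p \<tau> * v (q + Xi p \<tau>) / (z - fst \<tau>))) \<partial>lborel)"
      unfolding g_def by (intro nn_integral_mono mult_mono Sest) auto
    also have "\<dots> = ennreal (K * cc) * (\<integral>\<^sup>+\<tau>. ennreal (cmod (gw p \<tau> * v (q + Xi p \<tau>) / (z - fst \<tau>))) \<partial>lborel)"
      by (rule nn_integral_cmult) measurable
    also have "\<dots> \<le> ennreal (K * cc) * ennreal (V * cc)"
      unfolding cc_def using v_shift_bound[of q] by (intro mult_left_mono circ_estimate(1)[OF p mu V0]) (auto simp: V_def)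
    also have "\<dots> < \<infinity>" by (simp add: ennreal_mult_less_top)
    finally have fin: "(\<integral>\<^sup>+\<tau>. \<integral>\<^sup>+\<sigma>. ennreal (cmod (?F \<tau> \<sigma>)) \<partial>lborel \<partial>lborel) < \<infinity>" .
    have fin': "(\<integral>\<^sup>+\<sigma>. \<integral>\<^sup>+\<tau>. ennreal (cmod (?F \<tau> \<sigma>)) \<partial>lborel \<partial>lborel) < \<infinity>"
      by (subst nn_integral_lborel_swap) (use fin in \<open>simp_all add: case_prod_beta\<close>)
    note sw = lborel_integral_swap[OF Fm fin'] and in1 = lborel_integrable_inner[OF Fm fin']
    have in2: "integrable lborel (\<lambda>\<sigma>. \<Sum>i\<le>n. g \<sigma> * (W p (Suc i) \<sigma> q * neumann v (n - i) (kk p \<sigma>) (- Xi p \<sigma>)))"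
    proof (rule Bochner_Integration.integrable_sum)
      fix i
      have bd: "cmod (W p (Suc i) \<sigma> q * neumann v (n - i) (kk p \<sigma>) (- Xi p \<sigma>)) \<le> C * (c1 * C) ^ Suc i * (C * (c1 * C) ^ (n - i)) * wt \<mu> (Xi p \<sigma>)"
        if z: "fst \<sigma> \<noteq> 0" for \<sigma>
        unfolding norm_mult
        using mult_mono[OF W_bound[OF p z, of "Suc i" q] psi_bound[OF p z, of "n - i"]] CC0[of "Suc i"] by (simp only: mult.assoc norm_ge_zero)
      have "integrable lborel (\<lambda>\<sigma>. gw p \<sigma> * (W p (Suc i) \<sigma> q * neumann v (n - i) (kk p \<sigma>) (- Xi p \<sigma>)) / (z - fst \<sigma>))"
        by (rule circ_estimate(2)[OF p mu _ _ bd]) (use CC0[of "Suc i"] CC0[of "n - i"] in \<open>auto simp del: power_Suc\<close>)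
      then show "integrable lborel (\<lambda>\<sigma>. g \<sigma> * (W p (Suc i) \<sigma> q * neumann v (n - i) (kk p \<sigma>) (- Xi p \<sigma>)))"
        by (simp add: g_def)
    qed
    have "(LINT \<sigma>|lborel. - (\<Sum>i\<le>n. g \<sigma> * (W p (Suc i) \<sigma> q * neumann v (n - i) (kk p \<sigma>) (- Xi p \<sigma>))) - (LINT \<tau>|lborel. ?F \<tau> \<sigma>)) =
      - (LINT \<sigma>|lborel. (\<Sum>i\<le>n. g \<sigma> * (W p (Suc i) \<sigma> q * neumann v (n - i) (kk p \<sigma>) (- Xi p \<sigma>)))) - (LINT \<sigma>|lborel. LINT \<tau>|lborel. ?F \<tau> \<sigma>)"
      using in1 in2 by (subst Bochner_Integration.integral_diff) auto
    also have "(LINT \<sigma>|lborel. LINT \<tau>|lborel. ?F \<tau> \<sigma>) = (LINT \<tau>|lborel. LINT \<sigma>|lborel. ?F \<tau> \<sigma>)" by (rule sw)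
    also have "\<dots> = (LINT \<tau>|lborel. gw p \<tau> * (W p 0 \<tau> q * neumann v (Suc n) (kk p \<tau>) (- Xi p \<tau>)) / (z - fst \<tau>))"
    proof (rule Bochner_Integration.integral_cong[OF refl])
      fix \<tau> :: "complex \<times> real"
      show "(LINT \<sigma>|lborel. ?F \<tau> \<sigma>) = gw p \<tau> * (W p 0 \<tau> q * neumann v (Suc n) (kk p \<tau>) (- Xi p \<tau>)) / (z - fst \<tau>)"
      proof (cases "fst \<tau> = 0")
        case True then show ?thesis by (simp add: g_def gw_0)
      next
        case False
        have "(LINT \<sigma>|lborel. ?F \<tau> \<sigma>) = (LINT \<sigma>|lborel. gw p \<sigma> * SS p n \<sigma> (- Xi p \<tau>) / (fst \<sigma> - fst \<tau>)) * (g \<tau> * v (q + Xi p \<tau>))"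
          by (rule integral_mult_left_zero)
        also have "(LINT \<sigma>|lborel. gw p \<sigma> * SS p n \<sigma> (- Xi p \<tau>) / (fst \<sigma> - fst \<tau>)) =
          - (LINT \<sigma>|lborel. gw p \<sigma> * SS p n \<sigma> (- Xi p \<tau>) / (fst \<tau> - fst \<sigma>))"
          by (subst Bochner_Integration.integral_minus[symmetric]) (simp add: minus_divide_right)
        also have "\<dots> = neumann v (Suc n) (kk p \<tau>) (- Xi p \<tau>)" by (rule IH[OF False, symmetric])
        finally show ?thesis by (simp add: g_def W_0 mult_ac)
      qed
    qed
    also have "(LINT \<sigma>|lborel. (\<Sum>i\<le>n. g \<sigma> * (W p (Suc i) \<sigma> q * neumann v (n - i) (kk p \<sigma>) (- Xi p \<sigma>)))) =
      (LINT \<sigma>|lborel. gw p \<sigma> * (\<Sum>i\<le>n. W p (Suc i) \<sigma> q * neumann v (n - i) (kk p \<sigma>) (- Xi p \<sigma>)) / (z - fst \<sigma>))"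
      by (intro Bochner_Integration.integral_cong refl) (simp add: g_def sum_distrib_left sum_divide_distrib)
    finally show ?thesis .
  qed
  also have "\<dots> = - (LINT \<sigma>|lborel. gw p \<sigma> * SS p (Suc n) \<sigma> q / (z - fst \<sigma>))"
  proof -
    have b1: "cmod (\<Sum>i\<le>n. W p (Suc i) \<sigma> q * neumann v (n - i) (kk p \<sigma>) (- Xi p \<sigma>)) \<le> (K * (c1 * C)) * wt \<mu> (Xi p \<sigma>)"
      and b2: "cmod (W p 0 \<sigma> q * neumann v (Suc n) (kk p \<sigma>) (- Xi p \<sigma>)) \<le> (C * (C * (c1 * C) ^ Suc n)) * wt \<mu> (Xi p \<sigma>)"
      if z: "fst \<sigma> \<noteq> 0" for \<sigma>
    proof -
      have "cmod (\<Sum>i\<le>n. W p (Suc i) \<sigma> q * neumann v (n - i) (kk p \<sigma>) (- Xi p \<sigma>)) \<le> (\<Sum>i\<le>n. C * C * (c1 * C) ^ Suc n * wt \<mu> (Xi p \<sigma>))"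
      proof (rule sum_norm_le)
        fix i assume "i \<in> {..n}"
        then have e: "(c1 * C) ^ Suc n = (c1 * C) ^ Suc i * (c1 * C) ^ (n - i)" by (simp add: power_add[symmetric])
        have "cmod (W p (Suc i) \<sigma> q) * cmod (neumann v (n - i) (kk p \<sigma>) (- Xi p \<sigma>)) \<le> (C * (c1 * C) ^ Suc i) * (C * (c1 * C) ^ (n - i) * wt \<mu> (Xi p \<sigma>))"
          by (intro mult_mono W_bound psi_bound p z CC0) auto
        then show "cmod (W p (Suc i) \<sigma> q * neumann v (n - i) (kk p \<sigma>) (- Xi p \<sigma>)) \<le> C * C * (c1 * C) ^ Suc n * wt \<mu> (Xi p \<sigma>)"
          unfolding e norm_mult by (simp only: mult_ac)
      qed
      then show "cmod (\<Sum>i\<le>n. W p (Suc i) \<sigma> q * neumann v (n - i) (kk p \<sigma>) (- Xi p \<sigma>)) \<le> (K * (c1 * C)) * wt \<mu> (Xi p \<sigma>)"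
        by (simp add: K_def mult_ac)
      have "cmod (W p 0 \<sigma> q) * cmod (neumann v (Suc n) (kk p \<sigma>) (- Xi p \<sigma>)) \<le> (C * (c1 * C) ^ 0) * (C * (c1 * C) ^ Suc n * wt \<mu> (Xi p \<sigma>))"
        by (intro mult_mono W_bound psi_bound p z CC0) auto
      then show "cmod (W p 0 \<sigma> q * neumann v (Suc n) (kk p \<sigma>) (- Xi p \<sigma>)) \<le> (C * (C * (c1 * C) ^ Suc n)) * wt \<mu> (Xi p \<sigma>)"
        by (simp only: norm_mult power_0 mult_1_right mult.assoc)
    qed
    have i1: "integrable lborel (\<lambda>\<sigma>. gw p \<sigma> * (\<Sum>i\<le>n. W p (Suc i) \<sigma> q * neumann v (n - i) (kk p \<sigma>) (- Xi p \<sigma>)) / (z - fst \<sigma>))"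
      by (rule circ_estimate(2)[OF p mu _ _ b1]) (use K0 c1C0 in auto)
    have i2: "integrable lborel (\<lambda>\<sigma>. gw p \<sigma> * (W p 0 \<sigma> q * neumann v (Suc n) (kk p \<sigma>) (- Xi p \<sigma>)) / (z - fst \<sigma>))"
      by (rule circ_estimate(2)[OF p mu _ _ b2]) (use C0 CC0[of "Suc n"] in \<open>auto simp del: power_Suc\<close>)
    have SS_Suc: "SS p (Suc n) \<sigma> q = (\<Sum>i\<le>n. W p (Suc i) \<sigma> q * neumann v (n - i) (kk p \<sigma>) (- Xi p \<sigma>)) +
        W p 0 \<sigma> q * neumann v (Suc n) (kk p \<sigma>) (- Xi p \<sigma>)" for \<sigma>
      unfolding SS_def sum.atMost_Suc_shift diff_Suc_Suc minus_nat.diff_0 by (rule add.commute)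
    show ?thesis
      unfolding SS_Suc ring_distribs add_divide_distrib Bochner_Integration.integral_add[OF i1 i2] by (simp only: minus_add_distrib diff_conv_add_uminus)
  qed
  finally show ?case .
qed

text \<open>Summation of \<open>neumann_poles\<close> over n. The Cauchy product turns the summed
  residues into a product of two values of H; the n + 1 summands of \<open>SS p n\<close> cost a
  linear factor, harmless against \<open>(c1 * C) ^ n\<close>. For q = p the integrand is that of
  the bracket.\<close>

theorem fadH_poles:
  assumes p: "p \<notin> line \<nu>" and z: "z \<noteq> 0"
  shows "fadH (k_of \<theta> z p) q = v q - (LINT \<sigma>|lborel. gw p \<sigma> * (fadH (kk p \<sigma> + cvec (Xi p \<sigma>)) (q + Xi p \<sigma>) * fadH (kk p \<sigma>) (- Xi p \<sigma>)) / (z - fst \<sigma>))"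
proof -
  let ?f = "\<lambda>n \<sigma>. gw p \<sigma> * SS p n \<sigma> q / (z - fst \<sigma>)"
  let ?K = "\<lambda>n. real (Suc n) * (C * C * (c1 * C) ^ n)"
  have int: "integrable lborel (?f n)" for n
    by (rule circ_estimate(2)[OF p mu SS_const_nonneg]) (use SS_bound[OF p] in auto)
  have k: "k_of \<theta> z p \<in> Sigma_cone" using kk_Sigma(1)[OF p, of "(z, 0)"] z by simp
  have sums: "(\<lambda>n. SS p n \<sigma> q) sums (fadH (kk p \<sigma> + cvec (Xi p \<sigma>)) (q + Xi p \<sigma>) * fadH (kk p \<sigma>) (- Xi p \<sigma>))"
      and abs: "summable (\<lambda>n. cmod (SS p n \<sigma> q))" if "fst \<sigma> \<noteq> 0" for \<sigma>
  proof -
    show "(\<lambda>n. SS p n \<sigma> q) sums (fadH (kk p \<sigma> + cvec (Xi p \<sigma>)) (q + Xi p \<sigma>) * fadH (kk p \<sigma>) (- Xi p \<sigma>))"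
      unfolding SS_def W_def fadH_def by (intro Cauchy_product_sums neumann_summable kk_Sigma p that)
    have "summable (\<lambda>n. (c1 * C) ^ n * real (Suc n) powr 1 * (C * C * wt \<mu> (Xi p \<sigma>)))"
      by (intro summable_mult2 summable_power_powr c1C0 cC)
    then show "summable (\<lambda>n. cmod (SS p n \<sigma> q))"
      by (rule summable_comparison_test'[of _ 0]) (use SS_bound[OF p that] in \<open>simp add: mult_ac\<close>)
  qed
  have "(\<lambda>n. LINT \<sigma>|lborel. ?f n \<sigma>) sums (LINT \<sigma>|lborel. (\<Sum>n. ?f n \<sigma>))"
  proof (rule sums_integral[OF int])
    show "AE \<sigma> in lborel. summable (\<lambda>n. norm (?f n \<sigma>))"
      using AE_fst_neq[of 0]
    proof eventually_elim
      case (elim \<sigma>)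
      show ?case using abs[OF elim] by (auto simp: norm_mult norm_divide intro!: summable_divide summable_mult)
    qed
    show "summable (\<lambda>n. LINT \<sigma>|lborel. norm (?f n \<sigma>))"
    proof (rule summable_comparison_test'[of "\<lambda>n. (c1 * C) ^ n * real (Suc n) powr 1 * (C * C * circ_const (norm p / 2))" 0])
      show "summable (\<lambda>n. (c1 * C) ^ n * real (Suc n) powr 1 * (C * C * circ_const (norm p / 2)))"
        by (intro summable_mult2 summable_power_powr c1C0 cC)
      fix n :: nat
      have "ennreal (LINT \<sigma>|lborel. norm (?f n \<sigma>)) \<le> ennreal (?K n * circ_const (norm p / 2))"
        using circ_estimate(1)[OF p mu SS_const_nonneg, of "\<lambda>\<sigma>. SS p n \<sigma> q" n z] SS_bound[OF p]
        by (subst nn_integral_eq_integral[symmetric]) (use int in auto)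
      then have "(LINT \<sigma>|lborel. norm (?f n \<sigma>)) \<le> ?K n * circ_const (norm p / 2)"
        using SS_const_nonneg[of n] circ_const_nonneg[OF b_pos[OF p]] by (subst (asm) ennreal_le_iff) auto
      then show "norm (LINT \<sigma>|lborel. norm (?f n \<sigma>)) \<le> (c1 * C) ^ n * real (Suc n) powr 1 * (C * C * circ_const (norm p / 2))"
        by (simp add: mult_ac)
    qed
  qed
  also have "(LINT \<sigma>|lborel. (\<Sum>n. ?f n \<sigma>)) =
    (LINT \<sigma>|lborel. gw p \<sigma> * (fadH (kk p \<sigma> + cvec (Xi p \<sigma>)) (q + Xi p \<sigma>) * fadH (kk p \<sigma>) (- Xi p \<sigma>)) / (z - fst \<sigma>))"
  proof (rule Bochner_Integration.integral_cong[OF refl])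
    fix \<sigma> :: "complex \<times> real"
    show "(\<Sum>n. ?f n \<sigma>) = gw p \<sigma> * (fadH (kk p \<sigma> + cvec (Xi p \<sigma>)) (q + Xi p \<sigma>) * fadH (kk p \<sigma>) (- Xi p \<sigma>)) / (z - fst \<sigma>)"
    proof (cases "fst \<sigma> = 0")
      case False
      show ?thesis by (rule sums_unique[symmetric]) (intro sums_divide sums_mult sums[OF False])
    qed (simp add: gw_0)
  qed
  finally have "(\<lambda>n. - (LINT \<sigma>|lborel. ?f n \<sigma>)) sums
    - (LINT \<sigma>|lborel. gw p \<sigma> * (fadH (kk p \<sigma> + cvec (Xi p \<sigma>)) (q + Xi p \<sigma>) * fadH (kk p \<sigma>) (- Xi p \<sigma>)) / (z - fst \<sigma>))"
    by (rule sums_minus)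
  then have "(\<lambda>n. neumann v (Suc n) (k_of \<theta> z p) q) sums
    - (LINT \<sigma>|lborel. gw p \<sigma> * (fadH (kk p \<sigma> + cvec (Xi p \<sigma>)) (q + Xi p \<sigma>) * fadH (kk p \<sigma>) (- Xi p \<sigma>)) / (z - fst \<sigma>))"
    unfolding neumann_poles[OF p z] .
  then have "(\<lambda>n. neumann v n (k_of \<theta> z p) q) sums
    (- (LINT \<sigma>|lborel. gw p \<sigma> * (fadH (kk p \<sigma> + cvec (Xi p \<sigma>)) (q + Xi p \<sigma>) * fadH (kk p \<sigma>) (- Xi p \<sigma>)) / (z - fst \<sigma>)) + neumann v 0 (k_of \<theta> z p) q)"
    by (rule iffD1[OF sums_Suc_iff])
  then show ?thesis unfolding fadH_def by (simp add: sums_iff)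
qed

end

section \<open>Almost everywhere classes in the coordinates\<close>

text \<open>Lebesgue measurability of f follows from its equality with a Borel function almost
  everywhere, so f may be built from arbitrary representatives.\<close>

lemma integral_lebesgue_AE_eq:
  fixes f g :: "'a::euclidean_space \<Rightarrow> complex"
  assumes [measurable]: "g \<in> borel_measurable borel" and ae: "AE x in lborel. f x = g x"
  shows "(LINT x|lebesgue. f x) = (LINT x|lborel. g x)"
proof -
  have gm: "g \<in> borel_measurable lebesgue" by (intro measurable_completion) simp
  have ae': "AE x in lebesgue. g x = f x" using AE_completion[OF ae] by eventually_elim simp
  have "f \<in> borel_measurable lebesgue" by (rule borel_measurable_AE[OF gm ae'])
  then have "(LINT x|lebesgue. f x) = (LINT x|lebesgue. g x)"
    using ae' by (intro integral_cong_AE gm) (auto elim: eventually_mono)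
  then show ?thesis by (simp add: integral_completion)
qed

lemma AE_obtain_null:
  assumes "AE x in (lborel :: 'a::euclidean_space measure). P x"
  obtains N where "N \<in> sets borel" "AE x in lborel. x \<notin> N" "\<And>x. x \<notin> N \<Longrightarrow> P x"
proof -
  from assms obtain N where N: "{x \<in> space lborel. \<not> P x} \<subseteq> N" "emeasure lborel N = 0" "N \<in> sets lborel" by (rule AE_E)
  have "AE x in lborel. x \<notin> N" using N by (intro AE_not_in) auto
  with N that[of N] show thesis by auto
qed

lemma AE_lborel_commute:
  fixes P :: "'a::euclidean_space \<Rightarrow> 'b::euclidean_space \<Rightarrow> bool"
  assumes P: "{x. P (fst x) (snd x)} \<in> sets borel"
  shows "(AE x in lborel. AE y in lborel. P x y) \<longleftrightarrow> (AE y in lborel. AE x in lborel. P x y)"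
  by (rule lborel_pair.AE_commute) (unfold lborel_prod, use P in simp)

lemma AE_lborel_pair_iff:
  fixes P :: "'a::euclidean_space \<Rightarrow> 'b::euclidean_space \<Rightarrow> bool"
  assumes P: "{x. P (fst x) (snd x)} \<in> sets borel"
  shows "(AE x in lborel. P (fst x) (snd x)) \<longleftrightarrow> (AE y in lborel. AE x in lborel. P x y)"
proof -
  have "(AE x in lborel. P (fst x) (snd x)) \<longleftrightarrow> (AE x in lborel. AE y in lborel. P x y)"
  proof -
    have "(AE x in lborel. AE y in lborel. P x y) \<longleftrightarrow> (AE x in lborel \<Otimes>\<^sub>M lborel. P (fst x) (snd x))"
      by (rule lborel_pair.AE_pair_iff) (unfold lborel_prod, use P in simp)
    then show ?thesis unfolding lborel_prod by simp
  qed
  then show ?thesis unfolding AE_lborel_commute[OF P] .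
qed

lemma AE_lborel_snd_fst:
  fixes P :: "'a::euclidean_space \<times> 'b::euclidean_space \<Rightarrow> bool"
  assumes "AE x in lborel. P x"
  shows "AE y in lborel. AE x in lborel. P (x, y)"
proof -
  obtain N where [measurable]: "N \<in> sets borel" and ae: "AE x in lborel. x \<notin> N" and N: "\<And>x. x \<notin> N \<Longrightarrow> P x"
    by (rule AE_obtain_null[OF assms]) blast
  have "AE y in lborel. AE x in lborel. (x, y) \<notin> N"
    using ae by (subst AE_lborel_pair_iff[symmetric]) (simp_all add: Compl_eq[symmetric])
  then show ?thesis by eventually_elim (auto elim: eventually_mono intro: N)
qed

lemma AE_lborel_translate:
  fixes P :: "'a::euclidean_space \<Rightarrow> bool"
  assumes "AE x in lborel. P x" shows "AE x in lborel. P (x + a)"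
proof -
  have "AE x in distr lborel borel ((+) a). P x" using assms unfolding lborel_distr_plus .
  then have "AE x in lborel. P (a + x)" by (rule AE_distrD[rotated]) measurable
  then show ?thesis by (simp add: add.commute)
qed

lemma closed_line: "closed (line \<nu>)"
proof -
  have "line \<nu> = span {\<nu>}" by (auto simp: line_def span_singleton)
  then show ?thesis by (simp add: closed_subspace)
qed

lemma line_borel [measurable]: "line \<nu> \<in> sets borel"
  using closed_line by (rule borel_closed)

lemma AE_not_line: "AE p in lborel. p \<notin> line \<nu>"
proof -
  have l: "line \<nu> = span {\<nu>}" by (auto simp: line_def span_singleton)
  have "dim (line \<nu>) \<le> card {\<nu>}" unfolding l dim_span by (rule dim_le_card') simp
  then have "negligible (line \<nu>)" by (intro negligible_lowdim) simp
  then have "line \<nu> \<in> null_sets lebesgue" by (simp add: negligible_iff_null_sets)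
  then have "AE p in lebesgue. p \<notin> line \<nu>" by (rule AE_not_in)
  then show ?thesis by (simp add: AE_completion_iff)
qed

lemma coord_dom_borel [measurable]: "coord_dom \<nu> \<in> sets borel"
proof -
  have "coord_dom \<nu> = (- {0}) \<times> (- line \<nu>)" by (auto simp: coord_dom_def)
  moreover have "open \<dots>" by (intro open_Times open_Compl closed_line closed_singleton)
  ultimately show ?thesis by simp
qed

lemma AE_coord_dom: "AE x in lborel. x \<in> coord_dom \<nu>"
proof -
  have "AE x in (lborel :: (complex \<times> (real ^ 3)) measure). snd x \<notin> line \<nu>"
  proof (subst AE_lborel_pair_iff[of "\<lambda>_ p. p \<notin> line \<nu>", unfolded])
    have "{x :: complex \<times> (real ^ 3). snd x \<notin> line \<nu>} = UNIV \<times> (- line \<nu>)" by auto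
    then show "{x :: complex \<times> (real ^ 3). snd x \<notin> line \<nu>} \<in> sets borel" by (simp add: borel_open open_Times open_Compl closed_line)
    show "AE y in lborel. AE x in (lborel :: complex measure). y \<notin> line \<nu>"
      using AE_not_line[of \<nu>] by eventually_elim simp
  qed
  with AE_fst_neq[of 0] show ?thesis by eventually_elim (auto simp: coord_dom_def)
qed

lemma AE_lebesgue_on_coord_dom:
  "(AE x in lebesgue_on (coord_dom \<nu>). P x) \<longleftrightarrow> (AE x in lborel. P x)"
proof -
  have "(AE x in lebesgue_on (coord_dom \<nu>). P x) \<longleftrightarrow> (AE x in lebesgue. x \<in> coord_dom \<nu> \<longrightarrow> P x)"
    by (rule AE_restrict_space_iff) (simp add: sets_completionI_sets)
  also have "\<dots> \<longleftrightarrow> (AE x in lborel. x \<in> coord_dom \<nu> \<longrightarrow> P x)" by (simp add: AE_completion_iff)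
  also have "\<dots> \<longleftrightarrow> (AE x in lborel. P x)" using AE_coord_dom[of \<nu>] by (auto elim: eventually_elim2)
  finally show ?thesis .
qed

lemma weighted_le_iff: "ereal ((1 + norm p) powr \<mu> * c) \<le> ereal M \<longleftrightarrow> c \<le> M * wt \<mu> p"
proof -
  have e: "(1 + norm p) powr \<mu> * (M * wt \<mu> p) = M" using powr_wt[of p \<mu>] by (simp add: mult_ac)
  have "(1 + norm p) powr \<mu> > 0" by simp
  then have "c \<le> M * wt \<mu> p \<longleftrightarrow> (1 + norm p) powr \<mu> * c \<le> (1 + norm p) powr \<mu> * (M * wt \<mu> p)"
    by (subst mult_le_cancel_left_pos) auto
  then show ?thesis unfolding e by simp
qed

lemma norm2_muD:
  assumes "norm2_mu \<nu> \<mu> U \<le> ereal M"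
  shows "AE x in lborel. cmod (U (fst x) (snd x)) \<le> M * wt \<mu> (snd x)"
proof -
  have "AE x in lebesgue_on (coord_dom \<nu>). (\<lambda>(z, p). ereal ((1 + norm p) powr \<mu> * cmod (U z p))) x \<le> norm2_mu \<nu> \<mu> U"
    unfolding norm2_mu_def by (rule esssup_AE)
  then have "AE x in lborel. (\<lambda>(z, p). ereal ((1 + norm p) powr \<mu> * cmod (U z p))) x \<le> norm2_mu \<nu> \<mu> U"
    unfolding AE_lebesgue_on_coord_dom .
  then show ?thesis
  proof eventually_elim
    case (elim x)
    then have "ereal ((1 + norm (snd x)) powr \<mu> * cmod (U (fst x) (snd x))) \<le> ereal M"
      by (simp only: case_prod_beta order_trans[OF _ assms])
    then show ?case unfolding weighted_le_iff .
  qed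
qed

lemma
  assumes U: "case_prod U \<in> borel_measurable borel"
    and bd: "AE x in lborel. cmod (U (fst x) (snd x)) \<le> M * wt \<mu> (snd x)"
  shows norm2_muI: "norm2_mu \<nu> \<mu> U \<le> ereal M" and Linf2_muI: "U \<in> Linf2_mu \<nu> \<mu>"
proof -
  have m: "f \<in> borel_measurable (lebesgue_on (coord_dom \<nu>))" if "f \<in> borel_measurable borel"
    for f :: "complex \<times> (real ^ 3) \<Rightarrow> 'b::topological_space"
    by (rule measurable_restrict_space1, rule measurable_completion) (use that in simp)
  show 1: "norm2_mu \<nu> \<mu> U \<le> ereal M"
    unfolding norm2_mu_def
  proof (rule esssup_I)
    have [measurable]: "(\<lambda>x. U (fst x) (snd x)) \<in> borel_measurable borel" using U by (simp add: case_prod_unfold)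
    show "(\<lambda>(z, p). ereal ((1 + norm p) powr \<mu> * cmod (U z p))) \<in> borel_measurable (lebesgue_on (coord_dom \<nu>))"
      unfolding case_prod_beta by (rule m) measurable
    show "AE x in lebesgue_on (coord_dom \<nu>). (case x of (z, p) \<Rightarrow> ereal ((1 + norm p) powr \<mu> * cmod (U z p))) \<le> ereal M"
      unfolding AE_lebesgue_on_coord_dom using bd
    proof eventually_elim
      case (elim x) then show ?case unfolding case_prod_beta weighted_le_iff .
    qed
  qed
  then have "norm2_mu \<nu> \<mu> U < \<infinity>" by (auto intro: le_less_trans)
  then show "U \<in> Linf2_mu \<nu> \<mu>" using m[OF U] by (simp add: Linf2_mu_def)
qed

text \<open>Borel measurability and a bound at every point. For fixed p the operators evaluate U on
  a null subset of the coordinate space, so a bound almost everywhere would say nothing about an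
  individual integral.\<close>

definition regular :: "real \<Rightarrow> real \<Rightarrow> (complex \<Rightarrow> real ^ 3 \<Rightarrow> complex) \<Rightarrow> bool" where
  "regular \<mu> M U \<longleftrightarrow> case_prod U \<in> borel_measurable borel \<and> (\<forall>z p. cmod (U z p) \<le> M * wt \<mu> p)"

lemma regularD:
  assumes "regular \<mu> M U"
  shows "cmod (U z p) \<le> M * wt \<mu> p" "M \<ge> 0" "case_prod U \<in> borel_measurable borel"
proof -
  show b: "cmod (U z p) \<le> M * wt \<mu> p" for z p using assms by (simp add: regular_def)
  have "0 \<le> M * wt \<mu> (0 :: real ^ 3)" using order_trans[OF norm_ge_zero b[of 0 0]] .
  then show "M \<ge> 0" by (rule nonneg_of_mult_pos) (rule wt_pos)
  show "case_prod U \<in> borel_measurable borel" using assms by (simp add: regular_def)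
qed

lemma regular_measurable:
  assumes "regular \<mu> M U" "f \<in> borel_measurable N" "g \<in> borel_measurable N"
  shows "(\<lambda>x. U (f x) (g x)) \<in> borel_measurable N"
  using measurable_compose[OF borel_measurable_Pair[OF assms(2,3)] regularD(3)[OF assms(1)]] by simp

lemma Linf2_mu_regular:
  assumes U: "U \<in> Linf2_mu \<nu> \<mu>" and n: "norm2_mu \<nu> \<mu> U \<le> ereal M" and M: "M \<ge> 0"
  obtains V where "regular \<mu> M V" "AE x in lborel. U (fst x) (snd x) = V (fst x) (snd x)"
proof -
  have "(\<lambda>x. if x \<in> coord_dom \<nu> then case_prod U x else 0) \<in> borel_measurable lebesgue"
    using U by (subst measurable_restrict_space_iff[symmetric]) (auto simp: Linf2_mu_def sets_completionI_sets)
  then obtain g where [measurable]: "g \<in> borel_measurable lborel"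
    and g: "AE x in lborel. (if x \<in> coord_dom \<nu> then case_prod U x else 0) = g x"
    using completion_ex_borel_measurable_complex by blast
  define V where "V z p = (if cmod (g (z, p)) \<le> M * wt \<mu> p then g (z, p) else 0)" for z p
  have "case_prod V = (\<lambda>x. if cmod (g x) \<le> M * wt \<mu> (snd x) then g x else 0)" by (auto simp: V_def)
  then have "regular \<mu> M V" using M by (auto simp: regular_def V_def)
  moreover have "AE x in lborel. U (fst x) (snd x) = V (fst x) (snd x)"
    using g AE_coord_dom[of \<nu>] norm2_muD[OF n] by eventually_elim (auto simp: V_def case_prod_beta)
  ultimately show thesis by (rule that)
qed

section \<open>The nonlinear operator\<close>

lemma circ_w_kernel:
  assumes z: "z \<noteq> 0"
  shows "of_real (b * ((cmod z)\<^sup>2 - 1)) / (cnj z * of_real (cmod z)) * of_real (cos \<phi> - 1) - of_real (2 * b) / cnj z * of_real (sin \<phi>)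
    = 4 * circ_w b (z, \<phi>)"
proof -
  define r where "r = cmod z"
  have r: "r > 0" using z by (simp add: r_def)
  have "b * (r\<^sup>2 - 1) / r * (cos \<phi> - 1) - 2 * b * sin \<phi> = 2 * (circ_m b z \<phi> * r)"
    using r by (simp add: circ_m_def r_def[symmetric] field_simps power2_eq_square)
  then have "complex_of_real (b * (r\<^sup>2 - 1) / r * (cos \<phi> - 1) - 2 * b * sin \<phi>) / cnj z = complex_of_real (2 * (circ_m b z \<phi> * r)) / cnj z"
    by simp
  then show ?thesis
    by (simp add: circ_w_def r_def[symmetric] diff_divide_distrib mult_ac)
qed

context frame_field
begin

definition to_fr :: "real ^ 3 \<Rightarrow> real ^ 3 \<Rightarrow> complex \<times> real" where
  "to_fr p \<xi> = (Complex (omega \<theta> p \<bullet> \<xi>) (\<theta> p \<bullet> \<xi>), ax p \<bullet> \<xi>)"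

lemma fr_to_fr: "p \<notin> line \<nu> \<Longrightarrow> fr p (to_fr p \<xi>) = \<xi>"
  using orthonormal_expansion[OF frame_facts(1), of p \<xi>] by (simp add: fr_def from_frame_def to_fr_def)

lemma to_fr_fr: "p \<notin> line \<nu> \<Longrightarrow> to_fr p (fr p x) = x"
  using inner_from_frame[OF frame_facts(1), of p x] by (simp add: fr_def to_fr_def)

lemma to_fr_measurable [measurable (raw)]:
  assumes [measurable]: "f \<in> borel_measurable M" "g \<in> borel_measurable M"
  shows "(\<lambda>x. to_fr (f x) (g x)) \<in> borel_measurable M"
  unfolding to_fr_def by measurable

lemma fr_measurable: "fr p \<in> borel \<rightarrow>\<^sub>M borel"
  unfolding fr_def by measurable

lemma distr_fr: "p \<notin> line \<nu> \<Longrightarrow> distr lborel borel (fr p) = lborel"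
  unfolding fr_def by (rule distr_from_frame[OF frame_facts(1)])

lemma AE_fr:
  assumes p: "p \<notin> line \<nu>" and P: "AE \<xi> in lborel. P \<xi>" shows "AE x in lborel. P (fr p x)"
proof (rule AE_distrD[where f = "fr p" and P = P])
  show "fr p \<in> lborel \<rightarrow>\<^sub>M borel" using fr_measurable by simp
  show "AE \<xi> in distr lborel borel (fr p). P \<xi>" unfolding distr_fr[OF p] by (rule P)
qed

lemma AE_to_fr:
  assumes p: "p \<notin> line \<nu>" and P: "AE x in lborel. P x" shows "AE \<xi> in lborel. P (to_fr p \<xi>)"
proof -
  obtain N where N [measurable]: "N \<in> sets borel" and ae: "AE x in lborel. x \<notin> N" and NP: "\<And>x. x \<notin> N \<Longrightarrow> P x"
    by (rule AE_obtain_null[OF P]) blast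
  note [measurable] = fr_measurable
  have "(AE \<xi> in distr lborel borel (fr p). to_fr p \<xi> \<notin> N) \<longleftrightarrow> (AE x in lborel. to_fr p (fr p x) \<notin> N)"
    by (rule AE_distr_iff) measurable
  then have "AE \<xi> in lborel. to_fr p \<xi> \<notin> N" using ae unfolding distr_fr[OF p] to_fr_fr[OF p] by simp
  then show ?thesis by eventually_elim (rule NP)
qed

lemma AE_Xi:
  assumes p: "p \<notin> line \<nu>" and P: "AE \<xi> in lborel. P \<xi>"
  shows "AE \<sigma> in lborel. \<sigma> \<in> circ_dom \<longrightarrow> P (Xi p \<sigma>)"
  unfolding Xi_def by (rule AE_circ_pt[OF b_pos[OF p] AE_fr[OF p P]])

text \<open>A point \<open>(k, q)\<close> of the quadric with \<open>\<xi>\<^sup>2 + 2 k \<cdot> \<xi> = 0\<close> has as its first coordinate one of the two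
  roots that \<open>\<xi>\<close> determines in the frame at \<open>q\<close>; so null sets in the coordinates can be handled by Fubini's
  theorem in \<open>(q, \<xi>)\<close>.\<close>

lemma lambda_of_eq_lam:
  assumes q: "q \<notin> line \<nu>" and k: "cdot k k = 0" "2 * cdot k (cvec q) = of_real (q \<bullet> q)"
    and d: "disp_den k \<xi> = 0" and w: "fst (to_fr q \<xi>) \<noteq> 0"
  shows "\<exists>\<epsilon>\<in>{1, -1}. lambda_of \<theta> k q = lam (norm q / 2) \<epsilon> (to_fr q \<xi>)"
proof -
  let ?l = "lambda_of \<theta> k q"
  note l = k_of_lambda_of[OF q k]
  have "den (norm q / 2) ?l (to_fr q \<xi>) = 0"
    using disp_den_fr[OF q, of ?l "to_fr q \<xi>"] d unfolding l(2) fr_to_fr[OF q] by simp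
  then show ?thesis
    using den_factor[OF b_pos[OF q] w l(1)] b_pos[OF q] w l(1) by auto
qed

text \<open>Each of the two evaluation points of the bracket gets a partner at which its
  \<open>disp_den\<close> vanishes: -p for (k, -\<xi>), and -\<xi> for (k + \<xi>, p + \<xi>). With
  these partners \<open>lambda_of_eq_lam\<close> expresses both first coordinates through p and
  \<xi> alone, up to the choice of \<epsilon>.\<close>

lemma quadric_points:
  assumes p: "p \<notin> line \<nu>" and z: "fst \<sigma> \<noteq> 0"
  shows "cdot (kk p \<sigma>) (kk p \<sigma>) = 0"
    "2 * cdot (kk p \<sigma>) (cvec (- Xi p \<sigma>)) = of_real ((- Xi p \<sigma>) \<bullet> (- Xi p \<sigma>))"
    "disp_den (kk p \<sigma>) (- p) = 0"
    "cdot (kk p \<sigma> + cvec (Xi p \<sigma>)) (kk p \<sigma> + cvec (Xi p \<sigma>)) = 0"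
    "2 * cdot (kk p \<sigma> + cvec (Xi p \<sigma>)) (cvec (p + Xi p \<sigma>)) = of_real ((p + Xi p \<sigma>) \<bullet> (p + Xi p \<sigma>))"
    "disp_den (kk p \<sigma> + cvec (Xi p \<sigma>)) (- Xi p \<sigma>) = 0"
proof -
  define k \<xi> where "k = kk p \<sigma>" and "\<xi> = Xi p \<sigma>"
  note kq = k_of_on_quadric[OF p z, folded k_def]
  have d: "disp_den k \<xi> = 0" unfolding k_def \<xi>_def by (rule disp_den_Xi[OF p z])
  then have c: "2 * cdot k (cvec \<xi>) = - of_real (\<xi> \<bullet> \<xi>)" by (simp add: disp_den_def add_eq_0_iff)
  have 1: "2 * cdot k (cvec (- \<xi>)) = of_real ((- \<xi>) \<bullet> (- \<xi>))" "disp_den k (- p) = 0"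
    using c kq(2) by (simp_all add: disp_den_def cvec_simps cdot_simps)
  have 2: "cdot (k + cvec \<xi>) (k + cvec \<xi>) = 0" "disp_den (k + cvec \<xi>) (- \<xi>) = 0"
      "2 * cdot (k + cvec \<xi>) (cvec (p + \<xi>)) = of_real ((p + \<xi>) \<bullet> (p + \<xi>))"
    using c kq d by (simp_all add: cdot_commute[of "cvec \<xi>" k] cdot_shift disp_den_def cvec_simps cdot_simps inner_simps inner_commute ring_distribs)
  from kq(1) 1 2 show "cdot (kk p \<sigma>) (kk p \<sigma>) = 0"
    "2 * cdot (kk p \<sigma>) (cvec (- Xi p \<sigma>)) = of_real ((- Xi p \<sigma>) \<bullet> (- Xi p \<sigma>))"
    "disp_den (kk p \<sigma>) (- p) = 0"
    "cdot (kk p \<sigma> + cvec (Xi p \<sigma>)) (kk p \<sigma> + cvec (Xi p \<sigma>)) = 0"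
    "2 * cdot (kk p \<sigma> + cvec (Xi p \<sigma>)) (cvec (p + Xi p \<sigma>)) = of_real ((p + Xi p \<sigma>) \<bullet> (p + Xi p \<sigma>))"
    "disp_den (kk p \<sigma> + cvec (Xi p \<sigma>)) (- Xi p \<sigma>) = 0"
    unfolding k_def \<xi>_def by blast+
qed

text \<open>With the partners of \<open>quadric_points\<close>, the two evaluation points are
  determined by the pairs (-\<xi>, -p) and (p + \<xi>, -\<xi>), up to a choice between two zeros.
  These pairs depend on (p, \<xi>) through linear maps that preserve Lebesgue measure, so Fubini's
  theorem discards only a null set of p, and \<open>AE_Xi\<close> passes from \<xi> to \<sigma>.
  This is what makes the nonlinear operators well defined on classes.\<close>

lemma AE_quadric:
  assumes Q: "AE x in lborel. Q x"
  shows "AE p in lborel. AE \<sigma> in lborel. \<sigma> \<in> circ_dom \<longrightarrow>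
    - Xi p \<sigma> \<notin> line \<nu> \<and> p + Xi p \<sigma> \<notin> line \<nu> \<and>
    Q (lambda_of \<theta> (kk p \<sigma>) (- Xi p \<sigma>), - Xi p \<sigma>) \<and>
    Q (lambda_of \<theta> (kk p \<sigma> + cvec (Xi p \<sigma>)) (p + Xi p \<sigma>), p + Xi p \<sigma>)"
proof -
  obtain N where N [measurable]: "N \<in> sets borel" and ae: "AE x in lborel. x \<notin> N" and NQ: "\<And>x. x \<notin> N \<Longrightarrow> Q x"
    by (rule AE_obtain_null[OF Q]) blast
  \<comment> \<open>Both zeros are kept out of N, so that it does not matter which of them the first
    coordinate is.\<close>
  define good where "good q \<xi> \<longleftrightarrow> q \<notin> line \<nu> \<and> fst (to_fr q \<xi>) \<noteq> 0 \<and> (\<forall>\<epsilon>\<in>{1, -1}. (lam (norm q / 2) \<epsilon> (to_fr q \<xi>), q) \<notin> N)" for q \<xi>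
  have good_meas: "{x. good (f x) (g x)} \<in> sets borel" if [measurable]: "f \<in> borel_measurable borel" "g \<in> borel_measurable borel"
    for f g :: "(real ^ 3) \<times> (real ^ 3) \<Rightarrow> real ^ 3"
  proof -
    have "Measurable.pred borel (\<lambda>x. good (f x) (g x))" unfolding good_def by measurable
    then show ?thesis by (simp add: pred_def)
  qed
  have key: "Q (lambda_of \<theta> k q, q)"
    if "good q \<xi>" "cdot k k = 0" "2 * cdot k (cvec q) = of_real (q \<bullet> q)" "disp_den k \<xi> = 0" for k q \<xi>
    using lambda_of_eq_lam[of q k \<xi>] that unfolding good_def by (auto intro!: NQ)
  have A: "AE q in lborel. AE \<xi> in lborel. good q \<xi>"
    using AE_not_line[of \<nu>] AE_lborel_snd_fst[OF ae]
  proof eventually_elim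
    case (elim q)
    have "AE \<xi> in lborel. (lam (norm q / 2) \<epsilon> (to_fr q \<xi>), q) \<notin> N" if "\<epsilon> \<in> {1, -1}" for \<epsilon>
      by (rule AE_to_fr[OF elim(1)], rule AE_lam[OF b_pos[OF elim(1)] that elim(2)])
    then have "AE \<xi> in lborel. (lam (norm q / 2) 1 (to_fr q \<xi>), q) \<notin> N" "AE \<xi> in lborel. (lam (norm q / 2) (-1) (to_fr q \<xi>), q) \<notin> N"
      by auto
    with AE_to_fr[OF elim(1) AE_fst_neq[of 0]] show ?case
      by eventually_elim (use elim(1) in \<open>auto simp: good_def\<close>)
  qed
  have A': "AE \<xi> in lborel. AE q in lborel. good q \<xi>"
    using A by (subst AE_lborel_commute[symmetric]) (auto intro: good_meas)
  have B1: "AE p in lborel. AE \<eta> in lborel. good (- \<eta>) (- p)"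
    using AE_lborel_uminus[OF A'] by eventually_elim (rule AE_lborel_uminus)
  have "AE \<xi> in lborel. AE p in lborel. good (p + \<xi>) (- \<xi>)"
    using AE_lborel_uminus[OF A'] by eventually_elim (rule AE_lborel_translate)
  then have B2: "AE p in lborel. AE \<xi> in lborel. good (p + \<xi>) (- \<xi>)"
    by (subst AE_lborel_commute) (auto intro: good_meas)
  show ?thesis
    using B1 B2 AE_not_line[of \<nu>]
  proof eventually_elim
    case (elim p)
    show ?case using AE_Xi[OF elim(3) elim(1)] AE_Xi[OF elim(3) elim(2)] AE_fst_neq[of 0]
    proof eventually_elim
      case (elim \<sigma>)
      note q = quadric_points[OF \<open>p \<notin> line \<nu>\<close> elim(3)]
      show ?case
        using elim(1,2) key[OF _ q(1-3)] key[OF _ q(4-6)] by (auto simp: good_def)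
    qed
  qed
qed

text \<open>The parameter \<open>\<theta>'\<close> enters only through \<open>lambda_of\<close>; the
  points on the circles are always formed with \<open>\<theta>\<close>.\<close>

definition quad_prod :: "(real ^ 3 \<Rightarrow> real ^ 3) \<Rightarrow> (complex \<Rightarrow> real ^ 3 \<Rightarrow> complex) \<Rightarrow> (complex \<Rightarrow> real ^ 3 \<Rightarrow> complex) \<Rightarrow>
    real ^ 3 \<Rightarrow> complex \<times> real \<Rightarrow> complex" where
  "quad_prod \<theta>' U1 U2 p \<sigma> = U1 (lambda_of \<theta>' (kk p \<sigma>) (- Xi p \<sigma>)) (- Xi p \<sigma>) *
     U2 (lambda_of \<theta>' (kk p \<sigma> + cvec (Xi p \<sigma>)) (p + Xi p \<sigma>)) (p + Xi p \<sigma>)"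

text \<open>The constants cancel: -1/\<pi> from the transform, -\<pi>/4 from the bracket and 4 from
  \<open>circ_w_kernel\<close> multiply to 1. For an arbitrary representative the integrand need not
  be Borel, so only its equality with some Borel function \<open>j\<close> almost everywhere is
  demanded.\<close>

lemma I_op_eq:
  assumes p: "p \<notin> line \<nu>" and agree: "\<theta>' p = \<theta> p" and j [measurable]: "j \<in> borel_measurable borel"
    and ae: "AE \<sigma> in lborel. gw p \<sigma> * quad_prod \<theta>' U1 U2 p \<sigma> = j \<sigma>"
  shows "I_op \<theta>' U1 U2 z p = (LINT \<zeta>|lborel. (LINT \<phi>|lborel. j (\<zeta>, \<phi>)) / (\<zeta> - z))"
proof -
  have om: "omega \<theta>' p = omega \<theta> p" by (simp add: omega_def agree)
  have kof: "k_of \<theta>' \<zeta> p = k_of \<theta> \<zeta> p" for \<zeta> by (simp add: k_of_def om agree)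
  have xi: "xi_of \<theta>' \<zeta> p \<phi> = Xi p (\<zeta>, \<phi>)" if "\<zeta> \<noteq> 0" for \<zeta> \<phi>
    using xi_of_eq[OF p that] by (simp add: xi_of_def kof)
  define inner where "inner \<zeta> = (LINT \<phi>|lebesgue. gw p (\<zeta>, \<phi>) * quad_prod \<theta>' U1 U2 p (\<zeta>, \<phi>))" for \<zeta>
  have paren: "paren_op \<theta>' U1 U2 \<zeta> p = - of_real pi * inner \<zeta>" for \<zeta>
  proof (cases "\<zeta> = 0")
    case True then show ?thesis by (simp add: paren_op_def brace_op_def inner_def gw_0)
  next
    case False
    have "paren_op \<theta>' U1 U2 \<zeta> p = - of_real (pi / 4) * (LINT \<phi>|lebesgue. 4 * (gw p (\<zeta>, \<phi>) * quad_prod \<theta>' U1 U2 p (\<zeta>, \<phi>)))"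
      unfolding paren_op_def brace_op_def set_lebesgue_integral_def
    proof (intro arg_cong2[of _ _ _ _ "(*)"] refl Bochner_Integration.integral_cong)
      fix \<phi>
      show "indicator {-pi..pi} \<phi> *\<^sub>R ((of_real (norm p / 2 * ((cmod \<zeta>)\<^sup>2 - 1)) / (cnj \<zeta> * of_real (cmod \<zeta>)) * of_real (cos \<phi> - 1)
            - of_real (norm p) / cnj \<zeta> * of_real (sin \<phi>))
         * U1 (lambda_of \<theta>' (k_of \<theta>' \<zeta> p) (- xi_of \<theta>' \<zeta> p \<phi>)) (- xi_of \<theta>' \<zeta> p \<phi>)
         * U2 (lambda_of \<theta>' (k_of \<theta>' \<zeta> p + cvec (xi_of \<theta>' \<zeta> p \<phi>)) (p + xi_of \<theta>' \<zeta> p \<phi>)) (p + xi_of \<theta>' \<zeta> p \<phi>))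
        = 4 * (gw p (\<zeta>, \<phi>) * quad_prod \<theta>' U1 U2 p (\<zeta>, \<phi>))"
        using circ_w_kernel[OF False, of "norm p / 2" \<phi>]
        by (simp add: xi[OF False] kof gw_def quad_prod_def circ_dom_indicator scaleR_conv_of_real)
    qed
    then show ?thesis unfolding inner_def integral_mult_right_zero by simp
  qed
  have jm: "case_prod (\<lambda>\<zeta> \<phi>. j (\<zeta>, \<phi>)) \<in> borel_measurable (borel \<Otimes>\<^sub>M lborel)"
  proof -
    have "case_prod (\<lambda>\<zeta> \<phi>. j (\<zeta>, \<phi>)) = j" by auto
    moreover have "j \<in> borel_measurable (borel \<Otimes>\<^sub>M borel)" unfolding borel_prod by (rule j)
    ultimately show ?thesis by simp
  qed
  have [measurable]: "(\<lambda>\<zeta>. LINT \<phi>|lborel. j (\<zeta>, \<phi>)) \<in> borel_measurable borel"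
    by (rule lborel.borel_measurable_lebesgue_integral[OF jm])
  have "AE \<zeta> in lborel. AE \<phi> in lborel. gw p (\<zeta>, \<phi>) * quad_prod \<theta>' U1 U2 p (\<zeta>, \<phi>) = j (\<zeta>, \<phi>)"
    by (rule lborel_pair.AE_pair) (unfold lborel_prod, rule ae)
  then have ae1: "AE \<zeta> in lborel. inner \<zeta> / (\<zeta> - z) = (LINT \<phi>|lborel. j (\<zeta>, \<phi>)) / (\<zeta> - z)"
  proof eventually_elim
    case (elim \<zeta>)
    have "inner \<zeta> = (LINT \<phi>|lborel. j (\<zeta>, \<phi>))" unfolding inner_def
    proof (rule integral_lebesgue_AE_eq[OF _ elim])
      show "(\<lambda>\<phi>. j (\<zeta>, \<phi>)) \<in> borel_measurable borel" by measurable
    qed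
    then show ?case by simp
  qed
  have "I_op \<theta>' U1 U2 z p = - of_real (1 / pi) * (LINT \<zeta>|lebesgue. - of_real pi * (inner \<zeta> / (\<zeta> - z)))"
    unfolding I_op_def paren by simp
  also have "\<dots> = (LINT \<zeta>|lebesgue. inner \<zeta> / (\<zeta> - z))"
    unfolding integral_mult_right_zero by simp
  also have "\<dots> = (LINT \<zeta>|lborel. (LINT \<phi>|lborel. j (\<zeta>, \<phi>)) / (\<zeta> - z))"
    by (rule integral_lebesgue_AE_eq[OF _ ae1]) measurable
  finally show ?thesis .
qed

text \<open>The operator I as a single integral over \<sigma>, with a value at every (z, p). For
  regular arguments and p off the line this value is continuous in z.\<close>

definition Jop :: "(complex \<Rightarrow> real ^ 3 \<Rightarrow> complex) \<Rightarrow> (complex \<Rightarrow> real ^ 3 \<Rightarrow> complex) \<Rightarrow> complex \<Rightarrow> real ^ 3 \<Rightarrow> complex" where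
  "Jop U1 U2 z p = (LINT \<sigma>|lborel. gw p \<sigma> * quad_prod \<theta> U1 U2 p \<sigma> / (fst \<sigma> - z))"

lemma quad_prod_measurable [measurable (raw)]:
  assumes U: "regular \<mu> M1 U1" "regular \<mu> M2 U2"
    and [measurable]: "f \<in> borel_measurable N" "g \<in> borel_measurable N"
  shows "(\<lambda>x. quad_prod \<theta> U1 U2 (f x) (g x)) \<in> borel_measurable N"
  unfolding quad_prod_def
  by (intro borel_measurable_times regular_measurable[OF U(1)] regular_measurable[OF U(2)]) measurable

end

section \<open>A representative of I(U1, U2) that is continuous in the spectral parameter\<close>

locale weighted_frame = frame_field + fixes \<mu> :: real assumes mu: "\<mu> \<ge> 2"
begin

context
  fixes U1 U2 M1 M2
  assumes U1: "regular \<mu> M1 U1" and U2: "regular \<mu> M2 U2"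
begin

lemma Jop_measurable:
  assumes [measurable]: "f \<in> borel_measurable N" "g \<in> borel_measurable N"
  shows "(\<lambda>x. Jop U1 U2 (f x) (g x)) \<in> borel_measurable N"
proof -
  note [measurable (raw)] = quad_prod_measurable[OF U1 U2]
  have "(\<lambda>(x, \<sigma>). gw (g x) \<sigma> * quad_prod \<theta> U1 U2 (g x) \<sigma> / (fst \<sigma> - f x)) \<in> borel_measurable (N \<Otimes>\<^sub>M lborel)"
    by measurable
  then show ?thesis unfolding Jop_def by (rule lborel.borel_measurable_lebesgue_integral)
qed

lemma quad_prod_bound: "cmod (quad_prod \<theta> U1 U2 p \<sigma>) \<le> M1 * M2 * (wt \<mu> (Xi p \<sigma>) * wt \<mu> (p + Xi p \<sigma>))"
proof -
  have "cmod (quad_prod \<theta> U1 U2 p \<sigma>) \<le> (M1 * wt \<mu> (- Xi p \<sigma>)) * (M2 * wt \<mu> (p + Xi p \<sigma>))"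
    unfolding quad_prod_def norm_mult
    by (intro mult_mono regularD(1)[OF U1] regularD(1)[OF U2] mult_nonneg_nonneg regularD(2)[OF U1] wt_pos norm_ge_zero)
  then show ?thesis by (simp add: mult_ac)
qed

lemma M_nonneg: "M1 * M2 \<ge> 0" using regularD(2)[OF U1] regularD(2)[OF U2] by simp

lemma quad_prod_bound': "cmod (quad_prod \<theta> U1 U2 p \<sigma>) \<le> M1 * M2 * wt \<mu> (Xi p \<sigma>)"
proof -
  have "wt \<mu> (Xi p \<sigma>) * wt \<mu> (p + Xi p \<sigma>) \<le> wt \<mu> (Xi p \<sigma>) * 1"
    using mu by (intro mult_left_mono wt_le_1) auto
  then show ?thesis using quad_prod_bound[of p \<sigma>] mult_left_mono[OF _ M_nonneg] by (metis mult_1_right order_trans)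
qed

lemma Jop_integrable:
  assumes p: "p \<notin> line \<nu>" shows "integrable lborel (\<lambda>\<sigma>. gw p \<sigma> * quad_prod \<theta> U1 U2 p \<sigma> / (fst \<sigma> - z))"
proof -
  note [measurable (raw)] = quad_prod_measurable[OF U1 U2]
  have "integrable lborel (\<lambda>\<sigma>. gw p \<sigma> * quad_prod \<theta> U1 U2 p \<sigma> / (z - fst \<sigma>))"
    by (rule circ_estimate(2)[OF p mu M_nonneg _ quad_prod_bound']) measurable
  then have "integrable lborel (\<lambda>\<sigma>. - (gw p \<sigma> * quad_prod \<theta> U1 U2 p \<sigma> / (z - fst \<sigma>)))"
    by (rule Bochner_Integration.integrable_minus)
  then show ?thesis unfolding minus_divide_right minus_diff_eq .
qed

lemma I_op_Jop:
  assumes p: "p \<notin> line \<nu>" and agree: "\<theta>' p = \<theta> p"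
    and ae: "AE \<sigma> in lborel. gw p \<sigma> * quad_prod \<theta>' V1 V2 p \<sigma> = gw p \<sigma> * quad_prod \<theta> U1 U2 p \<sigma>"
  shows "I_op \<theta>' V1 V2 z p = Jop U1 U2 z p"
proof -
  note [measurable (raw)] = quad_prod_measurable[OF U1 U2]
  let ?j = "\<lambda>\<sigma>. gw p \<sigma> * quad_prod \<theta> U1 U2 p \<sigma>"
  have i: "integrable (lborel \<Otimes>\<^sub>M lborel) (\<lambda>\<sigma>. ?j \<sigma> / (fst \<sigma> - z))"
    using Jop_integrable[OF p] unfolding lborel_prod .
  have "I_op \<theta>' V1 V2 z p = (LINT \<zeta>|lborel. (LINT \<phi>|lborel. ?j (\<zeta>, \<phi>)) / (\<zeta> - z))"
    by (rule I_op_eq[OF p agree _ ae]) measurable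
  also have "\<dots> = (LINT \<zeta>|lborel. (LINT \<phi>|lborel. ?j (\<zeta>, \<phi>) / (\<zeta> - z)))" by simp
  also have "\<dots> = Jop U1 U2 z p"
    unfolding Jop_def using lborel_pair.integral_fst'[OF i] by (simp add: lborel_prod)
  finally show ?thesis .
qed

text \<open>Integration over \<phi> alone leaves the Cauchy transform of a function of \<zeta>. This
  function is integrable because the two factors of the bracket provide exponent 2 each, after
  \<open>wt_shift\<close> has moved p + \<xi> to \<xi> at the cost of (1 + |p|)^2; it is bounded by
  \<open>circ_w_bound\<close>.\<close>

lemma
  assumes p: "p \<notin> line \<nu>"
  shows Jop_continuous: "continuous_on UNIV (\<lambda>z. Jop U1 U2 z p)"
    and Jop_vanishes: "((\<lambda>z. Jop U1 U2 z p) \<longlongrightarrow> 0) at_infinity"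
proof -
  note [measurable (raw)] = quad_prod_measurable[OF U1 U2]
  let ?b = "norm p / 2"
  let ?j = "\<lambda>\<sigma>. gw p \<sigma> * quad_prod \<theta> U1 U2 p \<sigma>"
  define f where "f \<zeta> = (LINT \<phi>|lborel. ?j (\<zeta>, \<phi>))" for \<zeta>
  have jop: "Jop U1 U2 z p = (LINT \<zeta>|lborel. f \<zeta> / (\<zeta> - z))" for z
    using I_op_eq[where \<theta>' = \<theta> and j = ?j, OF p refl] I_op_Jop[where \<theta>' = \<theta> and ?V1.0 = U1 and ?V2.0 = U2, OF p refl] unfolding f_def by simp
  define L where "L = M1 * M2 * (1 + norm p) powr 2"
  have L: "L \<ge> 0" using M_nonneg by (simp add: L_def)
  have est: "cmod (?j \<sigma>) \<le> L * (indicator circ_dom \<sigma> * (cmod (circ_w ?b \<sigma>) * wt 4 (circ_pt ?b \<sigma>)))" for \<sigma>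
  proof -
    have "wt \<mu> (Xi p \<sigma>) * wt \<mu> (p + Xi p \<sigma>) \<le> wt 2 (Xi p \<sigma>) * ((1 + norm p) powr 2 * wt 2 (Xi p \<sigma>))"
    proof (intro mult_mono)
      show "wt \<mu> (Xi p \<sigma>) \<le> wt 2 (Xi p \<sigma>)" by (rule wt_exponent_mono[OF mu])
      have "wt \<mu> (p + Xi p \<sigma>) \<le> wt 2 (p + Xi p \<sigma>)" by (rule wt_exponent_mono[OF mu])
      also have "\<dots> \<le> (1 + norm (- p)) powr 2 * wt 2 (p + Xi p \<sigma> + (- p))" by (rule wt_shift) simp
      finally show "wt \<mu> (p + Xi p \<sigma>) \<le> (1 + norm p) powr 2 * wt 2 (Xi p \<sigma>)" by simp
    qed auto
    also have "\<dots> = (1 + norm p) powr 2 * wt 4 (circ_pt ?b \<sigma>)"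
      using wt_add_exponents[of 2 2 "Xi p \<sigma>"] wt_Xi[OF p, of 4 \<sigma>] by (simp add: mult_ac)
    finally have "cmod (quad_prod \<theta> U1 U2 p \<sigma>) \<le> M1 * M2 * ((1 + norm p) powr 2 * wt 4 (circ_pt ?b \<sigma>))"
      using quad_prod_bound[of p \<sigma>] mult_left_mono[OF _ M_nonneg] by (meson order_trans)
    then have "cmod (gw p \<sigma>) * cmod (quad_prod \<theta> U1 U2 p \<sigma>) \<le> (indicator circ_dom \<sigma> * cmod (circ_w ?b \<sigma>)) * (L * wt 4 (circ_pt ?b \<sigma>))"
      by (intro mult_mono) (auto simp: gw_def L_def mult_ac)
    then show ?thesis by (simp add: norm_mult mult_ac)
  qed
  have int: "integrable lborel ?j"
  proof (rule integrableI_bounded)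
    show "?j \<in> borel_measurable lborel" by measurable
    have "(\<integral>\<^sup>+\<sigma>. ennreal (norm (?j \<sigma>)) \<partial>lborel) \<le> (\<integral>\<^sup>+\<sigma>. ennreal L * (indicator circ_dom \<sigma> * ennreal (cmod (circ_w ?b \<sigma>) * wt 4 (circ_pt ?b \<sigma>))) \<partial>lborel)"
    proof (rule nn_integral_mono)
      fix \<sigma>
      have "ennreal (norm (?j \<sigma>)) \<le> ennreal (L * (indicator circ_dom \<sigma> * (cmod (circ_w ?b \<sigma>) * wt 4 (circ_pt ?b \<sigma>))))"
        by (rule ennreal_leI[OF est])
      also have "\<dots> = ennreal L * (indicator circ_dom \<sigma> * ennreal (cmod (circ_w ?b \<sigma>) * wt 4 (circ_pt ?b \<sigma>)))"
        using L by (auto simp: ennreal_mult' indicator_def)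
      finally show "ennreal (norm (?j \<sigma>)) \<le> \<dots>" .
    qed
    also have "\<dots> = ennreal L * (\<integral>\<^sup>+\<sigma>. indicator circ_dom \<sigma> * ennreal (cmod (circ_w ?b \<sigma>) * wt 4 (circ_pt ?b \<sigma>)) \<partial>lborel)"
      by (rule nn_integral_cmult) measurable
    also have "\<dots> < \<infinity>" using circ_w_integrable[OF b_pos[OF p]] by (simp add: ennreal_mult_less_top)
    finally show "(\<integral>\<^sup>+\<sigma>. ennreal (norm (?j \<sigma>)) \<partial>lborel) < \<infinity>" .
  qed
  then have int': "integrable (lborel \<Otimes>\<^sub>M lborel) ?j" unfolding lborel_prod .
  have fint: "integrable lborel f" unfolding f_def by (rule lborel_pair.integrable_fst'[OF int'])
  have fm: "f \<in> borel_measurable borel" using borel_measurable_integrable[OF fint] by simp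
  define K where "K = M1 * M2 * ((1 + 2 * ?b) / (2 * ?b))"
  have jb: "cmod (?j \<sigma>) \<le> K * indicator {-pi..pi} (snd \<sigma>)" for \<sigma>
  proof -
    have "cmod (circ_w ?b \<sigma>) * wt \<mu> (circ_pt ?b \<sigma>) \<le> (1 + 2 * ?b) / (2 * ?b) * (1 / (1 + (cmod (fst \<sigma>))\<^sup>2))"
      by (rule circ_w_bound[OF b_pos[OF p] mu])
    also have "\<dots> \<le> (1 + 2 * ?b) / (2 * ?b) * 1"
    proof (rule mult_left_mono)
      have "0 < 1 + (cmod (fst \<sigma>))\<^sup>2" by (rule add_pos_nonneg) auto
      then show "1 / (1 + (cmod (fst \<sigma>))\<^sup>2) \<le> 1" by (subst divide_le_eq_1_pos) auto
    qed auto
    finally have w: "cmod (circ_w ?b \<sigma>) * wt \<mu> (circ_pt ?b \<sigma>) \<le> (1 + 2 * ?b) / (2 * ?b)" by simp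
    have "cmod (?j \<sigma>) \<le> indicator circ_dom \<sigma> * cmod (circ_w ?b \<sigma>) * (M1 * M2 * wt \<mu> (circ_pt ?b \<sigma>))"
      unfolding norm_mult using quad_prod_bound'[of p \<sigma>] by (intro mult_mono) (auto simp: gw_def wt_Xi[OF p])
    also have "\<dots> = (M1 * M2 * (cmod (circ_w ?b \<sigma>) * wt \<mu> (circ_pt ?b \<sigma>))) * indicator circ_dom \<sigma>" by (simp add: mult_ac)
    also have "\<dots> \<le> K * indicator circ_dom \<sigma>" unfolding K_def by (intro mult_right_mono mult_left_mono w M_nonneg) auto
    finally show ?thesis by (simp add: circ_dom_indicator)
  qed
  have fb: "cmod (f \<zeta>) \<le> K * (2 * pi)" for \<zeta>
  proof -
    have i: "integrable lborel (\<lambda>\<phi>. K * indicator {-pi..pi} \<phi>)" by simp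
    have "cmod (f \<zeta>) \<le> (LINT \<phi>|lborel. K * indicator {-pi..pi} \<phi>)"
      unfolding f_def
    proof (rule Bochner_Integration.integral_norm_bound_integral[OF _ i])
      show "integrable lborel (\<lambda>\<phi>. ?j (\<zeta>, \<phi>))"
      proof (rule Bochner_Integration.integrable_bound[OF i])
        show "AE \<phi> in lborel. norm (?j (\<zeta>, \<phi>)) \<le> norm (K * indicator {-pi..pi} \<phi>)"
          by (intro AE_I2 order_trans[OF jb]) simp
      qed measurable
      show "norm (?j (\<zeta>, \<phi>)) \<le> K * indicator {-pi..pi} \<phi>" for \<phi> using jb[of "(\<zeta>, \<phi>)"] by simp
    qed
    then show ?thesis by simp
  qed
  show "continuous_on UNIV (\<lambda>z. Jop U1 U2 z p)" unfolding jop by (rule cauchy_transform_continuous[OF fm fint fb])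
  show "((\<lambda>z. Jop U1 U2 z p) \<longlongrightarrow> 0) at_infinity" unfolding jop by (rule cauchy_transform_vanishes[OF fm fint fb])
qed

text \<open>By \<open>AE_quadric\<close>, for almost every p a change of the arguments on a null set
  changes the circle integrand only on a null set of \<sigma>. As z enters only through the factor
  1/(\<zeta> - z), one exceptional set of p serves all z.\<close>

lemma I_op_regular:
  assumes agree: "\<And>p. p \<notin> line \<nu> \<Longrightarrow> \<theta>' p = \<theta> p"
    and V: "AE x in lborel. V1 (fst x) (snd x) = U1 (fst x) (snd x)" "AE x in lborel. V2 (fst x) (snd x) = U2 (fst x) (snd x)"
  shows "AE p in lborel. \<forall>z. I_op \<theta>' V1 V2 z p = Jop U1 U2 z p"
  using AE_quadric[OF AE_conjI[OF V]] AE_not_line[of \<nu>]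
proof eventually_elim
  case (elim p)
  have lam: "lambda_of \<theta>' k q = lambda_of \<theta> k q" if "q \<notin> line \<nu>" for k q
    by (simp add: lambda_of_def omega_def agree[OF that])
  have "AE \<sigma> in lborel. gw p \<sigma> * quad_prod \<theta>' V1 V2 p \<sigma> = gw p \<sigma> * quad_prod \<theta> U1 U2 p \<sigma>"
    using elim(1) by eventually_elim (auto simp: gw_def quad_prod_def lam)
  then show ?case by (intro allI I_op_Jop elim(2) agree)
qed

end

end

section \<open>The fixed point problem\<close>

lemma norm2_mu_nonneg: "norm2_mu \<nu> \<mu> U \<ge> 0"
proof (rule ccontr)
  assume "\<not> ?thesis"
  then have "norm2_mu \<nu> \<mu> U < 0" by simp
  then obtain M where "norm2_mu \<nu> \<mu> U < ereal M" "ereal M < 0" using ereal_dense2 by blast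
  then have M: "norm2_mu \<nu> \<mu> U \<le> ereal M" "M < 0" by (simp_all add: less_imp_le)
  obtain x where "cmod (U (fst x) (snd x)) \<le> M * wt \<mu> (snd x)"
    using AE_ex_in_open[OF norm2_muD[OF M(1)] open_UNIV] by auto
  then show False using mult_neg_pos[OF M(2) wt_pos(1)[of \<mu> "snd x"]] by (smt (verit) norm_ge_zero)
qed

lemma AE_lborel_snd:
  fixes P :: "'b::euclidean_space \<Rightarrow> bool"
  assumes "AE p in lborel. P p" shows "AE x in (lborel :: ('a::euclidean_space \<times> 'b) measure). P (snd x)"
proof -
  obtain N where N [measurable]: "N \<in> sets borel" and ae: "AE p in lborel. p \<notin> N" and NP: "\<And>p. p \<notin> N \<Longrightarrow> P p"
    by (rule AE_obtain_null[OF assms]) blast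
  have "AE x in (lborel :: ('a \<times> 'b) measure). snd x \<notin> N"
  proof (subst AE_lborel_pair_iff[of "\<lambda>_ p. p \<notin> N"])
    have "Measurable.pred borel (\<lambda>x :: 'a \<times> 'b. snd x \<notin> N)" by measurable
    then show "{x :: 'a \<times> 'b. snd x \<notin> N} \<in> sets borel" by (simp add: pred_def)
    show "AE y in lborel. AE x in (lborel :: 'a measure). y \<notin> N" using ae by eventually_elim simp
  qed
  then show ?thesis by eventually_elim (rule NP)
qed

lemma regular_diff:
  assumes U: "regular \<mu> M1 U" and V: "regular \<mu> M2 V"
  shows "regular \<mu> (M1 + M2) (\<lambda>z p. U z p - V z p)"
proof -
  have "case_prod (\<lambda>z p. U z p - V z p) = (\<lambda>x. case_prod U x - case_prod V x)" by auto
  also have "\<dots> \<in> borel_measurable borel" by (intro borel_measurable_diff regularD(3)[OF U] regularD(3)[OF V])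
  finally have "case_prod (\<lambda>z p. U z p - V z p) \<in> borel_measurable borel" .
  moreover have "cmod (U z p - V z p) \<le> (M1 + M2) * wt \<mu> p" for z p
    using norm_triangle_ineq4[of "U z p" "V z p"] regularD(1)[OF U, of z p] regularD(1)[OF V, of z p] by (simp add: ring_distribs)
  ultimately show ?thesis unfolding regular_def by blast
qed

lemma regular_AE: "regular \<mu> M U \<Longrightarrow> AE x in lborel. cmod (U (fst x) (snd x)) \<le> M * wt \<mu> (snd x)"
  using regularD(1) by (intro AE_I2)

lemma regular_mono: "regular \<mu> M U \<Longrightarrow> M \<le> M' \<Longrightarrow> regular \<mu> M' U"
  unfolding regular_def by (blast intro: order_trans mult_right_mono wt_pos(2))

text \<open>\<open>\<theta>'\<close> is the given frame field, whose values on the line are arbitrary, and \<open>\<theta>\<close> a Borel modification of it.\<close>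

locale reconstruction = weighted_frame +
  fixes \<theta>' :: "real ^ 3 \<Rightarrow> real ^ 3" and c6 :: real
  assumes agree: "\<And>p. p \<notin> line \<nu> \<Longrightarrow> \<theta>' p = \<theta> p"
    and c6_pos: "c6 > 0"
    and c6: "\<And>U1 U2. U1 \<in> Linf2_mu \<nu> \<mu> \<Longrightarrow> U2 \<in> Linf2_mu \<nu> \<mu> \<Longrightarrow>
               norm2_mu \<nu> \<mu> (I_op \<theta>' U1 U2) \<le> ereal c6 * norm2_mu \<nu> \<mu> U1 * norm2_mu \<nu> \<mu> U2"
begin

text \<open>The bound with \<open>c6\<close> holds almost everywhere in (z, p). By Fubini's theorem
  it holds, for almost every p, at almost every z, and by continuity at every z. In this form it can
  be used at z = \<open>\<lambda>\<^sub>0(p)\<close>.\<close>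

lemma Jop_bound:
  assumes U1: "regular \<mu> M1 U1" and U2: "regular \<mu> M2 U2"
    and d1: "AE x in lborel. cmod (U1 (fst x) (snd x)) \<le> d1 * wt \<mu> (snd x)"
    and d2: "AE x in lborel. cmod (U2 (fst x) (snd x)) \<le> d2 * wt \<mu> (snd x)"
    and d0: "d1 \<ge> 0" "d2 \<ge> 0"
  shows "AE p in lborel. \<forall>z. cmod (Jop U1 U2 z p) \<le> c6 * d1 * d2 * wt \<mu> p"
proof -
  note L1 = Linf2_muI[OF regularD(3)[OF U1] d1] norm2_muI[OF regularD(3)[OF U1] d1]
  note L2 = Linf2_muI[OF regularD(3)[OF U2] d2] norm2_muI[OF regularD(3)[OF U2] d2]
  have "norm2_mu \<nu> \<mu> (I_op \<theta>' U1 U2) \<le> ereal c6 * norm2_mu \<nu> \<mu> U1 * norm2_mu \<nu> \<mu> U2" by (rule c6[OF L1(1) L2(1)])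
  also have "\<dots> \<le> ereal c6 * ereal d1 * ereal d2"
    using c6_pos d0 by (intro ereal_mult_mono L1(2) L2(2) norm2_mu_nonneg) (auto intro: mult_nonneg_nonneg)
  finally have "norm2_mu \<nu> \<mu> (I_op \<theta>' U1 U2) \<le> ereal (c6 * d1 * d2)" by simp
  note bd = AE_lborel_snd_fst[OF norm2_muD[OF this]]
  have "AE p in lborel. \<forall>z. I_op \<theta>' U1 U2 z p = Jop U1 U2 z p"
    by (rule I_op_regular[OF U1 U2 agree]) auto
  with bd AE_not_line[of \<nu>]
  show ?thesis
  proof eventually_elim
    case (elim p)
    have "AE z in lborel. cmod (Jop U1 U2 z p) \<le> c6 * d1 * d2 * wt \<mu> p" using elim(1,3) by simp
    then show ?case
      by (intro allI AE_le_continuous[where f="\<lambda>z. cmod (Jop U1 U2 z p)" and g="\<lambda>_. c6 * d1 * d2 * wt \<mu> p"]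
        continuous_on_norm Jop_continuous[OF U1 U2 elim(2)] continuous_on_const)
  qed
qed

lemma Jop_diff:
  assumes U: "regular \<mu> M1 U" and V: "regular \<mu> M2 V" and p: "p \<notin> line \<nu>"
  shows "Jop U U z p - Jop V V z p = Jop (\<lambda>z p. U z p - V z p) U z p + Jop V (\<lambda>z p. U z p - V z p) z p"
proof -
  note D = regular_diff[OF U V]
  have "gw p \<sigma> * quad_prod \<theta> U U p \<sigma> / (fst \<sigma> - z) - gw p \<sigma> * quad_prod \<theta> V V p \<sigma> / (fst \<sigma> - z) =
    gw p \<sigma> * quad_prod \<theta> (\<lambda>z p. U z p - V z p) U p \<sigma> / (fst \<sigma> - z) + gw p \<sigma> * quad_prod \<theta> V (\<lambda>z p. U z p - V z p) p \<sigma> / (fst \<sigma> - z)" for \<sigma>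
    unfolding quad_prod_def diff_divide_distrib[symmetric] add_divide_distrib[symmetric] by (simp add: algebra_simps)
  note pw = this
  have "Jop U U z p - Jop V V z p = (LINT \<sigma>|lborel. gw p \<sigma> * quad_prod \<theta> U U p \<sigma> / (fst \<sigma> - z) - gw p \<sigma> * quad_prod \<theta> V V p \<sigma> / (fst \<sigma> - z))"
    unfolding Jop_def by (rule Bochner_Integration.integral_diff[OF Jop_integrable[OF U U p] Jop_integrable[OF V V p], symmetric])
  then show ?thesis
    unfolding pw unfolding Jop_def
    by (simp only: Bochner_Integration.integral_add[OF Jop_integrable[OF D U p] Jop_integrable[OF V D p]])
qed

text \<open>The two terms of \<open>Jop_diff\<close> each contain one factor U - V and one factor
  bounded by r.\<close>

lemma Jop_diff_bound:
  assumes U: "regular \<mu> r U" and V: "regular \<mu> r V"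
    and d: "AE x in lborel. cmod (U (fst x) (snd x) - V (fst x) (snd x)) \<le> d * wt \<mu> (snd x)" and d0: "d \<ge> 0"
  shows "AE p in lborel. \<forall>z. cmod (Jop U U z p - Jop V V z p) \<le> 2 * c6 * r * d * wt \<mu> p"
proof -
  note D = regular_diff[OF U V] and r = regularD(2)[OF U]
  show ?thesis
    using Jop_bound[OF D U d regular_AE[OF U] d0 r] Jop_bound[OF V D regular_AE[OF V] d r d0] AE_not_line[of \<nu>]
  proof eventually_elim
    case (elim p)
    show ?case
    proof
      fix z
      have "cmod (Jop U U z p - Jop V V z p) \<le> cmod (Jop (\<lambda>z p. U z p - V z p) U z p) + cmod (Jop V (\<lambda>z p. U z p - V z p) z p)"
        unfolding Jop_diff[OF U V elim(3)] by (rule norm_triangle_ineq)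
      also have "\<dots> \<le> c6 * d * r * wt \<mu> p + c6 * r * d * wt \<mu> p" using elim(1,2) by (intro add_mono) auto
      finally show "cmod (Jop U U z p - Jop V V z p) \<le> 2 * c6 * r * d * wt \<mu> p" by (simp add: algebra_simps)
    qed
  qed
qed

text \<open>Here \<open>l\<close> stands for \<open>\<lambda>\<^sub>0\<close>. As \<gamma> is only
  Lebesgue measurable, so is \<open>\<lambda>\<^sub>0\<close>, and the existence proof works with a
  Borel function equal to it almost everywhere.\<close>

definition recon_map :: "(real ^ 3 \<Rightarrow> complex) \<Rightarrow> (real ^ 3 \<Rightarrow> complex) \<Rightarrow> (complex \<Rightarrow> real ^ 3 \<Rightarrow> complex) \<Rightarrow> complex \<Rightarrow> real ^ 3 \<Rightarrow> complex" where
  "recon_map Q l U z p = Q p + Jop U U z p - Jop U U (l p) p"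

lemma recon_map_diff_bound:
  assumes U: "regular \<mu> r U" and V: "regular \<mu> r V"
    and d: "AE x in lborel. cmod (U (fst x) (snd x) - V (fst x) (snd x)) \<le> d * wt \<mu> (snd x)" and d0: "d \<ge> 0"
  shows "AE p in lborel. \<forall>z. cmod (recon_map Q l U z p - recon_map Q l V z p) \<le> 4 * c6 * r * d * wt \<mu> p"
  using Jop_diff_bound[OF U V d d0]
proof eventually_elim
  case (elim p)
  show ?case
  proof
    fix z
    have "recon_map Q l U z p - recon_map Q l V z p = (Jop U U z p - Jop V V z p) - (Jop U U (l p) p - Jop V V (l p) p)"
      by (simp add: recon_map_def)
    then have "cmod (recon_map Q l U z p - recon_map Q l V z p) \<le> cmod (Jop U U z p - Jop V V z p) + cmod (Jop U U (l p) p - Jop V V (l p) p)"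
      by (simp only: norm_triangle_ineq4)
    also have "\<dots> \<le> 2 * c6 * r * d * wt \<mu> p + 2 * c6 * r * d * wt \<mu> p" using elim by (intro add_mono) auto
    finally show "cmod (recon_map Q l U z p - recon_map Q l V z p) \<le> 4 * c6 * r * d * wt \<mu> p" by (simp add: algebra_simps)
  qed
qed

text \<open>Successive approximations from 0. Every estimate holds off a null set of p that does not
  depend on z; after countably many such sets are discarded, the iterates converge geometrically at
  every z. So the limit satisfies the equation for almost every p at every z, including z =
  \<open>l p\<close>.\<close>

lemma recon_map_solution:
  assumes [measurable]: "Q \<in> borel_measurable borel" "l \<in> borel_measurable borel"
    and Q: "AE p in lborel. cmod (Q p) \<le> r / 2 * wt \<mu> p" and r: "r \<ge> 0" and small: "4 * c6 * r < 1"
  obtains G where "regular \<mu> r G" "AE p in lborel. \<forall>z. G z p = recon_map Q l G z p"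
proof -
  define q where "q = 4 * c6 * r"
  have q: "0 \<le> q" "q < 1" using small c6_pos r by (auto simp: q_def)
  \<comment> \<open>Clipping keeps the iterates in the ball everywhere, not only almost everywhere.\<close>
  define clip where "clip p w = (if cmod w \<le> r * wt \<mu> p then w else (0::complex))" for p :: "real ^ 3" and w
  have clip_le: "cmod (clip p w) \<le> r * wt \<mu> p" for p w using r by (simp add: clip_def)
  define step where "step U z p = clip p (recon_map Q l U z p)" for U z p
  have step_regular: "regular \<mu> r (step U)" if U: "regular \<mu> r U" for U
  proof -
    note [measurable (raw)] = Jop_measurable[OF U U]
    have "case_prod (step U) = (\<lambda>x. step U (fst x) (snd x))" by (simp add: case_prod_unfold)
    also have "\<dots> \<in> borel_measurable borel" unfolding step_def clip_def recon_map_def by measurable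
    finally show ?thesis by (auto simp: regular_def step_def clip_le)
  qed
  have step_eq: "AE p in lborel. \<forall>z. step U z p = recon_map Q l U z p" if U: "regular \<mu> r U" for U
    using Q Jop_bound[OF U U regular_AE[OF U] regular_AE[OF U] r r]
  proof eventually_elim
    case (elim p)
    show ?case
    proof
      fix z
      have "cmod (recon_map Q l U z p) \<le> cmod (Q p) + cmod (Jop U U z p) + cmod (Jop U U (l p) p)"
        unfolding recon_map_def using norm_triangle_ineq4[of "Q p + Jop U U z p" "Jop U U (l p) p"] norm_triangle_ineq[of "Q p" "Jop U U z p"] by linarith
      also have "\<dots> \<le> r / 2 * wt \<mu> p + c6 * r * r * wt \<mu> p + c6 * r * r * wt \<mu> p"
        using elim by (intro add_mono) auto
      \<comment> \<open>Here 2 c6 r^2 = q r/2: the data use up half of the ball, and the two values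
        of the quadratic term fit into the other half since q < 1.\<close>
      also have "\<dots> = (r / 2 + q * r / 2) * wt \<mu> p" by (simp add: q_def algebra_simps)
      also have "\<dots> \<le> r * wt \<mu> p" using mult_right_mono[of q 1 r] q r by (intro mult_right_mono) auto
      finally show "step U z p = recon_map Q l U z p" by (simp add: step_def clip_def)
    qed
  qed
  define G where "G n = (step ^^ n) (\<lambda>_ _. 0)" for n
  have G_Suc: "G (Suc n) = step (G n)" and G_0: "G 0 = (\<lambda>_ _. 0)" for n by (simp_all add: G_def)
  have G_regular: "regular \<mu> r (G n)" for n
  proof (induction n)
    case 0 show ?case using r by (simp add: G_0 regular_def case_prod_unfold)
  qed (simp add: G_Suc step_regular)
  have inc: "AE p in lborel. \<forall>z. cmod (G (Suc n) z p - G n z p) \<le> q ^ n * r * wt \<mu> p" for n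
  proof (induction n)
    case 0 show ?case using regularD(1)[OF G_regular[of 1]] by (intro AE_I2) (simp add: G_0)
  next
    case (Suc n)
    have "AE x in (lborel :: (complex \<times> (real ^ 3)) measure). cmod (G (Suc n) (fst x) (snd x) - G n (fst x) (snd x)) \<le> q ^ n * r * wt \<mu> (snd x)"
      using AE_lborel_snd[OF Suc.IH] by eventually_elim blast
    then have "AE p in lborel. \<forall>z. cmod (recon_map Q l (G (Suc n)) z p - recon_map Q l (G n) z p) \<le> 4 * c6 * r * (q ^ n * r) * wt \<mu> p"
      using q r by (intro recon_map_diff_bound G_regular) auto
    moreover have "4 * c6 * r * (q ^ n * r) = q ^ Suc n * r" by (simp add: q_def)
    ultimately have "AE p in lborel. \<forall>z. cmod (recon_map Q l (G (Suc n)) z p - recon_map Q l (G n) z p) \<le> q ^ Suc n * r * wt \<mu> p"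
      by simp
    with step_eq[OF G_regular[of n]] step_eq[OF G_regular[of "Suc n"]] show ?case
      by eventually_elim (simp add: G_Suc)
  qed
  define L where "L z p = clip p (lim (\<lambda>n. G n z p))" for z p
  have L_regular: "regular \<mu> r L"
  proof -
    have [measurable]: "(\<lambda>x. G n (fst x) (snd x)) \<in> borel_measurable borel" for n
      by (rule regular_measurable[OF G_regular]) measurable
    have "case_prod L = (\<lambda>x. L (fst x) (snd x))" by (simp add: case_prod_unfold)
    also have "\<dots> \<in> borel_measurable borel" unfolding L_def clip_def by measurable
    finally show ?thesis by (auto simp: regular_def L_def clip_le)
  qed
  have "AE p in lborel. \<forall>n z. cmod (G (Suc n) z p - G n z p) \<le> q ^ n * r * wt \<mu> p"
    using inc by (simp add: AE_all_countable)
  then have conv: "AE p in lborel. \<forall>n z. cmod (L z p - G n z p) \<le> q ^ n * (r / (1 - q)) * wt \<mu> p"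
  proof eventually_elim
    case (elim p)
    show ?case
    proof (intro allI)
      fix n z
      define f where "f k = G (Suc k) z p - G k z p" for k
      have fb: "cmod (f k) \<le> q ^ k * r * wt \<mu> p" for k using elim by (simp add: f_def)
      have gs: "summable (\<lambda>k. q ^ k * r * wt \<mu> p)"
        using q by (intro summable_mult2 summable_geometric) auto
      have sf: "summable f" by (rule summable_comparison_test'[OF gs fb])
      have part: "(\<Sum>k<m. f k) = G m z p" for m
        unfolding f_def by (subst sum_lessThan_telescope) (simp add: G_0)
      have lim: "(\<lambda>m. G m z p) \<longlonglongrightarrow> suminf f" using summable_LIMSEQ[OF sf] unfolding part .
      have "cmod (suminf f) \<le> r * wt \<mu> p"
        by (rule Lim_bounded[OF tendsto_norm[OF lim]]) (use regularD(1)[OF G_regular] in auto)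
      then have L: "L z p = suminf f" unfolding L_def limI[OF lim] by (simp add: clip_def)
      have "cmod (suminf f - (\<Sum>k<n. f k)) = cmod (\<Sum>k. f (k + n))"
        by (subst suminf_minus_initial_segment[OF sf]) simp
      also have "\<dots> \<le> (\<Sum>k. q ^ n * (q ^ k * r * wt \<mu> p))"
      proof (rule norm_suminf_le)
        show "cmod (f (k + n)) \<le> q ^ n * (q ^ k * r * wt \<mu> p)" for k using fb[of "k + n"] by (simp add: power_add mult_ac)
        show "summable (\<lambda>k. q ^ n * (q ^ k * r * wt \<mu> p))" by (rule summable_mult[OF gs])
      qed
      also have "\<dots> = q ^ n * (r / (1 - q)) * wt \<mu> p"
      proof -
        have "(\<lambda>k. q ^ n * (q ^ k * r * wt \<mu> p)) sums (q ^ n * (1 / (1 - q) * r * wt \<mu> p))"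
          using q by (intro sums_mult sums_mult2 geometric_sums) auto
        then show ?thesis by (simp add: sums_iff mult_ac)
      qed
      finally show "cmod (L z p - G n z p) \<le> q ^ n * (r / (1 - q)) * wt \<mu> p" unfolding L part .
    qed
  qed
  define K where "K = r / (1 - q)"
  have K: "K \<ge> 0" using q r by (simp add: K_def)
  \<comment> \<open>The contraction estimate, applied to L and the n-th iterate, carries the
    recursion over to the limit.\<close>
  have "AE p in lborel. \<forall>z. cmod (recon_map Q l L z p - recon_map Q l (G n) z p) \<le> q * (q ^ n * K) * wt \<mu> p" for n
  proof -
    have "AE x in (lborel :: (complex \<times> (real ^ 3)) measure). cmod (L (fst x) (snd x) - G n (fst x) (snd x)) \<le> q ^ n * K * wt \<mu> (snd x)"
      using AE_lborel_snd[OF conv] by eventually_elim (simp add: K_def)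
    then show ?thesis unfolding q_def using K q by (intro recon_map_diff_bound L_regular G_regular) (auto simp: q_def)
  qed
  then have "AE p in lborel. \<forall>n z. cmod (recon_map Q l L z p - recon_map Q l (G n) z p) \<le> q * (q ^ n * K) * wt \<mu> p"
    by (simp add: AE_all_countable)
  moreover have "AE p in lborel. \<forall>n z. step (G n) z p = recon_map Q l (G n) z p"
    using step_eq[OF G_regular] by (simp add: AE_all_countable)
  ultimately have "AE p in lborel. \<forall>z. L z p = recon_map Q l L z p"
    using conv
  proof eventually_elim
    case (elim p)
    show ?case
    proof
      fix z
      have "cmod (L z p - recon_map Q l L z p) \<le> q ^ n * (2 * q * K * wt \<mu> p)" for n
      proof -
        have "L z p - recon_map Q l L z p = (L z p - G (Suc n) z p) - (recon_map Q l L z p - recon_map Q l (G n) z p)"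
          using elim(2) by (simp add: G_Suc)
        then have "cmod (L z p - recon_map Q l L z p) \<le> cmod (L z p - G (Suc n) z p) + cmod (recon_map Q l L z p - recon_map Q l (G n) z p)"
          by (simp only: norm_triangle_ineq4)
        also have "\<dots> \<le> q ^ Suc n * K * wt \<mu> p + q * (q ^ n * K) * wt \<mu> p"
          using elim(1) elim(3)[folded K_def] by (intro add_mono) blast+
        finally show ?thesis by (simp add: mult_ac)
      qed
      moreover have "(\<lambda>n. q ^ n * (2 * q * K * wt \<mu> p)) \<longlonglongrightarrow> 0"
        using q by (intro tendsto_mult_left_zero LIMSEQ_realpow_zero) auto
      ultimately have "cmod (L z p - recon_map Q l L z p) \<le> 0" by (intro LIMSEQ_le_const) auto
      then show "L z p = recon_map Q l L z p" by simp
    qed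
  qed
  with L_regular show thesis by (rule that)
qed

text \<open>A bound d on the difference of the solutions improves to e + q d. Iteration from the
  trivial bound leads to the fixed point E = e/(1 - q). The outputs contain a single value of the
  quadratic term, so their difference is at most e + (q/2) E, which is at most E.\<close>

lemma recon_map_stable:
  assumes H: "regular \<mu> r H" and V: "regular \<mu> r V" and small: "4 * c6 * r < 1" and e: "e \<ge> 0"
    and eqH: "AE x in lborel. H (fst x) (snd x) = recon_map R l H (fst x) (snd x)"
    and eqV: "AE x in lborel. V (fst x) (snd x) = recon_map Q l V (fst x) (snd x)"
    and RQ: "AE p in lborel. cmod (R p - Q p) \<le> e * wt \<mu> p"
  shows "AE p in lborel. cmod ((R p - Jop H H (l p) p) - (Q p - Jop V V (l p) p)) \<le> e / (1 - 4 * c6 * r) * wt \<mu> p"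
proof -
  define q where "q = 4 * c6 * r"
  have r: "r \<ge> 0" by (rule regularD(2)[OF H])
  have q: "0 \<le> q" "q < 1" using small c6_pos r by (auto simp: q_def)
  define E where "E = e / (1 - q)"
  have E: "e + q * E = E" "E \<ge> 0" using q e by (auto simp: E_def field_simps)
  have D: "AE x in lborel. cmod (H (fst x) (snd x) - V (fst x) (snd x)) \<le> (E + q ^ n * (2 * r)) * wt \<mu> (snd x)" for n
  proof (induction n)
    case 0
    have "r + r \<le> E + q ^ 0 * (2 * r)" using E by simp
    from regular_AE[OF regular_mono[OF regular_diff[OF H V] this]] show ?case .
  next
    case (Suc n)
    from recon_map_diff_bound[OF H V Suc.IH, of R l] E(2) q r
    have "AE p in lborel. \<forall>z. cmod (recon_map R l H z p - recon_map R l V z p) \<le> q * (E + q ^ n * (2 * r)) * wt \<mu> p"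
      by (simp add: q_def mult_ac)
    from AE_lborel_snd[OF this] AE_lborel_snd[OF RQ] eqH eqV show ?case
    proof eventually_elim
      case (elim x)
      have "H (fst x) (snd x) - V (fst x) (snd x) = (recon_map R l H (fst x) (snd x) - recon_map R l V (fst x) (snd x)) + (R (snd x) - Q (snd x))"
        unfolding elim(3,4) by (simp add: recon_map_def)
      then have "cmod (H (fst x) (snd x) - V (fst x) (snd x)) \<le> cmod (recon_map R l H (fst x) (snd x) - recon_map R l V (fst x) (snd x)) + cmod (R (snd x) - Q (snd x))"
        by (simp only: norm_triangle_ineq)
      also have "\<dots> \<le> q * (E + q ^ n * (2 * r)) * wt \<mu> (snd x) + e * wt \<mu> (snd x)"
        using elim(1,2) by (intro add_mono) auto
      also have "\<dots> = ((e + q * E) + q ^ Suc n * (2 * r)) * wt \<mu> (snd x)" by (simp add: algebra_simps)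
      finally show ?case unfolding E(1) .
    qed
  qed
  have "AE x in lborel. \<forall>n. cmod (H (fst x) (snd x) - V (fst x) (snd x)) \<le> (E + q ^ n * (2 * r)) * wt \<mu> (snd x)"
    using D by (simp add: AE_all_countable)
  then have "AE x in lborel. cmod (H (fst x) (snd x) - V (fst x) (snd x)) \<le> E * wt \<mu> (snd x)"
  proof eventually_elim
    case (elim x)
    have "(\<lambda>n. (E + q ^ n * (2 * r)) * wt \<mu> (snd x)) \<longlonglongrightarrow> (E + 0 * (2 * r)) * wt \<mu> (snd x)"
      using q by (intro tendsto_intros LIMSEQ_realpow_zero) auto
    from LIMSEQ_le_const[OF this] elim show ?case by auto
  qed
  from Jop_diff_bound[OF H V this E(2)] RQ show ?thesis
  proof eventually_elim
    case (elim p)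
    have "(R p - Jop H H (l p) p) - (Q p - Jop V V (l p) p) = (R p - Q p) - (Jop H H (l p) p - Jop V V (l p) p)" by simp
    then have "cmod ((R p - Jop H H (l p) p) - (Q p - Jop V V (l p) p)) \<le> cmod (R p - Q p) + cmod (Jop H H (l p) p - Jop V V (l p) p)"
      by (simp only: norm_triangle_ineq4)
    also have "\<dots> \<le> e * wt \<mu> p + 2 * c6 * r * E * wt \<mu> p" using elim by (intro add_mono) auto
    also have "\<dots> \<le> (e + q * E) * wt \<mu> p"
      using c6_pos r E(2) unfolding q_def ring_distribs by (intro add_mono mult_right_mono) auto
    finally show ?case unfolding E(1) unfolding E_def q_def .
  qed
qed

end

section \<open>Scattering data\<close>

locale scattering = faddeev_frame \<nu> \<theta> \<mu> c1 v C + reconstruction \<nu> \<theta> \<mu> \<theta>' c6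
  for \<nu> \<theta> \<mu> c1 v C \<theta>' c6 +
  fixes \<gamma> :: "real ^ 3 \<Rightarrow> real ^ 3"
  assumes small: "(c1 + 8 * c6) * C < 1"
    and gamma_meas: "\<gamma> \<in> borel_measurable lebesgue"
    and gamma_unit: "\<And>p. norm (\<gamma> p) = 1"
    and gamma_orth: "\<And>p. \<gamma> p \<bullet> p = 0"
begin

definition k0 :: "real ^ 3 \<Rightarrow> complex ^ 3" where
  "k0 p = (1 / 2) *s cvec p + (\<i> * of_real (norm p) / 2) *s cvec (\<gamma> p)"

lemma k0_quadric: "cdot (k0 p) (k0 p) = 0" "2 * cdot (k0 p) (cvec p) = of_real (p \<bullet> p)"
proof -
  have g: "\<gamma> p \<bullet> \<gamma> p = 1" using gamma_unit[of p] by (simp add: dot_square_norm)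
  have "\<i> * complex_of_real (norm p) * (\<i> * complex_of_real (norm p)) = (\<i> * \<i>) * of_real (norm p * norm p)"
    by (simp only: of_real_mult mult_ac)
  then have n: "\<i> * complex_of_real (norm p) * (\<i> * complex_of_real (norm p)) = - of_real (p \<bullet> p)"
    by (simp add: dot_square_norm power2_eq_square)
  show "cdot (k0 p) (k0 p) = 0"
    using n by (simp add: k0_def cdot_simps gamma_orth inner_commute[of p "\<gamma> p"] g)
  show "2 * cdot (k0 p) (cvec p) = of_real (p \<bullet> p)" by (simp add: k0_def cdot_simps gamma_orth)
qed

lemma k0_Sigma: "k0 p \<in> Sigma_cone" by (simp add: Sigma_cone_def k0_quadric)

lemma R_data_eq: "R_data \<mu> v \<gamma> p = fadH (k0 p) p"
  unfolding R_data_def k0_def[symmetric] by (simp add: faddeev_H_eq[OF k0_Sigma])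

lemma lambda0_eq:
  assumes p: "p \<notin> line \<nu>"
  shows "lambda0 \<theta> \<gamma> p \<noteq> 0" "k_of \<theta> (lambda0 \<theta> \<gamma> p) p = k0 p"
proof -
  have "p \<bullet> \<theta> p = 0" "p \<bullet> omega \<theta> p = 0" using frame_facts(8,9)[OF p] by (simp_all add: inner_commute)
  then have "lambda_of \<theta> (k0 p) p = lambda0 \<theta> \<gamma> p"
    using nonzero[OF p] by (simp add: lambda_of_def lambda0_def k0_def cdot_simps field_simps)
  with k_of_lambda_of[OF p k0_quadric] show "lambda0 \<theta> \<gamma> p \<noteq> 0" "k_of \<theta> (lambda0 \<theta> \<gamma> p) p = k0 p" by simp_all
qed

lemma lambda0_agree: "p \<notin> line \<nu> \<Longrightarrow> lambda0 \<theta>' \<gamma> p = lambda0 \<theta> \<gamma> p"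
  by (simp add: lambda0_def omega_def agree)

lemma gamma_measurable [measurable]: "\<gamma> \<in> borel_measurable (completion lborel)"
  by (rule gamma_meas)

lemma borel_imp_lebesgue: "f \<in> borel_measurable borel \<Longrightarrow> f \<in> borel_measurable lebesgue"
  by (intro measurable_completion) simp

lemma id_lebesgue: "(\<lambda>p. p) \<in> borel_measurable (completion lborel)"
  by (rule borel_imp_lebesgue) simp

lemma R_data_measurable [measurable]: "R_data \<mu> v \<gamma> \<in> borel_measurable (completion lborel)"
proof -
  note [measurable] = id_lebesgue
  have [measurable]: "k0 \<in> borel_measurable (completion lborel)" unfolding k0_def[abs_def] by measurable
  have "(\<lambda>p. fadH (k0 p) p) \<in> borel_measurable (completion lborel)" by measurable
  then show ?thesis by (simp add: R_data_eq[abs_def])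
qed

lemma lambda0_measurable [measurable]: "lambda0 \<theta> \<gamma> \<in> borel_measurable (completion lborel)"
proof -
  have [measurable]: "\<theta> \<in> borel_measurable (completion lborel)" "omega \<theta> \<in> borel_measurable (completion lborel)"
    by (auto intro!: borel_imp_lebesgue)
  show ?thesis unfolding lambda0_def[abs_def] by measurable
qed

definition R0 :: real where "R0 = 2 * C / (1 - c1 * C)"

lemma R0: "R0 \<ge> 0" "4 * c6 * R0 < 1" "1 / (1 - 4 * c6 * R0) = (1 - c1 * C) / (1 - (c1 + 8 * c6) * C)"
proof -
  have c: "1 - c1 * C > 0" using cC by simp
  show "R0 \<ge> 0" using c C0 by (simp add: R0_def)
  show "4 * c6 * R0 < 1" using c small by (simp add: R0_def field_simps)
  have "1 - 4 * c6 * R0 = (1 - (c1 + 8 * c6) * C) / (1 - c1 * C)" using c by (simp add: R0_def field_simps)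
  then show "1 / (1 - 4 * c6 * R0) = (1 - c1 * C) / (1 - (c1 + 8 * c6) * C)" by simp
qed

lemma R0_half: "R0 / 2 = C / (1 - c1 * C)"
  using cC by (simp add: R0_def field_simps)

lemma R_data_bound: "cmod (R_data \<mu> v \<gamma> p) \<le> R0 / 2 * wt \<mu> p"
  unfolding R_data_eq R0_half by (rule fadH_bound[OF k0_Sigma])

text \<open>The Faddeev function in coordinates, set to 0 where they degenerate so that its bound
  holds at every point.\<close>

definition H_coord :: "complex \<Rightarrow> real ^ 3 \<Rightarrow> complex" where
  "H_coord z p = (if p \<in> line \<nu> \<or> z = 0 then 0 else fadH (k_of \<theta> z p) p)"

lemma H_coord_regular: "regular \<mu> R0 H_coord"
proof -
  have "case_prod H_coord = (\<lambda>x. H_coord (fst x) (snd x))" by (simp add: case_prod_unfold)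
  also have "\<dots> \<in> borel_measurable borel" unfolding H_coord_def by measurable
  finally have "case_prod H_coord \<in> borel_measurable borel" .
  moreover have "cmod (H_coord z p) \<le> R0 * wt \<mu> p" for z p
  proof (cases "p \<in> line \<nu> \<or> z = 0")
    case True then show ?thesis using R0(1) by (auto simp: H_coord_def)
  next
    case False
    then have "k_of \<theta> z p \<in> Sigma_cone" using kk_Sigma(1)[of p "(z, 0)"] by simp
    from fadH_bound[OF this, of p] have "cmod (H_coord z p) \<le> R0 / 2 * wt \<mu> p" using False unfolding R0_half by (simp add: H_coord_def)
    also have "\<dots> \<le> R0 * wt \<mu> p" using R0(1) by (intro mult_right_mono) auto
    finally show ?thesis .
  qed
  ultimately show ?thesis by (simp add: regular_def)
qed

text \<open>This is \<open>fadH_poles\<close> at q = p. The values of H at (k, -\<xi>) and (k +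
  \<xi>, p + \<xi>) are values of \<open>H_coord\<close> by \<open>k_of_lambda_of\<close>, provided
  that both momenta avoid the line; for almost every p they do so for almost every \<sigma> in
  \<open>circ_dom\<close>.\<close>

lemma H_coord_equation: "AE p in lborel. \<forall>z. z \<noteq> 0 \<longrightarrow> H_coord z p = v p + Jop H_coord H_coord z p"
proof -
  have "AE p in lborel. AE \<sigma> in lborel. \<sigma> \<in> circ_dom \<longrightarrow> - Xi p \<sigma> \<notin> line \<nu> \<and> p + Xi p \<sigma> \<notin> line \<nu>"
    using AE_quadric[of "\<lambda>_. True"] by simp
  then show ?thesis using AE_not_line[of \<nu>]
  proof eventually_elim
    case (elim p)
    show ?case
    proof (intro allI impI)
      fix z :: complex assume z: "z \<noteq> 0"
      let ?F = "\<lambda>\<sigma>. fadH (kk p \<sigma> + cvec (Xi p \<sigma>)) (p + Xi p \<sigma>) * fadH (kk p \<sigma>) (- Xi p \<sigma>)"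
      have "(LINT \<sigma>|lborel. - (gw p \<sigma> * ?F \<sigma> / (z - fst \<sigma>))) = Jop H_coord H_coord z p"
        unfolding Jop_def
      proof (rule integral_cong_AE)
        note [measurable (raw)] = quad_prod_measurable[OF H_coord_regular H_coord_regular]
        show "(\<lambda>\<sigma>. gw p \<sigma> * quad_prod \<theta> H_coord H_coord p \<sigma> / (fst \<sigma> - z)) \<in> borel_measurable lborel" by measurable
        show "AE \<sigma> in lborel. - (gw p \<sigma> * ?F \<sigma> / (z - fst \<sigma>)) = gw p \<sigma> * quad_prod \<theta> H_coord H_coord p \<sigma> / (fst \<sigma> - z)"
          using elim(1) AE_fst_neq[of 0]
        proof eventually_elim
          case (elim \<sigma>)
          have "gw p \<sigma> * ?F \<sigma> = gw p \<sigma> * quad_prod \<theta> H_coord H_coord p \<sigma>"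
          proof (cases "\<sigma> \<in> circ_dom")
            case True
            then have l: "- Xi p \<sigma> \<notin> line \<nu>" "p + Xi p \<sigma> \<notin> line \<nu>" using elim(1) by auto
            note q = quadric_points[OF \<open>p \<notin> line \<nu>\<close> elim(2)]
            note a = k_of_lambda_of[OF l(1) q(1,2)] and b = k_of_lambda_of[OF l(2) q(4,5)]
            show ?thesis using l a b by (simp add: quad_prod_def H_coord_def mult.commute)
          qed (simp add: gw_def)
          then show ?case by (simp only: minus_divide_right minus_diff_eq)
        qed
      qed measurable
      moreover have "H_coord z p = v p - (LINT \<sigma>|lborel. gw p \<sigma> * ?F \<sigma> / (z - fst \<sigma>))"
        using fadH_poles[OF elim(2) z, of p] elim(2) z by (simp add: H_coord_def)
      ultimately show "H_coord z p = v p + Jop H_coord H_coord z p" by simp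
    qed
  qed
qed

text \<open>At \<open>\<lambda>\<^sub>0(p)\<close> the left side of \<open>H_coord_equation\<close>
  is the datum R(p). Solved for v, the equation gives v the form of an output of the procedure, with
  exact data R and with H as the solution.\<close>

lemma H_coord_lambda0: "AE p in lborel. v p = R_data \<mu> v \<gamma> p - Jop H_coord H_coord (lambda0 \<theta> \<gamma> p) p"
  using H_coord_equation AE_not_line[of \<nu>]
proof eventually_elim
  case (elim p)
  have "H_coord (lambda0 \<theta> \<gamma> p) p = R_data \<mu> v \<gamma> p" using lambda0_eq[OF elim(2)] elim(2) by (simp add: H_coord_def R_data_eq)
  with elim(1)[rule_format, OF lambda0_eq(1)[OF elim(2)]] show ?case by simp
qed

lemma H_coord_recon: "AE x in lborel. H_coord (fst x) (snd x) = recon_map (R_data \<mu> v \<gamma>) (lambda0 \<theta> \<gamma>) H_coord (fst x) (snd x)"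
  using AE_lborel_snd[OF H_coord_equation] AE_lborel_snd[OF H_coord_lambda0] AE_fst_neq[of 0]
  by eventually_elim (simp add: recon_map_def)

section \<open>Solvability and error of the reconstruction for given data\<close>

context
  fixes Q :: "real ^ 3 \<Rightarrow> complex"
  assumes Q_measurable [measurable]: "Q \<in> borel_measurable (completion lborel)" and Q_bound: "\<And>p. cmod (Q p) \<le> R0 / 2 * wt \<mu> p"
begin

lemma recon_solution_iff:
  assumes G: "G \<in> Linf2_mu \<nu> \<mu>" and V: "regular \<mu> R0 V" and ae: "AE x in lborel. G (fst x) (snd x) = V (fst x) (snd x)"
  shows "AE p in lborel. \<forall>z. Q p + M_op \<theta>' \<gamma> G z p = recon_map Q (lambda0 \<theta> \<gamma>) V z p"
proof -
  have "AE p in lborel. \<forall>z. I_op \<theta>' G G z p = Jop V V z p"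
    by (rule I_op_regular[OF V V _ ae ae]) (rule agree)
  then show ?thesis using AE_not_line[of \<nu>]
    by eventually_elim (simp add: M_op_def N_op_def recon_map_def lambda0_agree)
qed

lemma recon_solution_exists: "\<exists>G. recon_solution \<nu> \<theta>' \<gamma> \<mu> R0 Q G"
proof -
  \<comment> \<open>The iteration is run with Borel versions of Q and \<open>lambda0\<close>; the
    resulting equation holds almost everywhere for the original functions too.\<close>
  obtain Q' where Q' [measurable]: "Q' \<in> borel_measurable lborel" and Qe: "AE p in lborel. Q p = Q' p"
    using completion_ex_borel_measurable_complex[OF Q_measurable] by blast
  obtain l where l [measurable]: "l \<in> borel_measurable lborel" and le: "AE p in lborel. lambda0 \<theta> \<gamma> p = l p"
    using completion_ex_borel_measurable_complex[OF lambda0_measurable] by blast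
  have "AE p in lborel. cmod (Q' p) \<le> R0 / 2 * wt \<mu> p" using Qe by eventually_elim (use Q_bound in metis)
  note Q'_bound = this
  obtain G where G: "regular \<mu> R0 G" and eq: "AE p in lborel. \<forall>z. G z p = recon_map Q' l G z p"
    by (rule recon_map_solution[where l = l, OF _ _ Q'_bound R0(1,2)]) (use Q' l in simp_all)
  note GL = Linf2_muI[OF regularD(3)[OF G] regular_AE[OF G]]
  have "AE p in lborel. \<forall>z. G z p = Q p + M_op \<theta>' \<gamma> G z p"
    using recon_solution_iff[OF GL G AE_I2[OF refl]] eq Qe le by eventually_elim (simp add: recon_map_def)
  from AE_lborel_snd[OF this] have "AE x in lborel. G (fst x) (snd x) = Q (snd x) + M_op \<theta>' \<gamma> G (fst x) (snd x)"
    by eventually_elim blast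
  then have "recon_solution \<nu> \<theta>' \<gamma> \<mu> R0 Q G"
    unfolding recon_solution_def AE_lebesgue_on_coord_dom
    using GL norm2_muI[OF regularD(3)[OF G] regular_AE[OF G]] by (simp add: case_prod_unfold)
  then show ?thesis by blast
qed

text \<open>Whichever solution G was chosen, its regular representative V solves the fixed point
  equation, and \<open>H_coord\<close> solves it with R in place of Q. As N(V) vanishes at infinity,
  the limit that defines the output is Q - N(V) at \<open>\<lambda>\<^sub>0\<close>, and
  \<open>recon_map_stable\<close> compares it with v = R - N(H) at
  \<open>\<lambda>\<^sub>0\<close>.\<close>

lemma reconstruct_error:
  assumes e: "e \<ge> 0" and RQ: "AE p in lborel. cmod (R_data \<mu> v \<gamma> p - Q p) \<le> e * wt \<mu> p"
  shows "norm_mu \<mu> (\<lambda>p. v p - reconstruct \<nu> \<theta>' \<gamma> \<mu> R0 Q p) \<le> ereal (e / (1 - 4 * c6 * R0))"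
proof -
  define G where "G = recon_G \<nu> \<theta>' \<gamma> \<mu> R0 Q"
  have "recon_solution \<nu> \<theta>' \<gamma> \<mu> R0 Q G" unfolding G_def recon_G_def by (rule someI_ex[OF recon_solution_exists])
  then have G: "G \<in> Linf2_mu \<nu> \<mu>" "norm2_mu \<nu> \<mu> G \<le> ereal R0"
      and Geq: "AE x in lborel. G (fst x) (snd x) = Q (snd x) + M_op \<theta>' \<gamma> G (fst x) (snd x)"
    unfolding recon_solution_def AE_lebesgue_on_coord_dom by (simp_all add: case_prod_unfold)
  obtain V where V: "regular \<mu> R0 V" and ae: "AE x in lborel. G (fst x) (snd x) = V (fst x) (snd x)"
    by (rule Linf2_mu_regular[OF G R0(1)])
  note rep = recon_solution_iff[OF G(1) V ae]
  have "AE x in lborel. V (fst x) (snd x) = recon_map Q (lambda0 \<theta> \<gamma>) V (fst x) (snd x)"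
    using AE_lborel_snd[OF rep] Geq ae by eventually_elim simp
  note stable = recon_map_stable[OF H_coord_regular V R0(2) e H_coord_recon this RQ]
  have rec: "AE p in lborel. reconstruct \<nu> \<theta>' \<gamma> \<mu> R0 Q p = Q p - Jop V V (lambda0 \<theta> \<gamma> p) p"
    using rep AE_not_line[of \<nu>]
  proof eventually_elim
    case (elim p)
    have "((\<lambda>z. Q p + Jop V V z p - Jop V V (lambda0 \<theta> \<gamma> p) p) \<longlongrightarrow> Q p + 0 - Jop V V (lambda0 \<theta> \<gamma> p) p) at_infinity"
      by (intro tendsto_intros Jop_vanishes[OF V V elim(2)])
    then have "Lim at_infinity (\<lambda>z. Q p + Jop V V z p - Jop V V (lambda0 \<theta> \<gamma> p) p) = Q p + 0 - Jop V V (lambda0 \<theta> \<gamma> p) p"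
      by (rule tendsto_Lim[rotated]) (rule trivial_limit_at_infinity)
    then show ?case using elim(1) unfolding reconstruct_def G_def[symmetric] by (simp add: recon_map_def add_diff_eq)
  qed
  show ?thesis
  proof (rule norm_muI)
    have [measurable]: "v \<in> borel_measurable (completion lborel)"
      by (rule borel_imp_lebesgue) (rule borel_measurable_continuous_onI[OF v_cont])
    have [measurable]: "(\<lambda>p. Jop V V (lambda0 \<theta> \<gamma> p) p) \<in> borel_measurable (completion lborel)"
      by (rule Jop_measurable[OF V V lambda0_measurable id_lebesgue])
    have "AE p in lebesgue. v p - (Q p - Jop V V (lambda0 \<theta> \<gamma> p) p) = v p - reconstruct \<nu> \<theta>' \<gamma> \<mu> R0 Q p"
      using AE_completion[OF rec] by eventually_elim simp
    then show "(\<lambda>p. v p - reconstruct \<nu> \<theta>' \<gamma> \<mu> R0 Q p) \<in> borel_measurable lebesgue"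
      by (rule borel_measurable_AE[rotated]) measurable
    show "AE p in lborel. cmod (v p - reconstruct \<nu> \<theta>' \<gamma> \<mu> R0 Q p) \<le> e / (1 - 4 * c6 * R0) * wt \<mu> p"
      using stable rec H_coord_lambda0
    proof eventually_elim
      case (elim p)
      from elim(1) show ?case unfolding elim(3)[symmetric] elim(2)[symmetric] .
    qed
  qed
qed

end

end

theorem corollary2p1:
  fixes \<mu> \<mu>s C c1 c6 :: real
    and v :: "real ^ 3 \<Rightarrow> complex"
    and \<nu> :: "real ^ 3"
    and \<theta> \<gamma> :: "real ^ 3 \<Rightarrow> real ^ 3"
  assumes mu: "\<mu> \<ge> 2"
    and nu: "norm \<nu> = 1"
    and theta_smooth: "smooth_on (- line \<nu>) \<theta>"
    and theta_unit: "\<And>p. p \<notin> line \<nu> \<Longrightarrow> norm (\<theta> p) = 1"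
    and theta_orth: "\<And>p. p \<notin> line \<nu> \<Longrightarrow> \<theta> p \<bullet> p = 0"
    and c1_pos: "c1 > 0"
    and c1: "\<And>k w U. k \<in> Sigma_cone \<Longrightarrow> w \<in> Linf_mu \<mu> \<Longrightarrow> U \<in> Linf_mu \<mu> \<Longrightarrow>
               norm_mu \<mu> (A_op w k U) \<le> ereal c1 * norm_mu \<mu> w * norm_mu \<mu> U"
    and c6_pos: "c6 > 0"
    and c6: "\<And>U1 U2. U1 \<in> Linf2_mu \<nu> \<mu> \<Longrightarrow> U2 \<in> Linf2_mu \<nu> \<mu> \<Longrightarrow>
               norm2_mu \<nu> \<mu> (I_op \<theta> U1 U2) \<le> ereal c6 * norm2_mu \<nu> \<mu> U1 * norm2_mu \<nu> \<mu> U2"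
    and v_mem: "v \<in> Linf_mu \<mu>"
    and v_bound: "norm_mu \<mu> v \<le> ereal C"
    and C_small: "C < 1 / (c1 + 8 * c6)"
    and mu_star: "\<mu>s > \<mu>"
    and v_mem_star: "v \<in> Linf_mu \<mu>s"
    and v_cont: "continuous_on UNIV v"
    and gamma_meas: "\<gamma> \<in> borel_measurable lebesgue"
    and gamma_unit: "\<And>p. norm (\<gamma> p) = 1"
    and gamma_orth: "\<And>p. \<gamma> p \<bullet> p = 0"
  shows "R_data \<mu> v \<gamma> \<in> Linf_mu \<mu>s \<and>
    (\<forall>\<tau>>0. norm_mu \<mu> (\<lambda>p. v p -
         reconstruct \<nu> \<theta> \<gamma> \<mu> (2 * C / (1 - c1 * C)) (cutoff (2 * \<tau>) (R_data \<mu> v \<gamma>)) p)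
       \<le> ereal ((1 - c1 * C) / (1 - (c1 + 8 * c6) * C)) *
          (norm_mu \<mu>s (R_data \<mu> v \<gamma>) / ereal ((1 + 2 * \<tau>) powr (\<mu>s - \<mu>))))"
proof -
  \<comment> \<open>On the line the values of \<theta> are arbitrary; replacing them by 0 gives a
    field that is Borel on the whole space.\<close>
  define \<theta>0 where "\<theta>0 p = indicator (- line \<nu>) p *\<^sub>R \<theta> p" for p
  have agree: "\<theta> p = \<theta>0 p" if "p \<notin> line \<nu>" for p using that by (simp add: \<theta>0_def)
  have "Ck_on 0 (- line \<nu>) \<theta>" using theta_smooth unfolding smooth_on_def by blast
  then have "continuous_on (- line \<nu>) \<theta>" by simp
  then have borel: "\<theta>0 \<in> borel_measurable borel"
    unfolding \<theta>0_def[abs_def] by (intro borel_measurable_continuous_on_indicator) measurable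
  have C0: "C \<ge> 0" using order_trans[OF norm_mu_nonneg v_bound] by simp
  have small: "(c1 + 8 * c6) * C < 1" using C_small c1_pos c6_pos by (simp add: field_simps)
  have "c1 * C \<le> (c1 + 8 * c6) * C" using C0 c6_pos by (simp add: algebra_simps)
  then have cC: "c1 * C < 1" using small by simp
  \<comment> \<open>Since v is continuous, an essential bound holds at every point, which is the
    form the Neumann estimates use.\<close>
  have v_le: "cmod (v p) \<le> M * wt \<alpha> p" if "norm_mu \<alpha> v \<le> ereal M" for p M \<alpha>
    by (rule AE_le_continuous[OF norm_muD[OF that]]) (intro continuous_intros v_cont wt_continuous)+
  interpret scattering \<nu> \<theta>0 \<mu> c1 v C \<theta> c6 \<gamma>
    by unfold_locales
      (use nu borel theta_unit theta_orth mu c1_pos c1 v_cont v_le[OF v_bound] C0 cC agree c6_pos c6 small gamma_meas gamma_unit gamma_orth in auto)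
  define \<delta> where "\<delta> = \<mu>s - \<mu>"
  have \<delta>: "\<delta> \<ge> 0" "\<mu> + \<delta> = \<mu>s" using mu_star by (auto simp: \<delta>_def)
  obtain Cs where Cs: "norm_mu \<mu>s v = ereal Cs"
    using v_mem_star norm_mu_nonneg[of \<mu>s v] by (cases "norm_mu \<mu>s v") (auto simp: Linf_mu_def)
  have "cmod (v p) \<le> Cs * wt (\<mu> + \<delta>) p" for p unfolding \<delta>(2) by (rule v_le) (simp add: Cs)
  then obtain B where B: "\<And>k p. k \<in> Sigma_cone \<Longrightarrow> cmod (fadH k p) \<le> B * wt (\<mu> + \<delta>) p"
    by (rule fadH_decay[OF \<delta>(1)]) blast
  let ?R = "R_data \<mu> v \<gamma>"
  have R_mem: "?R \<in> Linf_mu \<mu>s"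
    by (rule Linf_muI[OF R_data_measurable, of B]) (use B[OF k0_Sigma] in \<open>simp add: R_data_eq \<delta>(2)\<close>)
  moreover have "norm_mu \<mu> (\<lambda>p. v p - reconstruct \<nu> \<theta> \<gamma> \<mu> (2 * C / (1 - c1 * C)) (cutoff (2 * \<tau>) ?R) p)
       \<le> ereal ((1 - c1 * C) / (1 - (c1 + 8 * c6) * C)) * (norm_mu \<mu>s ?R / ereal ((1 + 2 * \<tau>) powr (\<mu>s - \<mu>)))"
    if \<tau>: "\<tau> > 0" for \<tau>
  proof -
    obtain S where S: "norm_mu \<mu>s ?R = ereal S"
      using R_mem norm_mu_nonneg[of \<mu>s ?R] by (cases "norm_mu \<mu>s ?R") (auto simp: Linf_mu_def)
    have S0: "S \<ge> 0" using norm_mu_nonneg[of \<mu>s ?R] by (simp add: S)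
    define T where "T = (1 + 2 * \<tau>) powr \<delta>"
    have T: "T > 0" using \<tau> by (simp add: T_def)
    have "AE p in lborel. cmod (?R p) \<le> S * wt \<mu>s p" by (rule norm_muD) (simp add: S)
    \<comment> \<open>The difference lives on |p| \<ge> 2\<tau>, where the surplus exponent \<delta>
      contributes a factor of at most (1 + 2\<tau>)^(-\<delta>).\<close>
    then have tail: "AE p in lborel. cmod (?R p - cutoff (2 * \<tau>) ?R p) \<le> S / T * wt \<mu> p"
    proof eventually_elim
      case (elim p)
      show ?case
      proof (cases "norm p < 2 * \<tau>")
        case True then show ?thesis using S0 T by (simp add: cutoff_def)
      next
        case False
        have "wt \<delta> p \<le> 1 / T"
        proof -
          have "T \<le> (1 + norm p) powr \<delta>" unfolding T_def using False \<tau> \<delta>(1) by (intro powr_mono2) auto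
          then show ?thesis using T by (simp add: wt_def powr_minus_divide frac_le)
        qed
        then have "S * (wt \<mu> p * wt \<delta> p) \<le> S * (wt \<mu> p * (1 / T))" using S0 by (intro mult_left_mono) auto
        then show ?thesis using elim False wt_add_exponents[of \<mu> \<delta> p] by (simp add: cutoff_def \<delta>(2))
      qed
    qed
    have "cutoff (2 * \<tau>) ?R \<in> borel_measurable (completion lborel)" 
    proof -
      note [measurable] = id_lebesgue
      show ?thesis unfolding cutoff_def[abs_def] by measurable
    qed
    moreover have "cmod (cutoff (2 * \<tau>) ?R p) \<le> R0 / 2 * wt \<mu> p" for p
      using R_data_bound[of p] R0(1) by (auto simp: cutoff_def)
    ultimately have "norm_mu \<mu> (\<lambda>p. v p - reconstruct \<nu> \<theta> \<gamma> \<mu> R0 (cutoff (2 * \<tau>) ?R) p) \<le> ereal (S / T / (1 - 4 * c6 * R0))"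
      using S0 T by (intro reconstruct_error tail) auto
    also have "S / T / (1 - 4 * c6 * R0) = 1 / (1 - 4 * c6 * R0) * (S / T)" by simp
    also have "\<dots> = (1 - c1 * C) / (1 - (c1 + 8 * c6) * C) * (S / T)" unfolding R0(3) ..
    finally show ?thesis using T unfolding S R0_def T_def \<delta>_def by simp
  qed
  ultimately show ?thesis by blast
qed

end
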